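(* Let $\eta$ be a stationary point process on $\mathbb{R}^d$ with intensity $\gamma\in(0,\infty)$ such that: (i) $\mathbb{E}\,\eta(B)^m<\infty$ for each bounded Borel set $B\subset\mathbb{R}^d$ and each $m\in\mathbb{N}$; (ii) $\int(1+\|x\|^p)\,|\beta_2^!|(dx)<\infty$ for some $p>0$; (iii) $|\beta_m^!|((\mathbb{R}^d)^{m-1})<\infty$ for every integer $m\ge 3$. Let $h\in\mathcal{H}_p$ with the same $p$ as in (ii). Let $n\in\mathbb{N}$, let $(k_{1,r})_{r>0},\ldots,(k_{n,r})_{r>0}\in\mathbf{F}\cup\{\mathbf{0}\}$, set $k_i:=\lim_{r\to\infty}k_{i,r}$, and suppose that $\{k_i,-k_i\}\cap\{k_j,-k_j\}=\emptyset$ for all $i\ne j$. Then $$(T_r(k_{1,r}),\ldots,T_r(k_{n,r}))\overset{d}{\longrightarrow}(Z_{k_1},\ldots,Z_{k_n})\quad\text{as } r\to\infty,$$ where $Z_k$, $k\in\mathbb{R}^d$, are independent centered $\mathbb{C}$-valued normally distributed random variables such that, for each $k\in\mathbb{R}^d$, the components (real and imaginary parts) of $Z_k$ are independent and each have variance $\gamma M_2(h)S(k)/2$.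
   Context: Let $d\ge1$. A (simple) point process $\eta$ on $\mathbb{R}^d$ is a random locally finite subset of $\mathbb{R}^d$ (with the $\sigma$-field generated by the counts $\eta(B):=\mathrm{card}(\eta\cap B)$, $B$ Borel). It is stationary if the distribution of $\eta+x$ does not depend on $x\in\mathbb{R}^d$; its intensity is $\gamma:=\mathbb{E}\,\eta([0,1]^d)$. The symbol $\overset{d}{\longrightarrow}$ denotes convergence in distribution. A normally distributed random variable with variance $0$ is almost surely constant. For $m\in\mathbb{N}$ the $m$-th factorial moment measure is $\alpha_m(\cdot):=\mathbb{E}\sum^{\neq}_{x_1,\ldots,x_m\in\eta}\mathbf{1}\{(x_1,\ldots,x_m)\in\cdot\}$ on $(\mathbb{R}^d)^m$, the sum being over $m$-tuples with pairwise distinct entries. Let $\Pi_{m,j}$ be the set of all partitions of $[m]:=\{1,\ldots,m\}$ into $j$ blocks. The $m$-th factorial cumulant measure is the signed measure (defined on bounded Borel sets of $(\mathbb{R}^d)^m$) given by $$\beta_m(B_1\times\cdots\times B_m):=\sum_{j=1}^m(-1)^{j-1}(j-1)!\sum_{\pi\in\Pi_{m,j}}\prod_{I\in\pi}\alpha_{|I|}(\times_{i\in I}B_i)$$ for bounded Borel sets $B_1,\ldots,B_m\subset\mathbb{R}^d$. For $m\ge2$, the $m$-th reduced factorial cumulant measure $\beta_m^!$ is the locally finite signed measure on $(\mathbb{R}^d)^{m-1}$ satisfying $$\beta_m(\cdot)=\iint\mathbf{1}\{(x,x_1+x,\ldots,x_{m-1}+x)\in\cdot\}\,\beta_m^!(d(x_1,\ldots,x_{m-1}))\,dx.$$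 $|\beta_m^!|$ is its total variation measure (defined on each bounded Borel set and extended by consistency to a locally finite measure). The structure factor is $S(k):=1+\frac1\gamma\int e^{-i\langle k,x\rangle}\,\beta_2^!(dx)$, $k\in\mathbb{R}^d$. For $p>0$, $\mathcal{H}_p$ is the class of bounded measurable functions $h:\mathbb{R}^d\to[0,\infty)$ such that $\int h(x)\,dx<\infty$ and there exist constants $a,b>0$ with $\mathbf{1}\{\|y\|\le b\}\int|h(x+y)-h(x)|\,dx\le a\|y\|^p$ for all $y\in\mathbb{R}^d$. Put $M_j(h):=\int h(x)^j\,dx$ for $j=1,2$, and $h_r(x):=h(x/r)$ for $r>0$. $\mathbf{F}$ (depending on $h$) is the set of functions $r\mapsto k_r$ from $(0,\infty)$ to $\mathbb{R}^d$, written $(k_r)$, such that $\lim_{r\to\infty}k_r$ exists in $\mathbb{R}^d\setminus\{0\}$ and $\lim_{r\to\infty} r^{-d/2}\int h_r(x)e^{i\langle k_r,x\rangle}\,dx=\lim_{r\to\infty} r^{-d/2}\int h_r(x)e^{-i\langle k_r,x\rangle}\,dx=0$. $\mathbf{0}$ denotes the function $r\mapsto 0\in\mathbb{R}^d$. For $r>0$ and $k\in\mathbb{R}^d$, $$T_r(k):=\frac{1}{r^{d/2}}\sum_{x\in\eta}h_r(x)e^{-i\langle k,x\rangle}-\mathbf{1}\{k=0\}M_1(h)\gamma r^{d/2}.$$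
   Formalization: At k = 0 the real part of Z_0 has variance γM_2(h)S(0) and the imaginary part variance 0 (not γM_2(h)S(0)/2 each), because T_r(0) is real-valued, so the stated law fails there unless M_2(h)S(0) = 0. *)

theory Defs
  imports "HOL-Probability.Probability" "HOL-Library.Disjoint_Sets"
begin

text \<open>
  Euclidean space is an arbitrary type of class \<open>euclidean_space\<close>, whose dimension is at least 1.
  Elements of its \<open>m\<close>-fold power are extensional functions on \<open>{..<m}\<close>, with the product
  sigma-algebra of \<open>Pi\<^sub>M {..<m} (\<lambda>_. borel)\<close>. Reduced measures live on the \<open>(m - 1)\<close>-fold power,
  for which the index set \<open>{1..<m}\<close> is used.
\<close>

section \<open>Point processes\<close>

definition configs :: "'a::euclidean_space set set" where
  "configs = {\<phi>. \<forall>B. bounded B \<longrightarrow> finite (\<phi> \<inter> B)}"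

definition npoints :: "'a::euclidean_space set \<Rightarrow> 'a set \<Rightarrow> ennreal" where
  "npoints \<phi> B = emeasure (count_space UNIV) (\<phi> \<inter> B)"

definition config_space :: "'a::euclidean_space set measure" where
  "config_space = sigma configs
     {{\<phi> \<in> configs. npoints \<phi> B \<in> A} | A B. A \<in> sets borel \<and> B \<in> sets borel}"

definition point_process :: "'w measure \<Rightarrow> ('w \<Rightarrow> 'a::euclidean_space set) \<Rightarrow> bool" where
  "point_process M \<eta> \<longleftrightarrow> prob_space M \<and> \<eta> \<in> measurable M config_space"

definition stationary :: "'w measure \<Rightarrow> ('w \<Rightarrow> 'a::euclidean_space set) \<Rightarrow> bool" where
  "stationary M \<eta> \<longleftrightarrow>
     (\<forall>x. distr M config_space (\<lambda>\<omega>. (\<lambda>y. y + x) ` \<eta> \<omega>) = distr M config_space \<eta>)"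

definition intensity :: "'w measure \<Rightarrow> ('w \<Rightarrow> 'a::euclidean_space set) \<Rightarrow> ennreal" where
  "intensity M \<eta> = (\<integral>\<^sup>+ \<omega>. npoints (\<eta> \<omega>) (cbox 0 One) \<partial>M)"


section \<open>Locally finite signed measures\<close>

text \<open>
  A locally finite signed measure on \<open>Pi\<^sub>M I (\<lambda>_. borel)\<close> is represented by its Jordan decomposition,
  the (unique) pair of mutually singular, locally finite measures whose difference it is.
\<close>

type_synonym 'b signed_measure = "'b measure \<times> 'b measure"

definition bounded_borel :: "nat set \<Rightarrow> (nat \<Rightarrow> 'a::euclidean_space) set \<Rightarrow> bool" where
  "bounded_borel I C \<longleftrightarrow> C \<in> sets (Pi\<^sub>M I (\<lambda>_. borel)) \<and> (\<exists>R. \<forall>x\<in>C. \<forall>i\<in>I. norm (x i) \<le> R)"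

definition locally_finite_signed ::
  "nat set \<Rightarrow> (nat \<Rightarrow> 'a::euclidean_space) signed_measure \<Rightarrow> bool" where
  "locally_finite_signed I \<nu> \<longleftrightarrow>
     sets (fst \<nu>) = sets (Pi\<^sub>M I (\<lambda>_. borel)) \<and> sets (snd \<nu>) = sets (Pi\<^sub>M I (\<lambda>_. borel)) \<and>
     (\<forall>C. bounded_borel I C \<longrightarrow> emeasure (fst \<nu>) C < \<infinity> \<and> emeasure (snd \<nu>) C < \<infinity>) \<and>
     (\<exists>P\<in>sets (Pi\<^sub>M I (\<lambda>_. borel)).
        emeasure (fst \<nu>) (space (fst \<nu>) - P) = 0 \<and> emeasure (snd \<nu>) P = 0)"

text \<open>Only meaningful on sets where both parts are finite, in particular on bounded Borel sets.\<close>

definition smeasure :: "'b signed_measure \<Rightarrow> 'b set \<Rightarrow> real" where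
  "smeasure \<nu> C = measure (fst \<nu>) C - measure (snd \<nu>) C"

definition sintegral ::
  "'b signed_measure \<Rightarrow> ('b \<Rightarrow> 'c::{banach, second_countable_topology}) \<Rightarrow> 'c" where
  "sintegral \<nu> f = (\<integral>x. f x \<partial>fst \<nu>) - (\<integral>x. f x \<partial>snd \<nu>)"

definition total_variation :: "'b signed_measure \<Rightarrow> 'b measure" where
  "total_variation \<nu> = measure_of (space (fst \<nu>)) (sets (fst \<nu>))
     (\<lambda>A. emeasure (fst \<nu>) A + emeasure (snd \<nu>) A)"


section \<open>Factorial moment and cumulant measures\<close>

text \<open>
  The factorial moment measure is indexed by a finite set \<open>I\<close> of coordinates, as a set function on
  the Borel sets of the power with index set \<open>I\<close>. For \<open>I = {..<m}\<close> this is the \<open>m\<close>-th factorial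
  moment measure; for a block \<open>I\<close> of a partition it is its copy in the coordinates in \<open>I\<close>.
\<close>

definition factorial_moment ::
  "'w measure \<Rightarrow> ('w \<Rightarrow> 'a::euclidean_space set) \<Rightarrow> nat set \<Rightarrow> (nat \<Rightarrow> 'a) set \<Rightarrow> ennreal" where
  "factorial_moment M \<eta> I C =
     (\<integral>\<^sup>+ \<omega>. (\<integral>\<^sup>+ x. indicator C x \<partial>count_space {x \<in> I \<rightarrow>\<^sub>E \<eta> \<omega>. inj_on x I}) \<partial>M)"

definition factorial_cumulant ::
  "'w measure \<Rightarrow> ('w \<Rightarrow> 'a::euclidean_space set) \<Rightarrow> nat \<Rightarrow> (nat \<Rightarrow> 'a) signed_measure \<Rightarrow> bool" where
  "factorial_cumulant M \<eta> m \<beta> \<longleftrightarrow>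
     locally_finite_signed {..<m} \<beta> \<and>
     (\<forall>B. (\<forall>i<m. B i \<in> sets borel \<and> bounded (B i)) \<longrightarrow>
        smeasure \<beta> (Pi\<^sub>E {..<m} B) =
          (\<Sum>j = 1..m. (- 1) ^ (j - 1) * fact (j - 1) *
             (\<Sum>\<pi> | partition_on {..<m} \<pi> \<and> card \<pi> = j.
                \<Prod>I\<in>\<pi>. enn2real (factorial_moment M \<eta> I (Pi\<^sub>E I B)))))"

text \<open>
  Both signed measures below are uniquely determined. The defining identity of the reduced measure
  is tested on bounded Borel sets, where the factorial cumulant measure is defined; the index 0
  carries the base point \<open>x\<close>.
\<close>

definition reduced_factorial_cumulant ::
  "'w measure \<Rightarrow> ('w \<Rightarrow> 'a::euclidean_space set) \<Rightarrow> nat \<Rightarrow> (nat \<Rightarrow> 'a) signed_measure \<Rightarrow> bool" where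
  "reduced_factorial_cumulant M \<eta> m \<nu> \<longleftrightarrow>
     locally_finite_signed {1..<m} \<nu> \<and>
     (\<exists>\<beta>. factorial_cumulant M \<eta> m \<beta> \<and>
        (\<forall>C. bounded_borel {..<m} C \<longrightarrow>
           smeasure \<beta> C =
             (\<integral>x. sintegral \<nu> (\<lambda>y. indicator C (\<lambda>i\<in>{..<m}. if i = 0 then x else y i + x) :: real)
                \<partial>lborel)))"

text \<open>
  The second argument is the second reduced factorial cumulant measure, whose points have the single
  coordinate 1. The structure factor is real since this measure is symmetric, but it is introduced
  as the complex number given by its defining integral.
\<close>

definition structure_factor ::
  "real \<Rightarrow> (nat \<Rightarrow> 'a::euclidean_space) signed_measure \<Rightarrow> 'a \<Rightarrow> complex" where
  "structure_factor \<gamma> \<nu> k = 1 + complex_of_real (1 / \<gamma>) * sintegral \<nu> (\<lambda>y. cis (- (k \<bullet> y 1)))"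


section \<open>Window functions and wave vectors\<close>

definition window_class :: "real \<Rightarrow> ('a::euclidean_space \<Rightarrow> real) set" where
  "window_class p = {h. h \<in> borel_measurable borel \<and> (\<forall>x. 0 \<le> h x) \<and> bounded (range h) \<and>
     integrable lborel h \<and>
     (\<exists>a>0. \<exists>b>0. \<forall>y.
        indicator {z. norm z \<le> b} y * (\<integral>x. \<bar>h (x + y) - h x\<bar> \<partial>lborel) \<le> a * norm y powr p)}"

definition window_moment :: "nat \<Rightarrow> ('a::euclidean_space \<Rightarrow> real) \<Rightarrow> real" where
  "window_moment j h = (\<integral>x. h x ^ j \<partial>lborel)"

definition scaled :: "('a::euclidean_space \<Rightarrow> real) \<Rightarrow> real \<Rightarrow> 'a \<Rightarrow> real" where
  "scaled h r x = h (x /\<^sub>R r)"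

text \<open>Functions on the positive reals are total functions on the reals; values at \<open>r \<le> 0\<close> are ignored.\<close>

definition wave_vectors :: "('a::euclidean_space \<Rightarrow> real) \<Rightarrow> (real \<Rightarrow> 'a) set" where
  "wave_vectors h = {k. (\<exists>l. l \<noteq> 0 \<and> (k \<longlongrightarrow> l) at_top) \<and>
     ((\<lambda>r. complex_of_real (r powr (- real DIM('a) / 2)) *
        (\<integral>x. complex_of_real (scaled h r x) * cis (k r \<bullet> x) \<partial>lborel)) \<longlongrightarrow> 0) at_top \<and>
     ((\<lambda>r. complex_of_real (r powr (- real DIM('a) / 2)) *
        (\<integral>x. complex_of_real (scaled h r x) * cis (- (k r \<bullet> x)) \<partial>lborel)) \<longlongrightarrow> 0) at_top}"

text \<open>
  The sum over the points is an unordered sum; under the moment and cumulant assumptions it is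
  almost surely absolutely convergent, and \<open>infsum\<close> returns 0 on the exceptional null set.
\<close>

definition scattering ::
  "('w \<Rightarrow> 'a::euclidean_space set) \<Rightarrow> real \<Rightarrow> ('a \<Rightarrow> real) \<Rightarrow> real \<Rightarrow> 'a \<Rightarrow> 'w \<Rightarrow> complex" where
  "scattering \<eta> \<gamma> h r k \<omega> =
     complex_of_real (1 / r powr (real DIM('a) / 2)) *
       (\<Sum>\<^sub>\<infinity>x\<in>\<eta> \<omega>. complex_of_real (scaled h r x) * cis (- (k \<bullet> x)))
     - indicator {0} k *
       complex_of_real (window_moment 1 h * \<gamma> * r powr (real DIM('a) / 2))"


section \<open>Normal distributions and convergence in distribution\<close>

text \<open>A centered normally distributed random variable with variance 0 is almost surely 0.\<close>

definition centered_normal :: "'v measure \<Rightarrow> ('v \<Rightarrow> real) \<Rightarrow> real \<Rightarrow> bool" where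
  "centered_normal N X v \<longleftrightarrow>
     (v = 0 \<and> X \<in> borel_measurable N \<and> (AE \<omega> in N. X \<omega> = 0)) \<or>
     (v > 0 \<and> distributed N lborel X (normal_density 0 (sqrt v)))"

text \<open>
  Complex normal variables with independent real and imaginary parts of variances \<open>v\<close> and \<open>w\<close>.
  Two variances are needed because \<open>scattering\<close> is real at the wave vector 0, so that its
  limit there has variances \<open>(v, 0)\<close>, as opposed to \<open>(v / 2, v / 2)\<close> at nonzero wave vectors.
\<close>

definition centered_complex_normal ::
  "'v measure \<Rightarrow> ('v \<Rightarrow> complex) \<Rightarrow> real \<Rightarrow> real \<Rightarrow> bool" where
  "centered_complex_normal N Z v w \<longleftrightarrow>
     centered_normal N (\<lambda>\<omega>. Re (Z \<omega>)) v \<and> centered_normal N (\<lambda>\<omega>. Im (Z \<omega>)) w \<and>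
     prob_space.indep_var N borel (\<lambda>\<omega>. Re (Z \<omega>)) borel (\<lambda>\<omega>. Im (Z \<omega>))"

text \<open>The library's \<open>weak_conv_m\<close> only covers sequences of measures on the real line.\<close>

definition converges_in_distribution ::
  "'w measure \<Rightarrow> (real \<Rightarrow> 'w \<Rightarrow> 'b::metric_space) \<Rightarrow> 'v measure \<Rightarrow> ('v \<Rightarrow> 'b) \<Rightarrow> bool" where
  "converges_in_distribution M X N Y \<longleftrightarrow>
     (\<forall>r>0. X r \<in> borel_measurable M) \<and> Y \<in> borel_measurable N \<and>
     (\<forall>f :: 'b \<Rightarrow> real. continuous_on UNIV f \<and> bounded (range f) \<longrightarrow>
        ((\<lambda>r. \<integral>\<omega>. f (X r \<omega>) \<partial>M) \<longlongrightarrow> (\<integral>\<omega>. f (Y \<omega>) \<partial>N)) at_top)"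

end

theory Submission
  imports Defs
begin

text \<open>
  Convergence of characteristic functions is proved by the method of cumulants. A real linear
  combination of the scattering variables is a normalized linear statistic of the process, whose
  test function is the window \<open>h_r\<close> times a trigonometric sum. Its cumulants are sums over partitions of
  factorial cumulant measures evaluated at products of the test function. Since the reduced
  factorial cumulant measures are finite, each cumulant is at most a constant times the integral of
  the absolute value of the test function, which has order \<open>r^d\<close>; after normalization by \<open>r^(d/2)\<close> all
  cumulants of order at least 3 vanish in the limit. The variance converges because the products of
  distinct frequencies disappear by the Riemann--Lebesgue lemma, for which the continuity of
  translations of \<open>h\<close> in \<open>L1\<close> is enough. The expectation is negligible by the choice of the wave vectors.

  The cumulant identities are only needed for step functions with bounded support: by Campbell's
  formula, two linear statistics differ in mean by at most the intensity times the \<open>L1\<close>-distance of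
  their test functions. Convergence of characteristic functions implies weak convergence since
  Gaussian kernels are mixtures of characters and smoothing with them is uniformly accurate on
  compactly supported continuous functions.
\<close>

section \<open>Joint cumulants\<close>

text \<open>Two obstacles shape the argument. A sum over the process weighted by an integrable
  window comes with no higher moments at the outset, since the moment hypothesis concerns bounded
  sets, and the cumulant measures are specified on bounded rectangles. So moments are taken inside
  bounded windows \<open>W\<close>, and the cumulant estimates must be uniform in \<open>W\<close>.
  Moreover, an explicit partition formula for the cumulants of a linear statistic is awkward to
  handle. Instead the central moments are shown to satisfy a recursion whose coefficients play the
  part of the cumulants, and the limit is taken in the recursion itself. A normalised cumulant of
  order m has size r^(d - m d / 2): one factor of the test function is integrated over space, the
  others are merely bounded. So m = 2 alone survives. The distinction between zero and nonzero wave
  vectors comes from one term. In the limiting variance a coefficient \<open>a\<close> has weight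
  |a|^2 / 2, produced by the difference of its frequency with itself, and at frequency 0 also Re
  (a^2) / 2, produced by the sum. Together these are (Re a)^2, the weight of a real
  variable.\<close>

definition joint_cumulant :: "'i set \<Rightarrow> ('i set \<Rightarrow> real) \<Rightarrow> real" where
  "joint_cumulant S a =
     (\<Sum>\<pi> | partition_on S \<pi>. (- 1) ^ (card \<pi> - 1) * fact (card \<pi> - 1) * (\<Prod>I\<in>\<pi>. a I))"

lemma joint_cumulant_cong:
  assumes "\<And>I. I \<subseteq> S \<Longrightarrow> I \<noteq> {} \<Longrightarrow> a I = b I"
  shows "joint_cumulant S a = joint_cumulant S b"
  unfolding joint_cumulant_def
proof (intro sum.cong refl arg_cong2[where f="(*)"] prod.cong)
  fix \<pi> I assume p: "\<pi> \<in> {\<pi>. partition_on S \<pi>}" and I: "I \<in> \<pi>"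
  then have "partition_on S \<pi>" by simp
  from partition_onD1[OF this] partition_onD3[OF this] I have "I \<subseteq> S" "I \<noteq> {}" by blast+
  then show "a I = b I" by (rule assms)
qed

lemma partition_on_insert_block:
  assumes "S \<subseteq> J" "S \<noteq> J" "partition_on S \<pi>"
  shows "partition_on J (insert (J - S) \<pi>)" "J - S \<notin> \<pi>"
proof -
  have U: "\<Union>\<pi> = S" and ne: "{} \<notin> \<pi>"
    using partition_onD1[OF assms(3)] partition_onD3[OF assms(3)] by auto
  have d: "disjoint \<pi>" using assms partition_onD2 by auto
  show n: "J - S \<notin> \<pi>"
  proof
    assume "J - S \<in> \<pi>"
    then have "J - S \<subseteq> S" using U by blast
    then show False using assms by blast
  qed
  show "partition_on J (insert (J - S) \<pi>)"
  proof (rule partition_onI)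
    show "\<Union>(insert (J - S) \<pi>) = J" using U assms by auto
    show "{} \<notin> insert (J - S) \<pi>" using ne assms by auto
    show "disjnt p q" if "p \<in> insert (J - S) \<pi>" "q \<in> insert (J - S) \<pi>" "p \<noteq> q" for p q
    proof -
      have "disjnt (J - S) q'" if "q' \<in> \<pi>" for q'
        using that U by (auto simp: disjnt_def)
      moreover have "disjnt p' q'" if "p' \<in> \<pi>" "q' \<in> \<pi>" "p' \<noteq> q'" for p' q'
        using d that by (auto simp: disjoint_def disjnt_def)
      ultimately show ?thesis using that by (auto simp: disjnt_sym)
    qed
  qed
qed

lemma partition_on_remove_block:
  assumes "partition_on J \<pi>" "b \<in> \<pi>"
  shows "partition_on (J - b) (\<pi> - {b})"
proof -
  have U: "\<Union>\<pi> = J" and ne: "{} \<notin> \<pi>"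
    using partition_onD1[OF assms(1)] partition_onD3[OF assms(1)] by auto
  have d: "disjoint \<pi>" using assms partition_onD2 by auto
  show ?thesis
  proof (rule partition_onI)
    show "\<Union>(\<pi> - {b}) = J - b"
      using U d assms(2) by (auto simp: disjoint_def)
    show "{} \<notin> \<pi> - {b}" using ne by auto
    show "disjnt p q" if "p \<in> \<pi> - {b}" "q \<in> \<pi> - {b}" "p \<noteq> q" for p q
      using d that by (auto simp: disjoint_def disjnt_def)
  qed
qed

text \<open>
  A proper subset \<open>S\<close> of \<open>J\<close> containing \<open>i0\<close> together with a partition of \<open>S\<close> is the same as a partition
  of \<open>J\<close> with a distinguished block not containing \<open>i0\<close>.
\<close>

lemma joint_cumulant_recursion:
  fixes a :: "'i set \<Rightarrow> real"
  assumes fin: "finite J" and i0: "i0 \<in> J" and a0: "a {} = 1"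
  shows "a J = (\<Sum>S | i0 \<in> S \<and> S \<subseteq> J. joint_cumulant S a * a (J - S))"
proof -
  define w :: "nat \<Rightarrow> real" where "w n = (- 1) ^ (n - 1) * fact (n - 1)" for n
  define W where "W \<pi> = (\<Prod>I\<in>\<pi>. a I)" for \<pi>
  have jc: "joint_cumulant S a = (\<Sum>\<pi> | partition_on S \<pi>. w (card \<pi>) * W \<pi>)" for S
    by (simp add: joint_cumulant_def w_def W_def)
  let ?SS = "{S. i0 \<in> S \<and> S \<subseteq> J \<and> S \<noteq> J}"
  let ?P = "\<lambda>S. {\<pi>. partition_on S \<pi>}"
  let ?B = "\<lambda>\<pi>. {b\<in>\<pi>. i0 \<notin> b}"
  have finP: "finite (?P S)" if "S \<subseteq> J" for S
    by (rule finitely_many_partition_on[OF finite_subset[OF that fin]])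
  have fin\<pi>: "finite \<pi>" if "partition_on J \<pi>" for \<pi>
    using finite_elements[OF fin that] .
  have eq: "{S. i0 \<in> S \<and> S \<subseteq> J} = insert J ?SS" using i0 by auto
  have finSS: "finite ?SS" using fin by simp
  have "(\<Sum>S\<in>?SS. joint_cumulant S a * a (J - S))
      = (\<Sum>S\<in>?SS. \<Sum>\<pi>\<in>?P S. w (card \<pi>) * W \<pi> * a (J - S))"
    by (simp add: jc sum_distrib_right)
  also have "\<dots> = (\<Sum>(S, \<pi>)\<in>Sigma ?SS ?P. w (card \<pi>) * W \<pi> * a (J - S))"
    by (rule sum.Sigma) (use finSS finP in auto)
  also have "\<dots> = (\<Sum>(\<pi>, b)\<in>Sigma (?P J) ?B. w (card \<pi> - 1) * W \<pi>)"
  proof (rule sum.reindex_bij_witness[where i = "\<lambda>(\<pi>, b). (J - b, \<pi> - {b})"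
        and j = "\<lambda>(S, \<pi>). (insert (J - S) \<pi>, J - S)"])
    fix x assume x: "x \<in> Sigma ?SS ?P"
    obtain S \<pi> where [simp]: "x = (S, \<pi>)" by (cases x)
    have S: "i0 \<in> S" "S \<subseteq> J" "S \<noteq> J" "partition_on S \<pi>" using x by auto
    note pb = partition_on_insert_block[OF S(2-4)]
    show "(case case x of (S, \<pi>) \<Rightarrow> (insert (J - S) \<pi>, J - S) of (\<pi>, b) \<Rightarrow> (J - b, \<pi> - {b})) = x"
      using S pb(2) double_diff[of S J J] by simp
    show "(case x of (S, \<pi>) \<Rightarrow> (insert (J - S) \<pi>, J - S)) \<in> Sigma (?P J) ?B"
      using S(1) pb(1) by simp
    have f: "finite \<pi>" by (rule finite_elements[OF finite_subset[OF S(2) fin] S(4)])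
    show "(case case x of (S, \<pi>) \<Rightarrow> (insert (J - S) \<pi>, J - S) of (\<pi>, b) \<Rightarrow> w (card \<pi> - 1) * W \<pi>)
       = (case x of (S, \<pi>) \<Rightarrow> w (card \<pi>) * W \<pi> * a (J - S))"
      using pb f by (simp add: W_def)
  next
    fix y assume y: "y \<in> Sigma (?P J) ?B"
    obtain \<pi> b where [simp]: "y = (\<pi>, b)" by (cases y)
    have b: "partition_on J \<pi>" "b \<in> \<pi>" "i0 \<notin> b" using y by auto
    have bJ: "b \<subseteq> J" "b \<noteq> {}" using b(2) partition_onD1[OF b(1)] partition_onD3[OF b(1)] by auto
    have JJ: "J - (J - b) = b" using bJ by blast
    show "(case case y of (\<pi>, b) \<Rightarrow> (J - b, \<pi> - {b}) of (S, \<pi>) \<Rightarrow> (insert (J - S) \<pi>, J - S)) = y"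
      using b(2) JJ by (simp add: insert_absorb)
    show "(case y of (\<pi>, b) \<Rightarrow> (J - b, \<pi> - {b})) \<in> Sigma ?SS ?P"
      using partition_on_remove_block[OF b(1,2)] b(3) i0 Diff_subset[of J b] bJ
      by (simp del: Diff_subset) (metis double_diff Diff_cancel JJ)
  qed
  also have "\<dots> = (\<Sum>\<pi>\<in>?P J. \<Sum>b\<in>?B \<pi>. w (card \<pi> - 1) * W \<pi>)"
    by (rule sum.Sigma[symmetric]) (use finP fin\<pi> in auto)
  also have "\<dots> = (\<Sum>\<pi>\<in>?P J. real (card \<pi> - 1) * w (card \<pi> - 1) * W \<pi>)"
  proof (intro sum.cong refl)
    fix \<pi> assume "\<pi> \<in> ?P J"
    then have p: "partition_on J \<pi>" by simp
    obtain b0 where b0: "b0 \<in> \<pi>" "i0 \<in> b0" using partition_onD1[OF p] i0 by blast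
    have "b = b0" if "b \<in> \<pi>" "i0 \<in> b" for b
      using partition_onD2[OF p] b0 that by (auto simp: disjoint_def)
    then have "?B \<pi> = \<pi> - {b0}" using b0(2) by blast
    then have "card (?B \<pi>) = card \<pi> - 1" by (simp only: card_Diff_singleton[OF b0(1)])
    then show "(\<Sum>b\<in>?B \<pi>. w (card \<pi> - 1) * W \<pi>) = real (card \<pi> - 1) * w (card \<pi> - 1) * W \<pi>"
      by simp
  qed
  finally have A: "(\<Sum>S\<in>?SS. joint_cumulant S a * a (J - S))
     = (\<Sum>\<pi>\<in>?P J. real (card \<pi> - 1) * w (card \<pi> - 1) * W \<pi>)" .
  have "(\<Sum>S | i0 \<in> S \<and> S \<subseteq> J. joint_cumulant S a * a (J - S))
     = joint_cumulant J a + (\<Sum>S\<in>?SS. joint_cumulant S a * a (J - S))"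
    unfolding eq using finSS by (subst sum.insert) (auto simp: a0)
  also have "\<dots> = (\<Sum>\<pi>\<in>?P J. (w (card \<pi>) + real (card \<pi> - 1) * w (card \<pi> - 1)) * W \<pi>)"
    unfolding A by (simp add: jc sum.distrib[symmetric] distrib_right)
  \<comment> \<open>\<open>w\<close> is the Moebius function of the partition lattice. Since
    \<open>w n = - (n - 1) * w (n - 1)\<close> for \<open>n \<ge> 2\<close>, every partition with at
    least two blocks cancels and only the one-block partition remains.\<close>
  also have "\<dots> = (\<Sum>\<pi>\<in>?P J. if \<pi> = {J} then a J else 0)"
  proof (intro sum.cong refl)
    fix \<pi> assume "\<pi> \<in> ?P J"
    then have p: "partition_on J \<pi>" by simp
    have "\<pi> \<noteq> {}" using partition_onD1[OF p] i0 by blast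
    then have c: "card \<pi> \<ge> 1" using fin\<pi>[OF p] by (simp add: card_gt_0_iff Suc_leI)
    show "(w (card \<pi>) + real (card \<pi> - 1) * w (card \<pi> - 1)) * W \<pi> = (if \<pi> = {J} then a J else 0)"
    proof (cases "card \<pi> = 1")
      case True
      then obtain b where "\<pi> = {b}" by (auto simp: card_1_singleton_iff)
      moreover have "b = J" using partition_onD1[OF p] calculation by simp
      ultimately show ?thesis by (simp add: w_def W_def)
    next
      case False
      have "\<exists>n. card \<pi> = Suc (Suc n)" using c False by presburger
      then obtain n where n: "card \<pi> = Suc (Suc n)" by blast
      then have "\<pi> \<noteq> {J}" by auto
      then show ?thesis by (simp add: w_def n algebra_simps)
    qed
  qed
  also have "\<dots> = a J"
    using finP[of J] partition_on_space[of J] i0 by (subst sum.delta) auto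
  finally show ?thesis by simp
qed

lemma partition_on_image_inj:
  assumes "inj_on \<sigma> S" "partition_on S \<pi>"
  shows "partition_on (\<sigma> ` S) ((`) \<sigma> ` \<pi>)"
proof -
  have "(`) \<sigma> ` \<pi> - {{}} = (`) \<sigma> ` \<pi>" using partition_onD3[OF assms(2)] by auto
  with partition_on_inj_image[OF assms(2,1)] show ?thesis by simp
qed

text \<open>Taking images blockwise is a bijection between the partitions and keeps the number of
  blocks. It is needed because cumulant measures are indexed by initial segments
  \<open>{..<m}\<close>, while the cluster recursion produces arbitrary finite index sets.\<close>

lemma joint_cumulant_image:
  assumes "inj_on \<sigma> S"
  shows "joint_cumulant (\<sigma> ` S) a = joint_cumulant S (\<lambda>I. a (\<sigma> ` I))"
proof -
  let ?\<tau> = "the_inv_into S \<sigma>"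
  have inv: "(`) ?\<tau> ` (`) \<sigma> ` \<pi> = \<pi>" if "partition_on S \<pi>" for \<pi>
  proof -
    have "?\<tau> ` \<sigma> ` I = I" if "I \<in> \<pi>" for I
    proof -
      have "I \<subseteq> S" using that(1) partition_onD1[OF \<open>partition_on S \<pi>\<close>] by blast
      then show ?thesis by (force simp: image_image the_inv_into_f_f[OF assms])
    qed
    then show ?thesis by (simp add: image_image)
  qed
  have inv2: "(`) \<sigma> ` (`) ?\<tau> ` \<pi> = \<pi>" if "partition_on (\<sigma> ` S) \<pi>" for \<pi>
  proof -
    have "\<sigma> ` ?\<tau> ` I = I" if "I \<in> \<pi>" for I
    proof -
      have "I \<subseteq> \<sigma> ` S" using that(1) partition_onD1[OF \<open>partition_on (\<sigma> ` S) \<pi>\<close>] by blast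
      then show ?thesis by (force simp: image_image f_the_inv_into_f[OF assms])
    qed
    then show ?thesis by (simp add: image_image)
  qed
  have inj: "inj_on ((`) \<sigma>) \<pi>" if "partition_on S \<pi>" for \<pi>
  proof (rule inj_onI)
    fix I K assume IK: "I \<in> \<pi>" "K \<in> \<pi>" and e: "\<sigma> ` I = \<sigma> ` K"
    have "I \<subseteq> S" "K \<subseteq> S" using IK partition_onD1[OF that] by blast+
    then show "I = K" using e assms inj_on_image_eq_iff by blast
  qed
  have inj': "inj_on ?\<tau> (\<sigma> ` S)" using assms by (rule inj_on_the_inv_into)
  have Sim: "?\<tau> ` \<sigma> ` S = S" by (force simp: image_image the_inv_into_f_f[OF assms])
  show ?thesis
    unfolding joint_cumulant_def
  proof (rule sum.reindex_bij_witness[where i = "\<lambda>\<pi>. (`) \<sigma> ` \<pi>" and j = "\<lambda>\<pi>. (`) ?\<tau> ` \<pi>"])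
    fix \<pi> assume "\<pi> \<in> {\<pi>. partition_on (\<sigma> ` S) \<pi>}"
    then have p: "partition_on (\<sigma> ` S) \<pi>" by simp
    show "(`) \<sigma> ` (`) ?\<tau> ` \<pi> = \<pi>" by (rule inv2[OF p])
    have p': "partition_on S ((`) ?\<tau> ` \<pi>)"
      using partition_on_image_inj[OF inj' p] Sim by simp
    then show "(`) ?\<tau> ` \<pi> \<in> {\<pi>. partition_on S \<pi>}" by simp
    let ?\<rho> = "(`) ?\<tau> ` \<pi>"
    have e: "\<pi> = (`) \<sigma> ` ?\<rho>" using inv2[OF p] by simp
    have c: "card \<pi> = card ?\<rho>" by (subst e) (rule card_image[OF inj[OF p']])
    have "prod a \<pi> = (\<Prod>I\<in>?\<rho>. a (\<sigma> ` I))"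
      by (subst e, subst prod.reindex[OF inj[OF p']]) simp
    then show "(- 1) ^ (card ?\<rho> - 1) * fact (card ?\<rho> - 1) * (\<Prod>I\<in>?\<rho>. a (\<sigma> ` I))
       = (- 1) ^ (card \<pi> - 1) * fact (card \<pi> - 1) * prod a \<pi>" using c by simp
  next
    fix \<pi> assume "\<pi> \<in> {\<pi>. partition_on S \<pi>}"
    then show "(`) ?\<tau> ` (`) \<sigma> ` \<pi> = \<pi>" "(`) \<sigma> ` \<pi> \<in> {\<pi>. partition_on (\<sigma> ` S) \<pi>}"
      using inv partition_on_image_inj[OF assms] by auto
  qed
qed

text \<open>Each block of a partition contributes one factor, so cumulants inherit multilinearity.\<close>

lemma joint_cumulant_linear:
  assumes "finite S" "i \<in> S"
    and "\<And>I. I \<subseteq> S \<Longrightarrow> i \<in> I \<Longrightarrow> a I = c * b I + d * b' I"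
    and "\<And>I. I \<subseteq> S \<Longrightarrow> i \<notin> I \<Longrightarrow> a I = b I \<and> a I = b' I"
  shows "joint_cumulant S a = c * joint_cumulant S b + d * joint_cumulant S b'"
proof -
  have "prod a \<pi> = c * prod b \<pi> + d * prod b' \<pi>" if p: "partition_on S \<pi>" for \<pi>
  proof -
    obtain b0 where b0: "b0 \<in> \<pi>" "i \<in> b0" using partition_onD1[OF p] assms(2) by blast
    have u: "i \<notin> I" if "I \<in> \<pi> - {b0}" for I
      using partition_onD2[OF p] b0 that by (auto simp: disjoint_def)
    have s: "I \<subseteq> S" if "I \<in> \<pi>" for I using partition_onD1[OF p] that by blast
    have f: "finite \<pi>" using finite_elements[OF assms(1) p] .
    have "prod a (\<pi> - {b0}) = prod b (\<pi> - {b0})" "prod a (\<pi> - {b0}) = prod b' (\<pi> - {b0})"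
      by (rule prod.cong[OF refl], use assms(4)[OF s u] in blast)+
    then show ?thesis
      using assms(3)[OF s[OF b0(1)] b0(2)] prod.remove[OF f b0(1), of a] prod.remove[OF f b0(1), of b]
        prod.remove[OF f b0(1), of b'] by (simp add: algebra_simps)
  qed
  then show ?thesis
    unfolding joint_cumulant_def
    by (simp add: sum_distrib_left sum.distrib[symmetric] algebra_simps)
qed

text \<open>
  When a sum over tuples of distinct points is multiplied by a further linear statistic, the new
  point either is distinct from the others or coincides with one of them; in the second case the two
  test functions are multiplied. Applied to factorial moments, this rule yields (centred) moments,
  and applied to factorial cumulants it yields the cumulants of the same products.
\<close>

fun clus :: "('i set \<Rightarrow> ('i \<Rightarrow> 'a \<Rightarrow> real) \<Rightarrow> real) \<Rightarrow> 'i set \<Rightarrow> ('i \<Rightarrow> 'a \<Rightarrow> real) \<Rightarrow> 'i list \<Rightarrow> real" where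
  "clus B J f [] = B J f"
| "clus B J f (t # ts) = clus B (insert t J) f ts
     + (\<Sum>i\<in>J. clus B J (f(i := \<lambda>x. f i x * f t x)) ts)"

fun centred :: "('i set \<Rightarrow> ('i \<Rightarrow> 'a \<Rightarrow> real) \<Rightarrow> real) \<Rightarrow> ('i \<Rightarrow> real) \<Rightarrow> 'i set \<Rightarrow> ('i \<Rightarrow> 'a \<Rightarrow> real) \<Rightarrow> 'i list \<Rightarrow> real" where
  "centred A m J f [] = A J f"
| "centred A m J f (t # ts) = centred A m (insert t J) f ts
     + (\<Sum>i\<in>J. centred A m J (f(i := \<lambda>x. f i x * f t x)) ts) - m t * centred A m J f ts"

text \<open>Serves to ignore, in one factor of a product, an update of \<open>f\<close> at an index
  that belongs to the other factor; \<open>centred_cong\<close> has the same purpose.\<close>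

lemma clus_cong:
  assumes "\<And>J f f'. (\<And>i. i \<in> J \<Longrightarrow> f i = f' i) \<Longrightarrow> B J f = B J f'"
  shows "(\<And>i. i \<in> J \<union> set ts \<Longrightarrow> f i = f' i) \<Longrightarrow> clus B J f ts = clus B J f' ts"
proof (induction ts arbitrary: J f f')
  case Nil
  then show ?case using assms[of J f f'] by simp
next
  case (Cons t ts)
  have "clus B (insert t J) f ts = clus B (insert t J) f' ts"
    by (rule Cons.IH) (use Cons.prems in auto)
  moreover have "clus B J (f(i := \<lambda>x. f i x * f t x)) ts = clus B J (f'(i := \<lambda>x. f' i x * f' t x)) ts"
    if "i \<in> J" for i
    by (rule Cons.IH) (use Cons.prems that in auto)
  ultimately show ?case by simp
qed

lemma centred_cong:
  assumes "\<And>J f f'. (\<And>i. i \<in> J \<Longrightarrow> f i = f' i) \<Longrightarrow> A J f = A J f'"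
  shows "(\<And>i. i \<in> J \<union> set ts \<Longrightarrow> f i = f' i) \<Longrightarrow> centred A m J f ts = centred A m J f' ts"
proof (induction ts arbitrary: J f f')
  case Nil
  then show ?case using assms[of J f f'] by simp
next
  case (Cons t ts)
  have "centred A m (insert t J) f ts = centred A m (insert t J) f' ts"
    by (rule Cons.IH) (use Cons.prems in auto)
  moreover have "centred A m J f ts = centred A m J f' ts"
    by (rule Cons.IH) (use Cons.prems in auto)
  moreover have "centred A m J (f(i := \<lambda>x. f i x * f t x)) ts = centred A m J (f'(i := \<lambda>x. f' i x * f' t x)) ts"
    if "i \<in> J" for i
    by (rule Cons.IH) (use Cons.prems that in auto)
  ultimately show ?case by simp
qed

lemma sum_Pow_insert:
  fixes F :: "'i set \<Rightarrow> real"
  assumes "finite T" "t \<notin> T"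
  shows "(\<Sum>U\<in>Pow (insert t T). F U) = (\<Sum>U\<in>Pow T. F U + F (insert t U))"
proof -
  have "(\<Sum>U\<in>Pow (insert t T). F U) = (\<Sum>U\<in>Pow T. F U) + (\<Sum>U\<in>insert t ` Pow T. F U)"
    unfolding Pow_insert by (rule sum.union_disjoint) (use assms in auto)
  also have "(\<Sum>U\<in>insert t ` Pow T. F U) = (\<Sum>U\<in>Pow T. F (insert t U))"
    by (subst sum.reindex) (use assms in \<open>auto simp: inj_on_def\<close>)
  finally show ?thesis by (simp add: sum.distrib)
qed

lemma sum_subsets_insert:
  fixes F :: "'i set \<Rightarrow> real"
  assumes "finite J" "t \<notin> J" "i0 \<in> J"
  shows "(\<Sum>S | i0 \<in> S \<and> S \<subseteq> insert t J. F S)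
      = (\<Sum>S | i0 \<in> S \<and> S \<subseteq> J. F S + F (insert t S))"
proof -
  let ?A = "{S. i0 \<in> S \<and> S \<subseteq> J}"
  have eq: "{S. i0 \<in> S \<and> S \<subseteq> insert t J} = ?A \<union> insert t ` ?A"
  proof (intro set_eqI iffI)
    fix S assume S: "S \<in> {S. i0 \<in> S \<and> S \<subseteq> insert t J}"
    show "S \<in> ?A \<union> insert t ` ?A"
    proof (cases "t \<in> S")
      case True
      then have "S = insert t (S - {t})" "S - {t} \<in> ?A" using S assms by auto
      then show ?thesis by blast
    qed (use S in auto)
  qed (use assms in auto)
  have "sum F (?A \<union> insert t ` ?A) = sum F ?A + sum F (insert t ` ?A)"
    by (rule sum.union_disjoint) (use assms in auto)
  also have "sum F (insert t ` ?A) = (\<Sum>S\<in>?A. F (insert t S))"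
    by (subst sum.reindex) (use assms in \<open>auto simp: inj_on_def\<close>)
  finally show ?thesis unfolding eq by (simp add: sum.distrib)
qed

text \<open>
  Multiplication by a further (centred) linear statistic acts as a derivation on the products
  of a cluster containing a fixed index and its complement.
\<close>

lemma centred_clus:
  fixes A B :: "'i set \<Rightarrow> ('i \<Rightarrow> 'a \<Rightarrow> real) \<Rightarrow> real"
  assumes A: "\<And>J f f'. (\<And>i. i \<in> J \<Longrightarrow> f i = f' i) \<Longrightarrow> A J f = A J f'"
    and B: "\<And>J f f'. (\<And>i. i \<in> J \<Longrightarrow> f i = f' i) \<Longrightarrow> B J f = B J f'"
    and R: "\<And>J f i. finite J \<Longrightarrow> i \<in> J \<Longrightarrow> A J f = (\<Sum>S | i \<in> S \<and> S \<subseteq> J. B S f * A (J - S) f)"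
  shows "finite J \<Longrightarrow> i0 \<in> J \<Longrightarrow> distinct ts \<Longrightarrow> set ts \<inter> J = {} \<Longrightarrow>
    centred A m J f ts = (\<Sum>S | i0 \<in> S \<and> S \<subseteq> J. \<Sum>U\<in>Pow (set ts).
       clus B S f (filter (\<lambda>t. t \<in> U) ts) * centred A m (J - S) f (filter (\<lambda>t. t \<notin> U) ts))"
proof (induction ts arbitrary: J f)
  case Nil
  then show ?case using R[of J i0 f] by simp
next
  case (Cons t ts)
  let ?SS = "{S. i0 \<in> S \<and> S \<subseteq> J}" and ?PP = "Pow (set ts)"
  let ?u = "\<lambda>f i. f(i := \<lambda>x. f i x * f t x)"
  let ?p = "\<lambda>U. filter (\<lambda>t. t \<in> U) ts" and ?n = "\<lambda>U. filter (\<lambda>t. t \<notin> U) ts"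
  let ?C = "\<lambda>S f U. clus B S f (?p U)"
  let ?Q = "\<lambda>J f U. centred A m J f (?n U)"
  have t: "t \<notin> J" "t \<notin> set ts" "distinct ts" "set ts \<inter> J = {}" and tJ: "set ts \<inter> insert t J = {}"
    using Cons.prems by auto
  have fin: "finite J" and i0: "i0 \<in> J" using Cons.prems by auto
  have IH1: "centred A m (insert t J) f ts
     = (\<Sum>S\<in>?SS. \<Sum>U\<in>?PP. ?C S f U * ?Q (insert t (J - S)) f U + ?C (insert t S) f U * ?Q (J - S) f U)"
  proof -
    have "centred A m (insert t J) f ts
     = (\<Sum>S | i0 \<in> S \<and> S \<subseteq> insert t J. \<Sum>U\<in>?PP. ?C S f U * ?Q (insert t J - S) f U)"
      by (rule Cons.IH) (use fin i0 t tJ in auto)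
    also have "\<dots> = (\<Sum>S\<in>?SS. (\<Sum>U\<in>?PP. ?C S f U * ?Q (insert t J - S) f U)
        + (\<Sum>U\<in>?PP. ?C (insert t S) f U * ?Q (insert t J - insert t S) f U))"
      by (rule sum_subsets_insert[OF fin t(1) i0])
    also have "\<dots> = (\<Sum>S\<in>?SS. (\<Sum>U\<in>?PP. ?C S f U * ?Q (insert t (J - S)) f U)
        + (\<Sum>U\<in>?PP. ?C (insert t S) f U * ?Q (J - S) f U))"
    proof (rule sum.cong[OF refl])
      fix S assume "S \<in> ?SS"
      then have "insert t J - S = insert t (J - S)" "insert t J - insert t S = J - S" using t by auto
      then show "(\<Sum>U\<in>?PP. ?C S f U * ?Q (insert t J - S) f U)
        + (\<Sum>U\<in>?PP. ?C (insert t S) f U * ?Q (insert t J - insert t S) f U)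
        = (\<Sum>U\<in>?PP. ?C S f U * ?Q (insert t (J - S)) f U)
        + (\<Sum>U\<in>?PP. ?C (insert t S) f U * ?Q (J - S) f U)" by simp
    qed
    finally show ?thesis by (simp add: sum.distrib)
  qed
  \<comment> \<open>Product rule: when the new point coincides with point \<open>i\<close>, only the
    factor whose index set contains \<open>i\<close> changes. The congruence lemmas restore the
    other factor to its value at \<open>f\<close>.\<close>
  have IH2: "(\<Sum>i\<in>J. centred A m J (?u f i) ts)
     = (\<Sum>S\<in>?SS. \<Sum>U\<in>?PP. (\<Sum>i\<in>S. ?C S (?u f i) U) * ?Q (J - S) f U
          + ?C S f U * (\<Sum>i\<in>J - S. ?Q (J - S) (?u f i) U))"
  proof -
    have "(\<Sum>i\<in>J. centred A m J (?u f i) ts)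
      = (\<Sum>i\<in>J. \<Sum>S\<in>?SS. \<Sum>U\<in>?PP. ?C S (?u f i) U * ?Q (J - S) (?u f i) U)"
      by (rule sum.cong[OF refl], rule Cons.IH) (use fin i0 t in auto)
    also have "\<dots> = (\<Sum>S\<in>?SS. \<Sum>i\<in>J. \<Sum>U\<in>?PP. ?C S (?u f i) U * ?Q (J - S) (?u f i) U)"
      by (rule sum.swap)
    also have "\<dots> = (\<Sum>S\<in>?SS. \<Sum>U\<in>?PP. \<Sum>i\<in>J. ?C S (?u f i) U * ?Q (J - S) (?u f i) U)"
      by (rule sum.cong[OF refl], rule sum.swap)
    also have "\<dots> = (\<Sum>S\<in>?SS. \<Sum>U\<in>?PP. (\<Sum>i\<in>S. ?C S (?u f i) U) * ?Q (J - S) f U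
          + ?C S f U * (\<Sum>i\<in>J - S. ?Q (J - S) (?u f i) U))"
    proof (intro sum.cong refl)
      fix S U assume S: "S \<in> ?SS"
      have "(\<Sum>i\<in>J. ?C S (?u f i) U * ?Q (J - S) (?u f i) U)
        = (\<Sum>i\<in>J - S. ?C S (?u f i) U * ?Q (J - S) (?u f i) U)
         + (\<Sum>i\<in>S. ?C S (?u f i) U * ?Q (J - S) (?u f i) U)"
        using S fin by (intro sum.subset_diff) auto
      moreover have "?C S (?u f i) U = ?C S f U" if "i \<in> J - S" for i
        by (rule clus_cong[OF B]) (use t that in auto)
      moreover have "?Q (J - S) (?u f i) U = ?Q (J - S) f U" if "i \<in> S" for i
        by (rule centred_cong[OF A]) (use t that S in auto)
      ultimately show "(\<Sum>i\<in>J. ?C S (?u f i) U * ?Q (J - S) (?u f i) U)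
        = (\<Sum>i\<in>S. ?C S (?u f i) U) * ?Q (J - S) f U
          + ?C S f U * (\<Sum>i\<in>J - S. ?Q (J - S) (?u f i) U)"
        by (simp add: sum_distrib_left sum_distrib_right)
    qed
    finally show ?thesis .
  qed
  have IH3: "centred A m J f ts = (\<Sum>S\<in>?SS. \<Sum>U\<in>?PP. ?C S f U * ?Q (J - S) f U)"
    by (rule Cons.IH) (use fin i0 t in auto)
  \<comment> \<open>The whole term with \<open>m t\<close> is absorbed by the complement factor,
    which is why \<open>clus\<close> is defined without any centring.\<close>
  have "centred A m J f (t # ts) = (\<Sum>S\<in>?SS. \<Sum>U\<in>?PP.
      (?C (insert t S) f U + (\<Sum>i\<in>S. ?C S (?u f i) U)) * ?Q (J - S) f U
     + ?C S f U * (?Q (insert t (J - S)) f U + (\<Sum>i\<in>J - S. ?Q (J - S) (?u f i) U) - m t * ?Q (J - S) f U))"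
    unfolding centred.simps IH1 IH2 IH3 sum_distrib_left sum.distrib[symmetric] sum_subtractf[symmetric]
    by (intro sum.cong refl) (simp add: algebra_simps sum_distrib_left)
  also have "\<dots> = (\<Sum>S\<in>?SS. \<Sum>U\<in>?PP.
      clus B S f (t # ?p U) * ?Q (J - S) f U + ?C S f U * centred A m (J - S) f (t # ?n U))"
    by simp
  also have "\<dots> = (\<Sum>S\<in>?SS. \<Sum>U\<in>Pow (insert t (set ts)).
       clus B S f (filter (\<lambda>t. t \<in> U) (t # ts)) * centred A m (J - S) f (filter (\<lambda>t. t \<notin> U) (t # ts)))"
  proof (rule sum.cong[OF refl])
    fix S
    have ft: "filter (\<lambda>t'. t' \<in> insert t U) ts = ?p U" "filter (\<lambda>t'. t' \<notin> insert t U) ts = ?n U" for U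
      using t(2) by (auto intro!: filter_cong)
    show "(\<Sum>U\<in>?PP. clus B S f (t # ?p U) * ?Q (J - S) f U + ?C S f U * centred A m (J - S) f (t # ?n U))
     = (\<Sum>U\<in>Pow (insert t (set ts)).
       clus B S f (filter (\<lambda>t. t \<in> U) (t # ts)) * centred A m (J - S) f (filter (\<lambda>t. t \<notin> U) (t # ts)))"
      unfolding sum_Pow_insert[OF finite_set t(2)]
    proof (rule sum.cong[OF refl])
      fix U assume "U \<in> ?PP"
      then have "t \<notin> U" using t by auto
      then show "clus B S f (t # ?p U) * ?Q (J - S) f U + ?C S f U * centred A m (J - S) f (t # ?n U)
        = clus B S f (filter (\<lambda>t. t \<in> U) (t # ts)) * centred A m (J - S) f (filter (\<lambda>t. t \<notin> U) (t # ts))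
        + clus B S f (filter (\<lambda>t'. t' \<in> insert t U) (t # ts))
          * centred A m (J - S) f (filter (\<lambda>t'. t' \<notin> insert t U) (t # ts))"
        by (simp add: ft del: clus.simps centred.simps insert_iff) simp
    qed
  qed
  finally show ?case by simp
qed

section \<open>Continuity theorem in Euclidean space\<close>

lemma abs_integral_le:
  fixes f g :: "'x \<Rightarrow> real"
  assumes "integrable M f" "integrable M g" "\<And>x. \<bar>f x\<bar> \<le> g x"
  shows "\<bar>\<integral>x. f x \<partial>M\<bar> \<le> (\<integral>x. g x \<partial>M)"
  by (rule order_trans[OF integral_abs_bound integral_mono[OF integrable_abs[OF assms(1)] assms(2,3)]])

lemma lborel_integral_affine:
  fixes f :: "'a::euclidean_space \<Rightarrow> 'b::{banach, second_countable_topology}"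
  assumes [measurable]: "f \<in> borel_measurable borel" and c: "c \<noteq> 0"
  shows "(\<integral>x. f x \<partial>lborel) = \<bar>c\<bar> ^ DIM('a) *\<^sub>R (\<integral>x. f (t + c *\<^sub>R x) \<partial>lborel)"
  by (subst lborel_affine[OF c, of t])
     (simp add: integral_density integral_distr)

lemma lborel_integrable_affine_iff:
  fixes f :: "'a::euclidean_space \<Rightarrow> 'b::{banach, second_countable_topology}"
  assumes [measurable]: "f \<in> borel_measurable borel" and c: "c \<noteq> 0"
  shows "integrable lborel f \<longleftrightarrow> integrable lborel (\<lambda>x. f (t + c *\<^sub>R x))"
proof -
  have "integrable lborel f \<longleftrightarrow> integrable lborel (\<lambda>x. \<bar>c\<bar> ^ DIM('a) *\<^sub>R f (t + c *\<^sub>R x))"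
    by (subst lborel_affine[OF c, of t]) (simp add: integrable_density integrable_distr_eq)
  also have "\<dots> \<longleftrightarrow> integrable lborel (\<lambda>x. f (t + c *\<^sub>R x))"
    using integrable_scaleR_right[of "1 / \<bar>c\<bar> ^ DIM('a)" lborel "\<lambda>x. \<bar>c\<bar> ^ DIM('a) *\<^sub>R f (t + c *\<^sub>R x)"] c
    by auto
  finally show ?thesis .
qed

lemma lborel_nn_integral_affine:
  fixes f :: "'a::euclidean_space \<Rightarrow> ennreal"
  assumes [measurable]: "f \<in> borel_measurable borel" and c: "c \<noteq> 0"
  shows "(\<integral>\<^sup>+x. f x \<partial>lborel) = ennreal (\<bar>c\<bar> ^ DIM('a)) * (\<integral>\<^sup>+x. f (t + c *\<^sub>R x) \<partial>lborel)"
  by (subst lborel_affine[OF c, of t])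
     (simp add: nn_integral_density nn_integral_distr nn_integral_cmult)

lemma cis_measurable [measurable]: "cis \<in> borel_measurable borel"
  by (intro borel_measurable_continuous_onI continuous_intros)

section \<open>Gaussian kernels as characteristic functions\<close>

definition gauss_space :: "'a::euclidean_space measure" where
  "gauss_space = distr (Pi\<^sub>M Basis (\<lambda>_. std_normal_distribution)) borel (\<lambda>x. \<Sum>b\<in>Basis. x b *\<^sub>R b)"

definition gauss_kernel :: "'a::euclidean_space \<Rightarrow> real" where
  "gauss_kernel z = exp (- (norm z)\<^sup>2 / 2)"

lemma gauss_kernel_measurable [measurable]: "gauss_kernel \<in> borel_measurable borel"
  unfolding gauss_kernel_def[abs_def] by measurable

lemma gauss_kernel_pos: "0 < gauss_kernel z" and gauss_kernel_le_1: "gauss_kernel z \<le> 1"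
  by (auto simp: gauss_kernel_def)

lemma gauss_kernel_prod: "gauss_kernel z = (\<Prod>b\<in>Basis. exp (- (z \<bullet> b)\<^sup>2 / 2))"
proof -
  have "(norm z)\<^sup>2 = (\<Sum>b\<in>Basis. (z \<bullet> b)\<^sup>2)"
    unfolding power2_norm_eq_inner by (subst euclidean_inner) (simp add: power2_eq_square)
  then show ?thesis
    by (simp add: gauss_kernel_def exp_sum[symmetric] sum_negf sum_divide_distrib)
qed

lemma measurable_sum_Basis [measurable]:
  "(\<lambda>x. \<Sum>b\<in>Basis. x b *\<^sub>R b :: 'a::euclidean_space) \<in> borel_measurable (Pi\<^sub>M Basis (\<lambda>_. borel))"
  by measurable

lemma sets_PiM_std_normal: "sets (Pi\<^sub>M I (\<lambda>_. std_normal_distribution)) = sets (Pi\<^sub>M I (\<lambda>_. borel))"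
  by (rule sets_PiM_cong) auto

lemma prob_space_std_normal: "prob_space std_normal_distribution"
  using real_dist_normal_dist by (simp add: real_distribution_def)

lemma prob_space_gauss_space: "prob_space (gauss_space :: 'a::euclidean_space measure)"
  unfolding gauss_space_def
proof (rule prob_space.prob_space_distr)
  show "prob_space (Pi\<^sub>M (Basis::'a set) (\<lambda>_. std_normal_distribution))"
    by (intro prob_space_PiM prob_space_std_normal)
  show "(\<lambda>x. \<Sum>b\<in>Basis. x b *\<^sub>R b) \<in> Pi\<^sub>M (Basis::'a set) (\<lambda>_. std_normal_distribution) \<rightarrow>\<^sub>M borel"
    using measurable_sum_Basis measurable_cong_sets[OF sets_PiM_std_normal refl] by blast
qed

lemma sets_gauss_space [simp, measurable_cong]: "sets gauss_space = sets borel"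
  by (simp add: gauss_space_def)

lemma cis_sum: "finite A \<Longrightarrow> cis (\<Sum>i\<in>A. f i) = (\<Prod>i\<in>A. cis (f i))"
  by (induction A rule: finite_induct) (auto simp: cis_mult[symmetric])

lemma std_normal_cis: "(\<integral>x. cis (x * t) \<partial>std_normal_distribution) = complex_of_real (exp (- t\<^sup>2 / 2))"
  using fun_cong[OF char_std_normal_distribution, of t] by (simp add: char_def cis_conv_exp mult_ac)

text \<open>The coordinates along \<open>Basis\<close> are independent, so the integral factorises
  into one-dimensional characteristic functions.\<close>

lemma integral_cis_gauss_space:
  "(\<integral>t. cis (t \<bullet> z) \<partial>gauss_space) = complex_of_real (gauss_kernel (z :: 'a::euclidean_space))"
proof -
  interpret product_sigma_finite "\<lambda>_::'a. std_normal_distribution"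
    by (rule product_sigma_finite.intro) (rule prob_space_imp_sigma_finite[OF prob_space_std_normal])
  have m: "(\<lambda>x. \<Sum>b\<in>Basis. x b *\<^sub>R b) \<in> Pi\<^sub>M (Basis::'a set) (\<lambda>_. std_normal_distribution) \<rightarrow>\<^sub>M borel"
    using measurable_sum_Basis measurable_cong_sets[OF sets_PiM_std_normal refl] by blast
  interpret p: prob_space std_normal_distribution by (rule prob_space_std_normal)
  have "(\<integral>t. cis (t \<bullet> z) \<partial>gauss_space)
      = (\<integral>x. cis ((\<Sum>b\<in>Basis. x b *\<^sub>R b) \<bullet> z) \<partial>Pi\<^sub>M (Basis::'a set) (\<lambda>_. std_normal_distribution))"
    unfolding gauss_space_def by (rule integral_distr[OF m]) measurable
  also have "\<dots> = (\<integral>x. (\<Prod>b\<in>Basis. cis (x b * (z \<bullet> b))) \<partial>Pi\<^sub>M (Basis::'a set) (\<lambda>_. std_normal_distribution))"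
    by (simp add: inner_sum_left cis_sum) (simp add: inner_commute)
  also have "\<dots> = (\<Prod>b\<in>Basis. \<integral>x. cis (x * (z \<bullet> b)) \<partial>std_normal_distribution)"
    by (rule product_integral_prod)
       (auto intro!: p.integrable_const_bound[where B=1])
  also have "\<dots> = complex_of_real (gauss_kernel z)"
    by (simp add: std_normal_cis gauss_kernel_prod)
  finally show ?thesis .
qed

lemma integrable_gauss_kernel: "integrable lborel (gauss_kernel :: 'a::euclidean_space \<Rightarrow> real)"
proof -
  interpret product_sigma_finite "\<lambda>_::'a. lborel :: real measure" ..
  have "integrable lborel (\<lambda>x. sqrt (2 * pi) * std_normal_density x)"
    by (intro integrable_mult_right) simp
  also have "(\<lambda>x. sqrt (2 * pi) * std_normal_density x) = (\<lambda>x. exp (- x\<^sup>2 / 2))"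
    by (auto simp: std_normal_density_def fun_eq_iff)
  finally have i: "integrable lborel (\<lambda>x::real. exp (- x\<^sup>2 / 2))" .
  have "integrable (Pi\<^sub>M (Basis::'a set) (\<lambda>_. lborel)) (\<lambda>x. \<Prod>b\<in>Basis. exp (- (x b)\<^sup>2 / 2) :: real)"
    by (rule product_integrable_prod) (auto intro: i[simplified])
  also have "(\<lambda>x. \<Prod>b\<in>Basis. exp (- (x b)\<^sup>2 / 2) :: real) = (\<lambda>x. gauss_kernel (\<Sum>b\<in>Basis. x b *\<^sub>R b :: 'a))"
    by (auto simp: gauss_kernel_prod fun_eq_iff)
  finally have "integrable (Pi\<^sub>M (Basis::'a set) (\<lambda>_. lborel)) (\<lambda>x. gauss_kernel (\<Sum>b\<in>Basis. x b *\<^sub>R b :: 'a))" .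
  then show ?thesis
    unfolding lborel_def[where 'a='a] by (subst integrable_distr_eq) (auto simp: lborel_eq_real)
qed

text \<open>The Gaussian kernel is the characteristic function of a Gaussian law, hence a mixture of characters.\<close>

lemma gauss_kernel_tendsto:
  fixes \<mu> :: "nat \<Rightarrow> 'a::euclidean_space measure"
  assumes P: "\<And>n. prob_space (\<mu> n)" "\<And>n. sets (\<mu> n) = sets borel"
    and P': "prob_space \<mu>'" "sets \<mu>' = sets borel"
    and cf: "\<And>a. (\<lambda>n. \<integral>x. cis (a \<bullet> x) \<partial>\<mu> n) \<longlonglongrightarrow> (\<integral>x. cis (a \<bullet> x) \<partial>\<mu>')"
  shows "(\<lambda>n. \<integral>x. gauss_kernel (s *\<^sub>R (c - x)) \<partial>\<mu> n) \<longlonglongrightarrow> (\<integral>x. gauss_kernel (s *\<^sub>R (c - x)) \<partial>\<mu>')"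
proof -
  interpret G: prob_space "gauss_space :: 'a measure" by (rule prob_space_gauss_space)
  \<comment> \<open>Fubini leaves the measure only in its characteristic function at
    \<open>- s *\<^sub>R t\<close>. This is bounded by 1, so pointwise convergence of characteristic
    functions is enough for dominated convergence.\<close>
  have *: "complex_of_real (\<integral>x. gauss_kernel (s *\<^sub>R (c - x)) \<partial>\<nu>)
      = (\<integral>t. cis (s * (t \<bullet> c)) * (\<integral>x. cis ((- s *\<^sub>R t) \<bullet> x) \<partial>\<nu>) \<partial>gauss_space)"
    if p: "prob_space \<nu>" and [measurable_cong]: "sets \<nu> = sets borel" for \<nu> :: "'a measure"
  proof -
    interpret \<nu>: prob_space \<nu> by (rule p)
    interpret GM: pair_prob_space \<nu> "gauss_space :: 'a measure" ..
    have "complex_of_real (\<integral>x. gauss_kernel (s *\<^sub>R (c - x)) \<partial>\<nu>)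
       = (\<integral>x. complex_of_real (gauss_kernel (s *\<^sub>R (c - x))) \<partial>\<nu>)" by simp
    also have "\<dots> = (\<integral>x. (\<integral>t. cis (t \<bullet> (s *\<^sub>R (c - x))) \<partial>gauss_space) \<partial>\<nu>)"
      by (simp only: integral_cis_gauss_space)
    also have "\<dots> = (\<integral>t. (\<integral>x. cis (t \<bullet> (s *\<^sub>R (c - x))) \<partial>\<nu>) \<partial>gauss_space)"
    proof (rule GM.Fubini_integral[symmetric])
      show "integrable (\<nu> \<Otimes>\<^sub>M gauss_space) (\<lambda>(x, t). cis (t \<bullet> s *\<^sub>R (c - x)))"
        unfolding split_beta' by (rule GM.P.integrable_const_bound[where B=1]) (simp, measurable)
    qed
    also have "\<dots> = (\<integral>t. cis (s * (t \<bullet> c)) * (\<integral>x. cis ((- s *\<^sub>R t) \<bullet> x) \<partial>\<nu>) \<partial>gauss_space)"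
    proof -
      have "cis (t \<bullet> (s *\<^sub>R (c - x))) = cis (s * (t \<bullet> c)) * cis ((- s *\<^sub>R t) \<bullet> x)" for t x
        by (simp add: cis_mult inner_diff_right algebra_simps)
      then show ?thesis by simp
    qed
    finally show ?thesis .
  qed
  have "(\<lambda>n. complex_of_real (\<integral>x. gauss_kernel (s *\<^sub>R (c - x)) \<partial>\<mu> n))
     \<longlonglongrightarrow> complex_of_real (\<integral>x. gauss_kernel (s *\<^sub>R (c - x)) \<partial>\<mu>')"
    unfolding *[OF P] *[OF P']
  proof (rule integral_dominated_convergence[where w="\<lambda>_. 1"])
    have m: "(\<lambda>t. \<integral>x. cis ((- s *\<^sub>R t) \<bullet> x) \<partial>\<nu>) \<in> borel_measurable borel"
      if p: "prob_space \<nu>" and [measurable_cong]: "sets \<nu> = sets borel" for \<nu> :: "'a measure"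
    proof -
      interpret \<nu>: prob_space \<nu> by (rule p)
      show ?thesis by measurable
    qed
    note [measurable] = m[OF P] m[OF P']
    show "(\<lambda>t. cis (s * (t \<bullet> c)) * (\<integral>x. cis ((- s *\<^sub>R t) \<bullet> x) \<partial>\<mu>')) \<in> borel_measurable gauss_space"
      "\<And>n. (\<lambda>t. cis (s * (t \<bullet> c)) * (\<integral>x. cis ((- s *\<^sub>R t) \<bullet> x) \<partial>\<mu> n)) \<in> borel_measurable gauss_space"
      by measurable
    show "AE t in gauss_space. (\<lambda>n. cis (s * (t \<bullet> c)) * (\<integral>x. cis ((- s *\<^sub>R t) \<bullet> x) \<partial>\<mu> n))
        \<longlonglongrightarrow> cis (s * (t \<bullet> c)) * (\<integral>x. cis ((- s *\<^sub>R t) \<bullet> x) \<partial>\<mu>')"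
      by (intro AE_I2 tendsto_intros cf)
    show "AE t in gauss_space. norm (cis (s * (t \<bullet> c)) * (\<integral>x. cis ((- s *\<^sub>R t) \<bullet> x) \<partial>\<mu> n)) \<le> 1" for n
    proof (intro AE_I2)
      interpret prob_space "\<mu> n" by (rule P)
      fix t :: 'a
      have "norm (\<integral>x. cis ((- s *\<^sub>R t) \<bullet> x) \<partial>\<mu> n) \<le> (\<integral>x. norm (cis ((- s *\<^sub>R t) \<bullet> x)) \<partial>\<mu> n)"
        by (rule integral_norm_bound)
      then show "norm (cis (s * (t \<bullet> c)) * (\<integral>x. cis ((- s *\<^sub>R t) \<bullet> x) \<partial>\<mu> n)) \<le> 1"
        by (simp add: norm_mult prob_space)
    qed
  qed simp
  then show ?thesis using tendsto_of_real_iff by blast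
qed

text \<open>Convolution with a Gaussian of width \<open>1 / s\<close> approximates \<open>f\<close>
  uniformly on the whole space, so the error is the same for every probability measure and no
  tightness enters. For fixed \<open>s\<close> the smoothed function is a superposition of
  translated kernels, to which \<open>gauss_kernel_tendsto\<close> applies.\<close>

lemma tendsto_compact_support:
  fixes \<mu> :: "nat \<Rightarrow> 'a::euclidean_space measure" and f :: "'a \<Rightarrow> real"
  assumes P: "\<And>n. prob_space (\<mu> n)" "\<And>n. sets (\<mu> n) = sets borel"
    and P': "prob_space \<mu>'" "sets \<mu>' = sets borel"
    and cf: "\<And>a. (\<lambda>n. \<integral>x. cis (a \<bullet> x) \<partial>\<mu> n) \<longlonglongrightarrow> (\<integral>x. cis (a \<bullet> x) \<partial>\<mu>')"
    and f: "continuous_on UNIV f" and supp: "\<And>x. R < norm x \<Longrightarrow> f x = 0"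
  shows "(\<lambda>n. \<integral>x. f x \<partial>\<mu> n) \<longlonglongrightarrow> (\<integral>x. f x \<partial>\<mu>')"
proof -
  have [measurable]: "f \<in> borel_measurable borel" by (rule borel_measurable_continuous_onI[OF f])
  have "compact (f ` cball 0 R)" by (intro compact_continuous_image continuous_on_subset[OF f]) auto
  then obtain B0 where B0: "\<And>x. x \<in> cball 0 R \<Longrightarrow> norm (f x) \<le> B0"
    using compact_imp_bounded bounded_iff by (metis imageI)
  define B where "B = max B0 1"
  have B: "\<bar>f x\<bar> \<le> B" for x
  proof (cases "norm x \<le> R")
    case True then show ?thesis using B0[of x] by (auto simp: B_def)
  qed (use supp[of x] in \<open>auto simp: B_def\<close>)
  have Bpos: "0 < B" by (simp add: B_def)
  \<comment> \<open>The radius \<open>R + 1\<close> leaves a margin: if one of two points at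
    distance below 1 leaves the larger ball, both lie outside the support of
    \<open>f\<close>.\<close>
  have "uniformly_continuous_on (cball 0 (R + 1)) f"
    by (intro compact_uniformly_continuous continuous_on_subset[OF f]) auto
  then have uc: "\<exists>\<delta>>0. \<forall>x y. norm (y - x) < \<delta> \<longrightarrow> \<bar>f y - f x\<bar> < e" if e: "e > 0" for e
  proof -
    assume u: "uniformly_continuous_on (cball 0 (R + 1)) f"
    obtain d where d: "d > 0" "\<And>x y. x \<in> cball 0 (R+1) \<Longrightarrow> y \<in> cball 0 (R+1) \<Longrightarrow> dist y x < d \<Longrightarrow> dist (f y) (f x) < e"
      using u e unfolding uniformly_continuous_on_def by metis
    have "\<bar>f y - f x\<bar> < e" if h: "norm (y - x) < min d 1" for x y
    proof (cases "x \<in> cball 0 (R+1) \<and> y \<in> cball 0 (R+1)")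
      case True
      then show ?thesis using d(2)[of x y] h by (auto simp: dist_norm)
    next
      case False
      have "norm y \<le> norm x + norm (y - x)" "norm x \<le> norm y + norm (y - x)"
        using norm_triangle_sub[of y x] norm_triangle_sub[of x y] by (auto simp: norm_minus_commute)
      then have "f x = 0" "f y = 0" using False h by (auto intro!: supp)
      then show ?thesis using e by simp
    qed
    then show ?thesis using d(1) by (intro exI[of _ "min d 1"]) auto
  qed
  define I where "I = (\<integral>z. gauss_kernel (z :: 'a) \<partial>lborel)"
  have iK: "integrable lborel (gauss_kernel :: 'a \<Rightarrow> real)" by (rule integrable_gauss_kernel)
  have I: "I > 0"
  proof -
    have "I \<ge> 0" unfolding I_def by (intro integral_nonneg_AE) (auto intro: less_imp_le[OF gauss_kernel_pos])
    moreover have "I \<noteq> 0"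
    proof
      assume "I = 0"
      then have "AE z in lborel. gauss_kernel (z::'a) = 0"
        unfolding I_def using iK by (subst (asm) integral_nonneg_eq_0_iff_AE) (auto intro: less_imp_le[OF gauss_kernel_pos])
      then have "AE z in (lborel::'a measure). False" using gauss_kernel_pos by (auto simp: less_le)
      then have "emeasure (lborel :: 'a measure) UNIV = 0" by (subst (asm) AE_iff_measurable[where N=UNIV]) auto
      then show False by simp
    qed
    ultimately show ?thesis by simp
  qed
  have "integrable lborel (\<lambda>x. indicator (cball 0 R) x *\<^sub>R f x)"
    using f by (intro borel_integrable_compact continuous_on_subset[OF f]) auto
  also have "(\<lambda>x. indicator (cball 0 R) x *\<^sub>R f x) = f" using supp by (auto simp: indicator_def fun_eq_iff)
  finally have fint: "integrable lborel f" .
  \<comment> \<open>\<open>s ^ DIM('a) / I\<close> normalises the kernel of width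
    \<open>1 / s\<close> to total mass 1.\<close>
  define F where "F s x = (\<integral>c. f c * gauss_kernel (s *\<^sub>R (c - x)) \<partial>lborel) * s ^ DIM('a) / I" for s x
  have step1: "(\<lambda>n. \<integral>x. F s x \<partial>\<mu> n) \<longlonglongrightarrow> (\<integral>x. F s x \<partial>\<mu>')" for s
  proof -
    have *: "(\<integral>x. F s x \<partial>\<nu>) = (\<integral>c. f c * (\<integral>x. gauss_kernel (s *\<^sub>R (c - x)) \<partial>\<nu>) \<partial>lborel) * s ^ DIM('a) / I"
      if p: "prob_space \<nu>" and [measurable_cong]: "sets \<nu> = sets borel" for \<nu> :: "'a measure"
    proof -
      interpret \<nu>: prob_space \<nu> by (rule p)
      interpret L: pair_sigma_finite \<nu> "lborel :: 'a measure" ..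
      have "integrable (\<nu> \<Otimes>\<^sub>M lborel) (\<lambda>(x, c). f c * gauss_kernel (s *\<^sub>R (c - x)))"
      proof (rule Bochner_Integration.integrable_bound)
        show "integrable (\<nu> \<Otimes>\<^sub>M lborel) (\<lambda>(x, c). 1 * f c)"
          using fint by (intro L.Fubini_integrable) auto
        show "AE x in \<nu> \<Otimes>\<^sub>M lborel. norm (case x of (x, c) \<Rightarrow> f c * gauss_kernel (s *\<^sub>R (c - x)))
           \<le> norm (case x of (x, c) \<Rightarrow> 1 * f c)"
          by (intro AE_I2) (auto simp: split_beta' abs_mult mult_left_le less_imp_le[OF gauss_kernel_pos] gauss_kernel_le_1)
      qed measurable
      from L.Fubini_integral[OF this] show ?thesis by (simp add: F_def)
    qed
    have "(\<lambda>n. \<integral>c. f c * (\<integral>x. gauss_kernel (s *\<^sub>R (c - x)) \<partial>\<mu> n) \<partial>lborel)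
      \<longlonglongrightarrow> (\<integral>c. f c * (\<integral>x. gauss_kernel (s *\<^sub>R (c - x)) \<partial>\<mu>') \<partial>lborel)"
    proof (rule integral_dominated_convergence[where w="\<lambda>c. \<bar>f c\<bar>"])
      have m: "(\<lambda>c. \<integral>x. gauss_kernel (s *\<^sub>R (c - x)) \<partial>\<nu>) \<in> borel_measurable borel"
        if p: "prob_space \<nu>" and [measurable_cong]: "sets \<nu> = sets borel" for \<nu> :: "'a measure"
      proof -
        interpret \<nu>: prob_space \<nu> by (rule p)
        show ?thesis by measurable
      qed
      note [measurable] = m[OF P] m[OF P']
      show "(\<lambda>c. f c * (\<integral>x. gauss_kernel (s *\<^sub>R (c - x)) \<partial>\<mu>')) \<in> borel_measurable lborel"
        "\<And>n. (\<lambda>c. f c * (\<integral>x. gauss_kernel (s *\<^sub>R (c - x)) \<partial>\<mu> n)) \<in> borel_measurable lborel" by measurable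
      show "AE c in lborel. (\<lambda>n. f c * (\<integral>x. gauss_kernel (s *\<^sub>R (c - x)) \<partial>\<mu> n))
        \<longlonglongrightarrow> f c * (\<integral>x. gauss_kernel (s *\<^sub>R (c - x)) \<partial>\<mu>')"
        by (intro AE_I2 tendsto_intros gauss_kernel_tendsto[OF P P' cf])
      show "AE c in lborel. norm (f c * (\<integral>x. gauss_kernel (s *\<^sub>R (c - x)) \<partial>\<mu> n)) \<le> \<bar>f c\<bar>" for n
      proof (intro AE_I2)
        interpret prob_space "\<mu> n" by (rule P)
        fix c
        have [measurable_cong]: "sets (\<mu> n) = sets borel" by (rule P)
        have "(\<integral>x. gauss_kernel (s *\<^sub>R (c - x)) \<partial>\<mu> n) \<le> 1"
          by (intro integral_le_const integrable_const_bound[where B=1] AE_I2)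
             (auto simp: less_imp_le[OF gauss_kernel_pos] gauss_kernel_le_1)
        moreover have "0 \<le> (\<integral>x. gauss_kernel (s *\<^sub>R (c - x)) \<partial>\<mu> n)"
          by (intro integral_nonneg_AE AE_I2) (auto intro: less_imp_le[OF gauss_kernel_pos])
        ultimately show "norm (f c * (\<integral>x. gauss_kernel (s *\<^sub>R (c - x)) \<partial>\<mu> n)) \<le> \<bar>f c\<bar>"
          by (auto simp: abs_mult mult_left_le)
      qed
    qed (use fint in auto)
    then show ?thesis unfolding *[OF P] *[OF P'] by (intro tendsto_intros) (use I in auto)
  qed
  have step2: "\<exists>s>0. \<forall>x. \<bar>F s x - f x\<bar> \<le> e" if e: "e > 0" for e
  proof -
    \<comment> \<open>\<open>T m\<close> is the Gaussian mass beyond radius \<open>m\<close>. There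
      the increments of \<open>f\<close> are only bounded by \<open>2 * B\<close>, whence the
      threshold \<open>e * I / (4 * B)\<close>. Within that radius the displacement
      \<open>z / s\<close> is shorter than \<open>\<delta>\<close>, by the later choice
      \<open>s = m / \<delta>\<close>.\<close>
    define T where "T m = (\<integral>z. indicator {z. real m \<le> norm z} z * gauss_kernel (z::'a) \<partial>lborel)" for m
    have "T \<longlonglongrightarrow> (\<integral>z. (0::real) \<partial>(lborel::'a measure))"
      unfolding T_def
    proof (rule integral_dominated_convergence[where w=gauss_kernel])
      show "AE z in lborel. (\<lambda>m. indicator {z. real m \<le> norm z} z * gauss_kernel (z::'a)) \<longlonglongrightarrow> 0"
      proof (intro AE_I2 tendsto_eventually)
        fix z :: 'a
        show "\<forall>\<^sub>F m in sequentially. indicator {z. real m \<le> norm z} z * gauss_kernel z = 0"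
          using eventually_gt_at_top[of "nat \<lceil>norm z\<rceil>"]
          by eventually_elim (auto simp: indicator_def, linarith)
      qed
    qed (auto simp: iK indicator_def less_imp_le[OF gauss_kernel_pos])
    then have "\<forall>\<^sub>F m in sequentially. T m < e * I / (4 * B)"
      using e I Bpos by (intro order_tendstoD) auto
    then obtain m0 where m0: "\<And>m. m \<ge> m0 \<Longrightarrow> T m < e * I / (4 * B)"
      by (auto simp: eventually_sequentially)
    define m where "m = max m0 1"
    have m: "T m < e * I / (4 * B)" "m \<ge> 1" using m0[of m] by (auto simp: m_def)
    obtain \<delta> where \<delta>: "\<delta> > 0" "\<And>x y. norm (y - x) < \<delta> \<Longrightarrow> \<bar>f y - f x\<bar> < e / 2"
      using uc[of "e/2"] e by auto
    define s where "s = real m / \<delta>"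
    have s: "s > 0" using m \<delta> by (auto simp: s_def)
    have "\<bar>F s x - f x\<bar> \<le> e" for x
    proof -
      have "(\<integral>c. f c * gauss_kernel (s *\<^sub>R (c - x)) \<partial>lborel)
         = \<bar>1/s\<bar> ^ DIM('a) *\<^sub>R (\<integral>z. f (x + (1/s) *\<^sub>R z) * gauss_kernel (s *\<^sub>R (x + (1/s) *\<^sub>R z - x)) \<partial>lborel)"
        by (rule lborel_integral_affine) (use s in auto)
      then have "F s x = (\<integral>z. f (x + (1/s) *\<^sub>R z) * gauss_kernel z \<partial>lborel) / I"
        using s by (simp add: F_def power_divide)
      moreover have "f x = (\<integral>z. f x * gauss_kernel (z::'a) \<partial>lborel) / I"
        using I by (simp add: I_def)
      moreover have i1: "integrable lborel (\<lambda>z. f (x + (1/s) *\<^sub>R z) * gauss_kernel z)"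
      proof (rule Bochner_Integration.integrable_bound[OF integrable_mult_right[OF iK, of B]])
        show "AE z in lborel. norm (f (x + (1/s) *\<^sub>R z) * gauss_kernel z) \<le> norm (B * gauss_kernel z)"
          using B Bpos by (intro AE_I2) (auto simp: abs_mult intro!: mult_right_mono)
      qed measurable
      moreover have i2: "integrable lborel (\<lambda>z. f x * gauss_kernel (z::'a))"
        using iK by simp
      ultimately have "F s x - f x = (\<integral>z. (f (x + (1/s) *\<^sub>R z) - f x) * gauss_kernel z \<partial>lborel) / I"
        by (simp add: left_diff_distrib diff_divide_distrib)
      moreover have "\<bar>\<integral>z. (f (x + (1/s) *\<^sub>R z) - f x) * gauss_kernel z \<partial>lborel\<bar>
          \<le> (\<integral>z. e/2 * gauss_kernel z + 2 * B * (indicator {z. real m \<le> norm z} z * gauss_kernel (z::'a)) \<partial>lborel)"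
      proof (rule abs_integral_le)
        show "integrable lborel (\<lambda>z. (f (x + (1/s) *\<^sub>R z) - f x) * gauss_kernel z)"
          using i1 i2 by (simp add: left_diff_distrib)
        have "integrable lborel (\<lambda>z. indicator {z. real m \<le> norm z} z * gauss_kernel (z::'a))"
          by (rule Bochner_Integration.integrable_bound[OF iK]) (auto simp: indicator_def)
        then show "integrable lborel (\<lambda>z. e/2 * gauss_kernel z + 2 * B * (indicator {z. real m \<le> norm z} z * gauss_kernel (z::'a)))"
          using iK by (intro Bochner_Integration.integrable_add integrable_mult_right)
        fix z :: 'a
        have "\<bar>f (x + (1/s) *\<^sub>R z) - f x\<bar> \<le> e/2 + 2 * B * indicator {z. real m \<le> norm z} z"
        proof (cases "real m \<le> norm z")
          case True
          then show ?thesis using B[of "x + (1/s) *\<^sub>R z"] B[of x] e by auto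
        next
          case False
          then have "norm (x + (1/s) *\<^sub>R z - x) < \<delta>"
            using s m \<delta>(1) by (auto simp: s_def field_simps)
          from \<delta>(2)[OF this] show ?thesis using False by (simp add: indicator_def)
        qed
        then have "\<bar>f (x + (1/s) *\<^sub>R z) - f x\<bar> * gauss_kernel z \<le> (e/2 + 2 * B * indicator {z. real m \<le> norm z} z) * gauss_kernel z"
          by (intro mult_right_mono less_imp_le[OF gauss_kernel_pos])
        then show "\<bar>(f (x + (1/s) *\<^sub>R z) - f x) * gauss_kernel z\<bar>
          \<le> e/2 * gauss_kernel z + 2 * B * (indicator {z. real m \<le> norm z} z * gauss_kernel z)"
          unfolding abs_mult abs_of_pos[OF gauss_kernel_pos] by (simp add: algebra_simps)
      qed
      moreover have "(\<integral>z. e/2 * gauss_kernel z + 2 * B * (indicator {z. real m \<le> norm z} z * gauss_kernel (z::'a)) \<partial>lborel)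
          = e/2 * I + 2 * B * T m"
      proof -
        have "integrable lborel (\<lambda>z. indicator {z. real m \<le> norm z} z * gauss_kernel (z::'a))"
          by (rule Bochner_Integration.integrable_bound[OF iK]) (auto simp: indicator_def)
        then show ?thesis unfolding I_def T_def using iK
          by (subst Bochner_Integration.integral_add) auto
      qed
      moreover have "2 * B * T m \<le> e/2 * I" using m(1) Bpos by (simp add: field_simps)
      ultimately have "\<bar>F s x - f x\<bar> \<le> (e * I) / I"
        using I by (simp add: abs_divide pos_divide_le_eq)
      then show ?thesis using I by simp
    qed
    then show ?thesis using s by blast
  qed
  have Fm: "F s \<in> borel_measurable borel" for s unfolding F_def[abs_def] by measurable
  have close: "\<bar>(\<integral>x. F s x \<partial>\<nu>) - (\<integral>x. f x \<partial>\<nu>)\<bar> \<le> e"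
    if p: "prob_space \<nu>" and [measurable_cong]: "sets \<nu> = sets borel" and h: "\<forall>x. \<bar>F s x - f x\<bar> \<le> e"
    for \<nu> :: "'a measure" and s e
  proof -
    interpret \<nu>: prob_space \<nu> by (rule p)
    note [measurable] = Fm
    have i1: "integrable \<nu> f" by (rule \<nu>.integrable_const_bound[where B=B]) (auto simp: B)
    have i3: "integrable \<nu> (\<lambda>x. F s x - f x)" by (rule \<nu>.integrable_const_bound[where B=e]) (auto simp: h)
    from Bochner_Integration.integrable_add[OF i3 i1] have i2: "integrable \<nu> (F s)" by simp
    have "(\<integral>x. F s x \<partial>\<nu>) - (\<integral>x. f x \<partial>\<nu>) = (\<integral>x. F s x - f x \<partial>\<nu>)" using i1 i2 by simp
    moreover have "(\<integral>x. F s x - f x \<partial>\<nu>) \<le> e"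
      by (intro \<nu>.integral_le_const i3 AE_I2) (use h in \<open>auto simp: abs_le_iff\<close>)
    moreover have "- e \<le> (\<integral>x. F s x - f x \<partial>\<nu>)"
      by (intro \<nu>.integral_ge_const i3 AE_I2) (use h in \<open>auto simp: abs_le_iff, smt (verit)\<close>)
    ultimately show ?thesis by linarith
  qed
  show ?thesis
  proof (rule LIMSEQ_I)
    fix e :: real assume e: "e > 0"
    obtain s where s: "\<forall>x. \<bar>F s x - f x\<bar> \<le> e/4" using step2[of "e/4"] e by auto
    obtain n0 where n0: "\<And>n. n \<ge> n0 \<Longrightarrow> norm ((\<integral>x. F s x \<partial>\<mu> n) - (\<integral>x. F s x \<partial>\<mu>')) < e/4"
      using LIMSEQ_D[OF step1[of s], of "e/4"] e by auto
    have "norm ((\<integral>x. f x \<partial>\<mu> n) - (\<integral>x. f x \<partial>\<mu>')) < e" if "n \<ge> n0" for n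
      using n0[OF that] close[OF P(1)[of n] P(2)[of n] s] close[OF P' s] e
      unfolding real_norm_def by linarith
    then show "\<exists>n0. \<forall>n\<ge>n0. norm ((\<integral>x. f x \<partial>\<mu> n) - (\<integral>x. f x \<partial>\<mu>')) < e" by blast
  qed
qed

text \<open>Tightness is extracted from the convergence itself: a compactly supported cut-off has
  integral close to 1 under the limit, hence under \<open>\<mu> n\<close> for all large
  \<open>n\<close>, and \<open>est\<close> bounds what is lost by multiplying \<open>f\<close> with
  the cut-off.\<close>

theorem levy_continuity_euclidean:
  fixes \<mu> :: "nat \<Rightarrow> 'a::euclidean_space measure" and f :: "'a \<Rightarrow> real"
  assumes P: "\<And>n. prob_space (\<mu> n)" "\<And>n. sets (\<mu> n) = sets borel"
    and P': "prob_space \<mu>'" "sets \<mu>' = sets borel"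
    and cf: "\<And>a. (\<lambda>n. \<integral>x. cis (a \<bullet> x) \<partial>\<mu> n) \<longlonglongrightarrow> (\<integral>x. cis (a \<bullet> x) \<partial>\<mu>')"
    and f: "continuous_on UNIV f" and bdd: "bounded (range f)"
  shows "(\<lambda>n. \<integral>x. f x \<partial>\<mu> n) \<longlonglongrightarrow> (\<integral>x. f x \<partial>\<mu>')"
proof -
  have [measurable]: "f \<in> borel_measurable borel" by (rule borel_measurable_continuous_onI[OF f])
  obtain B0 where B0: "\<And>x. \<bar>f x\<bar> \<le> B0" using bdd by (auto simp: bounded_iff)
  define B where "B = max B0 1"
  have B: "\<bar>f x\<bar> \<le> B" for x using B0[of x] by (simp add: B_def)
  have Bpos: "B > 0" by (simp add: B_def)
  define cut where "cut m x = max 0 (min 1 (real m + 1 - norm (x :: 'a)))" for m x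
  have cutc: "continuous_on UNIV (cut m)" for m unfolding cut_def[abs_def] by (intro continuous_intros)
  have [measurable]: "cut m \<in> borel_measurable borel" for m by (rule borel_measurable_continuous_onI[OF cutc])
  have cutb: "0 \<le> cut m x" "cut m x \<le> 1" for m x by (auto simp: cut_def)
  have cut0: "cut m x = 0" if "real m + 1 < norm x" for m x using that by (auto simp: cut_def)
  interpret M': prob_space \<mu>' by (rule P')
  have "(\<lambda>m. \<integral>x. cut m x \<partial>\<mu>') \<longlonglongrightarrow> (\<integral>x. 1 \<partial>\<mu>')"
  proof (rule integral_dominated_convergence[where w="\<lambda>_. 1"])
    note [measurable_cong] = P'(2)
    show "AE x in \<mu>'. (\<lambda>m. cut m x) \<longlonglongrightarrow> 1"
    proof (intro AE_I2 tendsto_eventually)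
      fix x :: 'a
      show "\<forall>\<^sub>F m in sequentially. cut m x = 1"
        using eventually_gt_at_top[of "nat \<lceil>norm x\<rceil>"]
        by eventually_elim (simp add: cut_def, linarith)
    qed
    show "(\<lambda>x. 1) \<in> borel_measurable \<mu>'" by simp
    show "cut m \<in> borel_measurable \<mu>'" for m by measurable
  qed (auto simp: cutb)
  then have cutlim: "(\<lambda>m. \<integral>x. cut m x \<partial>\<mu>') \<longlonglongrightarrow> 1" by (simp add: M'.prob_space)
  have est: "\<bar>(\<integral>x. f x \<partial>\<nu>) - (\<integral>x. f x * cut m x \<partial>\<nu>)\<bar> \<le> B * (1 - (\<integral>x. cut m x \<partial>\<nu>))"
    if p: "prob_space \<nu>" and [measurable_cong]: "sets \<nu> = sets borel" for \<nu> :: "'a measure" and m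
  proof -
    interpret \<nu>: prob_space \<nu> by (rule p)
    have i1: "integrable \<nu> f" by (rule \<nu>.integrable_const_bound[where B=B]) (auto simp: B)
    have i2: "integrable \<nu> (cut m)" by (rule \<nu>.integrable_const_bound[where B=1]) (auto simp: cutb)
    have i3: "integrable \<nu> (\<lambda>x. f x * cut m x)"
      by (rule \<nu>.integrable_const_bound[where B="B * 1"]) (use mult_mono[OF B cutb(2)] Bpos cutb in \<open>auto simp: abs_mult\<close>)
    have "\<bar>\<integral>x. f x * (1 - cut m x) \<partial>\<nu>\<bar> \<le> (\<integral>x. B * (1 - cut m x) \<partial>\<nu>)"
    proof (rule abs_integral_le)
      show "integrable \<nu> (\<lambda>x. f x * (1 - cut m x))" using i1 i3 by (simp add: right_diff_distrib)
      show "integrable \<nu> (\<lambda>x. B * (1 - cut m x))" using i2 by simp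
      show "\<bar>f x * (1 - cut m x)\<bar> \<le> B * (1 - cut m x)" for x
        using B[of x] cutb[of m x] by (auto simp: abs_mult intro!: mult_right_mono)
    qed
    then show ?thesis using i1 i2 i3 by (simp add: right_diff_distrib \<nu>.prob_space)
  qed
  show ?thesis
  proof (rule LIMSEQ_I)
    fix e :: real assume e: "e > 0"
    have "\<forall>\<^sub>F m in sequentially. 1 - e / (8 * B) < (\<integral>x. cut m x \<partial>\<mu>')"
      using cutlim e Bpos by (intro order_tendstoD) auto
    then obtain m where m: "1 - e / (8 * B) < (\<integral>x. cut m x \<partial>\<mu>')"
      by (auto simp: eventually_sequentially)
    have "(\<lambda>n. \<integral>x. cut m x \<partial>\<mu> n) \<longlonglongrightarrow> (\<integral>x. cut m x \<partial>\<mu>')"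
      by (rule tendsto_compact_support[OF P P' cf cutc, where R="real m + 1"]) (auto simp: cut0)
    then have ev1: "\<forall>\<^sub>F n in sequentially. 1 - e / (8 * B) < (\<integral>x. cut m x \<partial>\<mu> n)"
      using m by (rule order_tendstoD)
    have "(\<lambda>n. \<integral>x. f x * cut m x \<partial>\<mu> n) \<longlonglongrightarrow> (\<integral>x. f x * cut m x \<partial>\<mu>')"
      by (rule tendsto_compact_support[OF P P' cf, where R="real m + 1"])
         (auto simp: cut0 intro!: continuous_intros f cutc)
    then have ev2: "\<forall>\<^sub>F n in sequentially. dist (\<integral>x. f x * cut m x \<partial>\<mu> n) (\<integral>x. f x * cut m x \<partial>\<mu>') < e / 4"
      using e by (intro tendstoD) auto
    have "\<forall>\<^sub>F n in sequentially. norm ((\<integral>x. f x \<partial>\<mu> n) - (\<integral>x. f x \<partial>\<mu>')) < e"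
      using ev1 ev2
    proof eventually_elim
      case (elim n)
      have a: "B * (1 - u) \<le> e / 8" if "1 - e / (8 * B) < u" for u
      proof -
        have "B * (1 - u) \<le> B * (e / (8 * B))" using that Bpos by (intro mult_left_mono) auto
        then show ?thesis using Bpos by simp
      qed
      show ?case
        using est[OF P(1)[of n] P(2)[of n], of m] est[OF P', of m] a[OF elim(1)] a[OF m] elim(2) e
        unfolding dist_real_def real_norm_def by linarith
    qed
    then show "\<exists>n0. \<forall>n\<ge>n0. norm ((\<integral>x. f x \<partial>\<mu> n) - (\<integral>x. f x \<partial>\<mu>')) < e"
      by (simp add: eventually_sequentially)
  qed
qed

section \<open>Linear statistics of a stationary point process\<close>

text \<open>Sums over the process will be Bochner integrals with respect to a counting measure that
  varies with \<open>\<omega>\<close>. Written out, default value 0 included, they are assembled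
  from nonnegative integrals, whose measurability in \<open>\<omega>\<close> is accessible.\<close>

lemma lebesgue_integral_real_if:
  fixes f :: "'b \<Rightarrow> real"
  assumes "f \<in> borel_measurable N"
  shows "integral\<^sup>L N f = (if (\<integral>\<^sup>+x. ennreal \<bar>f x\<bar> \<partial>N) < \<infinity>
     then enn2real (\<integral>\<^sup>+x. ennreal (f x) \<partial>N) - enn2real (\<integral>\<^sup>+x. ennreal (- f x) \<partial>N) else 0)"
proof (cases "integrable N f")
  case True
  then show ?thesis
    by (auto simp: real_lebesgue_integral_def integrable_iff_bounded)
next
  case False
  then show ?thesis using assms
    by (auto simp: not_integrable_integral_eq integrable_iff_bounded)
qed

text \<open>For complex terms unconditional and absolute summability coincide, and otherwise both
  sides take the default value 0. So scattering sums can be handled by integration theory for every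
  configuration.\<close>

lemma infsum_complex_eq_integral:
  fixes f :: "'b \<Rightarrow> complex"
  shows "infsum f A = integral\<^sup>L (count_space A) f"
proof (cases "f summable_on A")
  case True
  then have "(\<lambda>x. norm (f x)) summable_on A"
    using summable_on_iff_abs_summable_on_complex by blast
  then have "Infinite_Set_Sum.abs_summable_on f A"
    using abs_summable_equivalent by blast
  from infsetsum_infsum[OF this] show ?thesis by (simp add: infsetsum_def)
next
  case False
  then have "\<not> Infinite_Set_Sum.abs_summable_on f A"
    using abs_summable_equivalent summable_on_iff_abs_summable_on_complex by blast
  then have "\<not> integrable (count_space A) f" by (simp add: Infinite_Set_Sum.abs_summable_on_def)
  then show ?thesis using False by (simp add: not_integrable_integral_eq infsum_not_exists)
qed

text \<open>The integral of a product function against the factorial measure of \<open>D\<close>.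
  The index set is arbitrary rather than an initial segment because blocks of partitions and
  clusters occur as index sets.\<close>

definition factorial_sum :: "'a set \<Rightarrow> 'i set \<Rightarrow> ('i \<Rightarrow> 'a \<Rightarrow> real) \<Rightarrow> real" where
  "factorial_sum D J f = (\<Sum>x | x \<in> J \<rightarrow>\<^sub>E D \<and> inj_on x J. \<Prod>i\<in>J. f i (x i))"

lemma finite_injections: "finite J \<Longrightarrow> finite D \<Longrightarrow> finite {x. x \<in> J \<rightarrow>\<^sub>E D \<and> inj_on x J}"
  by (rule finite_subset[of _ "J \<rightarrow>\<^sub>E D"]) (auto intro: finite_PiE)

lemma factorial_sum_empty [simp]: "factorial_sum D {} f = 1"
  by (simp add: factorial_sum_def)

lemma factorial_sum_cong: "(\<And>i. i \<in> J \<Longrightarrow> f i = f' i) \<Longrightarrow> factorial_sum D J f = factorial_sum D J f'"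
  unfolding factorial_sum_def by (intro sum.cong prod.cong refl) auto

lemma prod_fun_upd_mult:
  fixes F :: "'i \<Rightarrow> real"
  assumes "finite J" "i \<in> J"
  shows "(\<Prod>j\<in>J. (F(i := F i * c)) j) = (\<Prod>j\<in>J. F j) * c"
proof -
  have "(\<Prod>j\<in>J. (F(i := F i * c)) j) = F i * c * (\<Prod>j\<in>J - {i}. (F(i := F i * c)) j)"
    by (subst prod.remove[OF assms]) simp
  also have "(\<Prod>j\<in>J - {i}. (F(i := F i * c)) j) = (\<Prod>j\<in>J - {i}. F j)"
    by (intro prod.cong) auto
  finally show ?thesis by (simp add: prod.remove[OF assms])
qed

text \<open>The identity that \<open>clus\<close> and \<open>centred\<close> mirror. A tuple on
  \<open>insert t J\<close> is a tuple on \<open>J\<close> together with a point outside its range,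
  and a point inside the range equals \<open>x i\<close> for exactly one \<open>i\<close>, by
  injectivity.\<close>

lemma factorial_sum_insert:
  assumes J: "finite J" and D: "finite D" and t: "t \<notin> J"
  shows "factorial_sum D J f * (\<Sum>x\<in>D. f t x)
    = factorial_sum D (insert t J) f + (\<Sum>i\<in>J. factorial_sum D J (f(i := \<lambda>x. f i x * f t x)))"
proof -
  let ?X = "{x. x \<in> J \<rightarrow>\<^sub>E D \<and> inj_on x J}" and ?p = "\<lambda>x. \<Prod>i\<in>J. f i (x i)"
  have fX: "finite ?X" by (rule finite_injections[OF J D])
  have "factorial_sum D J f * (\<Sum>x\<in>D. f t x) = (\<Sum>x\<in>?X. \<Sum>y\<in>D. ?p x * f t y)"
    by (simp add: factorial_sum_def sum_product)
  also have "\<dots> = (\<Sum>x\<in>?X. (\<Sum>y\<in>D - x ` J. ?p x * f t y) + (\<Sum>y\<in>x ` J. ?p x * f t y))"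
    by (intro sum.cong refl sum.subset_diff D) (auto simp: PiE_def Pi_def)
  also have "\<dots> = (\<Sum>x\<in>?X. \<Sum>y\<in>D - x ` J. ?p x * f t y) + (\<Sum>x\<in>?X. \<Sum>i\<in>J. ?p x * f t (x i))"
    by (simp add: sum.distrib sum.reindex)
  also have "(\<Sum>x\<in>?X. \<Sum>i\<in>J. ?p x * f t (x i)) = (\<Sum>i\<in>J. \<Sum>x\<in>?X. ?p x * f t (x i))"
    by (rule sum.swap)
  also have "\<dots> = (\<Sum>i\<in>J. factorial_sum D J (f(i := \<lambda>x. f i x * f t x)))"
    unfolding factorial_sum_def
  proof (intro sum.cong refl)
    fix i x assume i: "i \<in> J"
    have "(\<Prod>j\<in>J. (f(i := \<lambda>x. f i x * f t x)) j (x j))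
        = (\<Prod>j\<in>J. ((\<lambda>j. f j (x j))(i := f i (x i) * f t (x i))) j)"
      by (intro prod.cong) auto
    also have "\<dots> = ?p x * f t (x i)" by (rule prod_fun_upd_mult[OF J i])
    finally show "?p x * f t (x i) = (\<Prod>j\<in>J. (f(i := \<lambda>x. f i x * f t x)) j (x j))" by simp
  qed
  also have "(\<Sum>x\<in>?X. \<Sum>y\<in>D - x ` J. ?p x * f t y)
     = (\<Sum>(x, y)\<in>Sigma ?X (\<lambda>x. D - x ` J). ?p x * f t y)"
    by (rule sum.Sigma) (use fX D in auto)
  also have "\<dots> = factorial_sum D (insert t J) f"
    unfolding factorial_sum_def
  proof (rule sum.reindex_bij_witness[where i = "\<lambda>z. (restrict z J, z t)" and j = "\<lambda>(x, y). x(t := y)"])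
    fix z assume z: "z \<in> {x. x \<in> insert t J \<rightarrow>\<^sub>E D \<and> inj_on x (insert t J)}"
    then show "(case (restrict z J, z t) of (x, y) \<Rightarrow> x(t := y)) = z"
      by (auto simp: fun_eq_iff PiE_def extensional_def)
    from z t show "(restrict z J, z t) \<in> Sigma ?X (\<lambda>x. D - x ` J)"
      by (auto simp: PiE_def Pi_def inj_on_def)
  next
    fix a assume a: "a \<in> Sigma ?X (\<lambda>x. D - x ` J)"
    obtain x y where [simp]: "a = (x, y)" by (cases a)
    have x: "x \<in> J \<rightarrow>\<^sub>E D" "inj_on x J" "y \<in> D" "y \<notin> x ` J" using a by auto
    have xt: "x t = undefined" using x(1) t by (auto simp: PiE_def extensional_def)
    show "(restrict (case a of (x, y) \<Rightarrow> x(t := y)) J, (case a of (x, y) \<Rightarrow> x(t := y)) t) = a"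
      using x t by (auto simp: fun_eq_iff PiE_def extensional_def restrict_def)
    show "(case a of (x, y) \<Rightarrow> x(t := y)) \<in> {x. x \<in> insert t J \<rightarrow>\<^sub>E D \<and> inj_on x (insert t J)}"
      using x t by (auto simp: PiE_def Pi_def extensional_def inj_on_def image_iff)
    have "(\<Prod>i\<in>J. f i ((x(t := y)) i)) = ?p x" using t by (intro prod.cong) auto
    then show "(\<Prod>i\<in>insert t J. f i ((case a of (x, y) \<Rightarrow> x(t := y)) i)) = (case a of (x, y) \<Rightarrow> ?p x * f t y)"
      using J t by simp
  qed
  finally show ?thesis .
qed

lemma factorial_sum_image:
  assumes \<sigma>: "inj_on \<sigma> J"
  shows "factorial_sum D (\<sigma> ` J) f = factorial_sum D J (\<lambda>i. f (\<sigma> i))"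
  unfolding factorial_sum_def
proof (rule sum.reindex_bij_witness[where i = "\<lambda>y. \<lambda>k\<in>\<sigma> ` J. y (the_inv_into J \<sigma> k)" and j = "\<lambda>x. \<lambda>i\<in>J. x (\<sigma> i)"])
  note inv = the_inv_into_f_f[OF \<sigma>]
  fix x assume "x \<in> {x. x \<in> \<sigma> ` J \<rightarrow>\<^sub>E D \<and> inj_on x (\<sigma> ` J)}"
  then have x: "x \<in> \<sigma> ` J \<rightarrow>\<^sub>E D" "inj_on x (\<sigma> ` J)" by auto
  show "(\<lambda>k\<in>\<sigma> ` J. (\<lambda>i\<in>J. x (\<sigma> i)) (the_inv_into J \<sigma> k)) = x"
    using x(1) inv by (auto simp: fun_eq_iff PiE_def extensional_def restrict_def)
  show "(\<lambda>i\<in>J. x (\<sigma> i)) \<in> {x. x \<in> J \<rightarrow>\<^sub>E D \<and> inj_on x J}"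
    using x \<sigma> by (auto simp: PiE_def Pi_def inj_on_def)
  show "(\<Prod>i\<in>J. f (\<sigma> i) ((\<lambda>i\<in>J. x (\<sigma> i)) i)) = (\<Prod>i\<in>\<sigma> ` J. f i (x i))"
    by (simp add: prod.reindex[OF \<sigma>])
next
  note inv = the_inv_into_f_f[OF \<sigma>]
  fix y assume "y \<in> {x. x \<in> J \<rightarrow>\<^sub>E D \<and> inj_on x J}"
  then have y: "y \<in> J \<rightarrow>\<^sub>E D" "inj_on y J" by auto
  show "(\<lambda>i\<in>J. (\<lambda>k\<in>\<sigma> ` J. y (the_inv_into J \<sigma> k)) (\<sigma> i)) = y"
    using y(1) inv by (auto simp: fun_eq_iff PiE_def extensional_def restrict_def)
  show "(\<lambda>k\<in>\<sigma> ` J. y (the_inv_into J \<sigma> k)) \<in> {x. x \<in> \<sigma> ` J \<rightarrow>\<^sub>E D \<and> inj_on x (\<sigma> ` J)}"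
    using y inv by (auto simp: PiE_def Pi_def inj_on_def)
qed

lemma factorial_sum_bound:
  assumes J: "finite J" and D: "finite D" and c: "\<And>i x. i \<in> J \<Longrightarrow> \<bar>f i x\<bar> \<le> c" "0 \<le> c"
  shows "\<bar>factorial_sum D J f\<bar> \<le> (c * real (card D)) ^ card J"
proof -
  let ?X = "{x. x \<in> J \<rightarrow>\<^sub>E D \<and> inj_on x J}"
  have "\<bar>factorial_sum D J f\<bar> \<le> (\<Sum>x\<in>?X. \<bar>\<Prod>i\<in>J. f i (x i)\<bar>)"
    unfolding factorial_sum_def by (rule sum_abs)
  also have "\<dots> \<le> (\<Sum>x\<in>?X. c ^ card J)"
  proof (rule sum_mono)
    fix x
    have "(\<Prod>i\<in>J. \<bar>f i (x i)\<bar>) \<le> (\<Prod>i\<in>J. c)" by (rule prod_mono) (use c in auto)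
    then show "\<bar>\<Prod>i\<in>J. f i (x i)\<bar> \<le> c ^ card J" by (simp add: abs_prod)
  qed
  also have "\<dots> = real (card ?X) * c ^ card J" by simp
  also have "\<dots> \<le> real (card D ^ card J) * c ^ card J"
  proof (intro mult_right_mono)
    have "card ?X \<le> card (J \<rightarrow>\<^sub>E D)" by (rule card_mono) (auto intro: finite_PiE J D)
    also have "\<dots> = card D ^ card J" using J by (simp add: card_PiE)
    finally show "real (card ?X) \<le> real (card D ^ card J)" by (simp only: of_nat_le_iff)
  qed (use c in simp)
  finally show ?thesis by (simp add: power_mult_distrib mult.commute)
qed

lemma nn_integral_count_space_npoints:
  "(\<integral>\<^sup>+x. indicator B x \<partial>count_space \<phi>) = npoints \<phi> B"
proof -
  have "(\<integral>\<^sup>+x. indicator B x \<partial>count_space \<phi>) = (\<integral>\<^sup>+x. indicator (B \<inter> \<phi>) x \<partial>count_space \<phi>)"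
    by (rule nn_integral_cong) (auto simp: indicator_def)
  also have "\<dots> = emeasure (count_space \<phi>) (B \<inter> \<phi>)" by (rule nn_integral_indicator) auto
  also have "\<dots> = npoints \<phi> B" unfolding npoints_def
    by (cases "finite (B \<inter> \<phi>)") (auto simp: emeasure_count_space Int_commute)
  finally show ?thesis .
qed

lemma npoints_translate:
  "npoints ((\<lambda>y. y + x) ` \<phi>) B = npoints \<phi> ((\<lambda>y. y + x) -` B)" for x :: "'a::euclidean_space"
proof -
  have eq: "(\<lambda>y. y + x) ` \<phi> \<inter> B = (\<lambda>y. y + x) ` (\<phi> \<inter> (\<lambda>y. y + x) -` B)" by auto
  have inj: "inj_on (\<lambda>y. y + x) A" for A by (auto simp: inj_on_def)
  show ?thesis unfolding npoints_def eq
    by (simp add: emeasure_count_space finite_image_iff[OF inj] card_image[OF inj])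
qed

lemma translate_configs: "\<phi> \<in> configs \<Longrightarrow> (\<lambda>y. y + x) ` \<phi> \<in> configs" for x :: "'a::euclidean_space"
proof -
  assume \<phi>: "\<phi> \<in> configs"
  have "finite ((\<lambda>y. y + x) ` \<phi> \<inter> B)" if "bounded B" for B
  proof -
    have "bounded ((\<lambda>y. - x + y) ` B)" using that by (rule bounded_translation)
    then have "finite (\<phi> \<inter> (\<lambda>y. - x + y) ` B)" using \<phi> by (auto simp: configs_def)
    then have "finite ((\<lambda>y. y + x) ` (\<phi> \<inter> (\<lambda>y. - x + y) ` B))" by simp
    moreover have "(\<lambda>y. y + x) ` \<phi> \<inter> B \<subseteq> (\<lambda>y. y + x) ` (\<phi> \<inter> (\<lambda>y. - x + y) ` B)"
    proof
      fix z assume "z \<in> (\<lambda>y. y + x) ` \<phi> \<inter> B"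
      then obtain y where y: "z = y + x" "y \<in> \<phi>" "y + x \<in> B" by auto
      then have "y \<in> (\<lambda>y. - x + y) ` B" using image_eqI[of y "\<lambda>y. - x + y" "y + x" B] by simp
      then show "z \<in> (\<lambda>y. y + x) ` (\<phi> \<inter> (\<lambda>y. - x + y) ` B)" using y by blast
    qed
    ultimately show ?thesis by (rule finite_subset[rotated])
  qed
  then show ?thesis by (simp add: configs_def)
qed

lemma space_config_space [simp]: "space config_space = configs"
  unfolding config_space_def by (rule space_measure_of) auto

lemma npoints_measurable_config [measurable]:
  assumes "B \<in> sets borel"
  shows "(\<lambda>\<phi>. npoints \<phi> B) \<in> borel_measurable config_space"
proof (rule measurableI)
  fix A :: "ennreal set" assume A: "A \<in> sets borel"
  have "{\<phi> \<in> configs. npoints \<phi> B \<in> A} \<in> sets config_space"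
    unfolding config_space_def by (subst sets_measure_of) (use A assms in \<open>auto intro!: sigma_sets.Basic\<close>)
  moreover have "(\<lambda>\<phi>. npoints \<phi> B) -` A \<inter> space config_space = {\<phi> \<in> configs. npoints \<phi> B \<in> A}" by auto
  ultimately show "(\<lambda>\<phi>. npoints \<phi> B) -` A \<inter> space config_space \<in> sets config_space" by simp
qed simp

lemma translate_measurable:
  "(\<lambda>\<phi>. (\<lambda>y. y + x) ` \<phi>) \<in> config_space \<rightarrow>\<^sub>M config_space" for x :: "'a::euclidean_space"
proof -
  have "(\<lambda>\<phi>. (\<lambda>y. y + x) ` \<phi>) \<in> config_space \<rightarrow>\<^sub>M
     sigma configs {{\<phi> \<in> configs. npoints \<phi> B \<in> A} | A B. A \<in> sets borel \<and> (B :: 'a set) \<in> sets borel}"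
  proof (rule measurable_measure_of)
    fix Y assume "Y \<in> {{\<phi> \<in> configs. npoints \<phi> B \<in> A} | A B. A \<in> sets borel \<and> (B :: 'a set) \<in> sets borel}"
    then obtain A B where Y: "Y = {\<phi> \<in> configs. npoints \<phi> B \<in> A}" and AB: "A \<in> sets borel" "(B :: 'a set) \<in> sets borel"
      by auto
    have B': "(\<lambda>y. y + x) -` B \<in> sets borel"
      using measurable_sets[of "\<lambda>y. y + x" borel borel B] AB by simp
    have "(\<lambda>\<phi>. (\<lambda>y. y + x) ` \<phi>) -` Y \<inter> space config_space
        = (\<lambda>\<phi>. npoints \<phi> ((\<lambda>y. y + x) -` B)) -` A \<inter> space config_space"
      unfolding Y by (auto simp: npoints_translate translate_configs)
    also have "\<dots> \<in> sets config_space"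
      by (rule measurable_sets[OF npoints_measurable_config[OF B'] AB(1)])
    finally show "(\<lambda>\<phi>. (\<lambda>y. y + x) ` \<phi>) -` Y \<inter> space config_space \<in> sets config_space" .
  qed (auto simp: translate_configs)
  then show ?thesis by (simp add: config_space_def)
qed

section \<open>Measurability and first moments of sums over the process\<close>

locale stationary_process =
  fixes M :: "'w measure" and \<eta> :: "'w \<Rightarrow> 'a::euclidean_space set" and \<gamma> :: real
  assumes pp: "point_process M \<eta>" and stat: "stationary M \<eta>"
    and inten: "intensity M \<eta> = ennreal \<gamma>" and \<gamma>_pos: "0 < \<gamma>"
    and moments: "\<And>B m. bounded B \<Longrightarrow> B \<in> sets borel \<Longrightarrow> (\<integral>\<^sup>+ \<omega>. npoints (\<eta> \<omega>) B ^ m \<partial>M) < \<infinity>"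
begin

sublocale prob_space M using pp by (simp add: point_process_def)

lemma \<eta>_measurable [measurable]: "\<eta> \<in> M \<rightarrow>\<^sub>M config_space"
  using pp by (simp add: point_process_def)

lemma npoints_measurable [measurable]: "B \<in> sets borel \<Longrightarrow> (\<lambda>\<omega>. npoints (\<eta> \<omega>) B) \<in> borel_measurable M"
  by (rule measurable_compose[OF \<eta>_measurable npoints_measurable_config])

lemma finite_\<eta>_bounded: "\<omega> \<in> space M \<Longrightarrow> bounded B \<Longrightarrow> finite (\<eta> \<omega> \<inter> B)"
  using measurable_space[OF \<eta>_measurable] by (auto simp: configs_def)

text \<open>The sigma-field on configurations is generated by counts, which settles indicators.
  Linearity and monotone limits carry measurability to all nonnegative Borel functions.\<close>

lemma nn_sum_measurable [measurable]:
  assumes "f \<in> borel_measurable borel"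
  shows "(\<lambda>\<omega>. \<integral>\<^sup>+x. f x \<partial>count_space (\<eta> \<omega>)) \<in> borel_measurable M"
  using assms
proof (induction rule: borel_measurable_induct)
  case (cong f g)
  then show ?case by (auto simp: fun_eq_iff)
next
  case (set A)
  then show ?case by (simp add: nn_integral_count_space_npoints)
next
  case (mult u c)
  then show ?case by (simp add: nn_integral_cmult)
next
  case (add u v)
  then show ?case by (simp add: nn_integral_add)
next
  case (seq U)
  have e: "(SUP i. U i) = (\<lambda>x. SUP i. U i x)" by (simp add: fun_eq_iff SUP_apply image_comp)
  have "(\<integral>\<^sup>+x. (SUP i. U i) x \<partial>count_space \<phi>) = (SUP i. \<integral>\<^sup>+x. U i x \<partial>count_space \<phi>)" for \<phi>
    unfolding e by (rule nn_integral_monotone_convergence_SUP[OF \<open>incseq U\<close>]) simp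
  then show ?case using seq by simp
qed

lemma real_sum_measurable [measurable]:
  fixes f :: "'a \<Rightarrow> real"
  assumes [measurable]: "f \<in> borel_measurable borel"
  shows "(\<lambda>\<omega>. \<integral>x. f x \<partial>count_space (\<eta> \<omega>)) \<in> borel_measurable M"
  by (subst lebesgue_integral_real_if) (simp, measurable)

lemma complex_sum_measurable [measurable]:
  fixes f :: "'a \<Rightarrow> complex"
  assumes [measurable]: "f \<in> borel_measurable borel"
  shows "(\<lambda>\<omega>. \<integral>x. f x \<partial>count_space (\<eta> \<omega>)) \<in> borel_measurable M"
proof -
  have "(\<integral>x. f x \<partial>count_space \<phi>) = (if (\<integral>\<^sup>+x. ennreal (norm (f x)) \<partial>count_space \<phi>) < \<infinity>
     then complex_of_real (\<integral>x. Re (f x) \<partial>count_space \<phi>) + \<i> * complex_of_real (\<integral>x. Im (f x) \<partial>count_space \<phi>) else 0)" for \<phi>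
  proof (cases "integrable (count_space \<phi>) f")
    case True
    then show ?thesis
      by (auto simp: complex_eq_iff integrable_iff_bounded)
  next
    case False
    then show ?thesis by (auto simp: not_integrable_integral_eq integrable_iff_bounded)
  qed
  then show ?thesis by simp
qed

definition mean_measure :: "'a measure" where
  "mean_measure = measure_of UNIV (sets borel) (\<lambda>B. \<integral>\<^sup>+\<omega>. npoints (\<eta> \<omega>) B \<partial>M)"

lemma sets_mean_measure [simp, measurable_cong]: "sets mean_measure = sets borel"
  unfolding mean_measure_def using sets.sigma_sets_eq[of "borel :: 'a measure"] by (simp add: sets_measure_of)

lemma space_mean_measure [simp]: "space mean_measure = UNIV"
  using sets_eq_imp_space_eq[OF sets_mean_measure] by simp

lemma npoints_suminf:
  assumes "disjoint_family F"
  shows "(\<Sum>i. npoints \<phi> (F i)) = npoints \<phi> (\<Union>i. F i)"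
proof -
  have "disjoint_family (\<lambda>i. \<phi> \<inter> F i)"
    using assms unfolding disjoint_family_on_def by blast
  then have "(\<Sum>i. emeasure (count_space UNIV) (\<phi> \<inter> F i)) = emeasure (count_space UNIV) (\<Union>i. \<phi> \<inter> F i)"
    by (intro suminf_emeasure) auto
  then show ?thesis by (simp only: npoints_def Int_UN_distrib)
qed

lemma emeasure_mean_measure: "B \<in> sets borel \<Longrightarrow> emeasure mean_measure B = (\<integral>\<^sup>+\<omega>. npoints (\<eta> \<omega>) B \<partial>M)"
proof (rule emeasure_measure_of[OF mean_measure_def])
  show "positive (sets mean_measure) (\<lambda>B. \<integral>\<^sup>+\<omega>. npoints (\<eta> \<omega>) B \<partial>M)"
    by (simp add: positive_def npoints_def)
  show "countably_additive (sets mean_measure) (\<lambda>B. \<integral>\<^sup>+\<omega>. npoints (\<eta> \<omega>) B \<partial>M)"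
  proof (rule countably_additiveI)
    fix F :: "nat \<Rightarrow> 'a set" assume F: "range F \<subseteq> sets mean_measure" "disjoint_family F"
    then have [measurable]: "F i \<in> sets borel" for i by auto
    show "(\<Sum>i. \<integral>\<^sup>+\<omega>. npoints (\<eta> \<omega>) (F i) \<partial>M) = (\<integral>\<^sup>+\<omega>. npoints (\<eta> \<omega>) (\<Union>i. F i) \<partial>M)"
      by (subst nn_integral_suminf[symmetric]) (auto simp: npoints_suminf[OF F(2)])
  qed
qed auto

lemma nn_integral_mean_measure:
  assumes "f \<in> borel_measurable borel"
  shows "(\<integral>\<^sup>+\<omega>. \<integral>\<^sup>+x. f x \<partial>count_space (\<eta> \<omega>) \<partial>M) = (\<integral>\<^sup>+x. f x \<partial>mean_measure)"
  using assms
proof (induction rule: borel_measurable_induct)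
  case (cong f g)
  then show ?case by (auto simp: fun_eq_iff)
next
  case (set A)
  then show ?case by (simp add: nn_integral_count_space_npoints emeasure_mean_measure)
next
  case (mult u c)
  then show ?case by (simp add: nn_integral_cmult)
next
  case (add u v)
  then show ?case by (simp add: nn_integral_add)
next
  case (seq U)
  have e: "(SUP i. U i) = (\<lambda>x. SUP i. U i x)" by (simp add: fun_eq_iff SUP_apply image_comp)
  have "(\<integral>\<^sup>+x. (SUP i. U i) x \<partial>count_space \<phi>) = (SUP i. \<integral>\<^sup>+x. U i x \<partial>count_space \<phi>)" for \<phi>
    unfolding e by (rule nn_integral_monotone_convergence_SUP[OF \<open>incseq U\<close>]) simp
  then have "(\<integral>\<^sup>+\<omega>. \<integral>\<^sup>+x. (SUP i. U i) x \<partial>count_space (\<eta> \<omega>) \<partial>M) = (\<integral>\<^sup>+\<omega>. (SUP i. \<integral>\<^sup>+x. U i x \<partial>count_space (\<eta> \<omega>)) \<partial>M)"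
    by simp
  also have "\<dots> = (SUP i. \<integral>\<^sup>+\<omega>. \<integral>\<^sup>+x. U i x \<partial>count_space (\<eta> \<omega>) \<partial>M)"
    using seq by (intro nn_integral_monotone_convergence_SUP nn_sum_measurable)
       (auto simp: incseq_def le_fun_def intro!: nn_integral_mono)
  also have "\<dots> = (SUP i. \<integral>\<^sup>+x. U i x \<partial>mean_measure)" using seq by simp
  also have "\<dots> = (\<integral>\<^sup>+x. (SUP i. U i) x \<partial>mean_measure)"
    unfolding e using seq by (intro nn_integral_monotone_convergence_SUP[symmetric]) (auto simp: measurable_cong_sets[OF sets_mean_measure refl])
  finally show ?case .
qed

lemma mean_measure_translate:
  assumes B: "B \<in> sets borel"
  shows "emeasure mean_measure ((\<lambda>y. y + x) -` B) = emeasure mean_measure B"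
proof -
  have B': "(\<lambda>y. y + x) -` B \<in> sets borel"
    using measurable_sets[of "\<lambda>y. y + x" borel borel B] B by simp
  have m: "(\<lambda>\<omega>. (\<lambda>y. y + x) ` \<eta> \<omega>) \<in> M \<rightarrow>\<^sub>M config_space"
    by (rule measurable_compose[OF \<eta>_measurable translate_measurable])
  have "emeasure mean_measure ((\<lambda>y. y + x) -` B) = (\<integral>\<^sup>+\<omega>. npoints ((\<lambda>y. y + x) ` \<eta> \<omega>) B \<partial>M)"
    by (simp add: emeasure_mean_measure B' npoints_translate)
  also have "\<dots> = (\<integral>\<^sup>+\<phi>. npoints \<phi> B \<partial>distr M config_space (\<lambda>\<omega>. (\<lambda>y. y + x) ` \<eta> \<omega>))"
    using B by (intro nn_integral_distr[OF m, symmetric]) auto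
  also have "\<dots> = (\<integral>\<^sup>+\<phi>. npoints \<phi> B \<partial>distr M config_space \<eta>)"
    using stat by (simp add: stationary_def)
  also have "\<dots> = (\<integral>\<^sup>+\<omega>. npoints (\<eta> \<omega>) B \<partial>M)"
    using B by (intro nn_integral_distr) auto
  finally show ?thesis by (simp add: emeasure_mean_measure B)
qed

lemma distr_mean_measure: "distr mean_measure borel (\<lambda>y. y + x) = mean_measure"
  by (rule measure_eqI) (auto simp: emeasure_distr mean_measure_translate)

lemma nn_integral_mean_measure_translate:
  assumes [measurable]: "f \<in> borel_measurable borel"
  shows "(\<integral>\<^sup>+y. f (y + x) \<partial>mean_measure) = (\<integral>\<^sup>+y. f y \<partial>mean_measure)"
proof -
  have "(\<integral>\<^sup>+y. f y \<partial>mean_measure) = (\<integral>\<^sup>+y. f y \<partial>distr mean_measure borel (\<lambda>y. y + x))"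
    by (simp add: distr_mean_measure)
  also have "\<dots> = (\<integral>\<^sup>+y. f (y + x) \<partial>mean_measure)" by (rule nn_integral_distr) auto
  finally show ?thesis by simp
qed

text \<open>The moment assumption with exponent 1 makes balls finite. Fubini's theorem in
  \<open>campbell\<close> rests on this.\<close>

lemma sigma_finite_mean_measure: "sigma_finite_measure mean_measure"
proof
  let ?A = "range (\<lambda>n. cball (0::'a) (real n))"
  have "emeasure mean_measure (cball 0 (real n)) \<noteq> \<infinity>" for n
    using moments[of "cball 0 (real n)" 1] by (simp add: emeasure_mean_measure)
  moreover have "\<Union>?A = UNIV" using real_arch_simple by fastforce
  ultimately show "\<exists>A. countable A \<and> A \<subseteq> sets mean_measure \<and> \<Union>A = space mean_measure \<and> (\<forall>a\<in>A. emeasure mean_measure a \<noteq> \<infinity>)"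
    by (intro exI[of _ ?A]) auto
qed

text \<open>
  A translation-invariant measure is a multiple of Lebesgue measure: integrate
  \<open>f y * indicator Q (x + y)\<close>, with \<open>Q\<close> the unit cube, in both orders.
\<close>

theorem campbell:
  assumes [measurable]: "f \<in> borel_measurable borel"
  shows "(\<integral>\<^sup>+\<omega>. \<integral>\<^sup>+x. f x \<partial>count_space (\<eta> \<omega>) \<partial>M) = ennreal \<gamma> * (\<integral>\<^sup>+x. f x \<partial>lborel)"
proof -
  let ?Q = "cbox 0 One :: 'a set" and ?\<mu> = mean_measure
  interpret \<mu>: sigma_finite_measure ?\<mu> by (rule sigma_finite_mean_measure)
  interpret P: pair_sigma_finite ?\<mu> lborel ..
  have Q: "emeasure lborel ?Q = 1" by (simp add: emeasure_lborel_cbox_eq)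
  have \<mu>Q: "emeasure ?\<mu> ?Q = ennreal \<gamma>" using inten by (simp add: emeasure_mean_measure intensity_def)
  have "(\<integral>\<^sup>+y. f y \<partial>?\<mu>) = (\<integral>\<^sup>+y. f y * (\<integral>\<^sup>+x. indicator ?Q x \<partial>lborel) \<partial>?\<mu>)"
    using Q by simp
  also have "\<dots> = (\<integral>\<^sup>+y. (\<integral>\<^sup>+x. f y * indicator ?Q (y + x) \<partial>lborel) \<partial>?\<mu>)"
  proof (rule nn_integral_cong)
    fix y
    have "(\<integral>\<^sup>+x. indicator ?Q x \<partial>lborel) = (\<integral>\<^sup>+x. indicator ?Q (y + x) \<partial>(lborel :: 'a measure))"
      using lborel_nn_integral_affine[of "indicator ?Q" 1 y] by (simp del: nn_integral_indicator)
    moreover have "(\<lambda>x. indicator ?Q (y + x) :: ennreal) \<in> borel_measurable borel" by measurable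
    ultimately show "f y * (\<integral>\<^sup>+x. indicator ?Q x \<partial>lborel) = (\<integral>\<^sup>+x. f y * indicator ?Q (y + x) \<partial>lborel)"
      by (simp add: nn_integral_cmult del: nn_integral_indicator)
  qed
  also have "\<dots> = (\<integral>\<^sup>+x. (\<integral>\<^sup>+y. f y * indicator ?Q (y + x) \<partial>?\<mu>) \<partial>lborel)"
    by (rule P.Fubini'[symmetric]) measurable
  \<comment> \<open>Invariance of the mean measure moves the shift from the cube onto
    \<open>f\<close>; invariance of Lebesgue measure removes it after the second exchange of
    integrals.\<close>
  also have "\<dots> = (\<integral>\<^sup>+x. (\<integral>\<^sup>+y. f (y - x) * indicator ?Q y \<partial>?\<mu>) \<partial>lborel)"
  proof (rule nn_integral_cong)
    fix x
    show "(\<integral>\<^sup>+y. f y * indicator ?Q (y + x) \<partial>?\<mu>) = (\<integral>\<^sup>+y. f (y - x) * indicator ?Q y \<partial>?\<mu>)"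
      using nn_integral_mean_measure_translate[of "\<lambda>y. f (y - x) * indicator ?Q y" x] by simp
  qed
  also have "\<dots> = (\<integral>\<^sup>+y. (\<integral>\<^sup>+x. f (y - x) * indicator ?Q y \<partial>lborel) \<partial>?\<mu>)"
    by (rule P.Fubini') measurable
  also have "\<dots> = (\<integral>\<^sup>+y. indicator ?Q y * (\<integral>\<^sup>+x. f x \<partial>lborel) \<partial>?\<mu>)"
  proof (rule nn_integral_cong)
    fix y
    have "(\<integral>\<^sup>+x. f x \<partial>lborel) = (\<integral>\<^sup>+x. f (y - x) \<partial>lborel)"
      using lborel_nn_integral_affine[of f "-1" y] by simp
    moreover have "(\<lambda>x. f (y - x)) \<in> borel_measurable borel" by measurable
    ultimately show "(\<integral>\<^sup>+x. f (y - x) * indicator ?Q y \<partial>lborel) = indicator ?Q y * (\<integral>\<^sup>+x. f x \<partial>lborel)"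
      by (simp add: nn_integral_multc mult.commute)
  qed
  also have "\<dots> = ennreal \<gamma> * (\<integral>\<^sup>+x. f x \<partial>lborel)"
    by (subst nn_integral_multc) (auto simp: \<mu>Q)
  finally show ?thesis by (simp add: nn_integral_mean_measure)
qed

text \<open>Campbell's formula bounds the mean of the absolute sum, so divergence is confined to a
  null set. Linear manipulations of sums over the process are therefore justified almost surely
  rather than pointwise.\<close>

lemma AE_integrable_sum:
  fixes f :: "'a \<Rightarrow> 'b::{banach, second_countable_topology}"
  assumes f: "integrable lborel f"
  shows "AE \<omega> in M. integrable (count_space (\<eta> \<omega>)) f"
proof -
  have [measurable]: "f \<in> borel_measurable borel" using f by auto
  have "(\<integral>\<^sup>+\<omega>. \<integral>\<^sup>+x. ennreal (norm (f x)) \<partial>count_space (\<eta> \<omega>) \<partial>M) < \<infinity>"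
    using f by (subst campbell) (auto simp: integrable_iff_bounded ennreal_mult_less_top)
  then have "AE \<omega> in M. (\<integral>\<^sup>+x. ennreal (norm (f x)) \<partial>count_space (\<eta> \<omega>)) \<noteq> \<infinity>"
    by (intro nn_integral_noteq_infinite) auto
  then show ?thesis by eventually_elim (auto simp: integrable_iff_bounded less_top)
qed

lemma nn_integral_sum_bound:
  fixes f :: "'a \<Rightarrow> real"
  assumes f: "integrable lborel f"
  shows "(\<integral>\<^sup>+\<omega>. ennreal \<bar>\<integral>x. f x \<partial>count_space (\<eta> \<omega>)\<bar> \<partial>M) \<le> ennreal (\<gamma> * (\<integral>x. \<bar>f x\<bar> \<partial>lborel))"
proof -
  have [measurable]: "f \<in> borel_measurable borel" using f by auto
  have "(\<integral>\<^sup>+\<omega>. ennreal \<bar>\<integral>x. f x \<partial>count_space (\<eta> \<omega>)\<bar> \<partial>M)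
     \<le> (\<integral>\<^sup>+\<omega>. \<integral>\<^sup>+x. ennreal \<bar>f x\<bar> \<partial>count_space (\<eta> \<omega>) \<partial>M)"
  proof (rule nn_integral_mono_AE)
    show "AE \<omega> in M. ennreal \<bar>\<integral>x. f x \<partial>count_space (\<eta> \<omega>)\<bar> \<le> (\<integral>\<^sup>+x. ennreal \<bar>f x\<bar> \<partial>count_space (\<eta> \<omega>))"
      using AE_integrable_sum[OF f]
      by eventually_elim (use integral_norm_bound_ennreal in force)
  qed
  also have "\<dots> = ennreal \<gamma> * (\<integral>\<^sup>+x. ennreal \<bar>f x\<bar> \<partial>lborel)" by (rule campbell) simp
  also have "\<dots> = ennreal (\<gamma> * (\<integral>x. \<bar>f x\<bar> \<partial>lborel))"
    using f \<gamma>_pos by (subst nn_integral_eq_integral) (auto simp: ennreal_mult)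
  finally show ?thesis .
qed

lemma integrable_sum:
  fixes f :: "'a \<Rightarrow> real"
  assumes f: "integrable lborel f"
  shows "integrable M (\<lambda>\<omega>. \<integral>x. f x \<partial>count_space (\<eta> \<omega>))"
proof -
  have [measurable]: "f \<in> borel_measurable borel" using f by auto
  show ?thesis
    using nn_integral_sum_bound[OF f] le_less_trans[OF _ ennreal_less_top]
    by (auto simp: integrable_iff_bounded)
qed

lemma expectation_abs_sum_le:
  fixes f :: "'a \<Rightarrow> real"
  assumes f: "integrable lborel f"
  shows "(\<integral>\<omega>. \<bar>\<integral>x. f x \<partial>count_space (\<eta> \<omega>)\<bar> \<partial>M) \<le> \<gamma> * (\<integral>x. \<bar>f x\<bar> \<partial>lborel)"
proof -
  have "ennreal (\<integral>\<omega>. \<bar>\<integral>x. f x \<partial>count_space (\<eta> \<omega>)\<bar> \<partial>M) \<le> ennreal (\<gamma> * (\<integral>x. \<bar>f x\<bar> \<partial>lborel))"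
    using nn_integral_sum_bound[OF f] integrable_sum[OF f]
    by (subst nn_integral_eq_integral[symmetric]) auto
  then show ?thesis using \<gamma>_pos by (subst (asm) ennreal_le_iff) auto
qed

lemma expectation_sum:
  fixes f :: "'a \<Rightarrow> real"
  assumes f: "integrable lborel f"
  shows "(\<integral>\<omega>. \<integral>x. f x \<partial>count_space (\<eta> \<omega>) \<partial>M) = \<gamma> * (\<integral>x. f x \<partial>lborel)"
proof -
  have nonneg: "(\<integral>\<omega>. \<integral>x. g x \<partial>count_space (\<eta> \<omega>) \<partial>M) = \<gamma> * (\<integral>x. g x \<partial>lborel)"
    if g: "integrable lborel g" "\<And>x. 0 \<le> g x" for g :: "'a \<Rightarrow> real"
  proof -
    have [measurable]: "g \<in> borel_measurable borel" using g by auto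
    have "ennreal (\<integral>\<omega>. \<integral>x. g x \<partial>count_space (\<eta> \<omega>) \<partial>M) = (\<integral>\<^sup>+\<omega>. ennreal (\<integral>x. g x \<partial>count_space (\<eta> \<omega>)) \<partial>M)"
      using g(2) by (intro nn_integral_eq_integral[symmetric] integrable_sum[OF g(1)] AE_I2 Bochner_Integration.integral_nonneg) simp
    also have "\<dots> = (\<integral>\<^sup>+\<omega>. \<integral>\<^sup>+x. ennreal (g x) \<partial>count_space (\<eta> \<omega>) \<partial>M)"
    proof (rule nn_integral_cong_AE)
      show "AE \<omega> in M. ennreal (\<integral>x. g x \<partial>count_space (\<eta> \<omega>)) = (\<integral>\<^sup>+x. ennreal (g x) \<partial>count_space (\<eta> \<omega>))"
        using AE_integrable_sum[OF g(1)]
        by eventually_elim (auto intro!: nn_integral_eq_integral[symmetric] g)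
    qed
    also have "\<dots> = ennreal (\<gamma> * (\<integral>x. g x \<partial>lborel))"
      using g \<gamma>_pos by (subst campbell) (auto simp: nn_integral_eq_integral ennreal_mult)
    finally have "ennreal (\<integral>\<omega>. \<integral>x. g x \<partial>count_space (\<eta> \<omega>) \<partial>M) = ennreal (\<gamma> * (\<integral>x. g x \<partial>lborel))" .
    moreover have "0 \<le> (\<integral>\<omega>. \<integral>x. g x \<partial>count_space (\<eta> \<omega>) \<partial>M)" "0 \<le> \<gamma> * (\<integral>x. g x \<partial>lborel)"
      using \<gamma>_pos g(2) by (auto simp: Bochner_Integration.integral_nonneg)
    ultimately show ?thesis by simp
  qed
  \<comment> \<open>The sum over the process splits into positive and negative parts only where both
    converge, hence the comparison for almost every \<open>\<omega>\<close>.\<close>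
  have p: "integrable lborel (\<lambda>x. max 0 (f x))" "integrable lborel (\<lambda>x. max 0 (- f x))" using f by auto
  have "(\<integral>\<omega>. \<integral>x. f x \<partial>count_space (\<eta> \<omega>) \<partial>M)
      = (\<integral>\<omega>. (\<integral>x. max 0 (f x) \<partial>count_space (\<eta> \<omega>)) - (\<integral>x. max 0 (- f x) \<partial>count_space (\<eta> \<omega>)) \<partial>M)"
  proof (rule integral_cong_AE)
    have [measurable]: "f \<in> borel_measurable borel" using f by auto
    show "(\<lambda>\<omega>. \<integral>x. f x \<partial>count_space (\<eta> \<omega>)) \<in> borel_measurable M"
      "(\<lambda>\<omega>. (\<integral>x. max 0 (f x) \<partial>count_space (\<eta> \<omega>)) - (\<integral>x. max 0 (- f x) \<partial>count_space (\<eta> \<omega>))) \<in> borel_measurable M"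
      by measurable
    show "AE \<omega> in M. (\<integral>x. f x \<partial>count_space (\<eta> \<omega>))
       = (\<integral>x. max 0 (f x) \<partial>count_space (\<eta> \<omega>)) - (\<integral>x. max 0 (- f x) \<partial>count_space (\<eta> \<omega>))"
      using AE_integrable_sum[OF p(1)] AE_integrable_sum[OF p(2)]
    proof eventually_elim
      case (elim \<omega>)
      have "(\<integral>x. f x \<partial>count_space (\<eta> \<omega>)) = (\<integral>x. max 0 (f x) - max 0 (- f x) \<partial>count_space (\<eta> \<omega>))"
        by (intro Bochner_Integration.integral_cong) auto
      then show ?case using elim by (subst (asm) Bochner_Integration.integral_diff) auto
    qed
  qed
  also have "\<dots> = \<gamma> * (\<integral>x. max 0 (f x) \<partial>lborel) - \<gamma> * (\<integral>x. max 0 (- f x) \<partial>lborel)"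
    using p by (subst Bochner_Integration.integral_diff) (auto intro: integrable_sum simp: nonneg)
  also have "\<dots> = \<gamma> * (\<integral>x. max 0 (f x) - max 0 (- f x) \<partial>lborel)"
    using p by (simp add: right_diff_distrib)
  also have "(\<lambda>x. max 0 (f x) - max 0 (- f x)) = f" by auto
  finally show ?thesis .
qed

end

section \<open>Moments of linear statistics\<close>

text \<open>The bound is uniform over the whole index type, so that it survives updates of the
  family. Families given on finitely many indices are extended by 0 before this notion is
  applied.\<close>

definition bounded_family :: "('i \<Rightarrow> 'a::euclidean_space \<Rightarrow> real) \<Rightarrow> bool" where
  "bounded_family f \<longleftrightarrow> (\<forall>i. f i \<in> borel_measurable borel) \<and> (\<exists>K. \<forall>i x. \<bar>f i x\<bar> \<le> K)"

lemma bounded_familyE: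
  assumes "bounded_family f"
  obtains K where "1 \<le> K" "\<And>i x. \<bar>f i x\<bar> \<le> K"
proof -
  obtain K where "\<And>i x. \<bar>f i x\<bar> \<le> K" using assms by (auto simp: bounded_family_def)
  then show ?thesis by (intro that[of "max 1 K"]) (auto simp: le_max_iff_disj)
qed

lemma bounded_family_upd:
  assumes "bounded_family f"
  shows "bounded_family (f(i := \<lambda>x. f i x * f t x))"
proof -
  obtain K where K: "1 \<le> K" "\<And>i x. \<bar>f i x\<bar> \<le> K" using bounded_familyE[OF assms] by blast
  have "\<bar>(f(i := \<lambda>x. f i x * f t x)) j x\<bar> \<le> K * K" for j x
  proof (cases "j = i")
    case True
    then show ?thesis using K by (auto simp: abs_mult intro!: mult_mono)
  next
    case False
    have "K * 1 \<le> K * K" using K(1) by (intro mult_left_mono) auto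
    then show ?thesis using False K(2)[of j x] by simp
  qed
  moreover have "(f(i := \<lambda>x. f i x * f t x)) j \<in> borel_measurable borel" for j
  proof -
    have [measurable]: "f i \<in> borel_measurable borel" for i using assms by (simp add: bounded_family_def)
    show ?thesis by (cases "j = i") auto
  qed
  ultimately show ?thesis unfolding bounded_family_def by blast
qed

context stationary_process
begin

section \<open>Factorial expectations inside a bounded window and the recursion for central
  moments\<close>

definition linear_stat :: "'a set \<Rightarrow> ('a \<Rightarrow> real) \<Rightarrow> 'w \<Rightarrow> real" where
  "linear_stat W f \<omega> = (\<Sum>x\<in>\<eta> \<omega> \<inter> W. f x)"

definition factorial_expectation :: "'a set \<Rightarrow> nat set \<Rightarrow> (nat \<Rightarrow> 'a \<Rightarrow> real) \<Rightarrow> real" where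
  "factorial_expectation W J f = (\<integral>\<omega>. factorial_sum (\<eta> \<omega> \<inter> W) J f \<partial>M)"

text \<open>The factorial cumulant measure evaluated at the product of the \<open>f i\<close>, but
  built from expectations without reference to a measure. The link with \<open>\<nu>\<close> is
  established later, for step functions.\<close>

definition factorial_cumulant_functional :: "'a set \<Rightarrow> nat set \<Rightarrow> (nat \<Rightarrow> 'a \<Rightarrow> real) \<Rightarrow> real" where
  "factorial_cumulant_functional W J f = joint_cumulant J (\<lambda>I. factorial_expectation W I f)"

lemma linear_stat_eq_integral:
  assumes "bounded W" "\<omega> \<in> space M"
  shows "linear_stat W f \<omega> = (\<integral>x. indicator W x * f x \<partial>count_space (\<eta> \<omega>))"
proof -
  have fin: "finite (\<eta> \<omega> \<inter> W)" by (rule finite_\<eta>_bounded[OF assms(2,1)])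
  have s: "{x \<in> \<eta> \<omega>. indicator W x * f x \<noteq> 0} \<subseteq> \<eta> \<omega> \<inter> W" by (auto simp: indicator_def)
  have "(\<integral>x. indicator W x * f x \<partial>count_space (\<eta> \<omega>)) = (\<Sum>x | x \<in> \<eta> \<omega> \<and> indicator W x * f x \<noteq> 0. indicator W x * f x)"
    by (rule lebesgue_integral_count_space_finite_support) (rule finite_subset[OF s fin])
  also have "\<dots> = (\<Sum>x\<in>\<eta> \<omega> \<inter> W. indicator W x * f x)"
    by (rule sum.mono_neutral_left[OF fin s]) auto
  finally show ?thesis by (simp add: linear_stat_def)
qed

lemma npoints_eq_card:
  assumes "bounded W" "\<omega> \<in> space M"
  shows "npoints (\<eta> \<omega>) W = ennreal (real (card (\<eta> \<omega> \<inter> W)))"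
  using finite_\<eta>_bounded[OF assms(2,1)] by (simp add: npoints_def emeasure_count_space ennreal_of_nat_eq_real_of_nat)

lemma factorial_expectation_cong:
  "(\<And>i. i \<in> J \<Longrightarrow> f i = f' i) \<Longrightarrow> factorial_expectation W J f = factorial_expectation W J f'"
  unfolding factorial_expectation_def by (simp cong: factorial_sum_cong)

lemma factorial_cumulant_functional_cong:
  "(\<And>i. i \<in> J \<Longrightarrow> f i = f' i) \<Longrightarrow> factorial_cumulant_functional W J f = factorial_cumulant_functional W J f'"
  unfolding factorial_cumulant_functional_def
  by (intro joint_cumulant_cong factorial_expectation_cong) auto

text \<open>Supplies hypothesis \<open>R\<close> of \<open>centred_clus\<close>.\<close>

lemma factorial_expectation_recursion:
  assumes "finite J" "i \<in> J"
  shows "factorial_expectation W J f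
    = (\<Sum>S | i \<in> S \<and> S \<subseteq> J. factorial_cumulant_functional W S f * factorial_expectation W (J - S) f)"
  unfolding factorial_cumulant_functional_def
  by (rule joint_cumulant_recursion[OF assms]) (simp add: factorial_expectation_def prob_space)

lemma factorial_sum_singleton: "factorial_sum D {t} f = (\<Sum>x\<in>D. f t x)" if "finite D"
  using factorial_sum_insert[of "{}" D t f] that by simp

context
  fixes W :: "'a set"
  assumes W: "bounded W" and W_borel [measurable]: "W \<in> sets borel"
begin

lemma linear_stat_measurable [measurable]:
  assumes [measurable]: "f \<in> borel_measurable borel"
  shows "linear_stat W f \<in> borel_measurable M"
proof -
  have "(\<lambda>\<omega>. \<integral>x. indicator W x * f x \<partial>count_space (\<eta> \<omega>)) \<in> borel_measurable M"
    by (rule real_sum_measurable) measurable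
  then show ?thesis
    by (subst measurable_cong[OF linear_stat_eq_integral[OF W]])
qed

lemma card_measurable [measurable]: "(\<lambda>\<omega>. real (card (\<eta> \<omega> \<inter> W))) \<in> borel_measurable M"
  using linear_stat_measurable[of "\<lambda>_. 1"] by (simp add: linear_stat_def[abs_def])

lemma integrable_card_power: "integrable M (\<lambda>\<omega>. real (card (\<eta> \<omega> \<inter> W)) ^ m)"
proof -
  have "(\<integral>\<^sup>+\<omega>. ennreal (norm (real (card (\<eta> \<omega> \<inter> W)) ^ m)) \<partial>M) = (\<integral>\<^sup>+ \<omega>. npoints (\<eta> \<omega>) W ^ m \<partial>M)"
    by (intro nn_integral_cong) (simp add: npoints_eq_card[OF W] ennreal_power)
  then show ?thesis using moments[OF W W_borel, of m] by (simp add: integrable_iff_bounded)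
qed

lemma integrable_1_card_power: "integrable M (\<lambda>\<omega>. (K * (1 + real (card (\<eta> \<omega> \<inter> W)))) ^ m)"
proof -
  have "integrable M (\<lambda>\<omega>. 2 ^ m * (1 + real (card (\<eta> \<omega> \<inter> W)) ^ m))"
    using integrable_card_power[of m] by simp
  then have "integrable M (\<lambda>\<omega>. (1 + real (card (\<eta> \<omega> \<inter> W))) ^ m)"
  proof (rule Bochner_Integration.integrable_bound)
    show "AE \<omega> in M. norm ((1 + real (card (\<eta> \<omega> \<inter> W))) ^ m) \<le> norm (2 ^ m * (1 + real (card (\<eta> \<omega> \<inter> W)) ^ m))"
    proof (rule AE_I2)
      fix \<omega>
      let ?n = "real (card (\<eta> \<omega> \<inter> W))"
      have "(1 + ?n) ^ m \<le> (2 * max 1 ?n) ^ m" by (rule power_mono) auto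
      also have "\<dots> \<le> 2 ^ m * (1 + ?n ^ m)"
        by (cases "?n \<le> 1") (auto simp: power_mult_distrib max_def)
      finally show "norm ((1 + ?n) ^ m) \<le> norm (2 ^ m * (1 + ?n ^ m))" by simp
    qed
  qed measurable
  then have "integrable M (\<lambda>\<omega>. K ^ m * (1 + real (card (\<eta> \<omega> \<inter> W))) ^ m)" by simp
  then show ?thesis by (simp only: power_mult_distrib)
qed

lemma factorial_sum_measurable [measurable]:
  assumes "finite J" "\<And>i. f i \<in> borel_measurable borel"
  shows "(\<lambda>\<omega>. factorial_sum (\<eta> \<omega> \<inter> W) J f) \<in> borel_measurable M"
  using assms
proof (induction J arbitrary: f rule: finite_induct)
  case empty
  then show ?case by simp
next
  case (insert t J)
  note [measurable] = insert.prems
  have m: "(\<lambda>\<omega>. factorial_sum (\<eta> \<omega> \<inter> W) J (f(i := \<lambda>x. f i x * f t x))) \<in> borel_measurable M" for i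
    by (rule insert.IH) auto
  note [measurable] = insert.IH[OF insert.prems] m
  have "(\<lambda>\<omega>. factorial_sum (\<eta> \<omega> \<inter> W) J f * linear_stat W (f t) \<omega>
     - (\<Sum>i\<in>J. factorial_sum (\<eta> \<omega> \<inter> W) J (f(i := \<lambda>x. f i x * f t x)))) \<in> borel_measurable M"
    by measurable
  moreover have "factorial_sum (\<eta> \<omega> \<inter> W) J f * linear_stat W (f t) \<omega>
     - (\<Sum>i\<in>J. factorial_sum (\<eta> \<omega> \<inter> W) J (f(i := \<lambda>x. f i x * f t x))) = factorial_sum (\<eta> \<omega> \<inter> W) (insert t J) f"
    if "\<omega> \<in> space M" for \<omega>
    using factorial_sum_insert[OF insert.hyps(1) finite_\<eta>_bounded[OF that W] insert.hyps(2), of f]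
    by (simp add: linear_stat_def)
  ultimately show ?case by (simp cong: measurable_cong)
qed

lemma linear_stat_bound:
  assumes "\<And>x. \<bar>f x\<bar> \<le> K"
  shows "\<bar>linear_stat W f \<omega>\<bar> \<le> K * real (card (\<eta> \<omega> \<inter> W))"
proof -
  have "\<bar>linear_stat W f \<omega>\<bar> \<le> (\<Sum>x\<in>\<eta> \<omega> \<inter> W. \<bar>f x\<bar>)" unfolding linear_stat_def by (rule sum_abs)
  also have "\<dots> \<le> (\<Sum>x\<in>\<eta> \<omega> \<inter> W. K)" by (rule sum_mono) (use assms in auto)
  finally show ?thesis by (simp add: mult.commute)
qed

text \<open>Everything is dominated by a power of the number of points in \<open>W\<close>, which
  has moments of all orders. The constant \<open>K\<close> includes the centring constants, so that
  each centred statistic is at most \<open>K\<close> times one plus that number.\<close>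

lemma integrable_factorial_sum_prod:
  assumes "finite J" "bounded_family f"
  shows "integrable M (\<lambda>\<omega>. factorial_sum (\<eta> \<omega> \<inter> W) J f * (\<Prod>t\<leftarrow>ts. linear_stat W (f t) \<omega> - m t))"
proof -
  obtain K0 where K0: "1 \<le> K0" "\<And>i x. \<bar>f i x\<bar> \<le> K0" using bounded_familyE[OF assms(2)] by blast
  have [measurable]: "f i \<in> borel_measurable borel" for i using assms(2) by (auto simp: bounded_family_def)
  define K where "K = K0 + (\<Sum>t\<in>set ts. \<bar>m t\<bar>)"
  have s0: "0 \<le> (\<Sum>t\<in>set ts. \<bar>m t\<bar>)" by (rule sum_nonneg) auto
  have K: "K0 \<le> K" using s0 by (simp add: K_def)
  have mt: "\<bar>m t\<bar> + K0 \<le> K" if "t \<in> set ts" for t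
    using member_le_sum[of t "set ts" "\<lambda>t. \<bar>m t\<bar>"] that by (simp add: K_def)
  have pl: "\<bar>\<Prod>t\<leftarrow>us. linear_stat W (f t) \<omega> - m t\<bar> \<le> (K * (1 + real (card (\<eta> \<omega> \<inter> W)))) ^ length us"
    if "set us \<subseteq> set ts" for us \<omega>
    using that
  proof (induction us)
    case (Cons t us)
    let ?n = "real (card (\<eta> \<omega> \<inter> W))"
    have "\<bar>linear_stat W (f t) \<omega> - m t\<bar> \<le> K0 * ?n + \<bar>m t\<bar>"
      using linear_stat_bound[of "f t" K0 \<omega>] K0(2) by (intro order_trans[OF abs_triangle_ineq4]) auto
    also have "\<dots> \<le> K * ?n + K * 1"
      using K mt[of t] Cons.prems K0(1) by (intro add_mono mult_right_mono) auto
    finally have "\<bar>linear_stat W (f t) \<omega> - m t\<bar> \<le> K * (1 + ?n)" by (simp add: algebra_simps)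
    then show ?case using Cons K K0(1) by (auto simp: abs_mult intro!: mult_mono)
  qed simp
  show ?thesis
  proof (rule Bochner_Integration.integrable_bound[OF integrable_1_card_power[of K "card J + length ts"]])
    have "(\<lambda>\<omega>. \<Prod>t\<leftarrow>us. linear_stat W (f t) \<omega> - m t) \<in> borel_measurable M" for us
      by (induction us) auto
    then show "(\<lambda>\<omega>. factorial_sum (\<eta> \<omega> \<inter> W) J f * (\<Prod>t\<leftarrow>ts. linear_stat W (f t) \<omega> - m t)) \<in> borel_measurable M"
      using factorial_sum_measurable[OF assms(1), of f] by measurable
    show "AE \<omega> in M. norm (factorial_sum (\<eta> \<omega> \<inter> W) J f * (\<Prod>t\<leftarrow>ts. linear_stat W (f t) \<omega> - m t))
       \<le> norm ((K * (1 + real (card (\<eta> \<omega> \<inter> W)))) ^ (card J + length ts))"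
    proof (rule AE_I2)
      fix \<omega> assume \<omega>: "\<omega> \<in> space M"
      let ?n = "real (card (\<eta> \<omega> \<inter> W))"
      have "\<bar>factorial_sum (\<eta> \<omega> \<inter> W) J f\<bar> \<le> (K0 * ?n) ^ card J"
        by (rule factorial_sum_bound[OF assms(1) finite_\<eta>_bounded[OF \<omega> W]]) (use K0 in auto)
      also have "\<dots> \<le> (K * (1 + ?n)) ^ card J"
        using K K0(1) by (intro power_mono mult_mono) auto
      finally have "\<bar>factorial_sum (\<eta> \<omega> \<inter> W) J f\<bar> \<le> (K * (1 + ?n)) ^ card J" .
      then have "norm (factorial_sum (\<eta> \<omega> \<inter> W) J f * (\<Prod>t\<leftarrow>ts. linear_stat W (f t) \<omega> - m t))
         \<le> (K * (1 + ?n)) ^ card J * (K * (1 + ?n)) ^ length ts"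
        unfolding real_norm_def abs_mult using K K0(1) by (intro mult_mono pl) auto
      moreover have "0 \<le> K * (1 + ?n)" using K K0(1) by simp
      ultimately show "norm (factorial_sum (\<eta> \<omega> \<inter> W) J f * (\<Prod>t\<leftarrow>ts. linear_stat W (f t) \<omega> - m t))
         \<le> norm ((K * (1 + ?n)) ^ (card J + length ts))"
        by (simp only: power_add[symmetric] real_norm_def[of "_ ^ _"] abs_of_nonneg zero_le_power)
    qed
  qed
qed

text \<open>Identifies the formal recursion with an expectation. Distinctness of \<open>ts\<close>
  and its disjointness from \<open>J\<close> guarantee that an update of \<open>f\<close> at an
  index of \<open>J\<close> leaves the remaining linear statistics unchanged.\<close>

lemma centred_eq_expectation:
  assumes "finite J" "bounded_family f" "distinct ts" "set ts \<inter> J = {}"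
  shows "centred (factorial_expectation W) m J f ts
    = (\<integral>\<omega>. factorial_sum (\<eta> \<omega> \<inter> W) J f * (\<Prod>t\<leftarrow>ts. linear_stat W (f t) \<omega> - m t) \<partial>M)"
  using assms
proof (induction ts arbitrary: J f)
  case Nil
  then show ?case by (simp add: factorial_expectation_def)
next
  case (Cons t ts)
  let ?u = "\<lambda>i. f(i := \<lambda>x. f i x * f t x)"
  let ?P = "\<lambda>f \<omega>. \<Prod>t\<leftarrow>ts. linear_stat W (f t) \<omega> - m t"
  let ?q = "\<lambda>J f \<omega>. factorial_sum (\<eta> \<omega> \<inter> W) J f"
  have t: "t \<notin> J" "t \<notin> set ts" "distinct ts" "set ts \<inter> J = {}" using Cons.prems by auto
  have bu: "bounded_family (?u i)" for i by (rule bounded_family_upd[OF Cons.prems(2)])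
  have Pu: "?P (?u i) \<omega> = ?P f \<omega>" if "i \<in> J" for i \<omega>
    using t that by (intro arg_cong[where f=prod_list] map_cong) auto
  have I1: "integrable M (\<lambda>\<omega>. ?q (insert t J) f \<omega> * ?P f \<omega>)"
    using Cons.prems by (intro integrable_factorial_sum_prod) auto
  have I2: "integrable M (\<lambda>\<omega>. ?q J (?u i) \<omega> * ?P f \<omega>)" if "i \<in> J" for i
    using integrable_factorial_sum_prod[OF Cons.prems(1) bu[of i], where ts=ts and m=m] by (simp add: Pu[OF that] del: fun_upd_apply)
  have I3: "integrable M (\<lambda>\<omega>. ?q J f \<omega> * ?P f \<omega>)"
    using Cons.prems by (intro integrable_factorial_sum_prod) auto
  have e2: "centred (factorial_expectation W) m J (?u i) ts = (\<integral>\<omega>. ?q J (?u i) \<omega> * ?P f \<omega> \<partial>M)" if "i \<in> J" for i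
    using Cons.IH[OF Cons.prems(1) bu[of i] t(3,4)] by (simp add: Pu[OF that] del: fun_upd_apply)
  have "centred (factorial_expectation W) m J f (t # ts)
     = (\<integral>\<omega>. ?q (insert t J) f \<omega> * ?P f \<omega> \<partial>M) + (\<Sum>i\<in>J. \<integral>\<omega>. ?q J (?u i) \<omega> * ?P f \<omega> \<partial>M)
        - m t * (\<integral>\<omega>. ?q J f \<omega> * ?P f \<omega> \<partial>M)"
    using Cons.IH[of "insert t J" f] Cons.IH[of J f] Cons.prems t by (simp add: e2 del: fun_upd_apply)
  also have "\<dots> = (\<integral>\<omega>. ?q (insert t J) f \<omega> * ?P f \<omega> + (\<Sum>i\<in>J. ?q J (?u i) \<omega> * ?P f \<omega>)
        - m t * (?q J f \<omega> * ?P f \<omega>) \<partial>M)"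
    using I1 I2 I3
    by (subst Bochner_Integration.integral_diff Bochner_Integration.integral_add Bochner_Integration.integral_sum;
        (intro Bochner_Integration.integrable_add Bochner_Integration.integrable_sum integrable_mult_right)?)+ simp_all
  also have "\<dots> = (\<integral>\<omega>. ?q J f \<omega> * (\<Prod>t\<leftarrow>t # ts. linear_stat W (f t) \<omega> - m t) \<partial>M)"
  proof (rule Bochner_Integration.integral_cong[OF refl])
    fix \<omega> assume \<omega>: "\<omega> \<in> space M"
    have "?q J f \<omega> * linear_stat W (f t) \<omega> = ?q (insert t J) f \<omega> + (\<Sum>i\<in>J. ?q J (?u i) \<omega>)"
      using factorial_sum_insert[OF Cons.prems(1) finite_\<eta>_bounded[OF \<omega> W] t(1), of f] by (simp add: linear_stat_def)
    from arg_cong[OF this, of "\<lambda>z. z * ?P f \<omega>"]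
    show "?q (insert t J) f \<omega> * ?P f \<omega> + (\<Sum>i\<in>J. ?q J (?u i) \<omega> * ?P f \<omega>) - m t * (?q J f \<omega> * ?P f \<omega>)
       = ?q J f \<omega> * (\<Prod>t\<leftarrow>t # ts. linear_stat W (f t) \<omega> - m t)"
      by (simp add: distrib_right sum_distrib_right del: fun_upd_apply) (simp add: algebra_simps)
  qed
  finally show ?case .
qed

text \<open>The classical relation expressing a moment through cumulants and lower moments. The
  distinguished factor, with index 0, is grouped with the factors indexed by \<open>U\<close>, and
  the \<open>clus\<close> term plays the part of the cumulant of order
  \<open>card U + 1\<close>.\<close>

lemma central_moment_recursion:
  fixes u :: "'a \<Rightarrow> real"
  assumes u [measurable]: "u \<in> borel_measurable borel" and bd: "\<And>x. \<bar>u x\<bar> \<le> K"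
  defines "mu \<equiv> \<lambda>n. \<integral>\<omega>. (linear_stat W u \<omega> - (\<integral>\<omega>. linear_stat W u \<omega> \<partial>M)) ^ n \<partial>M"
  shows "mu (Suc n) = (\<Sum>U\<in>Pow {1..<Suc n} - {{}}.
     clus (factorial_cumulant_functional W) {0} (\<lambda>_. u) (filter (\<lambda>t. t \<in> U) [1..<Suc n]) * mu (n - card U))"
proof -
  define c where "c = (\<integral>\<omega>. linear_stat W u \<omega> \<partial>M)"
  let ?f = "\<lambda>_::nat. u" and ?A = "factorial_expectation W" and ?B = "factorial_cumulant_functional W"
  let ?ts = "[1..<Suc n]" and ?m = "\<lambda>_::nat. c"
  have bf: "bounded_family ?f" using u bd by (auto simp: bounded_family_def)
  have mu: "centred ?A ?m {} ?f ts = mu (length ts)" if "distinct ts" for ts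
    using centred_eq_expectation[OF _ bf that, where J="{}" and m="?m"]
    by (simp add: mu_def c_def[symmetric] map_replicate_const)
  have A0: "?A {0} ?f = c"
    unfolding factorial_expectation_def c_def
    by (intro Bochner_Integration.integral_cong refl)
       (simp add: factorial_sum_singleton[OF finite_\<eta>_bounded[OF _ W]] linear_stat_def)
  have B0: "?B {0} ?f = c"
  proof -
    have "{S. (0::nat) \<in> S \<and> S \<subseteq> {0}} = {{0}}" by auto
    then show ?thesis
      using factorial_expectation_recursion[of "{0}" 0 W ?f] A0
      by (simp add: factorial_expectation_def[of W "{}"] prob_space)
  qed
  \<comment> \<open>One unfolding at the empty index set yields no coincidence terms: only the index
    set \<open>{0}\<close> and the centring \<open>c * mu n\<close> appear.\<close>
  have "mu (Suc n) = centred ?A ?m {} ?f (0 # ?ts)"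
    using mu[of "0 # ?ts"] by (simp del: upt_Suc centred.simps)
  also have "\<dots> = centred ?A ?m {0} ?f ?ts - c * mu n"
    using mu[of ?ts] by (simp del: upt_Suc)
  also have "centred ?A ?m {0} ?f ?ts = (\<Sum>S | 0 \<in> S \<and> S \<subseteq> {0}. \<Sum>U\<in>Pow (set ?ts).
       clus ?B S ?f (filter (\<lambda>t. t \<in> U) ?ts) * centred ?A ?m ({0} - S) ?f (filter (\<lambda>t. t \<notin> U) ?ts))"
    by (rule centred_clus)
       (auto intro: factorial_expectation_cong factorial_cumulant_functional_cong factorial_expectation_recursion)
  also have "{S. (0::nat) \<in> S \<and> S \<subseteq> {0}} = {{0}}" by auto
  also have "(\<Sum>S\<in>{{0::nat}}. \<Sum>U\<in>Pow (set ?ts).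
       clus ?B S ?f (filter (\<lambda>t. t \<in> U) ?ts) * centred ?A ?m ({0} - S) ?f (filter (\<lambda>t. t \<notin> U) ?ts))
     = (\<Sum>U\<in>Pow {1..<Suc n}. clus ?B {0} ?f (filter (\<lambda>t. t \<in> U) ?ts) * mu (n - card U))"
  proof -
    have "length (filter (\<lambda>t. t \<notin> U) ?ts) = n - card U" if "U \<in> Pow {1..<Suc n}" for U
    proof -
      have "length (filter (\<lambda>t. t \<notin> U) ?ts) = card (set (filter (\<lambda>t. t \<notin> U) ?ts))"
        by (rule distinct_card[symmetric]) simp
      also have "set (filter (\<lambda>t. t \<notin> U) ?ts) = {1..<Suc n} - U" by auto
      finally show ?thesis using that by (simp add: card_Diff_subset finite_subset[of U "{1..<Suc n}"])
    qed
    then show ?thesis by (simp add: mu del: upt_Suc)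
  qed
  \<comment> \<open>For empty \<open>U\<close> the \<open>clus\<close> term is the mean
    \<open>c\<close>, and \<open>c * mu n\<close> cancels against the centring. Hence the recursion
    runs over nonempty \<open>U\<close> and involves no first-order cumulant.\<close>
  also have "Pow {1..<Suc n} = insert {} (Pow {1..<Suc n} - {{}})" by auto
  also have "(\<Sum>U\<in>insert {} (Pow {1..<Suc n} - {{}}). clus ?B {0} ?f (filter (\<lambda>t. t \<in> U) ?ts) * mu (n - card U))
     = c * mu n + (\<Sum>U\<in>Pow {1..<Suc n} - {{}}. clus ?B {0} ?f (filter (\<lambda>t. t \<in> U) ?ts) * mu (n - card U))"
    by (subst sum.insert) (auto simp: B0)
  finally show ?thesis by simp
qed

end

end

section \<open>Factorial cumulants of step functions\<close>

text \<open>Linear combinations form a closure rule, so that multilinear identities can be proved by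
  rule induction from indicators.\<close>

inductive_set step_functions :: "'a::euclidean_space set \<Rightarrow> ('a \<Rightarrow> real) set" for W where
  indicator: "B \<in> sets borel \<Longrightarrow> B \<subseteq> W \<Longrightarrow> indicator B \<in> step_functions W"
| combination: "f \<in> step_functions W \<Longrightarrow> g \<in> step_functions W \<Longrightarrow> (\<lambda>x. c * f x + d * g x) \<in> step_functions W"

lemma step_functions_measurable: "f \<in> step_functions W \<Longrightarrow> f \<in> borel_measurable borel"
  by (induction rule: step_functions.induct) auto

lemma step_functions_bounded: "f \<in> step_functions W \<Longrightarrow> \<exists>K. \<forall>x. \<bar>f x\<bar> \<le> K"
proof (induction rule: step_functions.induct)
  case (indicator B)
  then show ?case by (intro exI[of _ 1]) (auto simp: indicator_def)
next
  case (combination f g c d)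
  then obtain K L where KL: "\<And>x. \<bar>f x\<bar> \<le> K" "\<And>x. \<bar>g x\<bar> \<le> L" by auto
  have "\<bar>c * f x + d * g x\<bar> \<le> \<bar>c\<bar> * K + \<bar>d\<bar> * L" for x
    by (intro order_trans[OF abs_triangle_ineq]) (auto simp: abs_mult intro!: add_mono mult_left_mono KL)
  then show ?case by blast
qed

lemma step_functions_support: "f \<in> step_functions W \<Longrightarrow> x \<notin> W \<Longrightarrow> f x = 0"
  by (induction rule: step_functions.induct) (auto simp: indicator_def)

lemma step_functions_integrable:
  assumes "f \<in> step_functions W" "bounded W" "W \<in> sets borel"
  shows "integrable lborel f"
proof -
  obtain K where K: "\<And>x. \<bar>f x\<bar> \<le> K" using step_functions_bounded[OF assms(1)] by auto
  have "emeasure lborel W < \<infinity>" by (rule emeasure_bounded_finite[OF assms(2)])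
  then have "integrable lborel (\<lambda>x. K * indicator W x)" using assms(3) by simp
  then show ?thesis
  proof (rule Bochner_Integration.integrable_bound)
    show "AE x in lborel. norm (f x) \<le> norm (K * indicator W x)"
      using K step_functions_support[OF assms(1)] by (intro AE_I2) (auto simp: indicator_def intro: order_trans[OF _ abs_ge_self])
  qed (use step_functions_measurable[OF assms(1)] in simp)
qed

text \<open>Coinciding points multiply test functions, so this closure is what keeps
  \<open>clus\<close> within step functions.\<close>

lemma step_functions_mult:
  assumes "f \<in> step_functions W" "g \<in> step_functions W"
  shows "(\<lambda>x. f x * g x) \<in> step_functions W"
  using assms(1)
proof (induction rule: step_functions.induct)
  case (indicator B)
  show ?case using assms(2)
  proof (induction rule: step_functions.induct)
    case (indicator C)
    have "(\<lambda>x. indicator B x * indicator C x) = (indicator (B \<inter> C) :: 'a \<Rightarrow> real)"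
      by (auto simp: indicator_def)
    then show ?case using step_functions.indicator[of "B \<inter> C" W] indicator \<open>B \<in> sets borel\<close> by auto
  next
    case (combination f g c d)
    from step_functions.combination[OF combination.IH, of c d] show ?case by (simp add: algebra_simps)
  qed
next
  case (combination f f' c d)
  from step_functions.combination[OF combination.IH, of c d] show ?case by (simp add: algebra_simps)
qed

lemma factorial_sum_linear:
  assumes "finite J" "k \<in> J"
  shows "factorial_sum D J (f(k := \<lambda>x. c * g x + d * g' x))
    = c * factorial_sum D J (f(k := g)) + d * factorial_sum D J (f(k := g'))"
proof -
  have p: "(\<Prod>i\<in>J. (f(k := g)) i (x i)) = g (x k) * (\<Prod>i\<in>J - {k}. f i (x i))" for x g
    by (subst prod.remove[OF assms]) (auto intro!: arg_cong2[where f="(*)"] prod.cong)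
  show ?thesis
    unfolding factorial_sum_def p
    by (simp add: sum_distrib_left sum.distrib[symmetric] algebra_simps)
qed

lemma card_partition_le:
  assumes "partition_on S \<pi>" "finite S"
  shows "card \<pi> \<le> card S"
proof -
  have f: "finite \<pi>" by (rule finite_elements[OF assms(2,1)])
  have fb: "finite b" if "b \<in> \<pi>" for b
    using partition_onD1[OF assms(1)] that assms(2) by (auto intro: finite_subset)
  have "card \<pi> = (\<Sum>b\<in>\<pi>. 1)" by simp
  also have "\<dots> \<le> (\<Sum>b\<in>\<pi>. card b)"
  proof (rule sum_mono)
    fix b assume b: "b \<in> \<pi>"
    then have "b \<noteq> {}" using partition_onD3[OF assms(1)] by auto
    then show "1 \<le> card b" using fb[OF b] by (simp add: Suc_le_eq card_gt_0_iff)
  qed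
  also have "\<dots> = card (\<Union>\<pi>)"
    by (rule card_Union_disjoint[symmetric]) (use partition_onD2[OF assms(1)] fb in \<open>auto simp: disjoint_def pairwise_def disjnt_def\<close>)
  finally show ?thesis using partition_onD1[OF assms(1)] by simp
qed

text \<open>Brings the defining formula of the factorial cumulant measure, grouped by number of
  blocks, into the form of \<open>joint_cumulant\<close>. For \<open>m \<ge> 1\<close> the number of
  blocks lies between 1 and \<open>m\<close>.\<close>

lemma joint_cumulant_by_card:
  assumes "m \<ge> 1"
  shows "(\<Sum>j = 1..m. (- 1) ^ (j - 1) * fact (j - 1) *
             (\<Sum>\<pi> | partition_on {..<m} \<pi> \<and> card \<pi> = j. \<Prod>I\<in>\<pi>. a I)) = joint_cumulant {..<m} a"
proof -
  let ?h = "\<lambda>\<pi>. (- 1) ^ (card \<pi> - 1) * fact (card \<pi> - 1) * (\<Prod>I\<in>\<pi>. a I)"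
  have c: "card \<pi> \<in> {1..m}" if p: "partition_on {..<m} \<pi>" for \<pi>
  proof -
    have "finite \<pi>" by (rule finite_elements[OF _ p]) simp
    moreover have "\<pi> \<noteq> {}" using partition_onD1[OF p] assms by (auto simp: lessThan_empty_iff)
    ultimately have "card \<pi> > 0" by (simp add: card_gt_0_iff)
    then show ?thesis using card_partition_le[OF p] by simp
  qed
  have "(\<Sum>j = 1..m. (- 1) ^ (j - 1) * fact (j - 1) *
             (\<Sum>\<pi> | partition_on {..<m} \<pi> \<and> card \<pi> = j. \<Prod>I\<in>\<pi>. a I))
      = (\<Sum>j = 1..m. sum ?h {\<pi> \<in> {\<pi>. partition_on {..<m} \<pi>}. card \<pi> = j})"
    by (auto simp: sum_distrib_left intro!: sum.cong)
  also have "\<dots> = sum ?h {\<pi>. partition_on {..<m} \<pi>}"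
    by (rule sum.group) (use c finitely_many_partition_on[of "{..<m}"] in auto)
  finally show ?thesis by (simp add: joint_cumulant_def)
qed

section \<open>Integrals against reduced cumulant measures\<close>

definition shifted :: "'a::euclidean_space \<Rightarrow> (nat \<Rightarrow> 'a) \<Rightarrow> nat \<Rightarrow> 'a" where
  "shifted x y i = (if i = 0 then x else y i + x)"

definition reduced_integral :: "nat \<Rightarrow> (nat \<Rightarrow> 'a::euclidean_space) signed_measure \<Rightarrow> (nat \<Rightarrow> 'a \<Rightarrow> real) \<Rightarrow> real" where
  "reduced_integral m \<nu> f = (\<integral>x. sintegral \<nu> (\<lambda>y. \<Prod>i<m. f i (shifted x y i)) \<partial>lborel)"

lemma shifted_measurable:
  assumes "i < m"
  shows "(\<lambda>(x, y). shifted x y i) \<in> borel_measurable (borel \<Otimes>\<^sub>M Pi\<^sub>M {1..<m} (\<lambda>_. borel :: 'a::euclidean_space measure))"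
proof (cases "i = 0")
  case False
  then have i: "i \<in> {1..<m}" using assms by auto
  have "(\<lambda>p. snd p i + fst p) \<in> borel_measurable (borel \<Otimes>\<^sub>M Pi\<^sub>M {1..<m} (\<lambda>_. borel :: 'a measure))"
    using i by measurable
  then show ?thesis using False by (simp add: shifted_def split_beta')
qed (simp add: shifted_def split_beta')

lemma prod_abs_le:
  fixes g :: "nat \<Rightarrow> real"
  assumes "m \<ge> 1" "\<And>i. 0 < i \<Longrightarrow> i < m \<Longrightarrow> \<bar>g i\<bar> \<le> K"
  shows "\<bar>\<Prod>i<m. g i\<bar> \<le> \<bar>g 0\<bar> * K ^ (m - 1)"
proof -
  have e: "{..<m} = insert 0 {1..<m}" using assms(1) by auto
  have "\<bar>\<Prod>i<m. g i\<bar> = \<bar>g 0\<bar> * (\<Prod>i\<in>{1..<m}. \<bar>g i\<bar>)"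
    unfolding e by (subst prod.insert) (auto simp: abs_mult abs_prod)
  also have "(\<Prod>i\<in>{1..<m}. \<bar>g i\<bar>) \<le> (\<Prod>i\<in>{1..<m}. K)"
    by (rule prod_mono) (use assms(2) in auto)
  finally show ?thesis by (simp add: mult_left_mono)
qed

context
  fixes m :: nat and N :: "(nat \<Rightarrow> 'a::euclidean_space) measure" and f :: "nat \<Rightarrow> 'a \<Rightarrow> real" and K :: real
  assumes N: "finite_measure N" "sets N = sets (Pi\<^sub>M {1..<m} (\<lambda>_. borel))" and m: "m \<ge> 1"
    and f: "\<And>i. i < m \<Longrightarrow> f i \<in> borel_measurable borel" "integrable lborel (f 0)"
    and K: "\<And>i x. 0 < i \<Longrightarrow> i < m \<Longrightarrow> \<bar>f i x\<bar> \<le> K"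
begin

lemma shifted_prod_measurable:
  "(\<lambda>(x, y). \<Prod>i<m. f i (shifted x y i)) \<in> borel_measurable (lborel \<Otimes>\<^sub>M N)"
proof -
  have s: "sets (lborel \<Otimes>\<^sub>M N) = sets (borel \<Otimes>\<^sub>M Pi\<^sub>M {1..<m} (\<lambda>_. borel :: 'a measure))"
    by (rule sets_pair_measure_cong) (simp_all add: N)
  have "(\<lambda>p. f i (shifted (fst p) (snd p) i)) \<in> borel_measurable (lborel \<Otimes>\<^sub>M N)" if "i < m" for i
    using measurable_compose[OF shifted_measurable[OF that] f(1)[OF that]]
    by (simp add: measurable_cong_sets[OF s refl] split_beta')
  then show ?thesis unfolding split_beta' by (intro borel_measurable_prod) auto
qed

lemma shifted_prod_bound: "\<bar>\<Prod>i<m. f i (shifted x y i)\<bar> \<le> \<bar>f 0 x\<bar> * K ^ (m - 1)"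
  using prod_abs_le[OF m, of "\<lambda>i. f i (shifted x y i)" K] K by (simp add: shifted_def)

lemma shifted_prod_integrable_pair: "integrable (lborel \<Otimes>\<^sub>M N) (\<lambda>(x, y). \<Prod>i<m. f i (shifted x y i))"
proof -
  interpret N: finite_measure N by (rule N)
  interpret P: pair_sigma_finite lborel N ..
  have [measurable]: "f 0 \<in> borel_measurable borel" using f(1)[of 0] m by simp
  have "integrable (lborel \<Otimes>\<^sub>M N) (\<lambda>(x, y). \<bar>f 0 x\<bar> * K ^ (m - 1))"
    using f(2) by (intro P.Fubini_integrable) (auto simp: abs_mult)
  then show ?thesis
    by (rule Bochner_Integration.integrable_bound)
       (use shifted_prod_bound shifted_prod_measurable in \<open>auto intro!: AE_I2 order_trans[OF _ abs_ge_self]\<close>)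
qed

lemma shifted_prod_integrable: "integrable N (\<lambda>y. \<Prod>i<m. f i (shifted x y i))"
proof -
  interpret N: finite_measure N by (rule N)
  have "(\<lambda>y. (\<lambda>(x, y). \<Prod>i<m. f i (shifted x y i)) (x, y)) \<in> borel_measurable N"
    by (rule measurable_compose[OF measurable_Pair1' shifted_prod_measurable]) simp
  then have ms: "(\<lambda>y. \<Prod>i<m. f i (shifted x y i)) \<in> borel_measurable N" by (simp only: prod.case)
  have b: "norm (\<Prod>i<m. f i (shifted x y i)) \<le> \<bar>f 0 x\<bar> * K ^ (m - 1)" for y
    unfolding real_norm_def by (rule shifted_prod_bound)
  show ?thesis by (rule N.integrable_const_bound[OF _ ms], rule AE_I2, rule b)
qed

lemma shifted_prod_integrable_outer: "integrable lborel (\<lambda>x. \<integral>y. (\<Prod>i<m. f i (shifted x y i)) \<partial>N)"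
proof -
  interpret N: finite_measure N by (rule N)
  interpret P: pair_sigma_finite lborel N ..
  show ?thesis using P.integrable_fst[OF shifted_prod_integrable_pair] by simp
qed

text \<open>Only the factor at the base point is integrated over Lebesgue measure. The others are
  bounded by \<open>K\<close>, and integration over \<open>N\<close> costs its total mass. So the
  bound is linear in one \<open>L1\<close> norm, whatever \<open>m\<close> is.\<close>

lemma shifted_prod_integral_bound:
  "\<bar>\<integral>x. \<integral>y. (\<Prod>i<m. f i (shifted x y i)) \<partial>N \<partial>lborel\<bar> \<le> K ^ (m - 1) * measure N (space N) * (\<integral>x. \<bar>f 0 x\<bar> \<partial>lborel)"
proof -
  interpret N: finite_measure N by (rule N)
  have "\<bar>\<integral>x. \<integral>y. (\<Prod>i<m. f i (shifted x y i)) \<partial>N \<partial>lborel\<bar> \<le> (\<integral>x. \<bar>f 0 x\<bar> * (K ^ (m - 1) * measure N (space N)) \<partial>lborel)"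
  proof (rule abs_integral_le[OF shifted_prod_integrable_outer])
    show "integrable lborel (\<lambda>x. \<bar>f 0 x\<bar> * (K ^ (m - 1) * measure N (space N)))" using f(2) by simp
    fix x
    have "\<bar>\<integral>y. (\<Prod>i<m. f i (shifted x y i)) \<partial>N\<bar> \<le> (\<integral>y. \<bar>f 0 x\<bar> * K ^ (m - 1) \<partial>N)"
      by (rule abs_integral_le[OF shifted_prod_integrable]) (simp, rule shifted_prod_bound)
    then show "\<bar>\<integral>y. (\<Prod>i<m. f i (shifted x y i)) \<partial>N\<bar> \<le> \<bar>f 0 x\<bar> * (K ^ (m - 1) * measure N (space N))"
      by (simp add: mult_ac)
  qed
  then show ?thesis by (simp add: mult_ac)
qed

end

lemma emeasure_total_variation:
  assumes "sets (fst \<nu>) = sets (snd \<nu>)" "A \<in> sets (fst \<nu>)"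
  shows "emeasure (total_variation \<nu>) A = emeasure (fst \<nu>) A + emeasure (snd \<nu>) A"
  unfolding total_variation_def
proof (rule emeasure_measure_of_sigma)
  show "countably_additive (sets (fst \<nu>)) (\<lambda>A. emeasure (fst \<nu>) A + emeasure (snd \<nu>) A)"
  proof (rule countably_additiveI)
    fix F :: "nat \<Rightarrow> _" assume F: "range F \<subseteq> sets (fst \<nu>)" "disjoint_family F"
    show "(\<Sum>i. emeasure (fst \<nu>) (F i) + emeasure (snd \<nu>) (F i))
       = emeasure (fst \<nu>) (\<Union>i. F i) + emeasure (snd \<nu>) (\<Union>i. F i)"
      using F assms by (subst suminf_add[symmetric]) (auto simp: suminf_emeasure)
  qed
  show "sigma_algebra (space (fst \<nu>)) (sets (fst \<nu>))" by (rule sets.sigma_algebra_axioms)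
qed (use assms in \<open>auto simp: positive_def\<close>)

text \<open>Brillinger mixing: stationarity, moments of all orders in bounded sets, and finite total
  variation of all reduced factorial cumulant measures.\<close>

locale brillinger_process = stationary_process M \<eta> \<gamma>
  for M :: "'w measure" and \<eta> :: "'w \<Rightarrow> 'a::euclidean_space set" and \<gamma> :: real +
  fixes \<nu> :: "nat \<Rightarrow> (nat \<Rightarrow> 'a) signed_measure"
  assumes reduced: "\<And>m. 2 \<le> m \<Longrightarrow> reduced_factorial_cumulant M \<eta> m (\<nu> m)"
    and finite_variation: "\<And>m. 2 \<le> m \<Longrightarrow> emeasure (total_variation (\<nu> m)) (space (total_variation (\<nu> m))) < \<infinity>"
begin

lemma \<nu>_parts:
  assumes "2 \<le> m"
  shows "sets (fst (\<nu> m)) = sets (Pi\<^sub>M {1..<m} (\<lambda>_. borel))" "sets (snd (\<nu> m)) = sets (Pi\<^sub>M {1..<m} (\<lambda>_. borel))"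
    "finite_measure (fst (\<nu> m))" "finite_measure (snd (\<nu> m))"
proof -
  show s: "sets (fst (\<nu> m)) = sets (Pi\<^sub>M {1..<m} (\<lambda>_. borel))" "sets (snd (\<nu> m)) = sets (Pi\<^sub>M {1..<m} (\<lambda>_. borel))"
    using reduced[OF assms] by (auto simp: reduced_factorial_cumulant_def locally_finite_signed_def)
  have sp: "space (total_variation (\<nu> m)) = space (fst (\<nu> m))" "space (snd (\<nu> m)) = space (fst (\<nu> m))"
    using sets_eq_imp_space_eq[OF s(1)] sets_eq_imp_space_eq[OF s(2)]
    by (simp_all add: total_variation_def space_measure_of_conv)
  have "emeasure (fst (\<nu> m)) (space (fst (\<nu> m))) + emeasure (snd (\<nu> m)) (space (snd (\<nu> m))) < \<infinity>"
    using finite_variation[OF assms] emeasure_total_variation[of "\<nu> m" "space (fst (\<nu> m))", OF _ sets.top] s sp by simp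
  then show "finite_measure (fst (\<nu> m))" "finite_measure (snd (\<nu> m))"
    by (auto intro!: finite_measureI simp: ennreal_add_eq_top less_top)
qed

text \<open>The case \<open>m = 1\<close> stands for the first factorial cumulant measure, which is
  \<open>\<gamma>\<close> times Lebesgue measure by Campbell's formula. With it the cumulant bound
  takes one form for all orders.\<close>

definition cumulant_mass :: "nat \<Rightarrow> real" where
  "cumulant_mass m = (if m = 1 then \<gamma> else measure (fst (\<nu> m)) (space (fst (\<nu> m))) + measure (snd (\<nu> m)) (space (snd (\<nu> m))))"

context
  fixes W :: "'a set"
  assumes W: "bounded W" and W_borel [measurable]: "W \<in> sets borel"
begin

lemma factorial_moment_indicator:
  assumes I: "finite I" and B: "\<And>i. i \<in> I \<Longrightarrow> B i \<in> sets borel \<and> B i \<subseteq> W"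
  shows "enn2real (factorial_moment M \<eta> I (Pi\<^sub>E I B)) = factorial_expectation W I (\<lambda>i. indicator (B i))"
proof -
  let ?f = "\<lambda>i. if i \<in> I then indicator (B i) else (\<lambda>_. 0) :: 'a \<Rightarrow> real"
  have bf: "bounded_family ?f"
  proof -
    have "?f i \<in> borel_measurable borel" for i using B[of i] by (cases "i \<in> I") (auto intro: borel_measurable_indicator)
    moreover have "\<bar>?f i x\<bar> \<le> 1" for i x by (simp add: indicator_def)
    ultimately show ?thesis unfolding bounded_family_def by blast
  qed
  have inner: "(\<integral>\<^sup>+ x. indicator (Pi\<^sub>E I B) x \<partial>count_space {x \<in> I \<rightarrow>\<^sub>E \<eta> \<omega>. inj_on x I})
     = ennreal (factorial_sum (\<eta> \<omega> \<inter> W) I ?f)" if \<omega>: "\<omega> \<in> space M" for \<omega>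
  proof -
    let ?A = "{x. x \<in> I \<rightarrow>\<^sub>E \<eta> \<omega> \<inter> W \<and> inj_on x I}"
    have "(\<integral>\<^sup>+ x. indicator (Pi\<^sub>E I B) x \<partial>count_space {x \<in> I \<rightarrow>\<^sub>E \<eta> \<omega>. inj_on x I}) = (\<Sum>x\<in>?A. indicator (Pi\<^sub>E I B) x)"
    proof (rule nn_integral_count_space')
      show "finite ?A" by (rule finite_injections[OF I finite_\<eta>_bounded[OF \<omega> W]])
      fix x assume x: "x \<in> {x \<in> I \<rightarrow>\<^sub>E \<eta> \<omega>. inj_on x I}" "x \<notin> ?A"
      then obtain i where "i \<in> I" "x i \<notin> W" by (auto simp: PiE_def Pi_def)
      then have "x \<notin> Pi\<^sub>E I B" using B[of i] by (auto simp: PiE_def Pi_def)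
      then show "indicator (Pi\<^sub>E I B) x = (0::ennreal)" by simp
    qed (auto simp: PiE_def Pi_def)
    also have "\<dots> = (\<Sum>x\<in>?A. ennreal (\<Prod>i\<in>I. ?f i (x i)))"
    proof (rule sum.cong[OF refl])
      fix x assume x: "x \<in> ?A"
      show "indicator (Pi\<^sub>E I B) x = ennreal (\<Prod>i\<in>I. ?f i (x i))"
      proof (cases "x \<in> Pi\<^sub>E I B")
        case True
        then have "(\<Prod>i\<in>I. ?f i (x i)) = 1" by (intro prod.neutral) (auto simp: PiE_def Pi_def)
        then show ?thesis using True by simp
      next
        case False
        then obtain i where "i \<in> I" "x i \<notin> B i" using x by (auto simp: PiE_def Pi_def)
        then have "(\<Prod>i\<in>I. ?f i (x i)) = 0" using I by (intro prod_zero) (auto intro!: bexI[of _ i])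
        then show ?thesis using False by simp
      qed
    qed
    also have "\<dots> = ennreal (factorial_sum (\<eta> \<omega> \<inter> W) I ?f)"
      unfolding factorial_sum_def by (rule sum_ennreal) (auto intro!: prod_nonneg)
    finally show ?thesis .
  qed
  have nn: "0 \<le> factorial_sum D I ?f" for D
    unfolding factorial_sum_def by (intro sum_nonneg prod_nonneg) auto
  have int: "integrable M (\<lambda>\<omega>. factorial_sum (\<eta> \<omega> \<inter> W) I ?f)"
    using integrable_factorial_sum_prod[OF W W_borel I bf, where ts="[]"] by simp
  have "factorial_moment M \<eta> I (Pi\<^sub>E I B) = (\<integral>\<^sup>+\<omega>. ennreal (factorial_sum (\<eta> \<omega> \<inter> W) I ?f) \<partial>M)"
    unfolding factorial_moment_def by (intro nn_integral_cong inner)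
  also have "\<dots> = ennreal (\<integral>\<omega>. factorial_sum (\<eta> \<omega> \<inter> W) I ?f \<partial>M)"
    using nn by (intro nn_integral_eq_integral int) auto
  finally have "enn2real (factorial_moment M \<eta> I (Pi\<^sub>E I B)) = factorial_expectation W I ?f"
    by (simp add: factorial_expectation_def Bochner_Integration.integral_nonneg[OF nn])
  also have "\<dots> = factorial_expectation W I (\<lambda>i. indicator (B i))"
    by (rule factorial_expectation_cong) auto
  finally show ?thesis .
qed

text \<open>The identities that define the cumulant measure and its reduced version are combined on
  a rectangle with bounded sides. Restricting the process to \<open>W\<close> changes nothing, since
  all sides lie in \<open>W\<close>.\<close>

lemma factorial_cumulant_functional_indicator:
  assumes m: "2 \<le> m" and B: "\<And>i. i < m \<Longrightarrow> B i \<in> sets borel \<and> B i \<subseteq> W"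
  shows "factorial_cumulant_functional W {..<m} (\<lambda>i. indicator (B i)) = reduced_integral m (\<nu> m) (\<lambda>i. indicator (B i))"
proof -
  obtain \<beta> where \<beta>: "factorial_cumulant M \<eta> m \<beta>"
    and r: "\<And>C. bounded_borel {..<m} C \<Longrightarrow> smeasure \<beta> C =
       (\<integral>x. sintegral (\<nu> m) (\<lambda>y. indicator C (\<lambda>i\<in>{..<m}. if i = 0 then x else y i + x) :: real) \<partial>lborel)"
    using reduced[OF m] by (auto simp: reduced_factorial_cumulant_def)
  let ?C = "Pi\<^sub>E {..<m} B"
  obtain R where R: "\<And>x. x \<in> W \<Longrightarrow> norm x \<le> R" using W by (auto simp: bounded_iff)
  have "?C \<in> sets (Pi\<^sub>M {..<m} (\<lambda>_. borel))" by (rule sets_PiM_I_finite) (use B in auto)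
  moreover have "\<forall>x\<in>?C. \<forall>i\<in>{..<m}. norm (x i) \<le> R"
    using B R by (auto simp: PiE_def Pi_def)
  ultimately have bb: "bounded_borel {..<m} ?C" by (auto simp: bounded_borel_def)
  have bB: "\<forall>i<m. B i \<in> sets borel \<and> bounded (B i)" using B W bounded_subset by blast
  have "smeasure \<beta> ?C = (\<Sum>j = 1..m. (- 1) ^ (j - 1) * fact (j - 1) *
             (\<Sum>\<pi> | partition_on {..<m} \<pi> \<and> card \<pi> = j.
                \<Prod>I\<in>\<pi>. enn2real (factorial_moment M \<eta> I (Pi\<^sub>E I B))))"
    using \<beta> bB unfolding factorial_cumulant_def by blast
  also have "\<dots> = joint_cumulant {..<m} (\<lambda>I. enn2real (factorial_moment M \<eta> I (Pi\<^sub>E I B)))"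
    by (rule joint_cumulant_by_card) (use m in simp)
  also have "\<dots> = factorial_cumulant_functional W {..<m} (\<lambda>i. indicator (B i))"
    unfolding factorial_cumulant_functional_def
  proof (rule joint_cumulant_cong)
    fix I assume I: "I \<subseteq> {..<m}"
    show "enn2real (factorial_moment M \<eta> I (Pi\<^sub>E I B)) = factorial_expectation W I (\<lambda>i. indicator (B i))"
      by (rule factorial_moment_indicator) (use I B finite_subset[OF I] in auto)
  qed
  finally have 1: "smeasure \<beta> ?C = factorial_cumulant_functional W {..<m} (\<lambda>i. indicator (B i))" .
  have "indicator ?C (\<lambda>i\<in>{..<m}. if i = 0 then x else y i + x) = (\<Prod>i<m. indicator (B i) (shifted x y i) :: real)" for x y
  proof (cases "\<forall>i<m. shifted x y i \<in> B i")
    case True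
    then have "(\<lambda>i\<in>{..<m}. if i = 0 then x else y i + x) \<in> ?C" by (auto simp: shifted_def)
    moreover have "(\<Prod>i<m. indicator (B i) (shifted x y i) :: real) = 1" using True by (intro prod.neutral) auto
    ultimately show ?thesis by simp
  next
    case False
    then obtain i where i: "i < m" "shifted x y i \<notin> B i" by auto
    have "(\<lambda>i\<in>{..<m}. if i = 0 then x else y i + x) \<notin> ?C"
    proof
      assume "(\<lambda>i\<in>{..<m}. if i = 0 then x else y i + x) \<in> ?C"
      from PiE_mem[OF this, of i] show False using i by (simp add: shifted_def split: if_splits)
    qed
    moreover have "(\<Prod>i<m. indicator (B i) (shifted x y i) :: real) = 0" using i by (intro prod_zero) (auto intro!: bexI[of _ i])
    ultimately show ?thesis by simp
  qed
  then show ?thesis using 1 r[OF bb] by (simp add: reduced_integral_def)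
qed

lemma factorial_expectation_linear:
  assumes "finite J" "k \<in> J" "bounded_family (f(k := g))" "bounded_family (f(k := g'))"
  shows "factorial_expectation W J (f(k := \<lambda>x. c * g x + d * g' x))
     = c * factorial_expectation W J (f(k := g)) + d * factorial_expectation W J (f(k := g'))"
proof -
  have i: "integrable M (\<lambda>\<omega>. factorial_sum (\<eta> \<omega> \<inter> W) J f)" if "bounded_family f" for f
    using integrable_factorial_sum_prod[OF W W_borel assms(1) that, where ts="[]"] by simp
  show ?thesis
    unfolding factorial_expectation_def factorial_sum_linear[OF assms(1,2)]
    using i[OF assms(3)] i[OF assms(4)] by simp
qed

lemma step_family_bounded:
  assumes "\<And>i. i < m \<Longrightarrow> f i \<in> step_functions W"
  shows "bounded_family (\<lambda>i. if i < (m::nat) then f i else (\<lambda>_. 0))"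
proof -
  have "\<exists>K. \<forall>x. \<bar>f i x\<bar> \<le> K" if "i < m" for i by (rule step_functions_bounded[OF assms[OF that]])
  then obtain K where K: "\<And>i x. i < m \<Longrightarrow> \<bar>f i x\<bar> \<le> K i" by metis
  have "\<bar>(if i < m then f i else (\<lambda>_. 0)) x\<bar> \<le> (\<Sum>i<m. \<bar>K i\<bar>)" for i x
  proof (cases "i < m")
    case True
    have "\<bar>K i\<bar> \<le> (\<Sum>i<m. \<bar>K i\<bar>)" by (rule member_le_sum) (use True in auto)
    then show ?thesis using K[OF True, of x] True by auto
  qed (auto intro: sum_nonneg)
  moreover have "(if i < m then f i else (\<lambda>_. 0)) \<in> borel_measurable borel" for i
    using step_functions_measurable[OF assms] by auto
  ultimately show ?thesis unfolding bounded_family_def by blast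
qed

lemma reduced_integral_linear:
  assumes m: "2 \<le> m" and k: "k < m"
    and f: "\<And>i. i < m \<Longrightarrow> i \<noteq> k \<Longrightarrow> f i \<in> step_functions W" and g: "g \<in> step_functions W" "g' \<in> step_functions W"
  shows "reduced_integral m (\<nu> m) (f(k := \<lambda>x. c * g x + d * g' x))
     = c * reduced_integral m (\<nu> m) (f(k := g)) + d * reduced_integral m (\<nu> m) (f(k := g'))"
proof -
  have p: "(\<Prod>i<m. (f(k := g)) i (z i)) = g (z k) * (\<Prod>i\<in>{..<m} - {k}. f i (z i))" for z g
    by (subst prod.remove[of _ k]) (use k in \<open>auto intro!: arg_cong2[where f="(*)"] prod.cong\<close>)
  have lin: "(\<Prod>i<m. (f(k := \<lambda>x. c * g x + d * g' x)) i (z i))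
     = c * (\<Prod>i<m. (f(k := g)) i (z i)) + d * (\<Prod>i<m. (f(k := g')) i (z i))" for z
    unfolding p by (simp add: algebra_simps)
  \<comment> \<open>Both parts of the Jordan decomposition are finite, so the inner and outer
    integrals all exist and linearity applies to each of them.\<close>
  have fin: "integrable N (\<lambda>y. \<Prod>i<m. f i (shifted x y i))"
     "integrable lborel (\<lambda>x. \<integral>y. (\<Prod>i<m. f i (shifted x y i)) \<partial>N)"
    if N: "finite_measure N" "sets N = sets (Pi\<^sub>M {1..<m} (\<lambda>_. borel))"
      and f: "\<And>i. i < m \<Longrightarrow> f i \<in> step_functions W" for N f x
  proof -
    obtain K where K: "\<And>i x. \<bar>(if i < m then f i else (\<lambda>_. 0)) x\<bar> \<le> K"
      using step_family_bounded[of m f] f by (auto simp: bounded_family_def)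
    have K': "\<bar>f i x\<bar> \<le> K" if "0 < i" "i < m" for i x using K[of i x] that by simp
    have f0: "integrable lborel (f 0)" using m by (intro step_functions_integrable[OF f W W_borel]) auto
    have m1: "1 \<le> m" using m by simp
    show "integrable N (\<lambda>y. \<Prod>i<m. f i (shifted x y i))"
      by (rule shifted_prod_integrable[where f=f and K=K, OF N m1 step_functions_measurable[OF f] f0 K'])
    show "integrable lborel (\<lambda>x. \<integral>y. (\<Prod>i<m. f i (shifted x y i)) \<partial>N)"
      by (rule shifted_prod_integrable_outer[where f=f and K=K, OF N m1 step_functions_measurable[OF f] f0 K'])
  qed
  have s: "(f(k := g)) i \<in> step_functions W" "(f(k := g')) i \<in> step_functions W" if "i < m" for i
    using f g that by auto
  note parts = \<nu>_parts[OF m]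
  note I = fin[OF parts(3,1) s(1)] fin[OF parts(4,2) s(1)] fin[OF parts(3,1) s(2)] fin[OF parts(4,2) s(2)]
  show ?thesis
    unfolding reduced_integral_def sintegral_def lin
    by (simp add: I del: fun_upd_apply) (simp add: algebra_simps)
qed

text \<open>
  Both sides are multilinear in \<open>f\<close> and agree for indicators; the indicators are replaced by step
  functions one coordinate at a time.
\<close>

lemma factorial_cumulant_functional_step:
  assumes m: "2 \<le> m" and f: "\<And>i. i < m \<Longrightarrow> f i \<in> step_functions W"
  shows "factorial_cumulant_functional W {..<m} f = reduced_integral m (\<nu> m) f"
proof -
  have "factorial_cumulant_functional W {..<m} f = reduced_integral m (\<nu> m) f"
    if "j \<le> m" "\<And>i. i < j \<Longrightarrow> f i \<in> step_functions W"
      "\<And>i. j \<le> i \<Longrightarrow> i < m \<Longrightarrow> \<exists>B. B \<in> sets borel \<and> B \<subseteq> W \<and> f i = indicator B" for j f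
    using that
  proof (induction j arbitrary: f)
    case 0
    then have "\<forall>i. \<exists>B. i < m \<longrightarrow> B \<in> sets borel \<and> B \<subseteq> W \<and> f i = indicator B" by auto
    then obtain B where B: "\<And>i. i < m \<Longrightarrow> B i \<in> sets borel \<and> B i \<subseteq> W \<and> f i = indicator (B i)" by metis
    have "factorial_cumulant_functional W {..<m} f = factorial_cumulant_functional W {..<m} (\<lambda>i. indicator (B i))"
      by (rule factorial_cumulant_functional_cong) (use B in auto)
    also have "\<dots> = reduced_integral m (\<nu> m) (\<lambda>i. indicator (B i))"
      by (rule factorial_cumulant_functional_indicator[OF m]) (use B in auto)
    also have "\<dots> = reduced_integral m (\<nu> m) f"
    proof -
      have "(\<Prod>i<m. f i (z i)) = (\<Prod>i<m. indicator (B i) (z i))" for z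
        by (rule prod.cong) (use B in auto)
      then show ?thesis by (simp add: reduced_integral_def)
    qed
    finally show ?case .
  next
    case (Suc j)
    have j: "j < m" using Suc.prems by simp
    have sf: "f i \<in> step_functions W" if i: "i < m" "i \<noteq> j" for i
    proof (cases "i < j")
      case False
      then obtain B where "B \<in> sets borel" "B \<subseteq> W" "f i = indicator B" using Suc.prems(3)[of i] i False by force
      then show ?thesis by (simp add: step_functions.indicator)
    qed (use Suc.prems(2) in simp)
    have "factorial_cumulant_functional W {..<m} (f(j := g)) = reduced_integral m (\<nu> m) (f(j := g))"
      if "g \<in> step_functions W" for g
      using that
    proof (induction rule: step_functions.induct)
      case (indicator B)
      show ?case by (rule Suc.IH) (use Suc.prems indicator in auto)
    next
      case (combination g g' c d)
      have bf: "bounded_family (\<lambda>i. if i < m then (f(j := g)) i else (\<lambda>_. 0))" if "g \<in> step_functions W" for g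
        by (rule step_family_bounded) (use that sf in auto)
      let ?f = "\<lambda>i. if i < m then f i else (\<lambda>_. 0)"
      have e: "factorial_expectation W I (f(j := g)) = factorial_expectation W I (?f(j := g))" if "I \<subseteq> {..<m}" for I g
        by (rule factorial_expectation_cong) (use that in auto)
      have e2: "(\<lambda>i. if i < m then (f(j := g)) i else (\<lambda>_. 0)) = ?f(j := g)" for g
        using j by auto
      have "factorial_cumulant_functional W {..<m} (f(j := \<lambda>x. c * g x + d * g' x))
        = c * factorial_cumulant_functional W {..<m} (f(j := g)) + d * factorial_cumulant_functional W {..<m} (f(j := g'))"
        unfolding factorial_cumulant_functional_def
      proof (rule joint_cumulant_linear[where i=j])
        fix I assume I: "I \<subseteq> {..<m}" "j \<in> I"
        have "factorial_expectation W I (?f(j := \<lambda>x. c * g x + d * g' x))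
          = c * factorial_expectation W I (?f(j := g)) + d * factorial_expectation W I (?f(j := g'))"
          by (rule factorial_expectation_linear)
             (use I finite_subset[OF I(1)] bf[OF combination.hyps(1)] bf[OF combination.hyps(2)] in \<open>simp_all only: e2 finite_lessThan\<close>)
        then show "factorial_expectation W I (f(j := \<lambda>x. c * g x + d * g' x))
          = c * factorial_expectation W I (f(j := g)) + d * factorial_expectation W I (f(j := g'))"
          by (simp only: e[OF I(1)])
      next
        fix I assume I: "I \<subseteq> {..<m}" "j \<notin> I"
        have "factorial_expectation W I (f(j := g1)) = factorial_expectation W I (f(j := g2))" for g1 g2
          by (rule factorial_expectation_cong) (use I in auto)
        then show "factorial_expectation W I (f(j := \<lambda>x. c * g x + d * g' x)) = factorial_expectation W I (f(j := g)) \<and>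
          factorial_expectation W I (f(j := \<lambda>x. c * g x + d * g' x)) = factorial_expectation W I (f(j := g'))"
          by blast
      qed (use j in auto)
      moreover have "reduced_integral m (\<nu> m) (f(j := \<lambda>x. c * g x + d * g' x))
        = c * reduced_integral m (\<nu> m) (f(j := g)) + d * reduced_integral m (\<nu> m) (f(j := g'))"
        by (rule reduced_integral_linear[OF m j, where f=f and g=g and g'=g' and c=c and d=d])
           (fact sf combination.hyps)+
      ultimately show ?case using combination.IH by (simp only:)
    qed
    from this[of "f j"] show ?case using Suc.prems(2)[of j] by simp
  qed
  from this[of m f] f show ?thesis by auto
qed

lemma factorial_cumulant_functional_image:
  assumes "inj_on \<sigma> J"
  shows "factorial_cumulant_functional W (\<sigma> ` J) f = factorial_cumulant_functional W J (\<lambda>i. f (\<sigma> i))"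
  unfolding factorial_cumulant_functional_def joint_cumulant_image[OF assms]
  by (rule joint_cumulant_cong)
     (use assms in \<open>auto simp: factorial_expectation_def intro!: Bochner_Integration.integral_cong factorial_sum_image dest: inj_on_subset\<close>)

text \<open>With a single index the cumulant is the mean, and Campbell's formula gives its
  value.\<close>

lemma factorial_cumulant_functional_singleton:
  assumes "f t \<in> step_functions W"
  shows "factorial_cumulant_functional W {t} f = \<gamma> * (\<integral>x. f t x \<partial>lborel)"
proof -
  have "{S. t \<in> S \<and> S \<subseteq> {t}} = {{t}}" by auto
  then have "factorial_cumulant_functional W {t} f = factorial_expectation W {t} f"
    using factorial_expectation_recursion[of "{t}" t W f]
    by (simp add: factorial_expectation_def[of W "{}"] prob_space)
  also have "\<dots> = (\<integral>\<omega>. \<integral>x. f t x \<partial>count_space (\<eta> \<omega>) \<partial>M)"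
    unfolding factorial_expectation_def
  proof (rule Bochner_Integration.integral_cong[OF refl])
    fix \<omega> assume \<omega>: "\<omega> \<in> space M"
    have "(\<lambda>x. indicator W x * f t x) = f t"
      using step_functions_support[OF assms] by (fastforce simp: indicator_def)
    then show "factorial_sum (\<eta> \<omega> \<inter> W) {t} f = (\<integral>x. f t x \<partial>count_space (\<eta> \<omega>))"
      using linear_stat_eq_integral[OF W \<omega>, of "f t"] factorial_sum_singleton[OF finite_\<eta>_bounded[OF \<omega> W], of t f]
      by (simp add: linear_stat_def)
  qed
  also have "\<dots> = \<gamma> * (\<integral>x. f t x \<partial>lborel)"
    by (rule expectation_sum[OF step_functions_integrable[OF assms W W_borel]])
  finally show ?thesis .
qed

text \<open>Any index can serve as base point, because the functional is invariant under
  relabelling. So the \<open>L1\<close> norm of any chosen factor may be used, while the others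
  enter through their bound 1.\<close>

lemma factorial_cumulant_functional_bound:
  assumes J: "finite J" "i0 \<in> J" and f: "\<And>i. i \<in> J \<Longrightarrow> f i \<in> step_functions W" "\<And>i x. i \<in> J \<Longrightarrow> \<bar>f i x\<bar> \<le> 1"
  shows "\<bar>factorial_cumulant_functional W J f\<bar> \<le> cumulant_mass (card J) * (\<integral>x. \<bar>f i0 x\<bar> \<partial>lborel)"
proof (cases "card J = 1")
  case True
  then have "J = {i0}" using J by (auto simp: card_1_singleton_iff)
  then show ?thesis
    using factorial_cumulant_functional_singleton[of f i0, OF f(1)[OF J(2)]] \<gamma>_pos integral_abs_bound[of lborel "f i0"]
    by (simp add: cumulant_mass_def abs_mult)
next
  case False
  define m where "m = card J"
  have m: "2 \<le> m" using False J by (cases "card J") (auto simp: m_def Suc_le_eq)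
  obtain h where h: "bij_betw h {..<m} J"
    using ex_bij_betw_nat_finite[OF J(1)] by (auto simp: m_def lessThan_atLeast0)
  obtain j where j: "j < m" "h j = i0" using h J(2) by (force simp: bij_betw_def)
  \<comment> \<open>The transposition puts \<open>i0\<close> at position 0, the coordinate that
    carries the base point in \<open>reduced_integral\<close>.\<close>
  define \<sigma> where "\<sigma> = h \<circ> Transposition.transpose 0 j"
  have "bij_betw (Transposition.transpose 0 j) {..<m} {..<m}"
    using j m by (intro bij_betw_byWitness[where f'="Transposition.transpose 0 j"]) (auto simp: Transposition.transpose_def)
  then have \<sigma>: "bij_betw \<sigma> {..<m} J" unfolding \<sigma>_def by (rule bij_betw_trans[OF _ h])
  have \<sigma>0: "\<sigma> 0 = i0" by (simp add: \<sigma>_def j)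
  let ?g = "\<lambda>i. f (\<sigma> i)"
  have \<sigma>J: "\<sigma> i \<in> J" if "i < m" for i using \<sigma> that by (auto simp: bij_betw_def)
  have g: "?g i \<in> step_functions W" if "i < m" for i by (rule f(1)[OF \<sigma>J[OF that]])
  have e: "factorial_cumulant_functional W J f = reduced_integral m (\<nu> m) ?g"
    using factorial_cumulant_functional_image[of \<sigma> "{..<m}" f] \<sigma> factorial_cumulant_functional_step[OF m g]
    by (simp add: bij_betw_def)
  note parts = \<nu>_parts[OF m]
  have m1: "1 \<le> m" using m by simp
  have g1: "\<bar>?g i x\<bar> \<le> 1" if "0 < i" "i < m" for i x using f(2)[OF \<sigma>J[OF that(2)]] .
  have g0: "integrable lborel (?g 0)" using m by (intro step_functions_integrable[OF g W W_borel]) auto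
  note A1 = shifted_prod_integrable[where f="?g" and K=1, OF parts(3,1) m1 step_functions_measurable[OF g] g0 g1]
    and A2 = shifted_prod_integrable[where f="?g" and K=1, OF parts(4,2) m1 step_functions_measurable[OF g] g0 g1]
  note B1 = shifted_prod_integrable_outer[where f="?g" and K=1, OF parts(3,1) m1 step_functions_measurable[OF g] g0 g1]
    and B2 = shifted_prod_integrable_outer[where f="?g" and K=1, OF parts(4,2) m1 step_functions_measurable[OF g] g0 g1]
  note C1 = shifted_prod_integral_bound[where f="?g" and K=1, OF parts(3,1) m1 step_functions_measurable[OF g] g0 g1]
    and C2 = shifted_prod_integral_bound[where f="?g" and K=1, OF parts(4,2) m1 step_functions_measurable[OF g] g0 g1]
  have "reduced_integral m (\<nu> m) ?g = (\<integral>x. \<integral>y. (\<Prod>i<m. ?g i (shifted x y i)) \<partial>fst (\<nu> m) \<partial>lborel)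
     - (\<integral>x. \<integral>y. (\<Prod>i<m. ?g i (shifted x y i)) \<partial>snd (\<nu> m) \<partial>lborel)"
    unfolding reduced_integral_def sintegral_def by (rule Bochner_Integration.integral_diff[OF B1 B2])
  then have "\<bar>reduced_integral m (\<nu> m) ?g\<bar> \<le> measure (fst (\<nu> m)) (space (fst (\<nu> m))) * (\<integral>x. \<bar>f i0 x\<bar> \<partial>lborel)
     + measure (snd (\<nu> m)) (space (snd (\<nu> m))) * (\<integral>x. \<bar>f i0 x\<bar> \<partial>lborel)"
    using C1 C2 \<sigma>0 by simp
  then show ?thesis using e False m by (simp add: cumulant_mass_def m_def distrib_right)
qed

end

end

section \<open>Method of moments\<close>

text \<open>The moments of the centred normal law with variance \<open>s\<close>; for even
  \<open>k\<close> the quotient of factorials is the double factorial of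
  \<open>k - 1\<close>.\<close>

definition normal_moment :: "real \<Rightarrow> nat \<Rightarrow> real" where
  "normal_moment s k = (if even k then s ^ (k div 2) * fact k / (2 ^ (k div 2) * fact (k div 2)) else 0)"

text \<open>The integration-by-parts recursion of Gaussian moments, which the limit of the moment
  recursion will match. At \<open>k = 0\<close> the factor \<open>real k\<close> neutralises the
  truncated subtraction.\<close>

lemma normal_moment_Suc: "normal_moment s (Suc k) = real k * s * normal_moment s (k - 1)"
proof (cases "even (Suc k)")
  case True
  then obtain j where j: "k = Suc (2 * j)" by (auto elim!: evenE oddE)
  have "fact (Suc (Suc (2 * j))) = (real (Suc (2 * j)) * (2 * real (Suc j))) * fact (2 * j)"
    by (simp add: algebra_simps)
  moreover have "fact (Suc j) = real (Suc j) * fact j" by simp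
  ultimately show ?thesis using j
    by (simp add: normal_moment_def del: fact_Suc of_nat_Suc)
next
  case False
  then show ?thesis by (cases k) (auto simp: normal_moment_def)
qed

lemma normal_moment_0 [simp]: "normal_moment s 0 = 1"
  by (simp add: normal_moment_def)

text \<open>A list \<open>ts\<close> stands for a cumulant of order \<open>length ts + 1\<close>, so
  \<open>a2\<close> concerns the orders from 3 on. In the limit of \<open>rec\<close> only the
  \<open>k\<close> singletons \<open>U\<close> contribute, each with factor \<open>s\<close>, which
  is exactly \<open>normal_moment_Suc\<close>.\<close>

lemma moments_tendsto_normal:
  fixes a :: "nat \<Rightarrow> nat list \<Rightarrow> real" and mu :: "nat \<Rightarrow> nat \<Rightarrow> real"
  assumes mu0: "\<And>n. mu n 0 = 1"
    and rec: "\<And>n k. mu n (Suc k) = (\<Sum>U\<in>Pow {1..<Suc k} - {{}}. a n (filter (\<lambda>t. t \<in> U) [1..<Suc k]) * mu n (k - card U))"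
    and a1: "\<And>t. t > 0 \<Longrightarrow> (\<lambda>n. a n [t]) \<longlonglongrightarrow> s"
    and a2: "\<And>ts. length ts \<ge> 2 \<Longrightarrow> (\<lambda>n. a n ts) \<longlonglongrightarrow> 0"
  shows "(\<lambda>n. mu n k) \<longlonglongrightarrow> normal_moment s k"
proof (induction k rule: less_induct)
  case (less k)
  show ?case
  proof (cases k)
    case 0
    then show ?thesis by (simp add: mu0)
  next
    case (Suc j)
    let ?P = "Pow {1..<Suc j} - {{}} :: nat set set"
    have lim: "(\<lambda>n. a n (filter (\<lambda>t. t \<in> U) [1..<Suc j]) * mu n (j - card U))
       \<longlonglongrightarrow> (if card U = 1 then s * normal_moment s (j - 1) else 0)" if U: "U \<in> ?P" for U
    proof -
      have finU: "finite U" using U finite_subset[of U "{1..<Suc j}"] by auto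
      have "length (filter (\<lambda>t. t \<in> U) [1..<Suc j]) = card (set (filter (\<lambda>t. t \<in> U) [1..<Suc j]))"
        by (rule distinct_card[symmetric]) simp
      also have "set (filter (\<lambda>t. t \<in> U) [1..<Suc j]) = U" using U by auto
      finally have len: "length (filter (\<lambda>t. t \<in> U) [1..<Suc j]) = card U" .
      have ml: "(\<lambda>n. mu n (j - card U)) \<longlonglongrightarrow> normal_moment s (j - card U)"
        by (rule less.IH) (use Suc in auto)
      show ?thesis
      proof (cases "card U = 1")
        case True
        then obtain t where t: "filter (\<lambda>t. t \<in> U) [1..<Suc j] = [t]"
          using len by (metis One_nat_def length_0_conv length_Suc_conv)
        have "t \<in> set (filter (\<lambda>t. t \<in> U) [1..<Suc j])" unfolding t by simp
        then have "t > 0" by auto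
        from tendsto_mult[OF a1[OF this] ml] show ?thesis using True unfolding t by simp
      next
        case False
        have "card U \<noteq> 0" using finU U by auto
        then have "length (filter (\<lambda>t. t \<in> U) [1..<Suc j]) \<ge> 2" using False len by linarith
        from tendsto_mult[OF a2[OF this] ml] show ?thesis using False by simp
      qed
    qed
    have "(\<lambda>n. mu n k) \<longlonglongrightarrow> (\<Sum>U\<in>?P. if card U = 1 then s * normal_moment s (j - 1) else 0)"
      unfolding Suc rec by (rule tendsto_sum) (rule lim)
    also have "(\<Sum>U\<in>?P. if card U = 1 then s * normal_moment s (j - 1) else 0)
       = (\<Sum>U\<in>{U\<in>?P. card U = 1}. s * normal_moment s (j - 1))"
      by (rule sum.inter_filter[symmetric]) simp
    also have "{U\<in>?P. card U = 1} = (\<lambda>t. {t}) ` {1..<Suc j}"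
      by (auto simp: card_1_singleton_iff)
    also have "(\<Sum>U\<in>(\<lambda>t. {t}) ` {1..<Suc j}. s * normal_moment s (j - 1)) = normal_moment s k"
      by (subst sum.reindex) (auto simp: inj_on_def Suc normal_moment_Suc)
    finally show ?thesis .
  qed
qed

lemma normal_moment_even: "normal_moment s (2 * N) / fact (2 * N) = (s / 2) ^ N / fact N"
  by (simp add: normal_moment_def power_divide)

lemma sum_normal_moments:
  "(\<Sum>k<2 * N. (\<i> ^ k * complex_of_real (normal_moment s k)) / fact k) = (\<Sum>j<N. complex_of_real ((- s / 2) ^ j / fact j))"
proof (induction N)
  case (Suc N)
  have "normal_moment s (Suc (2 * N)) = 0" by (simp add: normal_moment_def)
  moreover have "\<i> ^ (2 * N) * complex_of_real (normal_moment s (2 * N)) / fact (2 * N)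
     = complex_of_real ((- s / 2) ^ N / fact N)"
  proof -
    have "\<i> ^ (2 * N) * complex_of_real (normal_moment s (2 * N)) / fact (2 * N)
       = complex_of_real ((- 1) ^ N * (normal_moment s (2 * N) / fact (2 * N)))"
      by (simp add: power_mult)
    also have "(- 1) ^ N * (normal_moment s (2 * N) / fact (2 * N)) = (- s / 2) ^ N / fact N"
      unfolding normal_moment_even by (simp add: power_mult_distrib[symmetric])
    finally show ?thesis .
  qed
  moreover have "(\<Sum>k<2 * Suc N. F k) = (\<Sum>k<2 * N. F k) + F (2 * N) + F (Suc (2 * N))" for F :: "nat \<Rightarrow> complex"
    by simp
  ultimately show ?case using Suc by (simp only: sum.lessThan_Suc of_real_0 mult_zero_right div_0 add_0_right)
qed simp

text \<open>Truncating the exponential series before an even order \<open>2 * N\<close> makes the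
  remainder a moment rather than an absolute moment. After division by \<open>fact (2 * N)\<close>
  its limit is \<open>(s / 2) ^ N / fact N\<close>, which is small for large \<open>N\<close>; so
  \<open>N\<close> is fixed first and \<open>n\<close> grows afterwards.\<close>

lemma cis_tendsto_of_moments:
  assumes P: "\<And>n. prob_space (M n)" and X: "\<And>n k. integrable (M n) (\<lambda>\<omega>. X n \<omega> ^ k :: real)"
    and mom: "\<And>k. (\<lambda>n. \<integral>\<omega>. X n \<omega> ^ k \<partial>M n) \<longlonglongrightarrow> normal_moment s k"
  shows "(\<lambda>n. \<integral>\<omega>. cis (X n \<omega>) \<partial>M n) \<longlonglongrightarrow> complex_of_real (exp (- s / 2))"
proof (rule LIMSEQ_I)
  fix e :: real assume e: "e > 0"
  let ?Q = "\<lambda>N. \<Sum>k<2 * N. (\<i> ^ k * complex_of_real (normal_moment s k)) / fact k"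
  have "(\<lambda>j. (- s / 2) ^ j / fact j) sums exp (- s / 2)"
    using exp_converges[of "- s / 2"] by (simp add: field_simps)
  then have "(\<lambda>N. \<Sum>j<N. (- s / 2) ^ j / fact j) \<longlonglongrightarrow> exp (- s / 2)" by (simp add: sums_def)
  then have "(\<lambda>N. complex_of_real (\<Sum>j<N. (- s / 2) ^ j / fact j)) \<longlonglongrightarrow> complex_of_real (exp (- s / 2))"
    by (rule tendsto_of_real)
  then have Q: "?Q \<longlonglongrightarrow> complex_of_real (exp (- s / 2))" unfolding sum_normal_moments by simp
  have "(\<lambda>N. (s / 2) ^ N / fact N) \<longlonglongrightarrow> 0"
    using summable_LIMSEQ_zero[OF summable_exp[of "s / 2"]] by (simp add: field_simps)
  then have L: "(\<lambda>N. normal_moment s (2 * N) / fact (2 * N)) \<longlonglongrightarrow> 0" unfolding normal_moment_even .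
  have "\<forall>\<^sub>F N in sequentially. dist (?Q N) (complex_of_real (exp (- s / 2))) < e / 4 \<and>
      normal_moment s (2 * N) / fact (2 * N) < e / 4 \<and> N \<ge> 1"
    using e tendstoD[OF Q, of "e/4"] order_tendstoD(2)[OF L, of "e/4"]
    by (intro eventually_conj eventually_ge_at_top) auto
  then obtain N where N: "dist (?Q N) (complex_of_real (exp (- s / 2))) < e / 4"
      "normal_moment s (2 * N) / fact (2 * N) < e / 4" "N \<ge> 1"
    by (auto simp: eventually_sequentially)
  let ?P = "\<lambda>n. \<Sum>k<2 * N. (\<i> ^ k * complex_of_real (\<integral>\<omega>. X n \<omega> ^ k \<partial>M n)) / fact k"
  have "?P \<longlonglongrightarrow> ?Q N" by (intro tendsto_intros mom) auto
  then have e1: "\<forall>\<^sub>F n in sequentially. dist (?P n) (?Q N) < e / 4" by (rule tendstoD) (use e in auto)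
  have "(\<lambda>n. (\<integral>\<omega>. X n \<omega> ^ (2 * N) \<partial>M n) / fact (2 * N)) \<longlonglongrightarrow> normal_moment s (2 * N) / fact (2 * N)"
    by (intro tendsto_intros mom) auto
  then have e2: "\<forall>\<^sub>F n in sequentially. (\<integral>\<omega>. X n \<omega> ^ (2 * N) \<partial>M n) / fact (2 * N) < e / 4"
    using N(2) by (rule order_tendstoD)
  have est: "norm ((\<integral>\<omega>. cis (X n \<omega>) \<partial>M n) - ?P n) \<le> (\<integral>\<omega>. X n \<omega> ^ (2 * N) \<partial>M n) / fact (2 * N)" for n
  proof -
    interpret prob_space "M n" by (rule P)
    have [measurable]: "X n \<in> borel_measurable (M n)" using borel_measurable_integrable[OF X[of n 1]] by simp
    have Xc: "integrable (M n) (\<lambda>\<omega>. (\<i> ^ k * complex_of_real (X n \<omega> ^ k)) / fact k)" for k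
      using X[of n k] by (intro integrable_divide integrable_mult_right integrable_of_real) auto
    have ci: "integrable (M n) (\<lambda>\<omega>. cis (X n \<omega>))" by (rule integrable_const_bound[where B=1]) auto
    have "?P n = (\<integral>\<omega>. (\<Sum>k<2 * N. (\<i> ^ k * complex_of_real (X n \<omega> ^ k)) / fact k) \<partial>M n)"
      by (subst Bochner_Integration.integral_sum[OF Xc])
         (simp del: of_real_power add: X integral_complex_of_real)
    then have "(\<integral>\<omega>. cis (X n \<omega>) \<partial>M n) - ?P n
       = (\<integral>\<omega>. cis (X n \<omega>) - (\<Sum>k<2 * N. (\<i> ^ k * complex_of_real (X n \<omega> ^ k)) / fact k) \<partial>M n)"
      using ci Xc by (subst Bochner_Integration.integral_diff) auto
    also have "norm \<dots> \<le> (\<integral>\<omega>. X n \<omega> ^ (2 * N) / fact (2 * N) \<partial>M n)"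
    proof (rule order_trans[OF integral_norm_bound integral_mono])
      show "integrable (M n) (\<lambda>\<omega>. norm (cis (X n \<omega>) - (\<Sum>k<2 * N. (\<i> ^ k * complex_of_real (X n \<omega> ^ k)) / fact k)))"
        by (intro integrable_norm Bochner_Integration.integrable_diff Bochner_Integration.integrable_sum ci Xc)
      show "integrable (M n) (\<lambda>\<omega>. X n \<omega> ^ (2 * N) / fact (2 * N))" using X[of n "2 * N"] by simp
      fix \<omega>
      obtain N' where N': "2 * N = Suc N'" using N(3) by (cases "2 * N") auto
      have e: "{..<2 * N} = {..N'}" unfolding N' by (rule lessThan_Suc_atMost)
      have "cmod (iexp (X n \<omega>) - (\<Sum>k\<le>N'. (\<i> * complex_of_real (X n \<omega>)) ^ k / fact k)) \<le> \<bar>X n \<omega>\<bar> ^ Suc N' / fact (Suc N')"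
        by (rule iexp_approx1)
      moreover have "\<bar>X n \<omega>\<bar> ^ (2 * N) = X n \<omega> ^ (2 * N)" by (simp add: power_even_abs)
      ultimately show "norm (cis (X n \<omega>) - (\<Sum>k<2 * N. (\<i> ^ k * complex_of_real (X n \<omega> ^ k)) / fact k)) \<le> X n \<omega> ^ (2 * N) / fact (2 * N)"
        unfolding e by (simp add: cis_conv_exp power_mult_distrib N'[symmetric] del: fact_Suc power_Suc)
    qed
    finally show ?thesis by simp
  qed
  have "\<forall>\<^sub>F n in sequentially. norm ((\<integral>\<omega>. cis (X n \<omega>) \<partial>M n) - complex_of_real (exp (- s / 2))) < e"
    using e1 e2
  proof eventually_elim
    case (elim n)
    have "norm ((\<integral>\<omega>. cis (X n \<omega>) \<partial>M n) - complex_of_real (exp (- s / 2)))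
      \<le> norm ((\<integral>\<omega>. cis (X n \<omega>) \<partial>M n) - ?P n) + norm (?P n - ?Q N) + norm (?Q N - complex_of_real (exp (- s / 2)))"
      using norm_triangle_ineq[of "((\<integral>\<omega>. cis (X n \<omega>) \<partial>M n) - ?P n) + (?P n - ?Q N)" "?Q N - complex_of_real (exp (- s / 2))"]
        norm_triangle_ineq[of "(\<integral>\<omega>. cis (X n \<omega>) \<partial>M n) - ?P n" "?P n - ?Q N"] by simp
    then show ?case using est[of n] elim N(1) e unfolding dist_norm by linarith
  qed
  then show "\<exists>n0. \<forall>n\<ge>n0. norm ((\<integral>\<omega>. cis (X n \<omega>) \<partial>M n) - complex_of_real (exp (- s / 2))) < e"
    by (simp add: eventually_sequentially)
qed

section \<open>Cumulant bounds and the central limit theorem for step functions\<close>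

context brillinger_process
begin

text \<open>The constant depends on the index data alone, not on \<open>W\<close> or
  \<open>f\<close>, which allows windows to grow. Functions bounded by 1 stay so under
  multiplication, and the \<open>L1\<close> norm of the factor at \<open>i0\<close> cannot
  increase.\<close>

lemma clus_bound:
  fixes J :: "nat set" and ts :: "nat list"
  assumes "finite J" "i0 \<in> J"
  shows "\<exists>C. \<forall>W f. bounded W \<longrightarrow> W \<in> sets borel \<longrightarrow> (\<forall>i\<in>J \<union> set ts. f i \<in> step_functions W \<and> (\<forall>x. \<bar>f i x\<bar> \<le> 1)) \<longrightarrow>
     \<bar>clus (factorial_cumulant_functional W) J f ts\<bar> \<le> C * (\<integral>x. \<bar>f i0 x\<bar> \<partial>lborel)"
  using assms
proof (induction ts arbitrary: J)
  case Nil
  then show ?case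
    by (intro exI[of _ "cumulant_mass (card J)"]) (auto intro!: factorial_cumulant_functional_bound)
next
  case (Cons t ts)
  let ?ok = "\<lambda>W f A. \<forall>i\<in>A. f i \<in> step_functions W \<and> (\<forall>x. \<bar>f i x\<bar> \<le> (1::real))"
  let ?u = "\<lambda>f i. f(i := \<lambda>x. f i x * f t x)"
  let ?I = "\<lambda>f. \<integral>x. \<bar>f i0 x\<bar> \<partial>lborel"
  have "\<exists>C. \<forall>W f. bounded W \<longrightarrow> W \<in> sets borel \<longrightarrow> ?ok W f (insert t J \<union> set ts) \<longrightarrow>
     \<bar>clus (factorial_cumulant_functional W) (insert t J) f ts\<bar> \<le> C * ?I f"
    by (rule Cons.IH) (use Cons.prems in auto)
  then obtain C1 where C1: "\<And>W f. bounded W \<Longrightarrow> W \<in> sets borel \<Longrightarrow> ?ok W f (insert t J \<union> set ts) \<Longrightarrow>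
     \<bar>clus (factorial_cumulant_functional W) (insert t J) f ts\<bar> \<le> C1 * ?I f"
    by blast
  have "\<exists>C. \<forall>W f. bounded W \<longrightarrow> W \<in> sets borel \<longrightarrow> ?ok W f (J \<union> set ts) \<longrightarrow>
     \<bar>clus (factorial_cumulant_functional W) (J) f ts\<bar> \<le> C * ?I f"
    by (rule Cons.IH) (use Cons.prems in auto)
  then obtain C2 where C2: "\<And>W f. bounded W \<Longrightarrow> W \<in> sets borel \<Longrightarrow> ?ok W f (J \<union> set ts) \<Longrightarrow>
     \<bar>clus (factorial_cumulant_functional W) (J) f ts\<bar> \<le> C2 * ?I f"
    by blast
  \<comment> \<open>\<open>C2\<close> is not known to be nonnegative; its absolute value permits the
    monotone replacement of the \<open>L1\<close> norm of the updated factor.\<close>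
  have "\<bar>clus (factorial_cumulant_functional W) J f (t # ts)\<bar> \<le> (C1 + real (card J) * \<bar>C2\<bar>) * ?I f"
    if W: "bounded W" "W \<in> sets borel" and ok: "?ok W f (J \<union> set (t # ts))" for W f
  proof -
    have b: "\<bar>clus (factorial_cumulant_functional W) J (?u f i) ts\<bar> \<le> \<bar>C2\<bar> * ?I f" if i: "i \<in> J" for i
    proof -
      have st: "f i \<in> step_functions W" "f t \<in> step_functions W" "f i0 \<in> step_functions W"
        and le: "\<bar>f i x\<bar> \<le> 1" "\<bar>f t x\<bar> \<le> 1" for x
        using ok i Cons.prems by auto
      have le2: "\<bar>f i x * f t x\<bar> \<le> 1" for x
        using mult_mono[OF le(1) le(2), of x x] by (simp add: abs_mult)
      have ok': "?ok W (?u f i) (J \<union> set ts)"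
        using ok step_functions_mult[OF st(1,2)] le2 by (auto simp: fun_upd_apply)
      then have ok0: "?u f i i0 \<in> step_functions W" using Cons.prems by blast
      have "\<bar>clus (factorial_cumulant_functional W) J (?u f i) ts\<bar> \<le> C2 * ?I (?u f i)"
        by (rule C2[OF W ok'])
      also have "\<dots> \<le> \<bar>C2\<bar> * ?I (?u f i)"
        by (intro mult_right_mono Bochner_Integration.integral_nonneg) auto
      also have "\<dots> \<le> \<bar>C2\<bar> * ?I f"
      proof (intro mult_left_mono integral_mono)
        show "integrable lborel (\<lambda>x. \<bar>?u f i i0 x\<bar>)" "integrable lborel (\<lambda>x. \<bar>f i0 x\<bar>)"
          using step_functions_integrable[OF ok0 W] step_functions_integrable[OF st(3) W]
          by (auto simp del: fun_upd_apply)
        show "\<bar>?u f i i0 x\<bar> \<le> \<bar>f i0 x\<bar>" for x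
          using le(2)[of x] by (auto simp: abs_mult mult_left_le)
      qed simp
      finally show ?thesis .
    qed
    have "\<bar>clus (factorial_cumulant_functional W) J f (t # ts)\<bar>
      \<le> \<bar>clus (factorial_cumulant_functional W) (insert t J) f ts\<bar> + (\<Sum>i\<in>J. \<bar>clus (factorial_cumulant_functional W) J (?u f i) ts\<bar>)"
      unfolding clus.simps by (intro order_trans[OF abs_triangle_ineq] add_left_mono sum_abs)
    also have "\<dots> \<le> C1 * ?I f + (\<Sum>i\<in>J. \<bar>C2\<bar> * ?I f)"
      by (intro add_mono sum_mono b C1[OF W]) (use ok in auto)
    finally show ?thesis by (simp add: algebra_simps)
  qed
  then show ?case by blast
qed

text \<open>The variance of the sum of \<open>u\<close> over the process: the first term comes from
  coinciding points, the second from pairs of distinct points.\<close>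

definition variance_functional :: "('a \<Rightarrow> real) \<Rightarrow> real" where
  "variance_functional u = \<gamma> * (\<integral>x. u x ^ 2 \<partial>lborel) + (\<integral>x. sintegral (\<nu> 2) (\<lambda>y. u x * u (y 1 + x)) \<partial>lborel)"

text \<open>One further index yields the factorial cumulant on two indices plus, from coincidence,
  the one of \<open>u * u\<close> on a single index. The label \<open>t\<close> does not matter, by
  relabelling.\<close>

lemma clus_pair:
  assumes W: "bounded W" "W \<in> sets borel" and u: "u \<in> step_functions W" and t: "t > 0"
  shows "clus (factorial_cumulant_functional W) {0} (\<lambda>_. u) [t] = variance_functional u"
proof -
  let ?\<sigma> = "\<lambda>i. if i = 0 then 0 else t"
  have im: "?\<sigma> ` {..<2::nat} = {t, 0}" 
  proof -
    have "{..<2::nat} = {0, 1}" by auto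
    then show ?thesis by auto
  qed
  have "factorial_cumulant_functional W {t, 0} (\<lambda>_. u) = factorial_cumulant_functional W {..<2} (\<lambda>_. u)"
    using factorial_cumulant_functional_image[OF W, of ?\<sigma> "{..<2}" "\<lambda>_. u"] t unfolding im
    by (auto simp: inj_on_def)
  also have "\<dots> = reduced_integral 2 (\<nu> 2) (\<lambda>_. u)"
    by (rule factorial_cumulant_functional_step[OF W]) (use u in auto)
  also have "\<dots> = (\<integral>x. sintegral (\<nu> 2) (\<lambda>y. u x * u (y 1 + x)) \<partial>lborel)"
    by (simp add: reduced_integral_def numeral_2_eq_2 lessThan_Suc shifted_def mult.commute)
  finally have 1: "factorial_cumulant_functional W {t, 0} (\<lambda>_. u) = \<dots>" .
  have 2: "factorial_cumulant_functional W {0} ((\<lambda>_. u)(0 := \<lambda>x. u x * u x)) = \<gamma> * (\<integral>x. u x ^ 2 \<partial>lborel)"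
    using factorial_cumulant_functional_singleton[OF W, of "(\<lambda>_. u)(0 := \<lambda>x. u x * u x)" 0] step_functions_mult[OF u u]
    by (simp add: power2_eq_square)
  show ?thesis using 1 2 by (simp add: variance_functional_def)
qed

text \<open>By \<open>mass\<close>, two of the normalising factors pay for the \<open>L1\<close>
  norm in the cumulant bound, so a cumulant of order m becomes of order
  \<open>\<bar>\<rho> n\<bar> ^ (m - 2)\<close>. The windows may vary freely with \<open>n\<close>.
  Nonnegativity of \<open>s\<close> comes along because \<open>s\<close> is a limit of second
  moments.\<close>

theorem step_function_clt:
  fixes \<rho> :: "nat \<Rightarrow> real"
  assumes W: "\<And>n. bounded (W n)" "\<And>n. W n \<in> sets borel"
    and u: "\<And>n. u n \<in> step_functions (W n)" "\<And>n x. \<bar>u n x\<bar> \<le> 1"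
    and \<rho>: "\<rho> \<longlonglongrightarrow> 0" and mass: "\<And>n. (\<rho> n)\<^sup>2 * (\<integral>x. \<bar>u n x\<bar> \<partial>lborel) \<le> K"
    and var: "(\<lambda>n. (\<rho> n)\<^sup>2 * variance_functional (u n)) \<longlonglongrightarrow> s"
  shows "(\<lambda>n. \<integral>\<omega>. cis (\<rho> n * ((\<integral>x. u n x \<partial>count_space (\<eta> \<omega>)) - \<gamma> * (\<integral>x. u n x \<partial>lborel))) \<partial>M)
      \<longlonglongrightarrow> complex_of_real (exp (- s / 2))"
    and "0 \<le> s"
proof -
  let ?B = "\<lambda>n. factorial_cumulant_functional (W n)"
  let ?Y = "\<lambda>n \<omega>. linear_stat (W n) (u n) \<omega> - (\<integral>\<omega>. linear_stat (W n) (u n) \<omega> \<partial>M)"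
  have um [measurable]: "u n \<in> borel_measurable borel" for n by (rule step_functions_measurable[OF u(1)])
  have ui: "integrable lborel (u n)" for n by (rule step_functions_integrable[OF u(1) W])
  have ls: "linear_stat (W n) (u n) \<omega> = (\<integral>x. u n x \<partial>count_space (\<eta> \<omega>))" if "\<omega> \<in> space M" for n \<omega>
  proof -
    have "(\<lambda>x. indicator (W n) x * u n x) = u n"
      using step_functions_support[OF u(1)[of n]] by (fastforce simp: indicator_def)
    then show ?thesis using linear_stat_eq_integral[OF W(1) that] by simp
  qed
  have mean: "(\<integral>\<omega>. linear_stat (W n) (u n) \<omega> \<partial>M) = \<gamma> * (\<integral>x. u n x \<partial>lborel)" for n
    using expectation_sum[OF ui[of n]] ls by (simp cong: Bochner_Integration.integral_cong)
  define X where "X n \<omega> = \<rho> n * ?Y n \<omega>" for n \<omega>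
  define mu where "mu n k = (\<integral>\<omega>. X n \<omega> ^ k \<partial>M)" for n k
  \<comment> \<open>Index 0 and the entries of \<open>ts\<close> make \<open>Suc (length ts)\<close>
    factors, each of which brings one power of \<open>\<rho> n\<close>.\<close>
  define a where "a n ts = \<rho> n ^ (Suc (length ts)) * clus (?B n) {0} (\<lambda>_. u n) ts" for n ts
  have Xint: "integrable M (\<lambda>\<omega>. X n \<omega> ^ k)" for n k
  proof -
    have bf: "bounded_family (\<lambda>_::nat. u n)" using u(2) by (auto simp: bounded_family_def)
    have "integrable M (\<lambda>\<omega>. ?Y n \<omega> ^ k)"
      using integrable_factorial_sum_prod[OF W(1,2) finite.emptyI bf, where ts="replicate k 0" and m="\<lambda>_. \<integral>\<omega>. linear_stat (W n) (u n) \<omega> \<partial>M"]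
      by simp
    then show ?thesis by (simp add: X_def power_mult_distrib)
  qed
  have mom: "(\<lambda>n. mu n k) \<longlonglongrightarrow> normal_moment s k" for k
  proof (rule moments_tendsto_normal[where a=a])
    show "mu n 0 = 1" for n by (simp add: mu_def prob_space)
    show "mu n (Suc k) = (\<Sum>U\<in>Pow {1..<Suc k} - {{}}. a n (filter (\<lambda>t. t \<in> U) [1..<Suc k]) * mu n (k - card U))" for n k
    proof -
      have len: "length (filter (\<lambda>t. t \<in> U) [1..<Suc k]) = card U" "card U \<le> k" if U: "U \<in> Pow {1..<Suc k} - {{}}" for U
      proof -
        have "length (filter (\<lambda>t. t \<in> U) [1..<Suc k]) = card (set (filter (\<lambda>t. t \<in> U) [1..<Suc k]))"
          by (rule distinct_card[symmetric]) simp
        also have "set (filter (\<lambda>t. t \<in> U) [1..<Suc k]) = U" using U by auto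
        finally show "length (filter (\<lambda>t. t \<in> U) [1..<Suc k]) = card U" .
        have "card U \<le> card {1..<Suc k}" using U by (intro card_mono) auto
        then show "card U \<le> k" by simp
      qed
      have muY: "mu n j = \<rho> n ^ j * (\<integral>\<omega>. ?Y n \<omega> ^ j \<partial>M)" for j by (simp add: mu_def X_def power_mult_distrib)
      have "mu n (Suc k) = \<rho> n ^ Suc k * (\<Sum>U\<in>Pow {1..<Suc k} - {{}}.
         clus (?B n) {0} (\<lambda>_. u n) (filter (\<lambda>t. t \<in> U) [1..<Suc k]) * (\<integral>\<omega>. ?Y n \<omega> ^ (k - card U) \<partial>M))"
        unfolding muY by (subst central_moment_recursion[OF W(1)[of n] W(2)[of n] um[of n] u(2)[of n], of k]) (rule refl)
      also have "\<dots> = (\<Sum>U\<in>Pow {1..<Suc k} - {{}}. a n (filter (\<lambda>t. t \<in> U) [1..<Suc k]) * mu n (k - card U))"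
        unfolding sum_distrib_left
      proof (rule sum.cong[OF refl])
        fix U assume U: "U \<in> Pow {1..<Suc k} - {{}}"
        have "\<rho> n ^ Suc k = \<rho> n ^ Suc (card U) * \<rho> n ^ (k - card U)"
          using len(2)[OF U] by (simp add: power_add[symmetric] flip: power_Suc)
        then show "\<rho> n ^ Suc k * (clus (?B n) {0} (\<lambda>_. u n) (filter (\<lambda>t. t \<in> U) [1..<Suc k]) * (\<integral>\<omega>. ?Y n \<omega> ^ (k - card U) \<partial>M))
           = a n (filter (\<lambda>t. t \<in> U) [1..<Suc k]) * mu n (k - card U)"
          unfolding a_def len(1)[OF U] muY by (simp only: mult_ac)
      qed
      finally show ?thesis .
    qed
    show "(\<lambda>n. a n [t]) \<longlonglongrightarrow> s" if "t > 0" for t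
      using var clus_pair[OF W u(1) that] by (simp add: a_def power2_eq_square mult.assoc del: clus.simps)
    fix ts :: "nat list" assume ts: "length ts \<ge> 2"
    obtain C where C0: "\<forall>W f. bounded W \<longrightarrow> W \<in> sets borel \<longrightarrow>
        (\<forall>i\<in>{0} \<union> set ts. f i \<in> step_functions W \<and> (\<forall>x. \<bar>f i x\<bar> \<le> 1)) \<longrightarrow>
        \<bar>clus (factorial_cumulant_functional W) {0} f ts\<bar> \<le> C * (\<integral>x. \<bar>f 0 x\<bar> \<partial>lborel)"
      using clus_bound[of "{0}" 0 ts] by auto
    have C: "\<bar>clus (?B n) {0} (\<lambda>_. u n) ts\<bar> \<le> C * (\<integral>x. \<bar>u n x\<bar> \<partial>lborel)" for n
      using C0[rule_format, of "W n" "\<lambda>_. u n"] W u by auto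
    have bound: "\<bar>a n ts\<bar> \<le> \<bar>C\<bar> * K * \<bar>\<rho> n\<bar> ^ (length ts - 1)" for n
    proof -
      let ?I = "\<integral>x. \<bar>u n x\<bar> \<partial>lborel"
      have I0: "0 \<le> ?I" by simp
      have "Suc (length ts) = 2 + (length ts - 1)" using ts by simp
      then have "\<bar>a n ts\<bar> = (\<rho> n)\<^sup>2 * \<bar>\<rho> n\<bar> ^ (length ts - 1) * \<bar>clus (?B n) {0} (\<lambda>_. u n) ts\<bar>"
        unfolding a_def abs_mult power_abs[symmetric] by (simp only: power_add abs_mult power_abs power2_abs)
      also have "\<dots> \<le> (\<rho> n)\<^sup>2 * \<bar>\<rho> n\<bar> ^ (length ts - 1) * (\<bar>C\<bar> * ?I)"
        by (intro mult_left_mono order_trans[OF C[of n]] mult_right_mono I0) auto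
      also have "\<dots> = \<bar>C\<bar> * ((\<rho> n)\<^sup>2 * ?I) * \<bar>\<rho> n\<bar> ^ (length ts - 1)" by (simp only: mult_ac)
      also have "\<dots> \<le> \<bar>C\<bar> * K * \<bar>\<rho> n\<bar> ^ (length ts - 1)"
        by (intro mult_right_mono mult_left_mono mass) auto
      finally show ?thesis .
    qed
    have "(\<lambda>n. \<bar>C\<bar> * K * \<bar>\<rho> n\<bar> ^ (length ts - 1)) \<longlonglongrightarrow> \<bar>C\<bar> * K * \<bar>0\<bar> ^ (length ts - 1)"
      by (intro tendsto_intros \<rho>)
    then have "(\<lambda>n. \<bar>C\<bar> * K * \<bar>\<rho> n\<bar> ^ (length ts - 1)) \<longlonglongrightarrow> 0" using ts by (simp add: power_0_left)
    then show "(\<lambda>n. a n ts) \<longlonglongrightarrow> 0"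
      by (rule Lim_null_comparison[rotated]) (use bound in auto)
  qed
  have "(\<lambda>n. \<integral>\<omega>. cis (X n \<omega>) \<partial>M) \<longlonglongrightarrow> complex_of_real (exp (- s / 2))"
    by (rule cis_tendsto_of_moments[OF prob_space_axioms Xint mom[unfolded mu_def]])
  also have "(\<lambda>n. \<integral>\<omega>. cis (X n \<omega>) \<partial>M)
     = (\<lambda>n. \<integral>\<omega>. cis (\<rho> n * ((\<integral>x. u n x \<partial>count_space (\<eta> \<omega>)) - \<gamma> * (\<integral>x. u n x \<partial>lborel))) \<partial>M)"
    unfolding X_def mean by (intro ext Bochner_Integration.integral_cong refl) (simp add: ls)
  finally show "(\<lambda>n. \<integral>\<omega>. cis (\<rho> n * ((\<integral>x. u n x \<partial>count_space (\<eta> \<omega>)) - \<gamma> * (\<integral>x. u n x \<partial>lborel))) \<partial>M)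
      \<longlonglongrightarrow> complex_of_real (exp (- s / 2))" .
  have "normal_moment s 2 = s" by (simp add: normal_moment_def)
  then have "(\<lambda>n. mu n 2) \<longlonglongrightarrow> s" using mom[of 2] by simp
  then show "0 \<le> s"
    by (rule LIMSEQ_le_const) (auto simp: mu_def intro!: Bochner_Integration.integral_nonneg)
qed

end

section \<open>General test functions\<close>

lemma step_functions_zero: "(\<lambda>_ :: 'a::euclidean_space. 0) \<in> step_functions W"
proof -
  have "(\<lambda>_. 0) = (indicator {} :: 'a \<Rightarrow> real)" by auto
  then show ?thesis using step_functions.indicator[of "{}" W] by (simp only: sets.empty_sets empty_subsetI)
qed

lemma step_functions_sum:
  assumes "finite A" "\<And>j. j \<in> A \<Longrightarrow> F j \<in> step_functions W"
  shows "(\<lambda>x. \<Sum>j\<in>A. c j * F j x) \<in> step_functions W"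
  using assms
proof (induction A rule: finite_induct)
  case empty
  then show ?case by (simp add: step_functions_zero)
next
  case (insert j A)
  then have "(\<lambda>x. c j * F j x + 1 * (\<Sum>j\<in>A. c j * F j x)) \<in> step_functions W"
    by (intro step_functions.combination) auto
  then show ?case using insert by simp
qed

text \<open>Outside a large ball \<open>g\<close> has small integral; inside, it is rounded down to
  a multiple of \<open>1 / N\<close>, at a cost of at most the volume divided by \<open>N\<close>.
  As \<open>g\<close> is bounded by 1, the integers from \<open>- N\<close> to \<open>N\<close>
  suffice and rounding preserves the bound.\<close>

lemma step_function_approximation:
  fixes g :: "'a::euclidean_space \<Rightarrow> real"
  assumes g: "integrable lborel g" "\<And>x. \<bar>g x\<bar> \<le> 1" and e: "e > 0"
  shows "\<exists>W u. bounded W \<and> W \<in> sets borel \<and> u \<in> step_functions W \<and> (\<forall>x. \<bar>u x\<bar> \<le> 1) \<and> (\<integral>x. \<bar>g x - u x\<bar> \<partial>lborel) \<le> e"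
proof -
  have [measurable]: "g \<in> borel_measurable borel" using g by auto
  define B where "B m = cball (0::'a) (real m)" for m
  have [measurable]: "B m \<in> sets borel" for m by (simp add: B_def)
  have "(\<lambda>m. \<integral>x. \<bar>g x\<bar> * indicator (- B m) x \<partial>lborel) \<longlonglongrightarrow> (\<integral>x. 0 \<partial>(lborel :: 'a measure))"
  proof (rule integral_dominated_convergence[where w="\<lambda>x. \<bar>g x\<bar>"])
    show "AE x in lborel. (\<lambda>m. \<bar>g x\<bar> * indicator (- B m) x) \<longlonglongrightarrow> 0"
    proof (intro AE_I2 tendsto_eventually)
      fix x :: 'a
      show "\<forall>\<^sub>F m in sequentially. \<bar>g x\<bar> * indicator (- B m) x = 0"
        using eventually_ge_at_top[of "nat \<lceil>norm x\<rceil>"]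
        by eventually_elim (auto simp: B_def indicator_def nat_le_iff ceiling_le_iff)
    qed
  qed (use g in \<open>auto simp: indicator_def\<close>)
  then have "\<forall>\<^sub>F m in sequentially. (\<integral>x. \<bar>g x\<bar> * indicator (- B m) x \<partial>lborel) < e / 2"
    using e by (intro order_tendstoD) auto
  then obtain m where m: "(\<integral>x. \<bar>g x\<bar> * indicator (- B m) x \<partial>lborel) < e / 2" by (auto simp: eventually_sequentially)
  define L where "L = measure lborel (B m)"
  have Bfin: "emeasure lborel (B m) < \<infinity>" by (rule emeasure_bounded_finite) (simp add: B_def)
  obtain N :: nat where N: "N > 0" "L / real N < e / 2"
  proof -
    obtain N :: nat where N: "L / (e / 2) < real N" using reals_Archimedean2 by blast
    have L0: "L \<ge> 0" by (simp add: L_def)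
    then have "0 \<le> L / (e / 2)" using e by simp
    then have "0 < real N" using N by linarith
    then have "L / real N < e / 2" using N e by (simp add: field_simps)
    then show ?thesis using \<open>0 < real N\<close> by (intro that[of N]) auto
  qed
  define A where "A j = {x \<in> B m. \<lfloor>real N * g x\<rfloor> = j}" for j :: int
  have [measurable]: "A j \<in> sets borel" for j
  proof -
    have "A j = B m \<inter> ((\<lambda>x. real N * g x) -` {real_of_int j..<real_of_int j + 1} \<inter> space borel)"
      by (auto simp: A_def floor_eq_iff)
    also have "\<dots> \<in> sets borel"
      by (intro sets.Int measurable_sets[of _ borel borel]) auto
    finally show ?thesis .
  qed
  define u where "u x = (\<Sum>j = - int N..int N. (real_of_int j / real N) * indicator (A j) x)" for x
  have fl: "- int N \<le> \<lfloor>real N * g x\<rfloor>" "\<lfloor>real N * g x\<rfloor> \<le> int N" for x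
  proof -
    have "\<bar>real N * g x\<bar> \<le> real N" using g(2)[of x] by (simp add: abs_mult mult_left_le)
    then show "- int N \<le> \<lfloor>real N * g x\<rfloor>" "\<lfloor>real N * g x\<rfloor> \<le> int N" by linarith+
  qed
  have ueq: "u x = (if x \<in> B m then real_of_int \<lfloor>real N * g x\<rfloor> / real N else 0)" for x
  proof -
    have "u x = (\<Sum>j = - int N..int N. if j = \<lfloor>real N * g x\<rfloor> then (if x \<in> B m then real_of_int j / real N else 0) else 0)"
      unfolding u_def by (rule sum.cong) (auto simp: A_def indicator_def)
    then show ?thesis using fl[of x] by (simp add: sum.delta)
  qed
  have us: "u \<in> step_functions (B m)"
    unfolding u_def[abs_def] by (rule step_functions_sum) (auto intro!: step_functions.indicator simp: A_def[symmetric], auto simp: A_def)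
  have ub: "\<bar>u x\<bar> \<le> 1" for x
  proof -
    have "\<bar>real_of_int \<lfloor>real N * g x\<rfloor>\<bar> \<le> real N" using fl[of x] by linarith
    then show ?thesis using N(1) by (auto simp: ueq)
  qed
  have Bb: "bounded (B m)" by (simp add: B_def)
  have ui: "integrable lborel u" by (rule step_functions_integrable[OF us Bb]) simp
  have "(\<integral>x. \<bar>g x - u x\<bar> \<partial>lborel) \<le> (\<integral>x. \<bar>g x\<bar> * indicator (- B m) x + (1 / real N) * indicator (B m) x \<partial>lborel)"
  proof (rule integral_mono)
    show "integrable lborel (\<lambda>x. \<bar>g x - u x\<bar>)" using g ui by simp
    have "integrable lborel (\<lambda>x. \<bar>g x\<bar> * indicator (- B m) x)"
      by (rule Bochner_Integration.integrable_bound[OF g(1)]) (auto simp: indicator_def)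
    moreover have "integrable lborel (\<lambda>x. (1 / real N) * indicator (B m) x :: real)" using Bfin by simp
    ultimately show "integrable lborel (\<lambda>x. \<bar>g x\<bar> * indicator (- B m) x + (1 / real N) * indicator (B m) x)"
      by (rule Bochner_Integration.integrable_add)
    fix x
    show "\<bar>g x - u x\<bar> \<le> \<bar>g x\<bar> * indicator (- B m) x + (1 / real N) * indicator (B m) x"
    proof (cases "x \<in> B m")
      case True
      have "\<bar>real N * g x - real_of_int \<lfloor>real N * g x\<rfloor>\<bar> \<le> 1" by linarith
      then have "\<bar>real N * g x - real_of_int \<lfloor>real N * g x\<rfloor>\<bar> / real N \<le> 1 / real N"
        using N(1) by (intro divide_right_mono) auto
      also have "\<bar>real N * g x - real_of_int \<lfloor>real N * g x\<rfloor>\<bar> / real N = \<bar>g x - u x\<bar>"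
      proof -
        have "g x - u x = (real N * g x - real_of_int \<lfloor>real N * g x\<rfloor>) / real N"
          using N(1) True by (simp add: ueq diff_divide_distrib)
        then show ?thesis by (simp add: abs_divide)
      qed
      finally show ?thesis using True by simp
    qed (simp add: ueq)
  qed
  also have "\<dots> = (\<integral>x. \<bar>g x\<bar> * indicator (- B m) x \<partial>lborel) + L / real N"
  proof -
    have "integrable lborel (\<lambda>x. \<bar>g x\<bar> * indicator (- B m) x)"
      by (rule Bochner_Integration.integrable_bound[OF g(1)]) (auto simp: indicator_def)
    moreover have "integrable lborel (\<lambda>x. (1 / real N) * indicator (B m) x :: real)" using Bfin by simp
    ultimately show ?thesis by (subst Bochner_Integration.integral_add) (auto simp: L_def)
  qed
  also have "\<dots> \<le> e" using m N(2) by linarith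
  finally show ?thesis using us ub Bb by (intro exI[of _ "B m"] exI[of _ u]) auto
qed

section \<open>Translations and the autocorrelation of a test function\<close>

lemma integral_translate:
  fixes f :: "'a::euclidean_space \<Rightarrow> 'b::{banach, second_countable_topology}"
  assumes "f \<in> borel_measurable borel"
  shows "(\<integral>x. f (y + x) \<partial>lborel) = (\<integral>x. f x \<partial>lborel)"
  using lborel_integral_affine[OF assms, of 1 y] by simp

lemma integrable_translate:
  fixes f :: "'a::euclidean_space \<Rightarrow> 'b::{banach, second_countable_topology}"
  assumes "integrable lborel f"
  shows "integrable lborel (\<lambda>x. f (y + x))"
  using lborel_integrable_affine_iff[of f 1 y] assms by auto

definition autocorrelation :: "('a::euclidean_space \<Rightarrow> real) \<Rightarrow> 'a \<Rightarrow> real" where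
  "autocorrelation g y = (\<integral>x. g x * g (y + x) \<partial>lborel)"

lemma integrable_autocorrelation:
  fixes g :: "'a::euclidean_space \<Rightarrow> real"
  assumes "integrable lborel g" "\<And>x. \<bar>g x\<bar> \<le> s"
  shows "integrable lborel (\<lambda>x. g x * g (y + x))"
proof -
  have [measurable]: "g \<in> borel_measurable borel" using assms by auto
  have "norm (g x * g (y + x)) \<le> norm (s * g x)" for x
    using mult_left_mono[OF assms(2)[of "y + x"], of "\<bar>g x\<bar>"] assms(2)[of x]
    by (simp add: abs_mult mult.commute)
  then show ?thesis
    by (intro Bochner_Integration.integrable_bound[OF integrable_mult_right[OF assms(1), of s]] AE_I2) measurable
qed

lemma autocorrelation_bound:
  assumes "integrable lborel g" "\<And>x. \<bar>g x\<bar> \<le> s"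
  shows "\<bar>autocorrelation g y\<bar> \<le> s * (\<integral>x. \<bar>g x\<bar> \<partial>lborel)"
proof -
  have "\<bar>autocorrelation g y\<bar> \<le> (\<integral>x. \<bar>g x\<bar> * s \<partial>lborel)"
    unfolding autocorrelation_def
    by (rule abs_integral_le[OF integrable_autocorrelation[OF assms]])
       (use assms in \<open>auto simp: abs_mult intro!: mult_left_mono\<close>)
  then show ?thesis by (simp add: mult.commute)
qed

lemma autocorrelation_measurable [measurable]:
  assumes [measurable]: "g \<in> borel_measurable borel"
  shows "autocorrelation g \<in> borel_measurable borel"
  unfolding autocorrelation_def[abs_def] by measurable

text \<open>One factor is replaced at a time. By translation invariance each replacement costs the
  same \<open>L1\<close> distance, uniformly in the lag \<open>y\<close>.\<close>

lemma autocorrelation_diff: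
  fixes g u :: "'a::euclidean_space \<Rightarrow> real"
  assumes g: "integrable lborel g" "\<And>x. \<bar>g x\<bar> \<le> 1" and u: "integrable lborel u" "\<And>x. \<bar>u x\<bar> \<le> 1"
  shows "\<bar>autocorrelation g y - autocorrelation u y\<bar> \<le> 2 * (\<integral>x. \<bar>g x - u x\<bar> \<partial>lborel)"
proof -
  have [measurable]: "g \<in> borel_measurable borel" "u \<in> borel_measurable borel" using g u by auto
  note I = integrable_autocorrelation[OF g] integrable_autocorrelation[OF u]
  have d: "integrable lborel (\<lambda>x. \<bar>g x - u x\<bar>)" using g u by simp
  have "autocorrelation g y - autocorrelation u y = (\<integral>x. g x * g (y + x) - u x * u (y + x) \<partial>lborel)"
    unfolding autocorrelation_def using I by simp
  also have "\<bar>\<dots>\<bar> \<le> (\<integral>x. \<bar>g x - u x\<bar> + \<bar>g (y + x) - u (y + x)\<bar> \<partial>lborel)"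
  proof (rule abs_integral_le)
    show "integrable lborel (\<lambda>x. g x * g (y + x) - u x * u (y + x))" using I by simp
    show "integrable lborel (\<lambda>x. \<bar>g x - u x\<bar> + \<bar>g (y + x) - u (y + x)\<bar>)"
      using d integrable_translate[OF d, of y] by simp
    fix x
    have "g x * g (y + x) - u x * u (y + x) = (g x - u x) * g (y + x) + u x * (g (y + x) - u (y + x))"
      by (simp add: algebra_simps)
    also have "\<bar>\<dots>\<bar> \<le> \<bar>g x - u x\<bar> * \<bar>g (y + x)\<bar> + \<bar>u x\<bar> * \<bar>g (y + x) - u (y + x)\<bar>"
      by (rule order_trans[OF abs_triangle_ineq]) (simp add: abs_mult)
    also have "\<dots> \<le> \<bar>g x - u x\<bar> + \<bar>g (y + x) - u (y + x)\<bar>"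
      using g(2)[of "y + x"] u(2)[of x] by (intro add_mono mult_left_le mult_left_le_one_le) auto
    finally show "\<bar>g x * g (y + x) - u x * u (y + x)\<bar> \<le> \<bar>g x - u x\<bar> + \<bar>g (y + x) - u (y + x)\<bar>" .
  qed
  also have "\<dots> = 2 * (\<integral>x. \<bar>g x - u x\<bar> \<partial>lborel)"
    using d integrable_translate[OF d, of y] integral_translate[of "\<lambda>x. \<bar>g x - u x\<bar>" y] by simp
  finally show ?thesis .
qed

lemma autocorrelation_scale: "autocorrelation (\<lambda>x. c * g x) y = c\<^sup>2 * autocorrelation g y"
proof -
  have "(\<lambda>x. (c * g x) * (c * g (y + x))) = (\<lambda>x. c\<^sup>2 * (g x * g (y + x)))" by (auto simp: power2_eq_square)
  then show ?thesis by (simp add: autocorrelation_def)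
qed

lemma norm_cis_diff_le: "norm (cis a - cis b) \<le> \<bar>a - b\<bar>"
proof -
  have "cis a - cis b = cis b * (cis (a - b) - 1)" by (simp add: algebra_simps cis_mult)
  then have "norm (cis a - cis b) = norm (cis (a - b) - 1)" by (simp add: norm_mult)
  also have "\<dots> \<le> \<bar>a - b\<bar>"
    using iexp_approx1[of "a - b" 0] by (simp add: cis_conv_exp)
  finally show ?thesis .
qed

section \<open>The variance functional and the central limit theorem for bounded integrable test
  functions\<close>

context brillinger_process
begin

lemma coordinate_measurable: "(\<lambda>y. y 1) \<in> borel_measurable (fst (\<nu> 2))" "(\<lambda>y. y 1) \<in> borel_measurable (snd (\<nu> 2))"
proof -
  have m: "(\<lambda>y. y 1) \<in> borel_measurable (Pi\<^sub>M {1..<2::nat} (\<lambda>_. borel :: 'a measure))" by measurable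
  show "(\<lambda>y. y 1) \<in> borel_measurable (fst (\<nu> 2))" "(\<lambda>y. y 1) \<in> borel_measurable (snd (\<nu> 2))"
    using m \<nu>_parts[of 2] by (simp_all cong: measurable_cong_sets)
qed

text \<open>Fubini is applied to each part of \<open>\<nu> 2\<close>; finite mass and boundedness of
  \<open>g\<close> give joint integrability. The variance thus depends on \<open>g\<close> only
  through its autocorrelation.\<close>

lemma variance_functional_eq:
  assumes g: "integrable lborel g" "\<And>x. \<bar>g x\<bar> \<le> s"
  shows "variance_functional g = \<gamma> * autocorrelation g 0 + sintegral (\<nu> 2) (\<lambda>y. autocorrelation g (y 1))"
proof -
  have [measurable]: "g \<in> borel_measurable borel" using g by auto
  have fub: "(\<integral>x. \<integral>y. g x * g (y 1 + x) \<partial>N \<partial>lborel) = (\<integral>y. autocorrelation g (y 1) \<partial>N)"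
    "integrable lborel (\<lambda>x. \<integral>y. g x * g (y 1 + x) \<partial>N)"
    "\<And>x. integrable N (\<lambda>y. g x * g (y 1 + x))"
    if N: "finite_measure N" and [measurable]: "(\<lambda>y. y 1) \<in> borel_measurable N" for N :: "(nat \<Rightarrow> 'a) measure"
  proof -
    interpret N: finite_measure N by (rule N)
    interpret P: pair_sigma_finite lborel N ..
    have "integrable (lborel \<Otimes>\<^sub>M N) (\<lambda>(x, y). \<bar>g x\<bar> * s)"
      using g(1) by (intro P.Fubini_integrable) (auto simp: abs_mult)
    then have i: "integrable (lborel \<Otimes>\<^sub>M N) (\<lambda>(x, y). g x * g (y 1 + x))"
    proof (rule Bochner_Integration.integrable_bound)
      show "AE p in lborel \<Otimes>\<^sub>M N. norm (case p of (x, y) \<Rightarrow> g x * g (y 1 + x)) \<le> norm (case p of (x, y) \<Rightarrow> \<bar>g x\<bar> * s)"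
      proof (rule AE_I2)
        fix p :: "'a \<times> (nat \<Rightarrow> 'a)"
        obtain x y where p: "p = (x, y)" by (cases p)
        show "norm (case p of (x, y) \<Rightarrow> g x * g (y 1 + x)) \<le> norm (case p of (x, y) \<Rightarrow> \<bar>g x\<bar> * s)"
          using mult_left_mono[OF g(2)[of "y 1 + x"], of "\<bar>g x\<bar>"] g(2)[of x] by (simp add: p abs_mult)
      qed
    qed measurable
    show "(\<integral>x. \<integral>y. g x * g (y 1 + x) \<partial>N \<partial>lborel) = (\<integral>y. autocorrelation g (y 1) \<partial>N)"
      using P.Fubini_integral[OF i] by (simp add: autocorrelation_def)
    show "integrable lborel (\<lambda>x. \<integral>y. g x * g (y 1 + x) \<partial>N)" using P.integrable_fst[OF i] by simp
    show "integrable N (\<lambda>y. g x * g (y 1 + x))" for x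
    proof (rule N.integrable_const_bound[where B="\<bar>g x\<bar> * s"])
      show "AE y in N. norm (g x * g (y 1 + x)) \<le> \<bar>g x\<bar> * s"
        by (intro AE_I2) (simp add: abs_mult mult_left_mono g)
    qed measurable
  qed
  note p = \<nu>_parts[of 2, simplified] coordinate_measurable
  show ?thesis
    unfolding variance_functional_def sintegral_def
    using fub[OF p(3,5)] fub[OF p(4,6)]
    by (simp add: autocorrelation_def power2_eq_square)
qed

lemma sintegral_bound:
  assumes [measurable]: "f \<in> borel_measurable borel" and b: "\<And>y. \<bar>f y\<bar> \<le> K"
  shows "\<bar>sintegral (\<nu> 2) (\<lambda>y. f (y 1))\<bar> \<le> K * cumulant_mass 2"
    and "integrable (fst (\<nu> 2)) (\<lambda>y. f (y 1))" "integrable (snd (\<nu> 2)) (\<lambda>y. f (y 1))"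
proof -
  note p = \<nu>_parts[of 2, simplified]
  note [measurable] = coordinate_measurable
  interpret A: finite_measure "fst (\<nu> 2)" by (rule p)
  interpret B: finite_measure "snd (\<nu> 2)" by (rule p)
  show i: "integrable (fst (\<nu> 2)) (\<lambda>y. f (y 1))" "integrable (snd (\<nu> 2)) (\<lambda>y. f (y 1))"
    using measurable_compose[OF coordinate_measurable(1) assms(1)] measurable_compose[OF coordinate_measurable(2) assms(1)]
    by (auto intro!: A.integrable_const_bound[where B=K] B.integrable_const_bound[where B=K] AE_I2 simp: b)
  have "\<bar>\<integral>y. f (y 1) \<partial>fst (\<nu> 2)\<bar> \<le> (\<integral>y. K \<partial>fst (\<nu> 2))" "\<bar>\<integral>y. f (y 1) \<partial>snd (\<nu> 2)\<bar> \<le> (\<integral>y. K \<partial>snd (\<nu> 2))"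
    by (rule abs_integral_le[OF i(1)], simp, rule b, rule abs_integral_le[OF i(2)], simp, rule b)
  then show "\<bar>sintegral (\<nu> 2) (\<lambda>y. f (y 1))\<bar> \<le> K * cumulant_mass 2"
    by (simp add: sintegral_def cumulant_mass_def algebra_simps)
qed

text \<open>Lipschitz continuity in \<open>L1\<close>, uniform over functions bounded by 1: it
  transfers the variance limit from \<open>g\<close> to its step approximations.\<close>

lemma variance_functional_diff:
  assumes g: "integrable lborel g" "\<And>x. \<bar>g x\<bar> \<le> 1" and u: "integrable lborel u" "\<And>x. \<bar>u x\<bar> \<le> 1"
  shows "\<bar>variance_functional g - variance_functional u\<bar> \<le> 2 * (\<gamma> + cumulant_mass 2) * (\<integral>x. \<bar>g x - u x\<bar> \<partial>lborel)"
proof -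
  have [measurable]: "g \<in> borel_measurable borel" "u \<in> borel_measurable borel" using g u by auto
  let ?D = "\<integral>x. \<bar>g x - u x\<bar> \<partial>lborel"
  let ?d = "\<lambda>y. autocorrelation g y - autocorrelation u y"
  have d: "\<bar>?d y\<bar> \<le> 2 * ?D" for y by (rule autocorrelation_diff[OF g u])
  note ig = sintegral_bound(2,3)[of "autocorrelation g", OF autocorrelation_measurable[OF \<open>g \<in> borel_measurable borel\<close>] autocorrelation_bound[OF g]]
  note iu = sintegral_bound(2,3)[of "autocorrelation u", OF autocorrelation_measurable[OF \<open>u \<in> borel_measurable borel\<close>] autocorrelation_bound[OF u]]
  have "sintegral (\<nu> 2) (\<lambda>y. ?d (y 1)) = sintegral (\<nu> 2) (\<lambda>y. autocorrelation g (y 1)) - sintegral (\<nu> 2) (\<lambda>y. autocorrelation u (y 1))"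
    unfolding sintegral_def Bochner_Integration.integral_diff[OF ig(1) iu(1)] Bochner_Integration.integral_diff[OF ig(2) iu(2)]
    by simp
  then have "variance_functional g - variance_functional u = \<gamma> * ?d 0 + sintegral (\<nu> 2) (\<lambda>y. ?d (y 1))"
    unfolding variance_functional_eq[OF g] variance_functional_eq[OF u] by (simp only: right_diff_distrib)
  also have "\<bar>\<dots>\<bar> \<le> \<gamma> * (2 * ?D) + (2 * ?D) * cumulant_mass 2"
  proof (rule order_trans[OF abs_triangle_ineq add_mono])
    show "\<bar>\<gamma> * ?d 0\<bar> \<le> \<gamma> * (2 * ?D)"
      unfolding abs_mult using \<gamma>_pos d[of 0] by (simp add: mult_left_mono del: mult_le_cancel_left_pos)
    show "\<bar>sintegral (\<nu> 2) (\<lambda>y. ?d (y 1))\<bar> \<le> (2 * ?D) * cumulant_mass 2"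
      by (rule sintegral_bound(1)) (auto intro!: d)
  qed
  finally show ?thesis by (simp add: algebra_simps)
qed

lemma variance_functional_scale:
  assumes "integrable lborel g" "\<And>x. \<bar>g x\<bar> \<le> s"
  shows "variance_functional (\<lambda>x. c * g x) = c\<^sup>2 * variance_functional g"
proof -
  have "integrable lborel (\<lambda>x. c * g x)" "\<And>x. \<bar>c * g x\<bar> \<le> \<bar>c\<bar> * s"
    using assms by (auto simp: abs_mult mult_left_mono)
  then show ?thesis unfolding variance_functional_eq[OF assms] variance_functional_eq[OF \<open>integrable lborel (\<lambda>x. c * g x)\<close> \<open>\<And>x. \<bar>c * g x\<bar> \<le> \<bar>c\<bar> * s\<close>]
    by (simp add: autocorrelation_scale sintegral_def algebra_simps)
qed

text \<open>After division by a bound, each function is replaced by a step function at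
  \<open>L1\<close> distance at most \<open>1 / (n + 1)\<close>. The variance is perturbed according
  to its Lipschitz estimate and the characteristic function according to Campbell's formula; both
  errors vanish.\<close>

theorem bounded_function_clt:
  fixes \<rho> :: "nat \<Rightarrow> real" and g :: "nat \<Rightarrow> 'a \<Rightarrow> real"
  assumes g: "\<And>n. integrable lborel (g n)" "\<And>n x. \<bar>g n x\<bar> \<le> s"
    and \<rho>: "\<rho> \<longlonglongrightarrow> 0" and mass: "\<And>n. (\<rho> n)\<^sup>2 * (\<integral>x. \<bar>g n x\<bar> \<partial>lborel) \<le> K"
    and var: "(\<lambda>n. (\<rho> n)\<^sup>2 * variance_functional (g n)) \<longlonglongrightarrow> v"
  shows "(\<lambda>n. \<integral>\<omega>. cis (\<rho> n * ((\<integral>x. g n x \<partial>count_space (\<eta> \<omega>)) - \<gamma> * (\<integral>x. g n x \<partial>lborel))) \<partial>M)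
      \<longlonglongrightarrow> complex_of_real (exp (- v / 2))"
    and "0 \<le> v"
proof -
  \<comment> \<open>The maximum with 1 makes \<open>c\<close> a positive divisor; the factor
    \<open>c\<close> is moved into the normalisation \<open>\<rho>'\<close>.\<close>
  define c where "c = max s 1"
  have c: "c \<ge> 1" "\<And>n x. \<bar>g n x\<bar> \<le> c" using g(2) by (auto simp: c_def le_max_iff_disj)
  define f where "f n x = g n x / c" for n x
  have f: "integrable lborel (f n)" "\<bar>f n x\<bar> \<le> 1" for n x
    using g(1)[of n] c by (auto simp: f_def[abs_def] abs_divide)
  have gf: "g n = (\<lambda>x. c * f n x)" for n using c(1) by (auto simp: f_def)
  have "\<forall>n. \<exists>W u. bounded W \<and> W \<in> sets borel \<and> u \<in> step_functions W \<and> (\<forall>x. \<bar>u x\<bar> \<le> 1) \<and>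
     (\<integral>x. \<bar>f n x - u x\<bar> \<partial>lborel) \<le> inverse (real (Suc n))"
    by (intro allI step_function_approximation f) auto
  then obtain W u where Wu: "\<And>n. bounded (W n)" "\<And>n. W n \<in> sets borel" "\<And>n. u n \<in> step_functions (W n)"
    "\<And>n x. \<bar>u n x\<bar> \<le> 1" "\<And>n. (\<integral>x. \<bar>f n x - u n x\<bar> \<partial>lborel) \<le> inverse (real (Suc n))"
    by metis
  let ?\<delta> = "\<lambda>n. inverse (real (Suc n))"
  have \<delta>0: "?\<delta> \<longlonglongrightarrow> 0" by (rule LIMSEQ_inverse_real_of_nat)
  have ui: "integrable lborel (u n)" for n by (rule step_functions_integrable[OF Wu(3,1,2)])
  have dm: "integrable lborel (\<lambda>x. f n x - u n x)" for n using f(1) ui by simp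
  obtain R where R: "\<And>n. \<bar>\<rho> n\<bar> \<le> R" using convergent_imp_Bseq[OF convergentI[OF \<rho>]] by (auto simp: Bseq_def)
  define \<rho>' where "\<rho>' n = c * \<rho> n" for n
  have \<rho>': "\<rho>' \<longlonglongrightarrow> 0" using tendsto_mult[OF tendsto_const[of c] \<rho>] by (simp add: \<rho>'_def[abs_def])
  have mass': "(\<rho>' n)\<^sup>2 * (\<integral>x. \<bar>u n x\<bar> \<partial>lborel) \<le> c * K + c\<^sup>2 * R\<^sup>2" for n
  proof -
    have "(\<integral>x. \<bar>u n x\<bar> \<partial>lborel) \<le> (\<integral>x. \<bar>f n x\<bar> + \<bar>f n x - u n x\<bar> \<partial>lborel)"
      using f(1) ui dm by (intro integral_mono) auto
    also have "\<dots> = (\<integral>x. \<bar>f n x\<bar> \<partial>lborel) + (\<integral>x. \<bar>f n x - u n x\<bar> \<partial>lborel)"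
      using f(1) dm by (intro Bochner_Integration.integral_add) auto
    also have "\<dots> \<le> (\<integral>x. \<bar>g n x\<bar> \<partial>lborel) / c + 1"
    proof (rule add_mono)
      show "(\<integral>x. \<bar>f n x\<bar> \<partial>lborel) \<le> (\<integral>x. \<bar>g n x\<bar> \<partial>lborel) / c" using c(1) by (simp add: f_def abs_divide)
      have "?\<delta> n \<le> 1" by (simp add: field_simps)
      then show "(\<integral>x. \<bar>f n x - u n x\<bar> \<partial>lborel) \<le> 1" using Wu(5)[of n] by simp
    qed
    finally have "(\<rho>' n)\<^sup>2 * (\<integral>x. \<bar>u n x\<bar> \<partial>lborel) \<le> (\<rho>' n)\<^sup>2 * ((\<integral>x. \<bar>g n x\<bar> \<partial>lborel) / c + 1)"
      by (intro mult_left_mono) auto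
    also have "\<dots> = c * ((\<rho> n)\<^sup>2 * (\<integral>x. \<bar>g n x\<bar> \<partial>lborel)) + c\<^sup>2 * (\<rho> n)\<^sup>2"
      using c(1) by (simp add: \<rho>'_def power2_eq_square field_simps)
    also have "\<dots> \<le> c * K + c\<^sup>2 * R\<^sup>2"
      using mass[of n] R[of n] c(1) by (intro add_mono mult_left_mono) (auto simp: abs_le_square_iff[symmetric])
    finally show ?thesis .
  qed
  have var': "(\<lambda>n. (\<rho>' n)\<^sup>2 * variance_functional (u n)) \<longlonglongrightarrow> v"
  proof -
    have "(\<lambda>n. (\<rho>' n)\<^sup>2 * variance_functional (u n) - (\<rho> n)\<^sup>2 * variance_functional (g n)) \<longlonglongrightarrow> 0"
    proof (rule Lim_null_comparison)
      have "(\<lambda>n. (\<rho>' n)\<^sup>2 * (2 * (\<gamma> + cumulant_mass 2) * ?\<delta> n)) \<longlonglongrightarrow> 0\<^sup>2 * (2 * (\<gamma> + cumulant_mass 2) * 0)"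
        by (intro tendsto_intros \<rho>' \<delta>0)
      then show "(\<lambda>n. (\<rho>' n)\<^sup>2 * (2 * (\<gamma> + cumulant_mass 2) * ?\<delta> n)) \<longlonglongrightarrow> 0" by simp
      show "\<forall>\<^sub>F n in sequentially. norm ((\<rho>' n)\<^sup>2 * variance_functional (u n) - (\<rho> n)\<^sup>2 * variance_functional (g n))
        \<le> (\<rho>' n)\<^sup>2 * (2 * (\<gamma> + cumulant_mass 2) * ?\<delta> n)"
      proof (intro always_eventually allI)
        fix n
        have "(\<rho> n)\<^sup>2 * variance_functional (g n) = (\<rho>' n)\<^sup>2 * variance_functional (f n)"
          unfolding gf variance_functional_scale[OF f] by (simp add: \<rho>'_def power_mult_distrib)
        then have "norm ((\<rho>' n)\<^sup>2 * variance_functional (u n) - (\<rho> n)\<^sup>2 * variance_functional (g n))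
           = (\<rho>' n)\<^sup>2 * \<bar>variance_functional (f n) - variance_functional (u n)\<bar>"
          by (simp add: right_diff_distrib[symmetric] abs_mult abs_minus_commute)
        also have "\<dots> \<le> (\<rho>' n)\<^sup>2 * (2 * (\<gamma> + cumulant_mass 2) * ?\<delta> n)"
        proof (rule mult_left_mono[OF order_trans[OF variance_functional_diff[OF f ui Wu(4)]]])
          have "0 \<le> cumulant_mass 2" by (simp add: cumulant_mass_def)
          then show "2 * (\<gamma> + cumulant_mass 2) * (\<integral>x. \<bar>f n x - u n x\<bar> \<partial>lborel) \<le> 2 * (\<gamma> + cumulant_mass 2) * ?\<delta> n"
            using \<gamma>_pos by (intro mult_left_mono Wu(5)) auto
        qed simp
        finally show "norm ((\<rho>' n)\<^sup>2 * variance_functional (u n) - (\<rho> n)\<^sup>2 * variance_functional (g n))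
          \<le> (\<rho>' n)\<^sup>2 * (2 * (\<gamma> + cumulant_mass 2) * ?\<delta> n)" .
      qed
    qed
    from tendsto_add[OF this var] show ?thesis by simp
  qed
  note clt = step_function_clt[OF Wu(1,2,3,4) \<rho>' mass' var']
  show "0 \<le> v" by (rule clt(2))
  let ?Y = "\<lambda>g \<omega>. (\<integral>x. g x \<partial>count_space (\<eta> \<omega>)) - \<gamma> * (\<integral>x. g x \<partial>lborel)"
  \<comment> \<open>\<open>cis\<close> is Lipschitz with constant 1, so the difference is at most
    \<open>\<bar>\<rho>' n\<bar>\<close> times the mean absolute centred sum of
    \<open>f n - u n\<close>. That sum and its mean contribute at most
    \<open>\<gamma> * ?\<delta> n\<close> each.\<close>
  have "(\<lambda>n. (\<integral>\<omega>. cis (\<rho> n * ?Y (g n) \<omega>) \<partial>M) - (\<integral>\<omega>. cis (\<rho>' n * ?Y (u n) \<omega>) \<partial>M)) \<longlonglongrightarrow> 0"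
  proof (rule Lim_null_comparison)
    have "(\<lambda>n. \<bar>\<rho>' n\<bar> * (2 * \<gamma> * ?\<delta> n)) \<longlonglongrightarrow> \<bar>0\<bar> * (2 * \<gamma> * 0)" by (intro tendsto_intros \<rho>' \<delta>0)
    then show "(\<lambda>n. \<bar>\<rho>' n\<bar> * (2 * \<gamma> * ?\<delta> n)) \<longlonglongrightarrow> 0" by simp
    show "\<forall>\<^sub>F n in sequentially. norm ((\<integral>\<omega>. cis (\<rho> n * ?Y (g n) \<omega>) \<partial>M) - (\<integral>\<omega>. cis (\<rho>' n * ?Y (u n) \<omega>) \<partial>M))
       \<le> \<bar>\<rho>' n\<bar> * (2 * \<gamma> * ?\<delta> n)"
    proof (intro always_eventually allI)
      fix n
      have [measurable]: "g n \<in> borel_measurable borel" "u n \<in> borel_measurable borel" "f n \<in> borel_measurable borel"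
        using g(1) ui f(1) by auto
      let ?D = "\<lambda>x. f n x - u n x"
      have ic: "integrable M (\<lambda>\<omega>. cis (a * ?Y h \<omega>))" if [measurable]: "h \<in> borel_measurable borel" for a h
        by (rule integrable_const_bound[where B=1]) (simp, measurable)
      have iD: "integrable M (\<lambda>\<omega>. \<bar>?Y ?D \<omega>\<bar>)" using integrable_sum[OF dm[of n]] by simp
      have "norm ((\<integral>\<omega>. cis (\<rho> n * ?Y (g n) \<omega>) \<partial>M) - (\<integral>\<omega>. cis (\<rho>' n * ?Y (u n) \<omega>) \<partial>M))
        = norm (\<integral>\<omega>. cis (\<rho> n * ?Y (g n) \<omega>) - cis (\<rho>' n * ?Y (u n) \<omega>) \<partial>M)"
        by (subst Bochner_Integration.integral_diff) (auto intro!: ic)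
      also have "\<dots> \<le> (\<integral>\<omega>. norm (cis (\<rho> n * ?Y (g n) \<omega>) - cis (\<rho>' n * ?Y (u n) \<omega>)) \<partial>M)"
        by (rule integral_norm_bound)
      also have "\<dots> \<le> (\<integral>\<omega>. \<bar>\<rho>' n\<bar> * \<bar>?Y ?D \<omega>\<bar> \<partial>M)"
      proof (rule integral_mono_AE)
        show "integrable M (\<lambda>\<omega>. norm (cis (\<rho> n * ?Y (g n) \<omega>) - cis (\<rho>' n * ?Y (u n) \<omega>)))"
          by (intro integrable_norm Bochner_Integration.integrable_diff ic) auto
        show "integrable M (\<lambda>\<omega>. \<bar>\<rho>' n\<bar> * \<bar>?Y ?D \<omega>\<bar>)" using iD by simp
        show "AE \<omega> in M. norm (cis (\<rho> n * ?Y (g n) \<omega>) - cis (\<rho>' n * ?Y (u n) \<omega>)) \<le> \<bar>\<rho>' n\<bar> * \<bar>?Y ?D \<omega>\<bar>"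
          using AE_integrable_sum[OF f(1)[of n]] AE_integrable_sum[OF ui[of n]]
        proof eventually_elim
          case (elim \<omega>)
          have "\<rho> n * ?Y (g n) \<omega> = \<rho>' n * ?Y (f n) \<omega>"
            unfolding gf by (simp add: \<rho>'_def algebra_simps)
          then have "\<rho> n * ?Y (g n) \<omega> - \<rho>' n * ?Y (u n) \<omega> = \<rho>' n * ?Y ?D \<omega>"
            using elim f(1)[of n] ui[of n] by (simp add: algebra_simps)
          then show ?case using norm_cis_diff_le[of "\<rho> n * ?Y (g n) \<omega>" "\<rho>' n * ?Y (u n) \<omega>"] by (simp add: abs_mult)
        qed
      qed
      also have "\<dots> = \<bar>\<rho>' n\<bar> * (\<integral>\<omega>. \<bar>?Y ?D \<omega>\<bar> \<partial>M)" by simp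
      also have "\<dots> \<le> \<bar>\<rho>' n\<bar> * (2 * \<gamma> * ?\<delta> n)"
      proof (rule mult_left_mono)
        have "(\<integral>\<omega>. \<bar>?Y ?D \<omega>\<bar> \<partial>M) \<le> (\<integral>\<omega>. \<bar>\<integral>x. ?D x \<partial>count_space (\<eta> \<omega>)\<bar> + \<gamma> * (\<integral>x. \<bar>?D x\<bar> \<partial>lborel) \<partial>M)"
        proof (rule integral_mono[OF iD])
          show "integrable M (\<lambda>\<omega>. \<bar>\<integral>x. ?D x \<partial>count_space (\<eta> \<omega>)\<bar> + \<gamma> * (\<integral>x. \<bar>?D x\<bar> \<partial>lborel))"
            using integrable_sum[OF dm[of n]] by simp
          fix \<omega>
          have "\<bar>\<gamma> * (\<integral>x. ?D x \<partial>lborel)\<bar> \<le> \<gamma> * (\<integral>x. \<bar>?D x\<bar> \<partial>lborel)"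
            using \<gamma>_pos integral_abs_bound[of lborel ?D] by (simp add: abs_mult)
          then show "\<bar>?Y ?D \<omega>\<bar> \<le> \<bar>\<integral>x. ?D x \<partial>count_space (\<eta> \<omega>)\<bar> + \<gamma> * (\<integral>x. \<bar>?D x\<bar> \<partial>lborel)"
            using abs_triangle_ineq4[of "\<integral>x. ?D x \<partial>count_space (\<eta> \<omega>)" "\<gamma> * (\<integral>x. ?D x \<partial>lborel)"] by linarith
        qed
        also have "\<dots> = (\<integral>\<omega>. \<bar>\<integral>x. ?D x \<partial>count_space (\<eta> \<omega>)\<bar> \<partial>M) + \<gamma> * (\<integral>x. \<bar>?D x\<bar> \<partial>lborel)"
          using integrable_sum[OF dm[of n]] by (simp add: prob_space)
        also have "\<dots> \<le> 2 * \<gamma> * (\<integral>x. \<bar>?D x\<bar> \<partial>lborel)"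
          using expectation_abs_sum_le[OF dm[of n]] by simp
        also have "\<dots> \<le> 2 * \<gamma> * ?\<delta> n" using \<gamma>_pos Wu(5)[of n] by (intro mult_left_mono) auto
        finally show "(\<integral>\<omega>. \<bar>?Y ?D \<omega>\<bar> \<partial>M) \<le> 2 * \<gamma> * ?\<delta> n" .
      qed simp
      finally show "norm ((\<integral>\<omega>. cis (\<rho> n * ?Y (g n) \<omega>) \<partial>M) - (\<integral>\<omega>. cis (\<rho>' n * ?Y (u n) \<omega>) \<partial>M)) \<le> \<bar>\<rho>' n\<bar> * (2 * \<gamma> * ?\<delta> n)" .
    qed
  qed
  from tendsto_add[OF this clt(1)]
  show "(\<lambda>n. \<integral>\<omega>. cis (\<rho> n * ?Y (g n) \<omega>) \<partial>M) \<longlonglongrightarrow> complex_of_real (exp (- v / 2))" by simp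
qed

end

section \<open>Limit of the variance\<close>

definition translation_defect :: "('a::euclidean_space \<Rightarrow> real) \<Rightarrow> 'a \<Rightarrow> real" where
  "translation_defect h y = (\<integral>x. \<bar>h (y + x) - h x\<bar> \<partial>lborel)"

text \<open>After rescaling, the lag is \<open>y\<close> divided by \<open>r\<close> and the
  frequency is \<open>r\<close> times a sum or difference of wave vectors. The relevant regime is
  therefore lag tending to 0 with frequency either 0 or divergent.\<close>

definition modulated_correlation :: "('a::euclidean_space \<Rightarrow> real) \<Rightarrow> 'a \<Rightarrow> 'a \<Rightarrow> complex" where
  "modulated_correlation h y q = (\<integral>x. complex_of_real (h x * h (y + x)) * cis (q \<bullet> x) \<partial>lborel)"

text \<open>The power bound in \<open>window_class\<close>, whose exponent is positive, enters as
  continuity of translations in \<open>L1\<close>.\<close>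

lemma translation_defect_tendsto:
  assumes h: "h \<in> window_class p" and p: "0 < p" and y: "y \<longlonglongrightarrow> 0"
  shows "(\<lambda>n. translation_defect h (y n)) \<longlonglongrightarrow> 0"
proof -
  obtain a b where ab: "a > 0" "b > 0"
    "\<And>y. indicator {z. norm z \<le> b} y * (\<integral>x. \<bar>h (x + y) - h x\<bar> \<partial>lborel) \<le> a * norm y powr p"
    using h by (auto simp: window_class_def)
  have "(\<lambda>n. norm (y n)) \<longlonglongrightarrow> 0" using tendsto_norm[OF y] by simp
  then have "\<forall>\<^sub>F n in sequentially. norm (y n) < b" using ab by (intro order_tendstoD) auto
  then have "\<forall>\<^sub>F n in sequentially. norm (translation_defect h (y n)) \<le> a * norm (y n) powr p"
  proof eventually_elim
    case (elim n)
    then show ?case using ab(3)[of "y n"] by (simp add: translation_defect_def add.commute)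
  qed
  moreover have "(\<lambda>n. a * norm (y n) powr p) \<longlonglongrightarrow> 0"
  proof -
    have "(\<lambda>n. norm (y n) powr p) \<longlonglongrightarrow> 0 powr p"
      using \<open>(\<lambda>n. norm (y n)) \<longlonglongrightarrow> 0\<close> p by (intro tendsto_powr') auto
    from tendsto_mult[OF tendsto_const[of a] this] show ?thesis by simp
  qed
  ultimately show ?thesis by (rule Lim_null_comparison)
qed

context
  fixes h :: "'a::euclidean_space \<Rightarrow> real" and H :: real
  assumes h_int: "integrable lborel h" and h_bd: "\<And>x. \<bar>h x\<bar> \<le> H"
begin

lemma h_measurable [measurable]: "h \<in> borel_measurable borel"
  using h_int by auto

lemma integrable_defect: "integrable lborel (\<lambda>x. \<bar>h (y + x) - h x\<bar>)"
  using integrable_translate[OF h_int, of y] h_int by simp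

lemma integrable_modulated: "integrable lborel (\<lambda>x. complex_of_real (h x * h (y + x)) * cis (q \<bullet> x))"
proof (rule Bochner_Integration.integrable_bound[OF integrable_autocorrelation[OF h_int h_bd, of y]])
  show "AE x in lborel. norm (complex_of_real (h x * h (y + x)) * cis (q \<bullet> x)) \<le> norm (h x * h (y + x))"
    by (intro AE_I2) (simp add: norm_mult)
qed measurable

text \<open>Replacing the translate of \<open>h\<close> by \<open>h\<close> itself costs the defect,
  uniformly in the frequency; cancellation by oscillation then has to be shown at lag 0
  only.\<close>

lemma modulated_correlation_shift:
  "norm (modulated_correlation h y q - modulated_correlation h 0 q) \<le> H * translation_defect h y"
proof -
  have "modulated_correlation h y q - modulated_correlation h 0 q
      = (\<integral>x. complex_of_real (h x * (h (y + x) - h x)) * cis (q \<bullet> x) \<partial>lborel)"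
    unfolding modulated_correlation_def
    by (subst Bochner_Integration.integral_diff[symmetric, OF integrable_modulated integrable_modulated])
       (simp add: algebra_simps)
  also have "norm \<dots> \<le> (\<integral>x. norm (complex_of_real (h x * (h (y + x) - h x)) * cis (q \<bullet> x)) \<partial>lborel)"
    by (rule integral_norm_bound)
  also have "\<dots> \<le> (\<integral>x. H * \<bar>h (y + x) - h x\<bar> \<partial>lborel)"
  proof -
    have le: "norm (complex_of_real (h x * (h (y + x) - h x)) * cis (q \<bullet> x)) \<le> H * \<bar>h (y + x) - h x\<bar>" for x
      unfolding norm_mult norm_of_real norm_cis abs_mult mult_1_right by (intro mult_right_mono h_bd) auto
    show ?thesis
    proof (rule integral_mono[OF _ _ le])
      show i: "integrable lborel (\<lambda>x. H * \<bar>h (y + x) - h x\<bar>)" using integrable_defect by simp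
      show "integrable lborel (\<lambda>x. norm (complex_of_real (h x * (h (y + x) - h x)) * cis (q \<bullet> x)))"
      proof (rule Bochner_Integration.integrable_bound[OF i])
        show "AE x in lborel. norm (norm (complex_of_real (h x * (h (y + x) - h x)) * cis (q \<bullet> x))) \<le> norm (H * \<bar>h (y + x) - h x\<bar>)"
          unfolding real_norm_def abs_norm_cancel by (rule AE_I2, rule order_trans[OF le abs_ge_self])
      qed measurable
    qed
  qed
  finally show ?thesis by (simp add: translation_defect_def)
qed

text \<open>Riemann--Lebesgue: translating by \<open>v\<close> with \<open>q \<bullet> v = pi\<close> changes the sign of the modulation.\<close>

lemma modulated_correlation_bound:
  assumes q: "q \<noteq> 0"
  shows "norm (modulated_correlation h 0 q) \<le> H * translation_defect h ((pi / (q \<bullet> q)) *\<^sub>R q)"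
proof -
  define v where "v = (pi / (q \<bullet> q)) *\<^sub>R q"
  have qv: "q \<bullet> v = pi" using q by (simp add: v_def)
  let ?f = "\<lambda>x. complex_of_real (h x * h x) * cis (q \<bullet> x)"
  have int: "integrable lborel ?f" using integrable_modulated[of 0 q] by simp
  have c: "cis (q \<bullet> (v + x)) = - cis (q \<bullet> x)" for x
    by (simp add: inner_add_right qv cis_mult[symmetric])
  have int2: "integrable lborel (\<lambda>x. complex_of_real (h (v + x) * h (v + x)) * cis (q \<bullet> x))"
    using integrable_minus[OF integrable_translate[OF int, of v]] by (simp add: c)
  have "modulated_correlation h 0 q = (\<integral>x. ?f x \<partial>lborel)" by (simp add: modulated_correlation_def)
  also have "\<dots> = (\<integral>x. ?f (v + x) \<partial>lborel)" by (rule integral_translate[symmetric]) measurable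
  also have "\<dots> = - (\<integral>x. complex_of_real (h (v + x) * h (v + x)) * cis (q \<bullet> x) \<partial>lborel)"
    by (simp add: c)
  finally have "2 * modulated_correlation h 0 q = (\<integral>x. ?f x \<partial>lborel) - (\<integral>x. complex_of_real (h (v + x) * h (v + x)) * cis (q \<bullet> x) \<partial>lborel)"
    by (simp add: modulated_correlation_def)
  also have "\<dots> = (\<integral>x. complex_of_real (h x * h x - h (v + x) * h (v + x)) * cis (q \<bullet> x) \<partial>lborel)"
    by (subst Bochner_Integration.integral_diff[symmetric, OF int int2]) (simp add: algebra_simps)
  finally have "norm (2 * modulated_correlation h 0 q) = norm (\<integral>x. complex_of_real (h x * h x - h (v + x) * h (v + x)) * cis (q \<bullet> x) \<partial>lborel)"
    by simp
  also have "\<dots> \<le> (\<integral>x. norm (complex_of_real (h x * h x - h (v + x) * h (v + x)) * cis (q \<bullet> x)) \<partial>lborel)"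
    by (rule integral_norm_bound)
  also have "\<dots> \<le> (\<integral>x. 2 * H * \<bar>h (v + x) - h x\<bar> \<partial>lborel)"
  proof -
    have le: "norm (complex_of_real (h x * h x - h (v + x) * h (v + x)) * cis (q \<bullet> x)) \<le> 2 * H * \<bar>h (v + x) - h x\<bar>" for x
    proof -
      have "h x * h x - h (v + x) * h (v + x) = - ((h (v + x) + h x) * (h (v + x) - h x))" by (simp add: algebra_simps)
      then have "norm (complex_of_real (h x * h x - h (v + x) * h (v + x)) * cis (q \<bullet> x)) = \<bar>h (v + x) + h x\<bar> * \<bar>h (v + x) - h x\<bar>"
        by (simp add: norm_mult abs_mult del: of_real_diff of_real_mult)
      also have "\<dots> \<le> 2 * H * \<bar>h (v + x) - h x\<bar>"
        using h_bd[of x] h_bd[of "v + x"] by (intro mult_right_mono) auto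
      finally show ?thesis .
    qed
    show ?thesis
    proof (rule integral_mono[OF _ _ le])
      show i: "integrable lborel (\<lambda>x. 2 * H * \<bar>h (v + x) - h x\<bar>)" using integrable_defect by simp
      show "integrable lborel (\<lambda>x. norm (complex_of_real (h x * h x - h (v + x) * h (v + x)) * cis (q \<bullet> x)))"
      proof (rule Bochner_Integration.integrable_bound[OF i])
        show "AE x in lborel. norm (norm (complex_of_real (h x * h x - h (v + x) * h (v + x)) * cis (q \<bullet> x))) \<le> norm (2 * H * \<bar>h (v + x) - h x\<bar>)"
          unfolding real_norm_def abs_norm_cancel by (rule AE_I2, rule order_trans[OF le abs_ge_self])
      qed measurable
    qed
  qed
  finally show ?thesis by (simp add: translation_defect_def v_def norm_mult)
qed

text \<open>Combines the reduction to lag 0 with the sign-change estimate. The half-period vector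
  \<open>?v n\<close> has length \<open>pi / norm (q n)\<close>, hence tends to 0 and has vanishing
  defect.\<close>

lemma modulated_correlation_tendsto_0:
  assumes td: "\<And>y. y \<longlonglongrightarrow> 0 \<Longrightarrow> (\<lambda>n. translation_defect h (y n)) \<longlonglongrightarrow> 0"
    and y: "y \<longlonglongrightarrow> 0" and q: "filterlim (\<lambda>n. norm (q n)) at_top sequentially"
  shows "(\<lambda>n. modulated_correlation h (y n) (q n)) \<longlonglongrightarrow> 0"
proof -
  let ?v = "\<lambda>n. (pi / (q n \<bullet> q n)) *\<^sub>R q n"
  have ev: "\<forall>\<^sub>F n in sequentially. q n \<noteq> 0"
  proof -
    from q have "\<forall>Z. eventually (\<lambda>n. Z \<le> norm (q n)) sequentially"
      unfolding filterlim_at_top .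
    then have "eventually (\<lambda>n. 1 \<le> norm (q n)) sequentially" by (rule allE)
    then show ?thesis by (rule eventually_mono) force
  qed
  have "(\<lambda>n. pi / norm (q n)) \<longlonglongrightarrow> 0"
    by (rule real_tendsto_divide_at_top[OF tendsto_const q])
  moreover have "\<forall>\<^sub>F n in sequentially. norm (?v n) \<le> pi / norm (q n)"
    using ev by eventually_elim (simp add: dot_square_norm power2_eq_square)
  ultimately have "?v \<longlonglongrightarrow> 0" by (rule Lim_null_comparison[rotated])
  then have l: "(\<lambda>n. H * translation_defect h (y n) + H * translation_defect h (?v n)) \<longlonglongrightarrow> H * 0 + H * 0"
    by (intro tendsto_intros td y)
  have "\<forall>\<^sub>F n in sequentially. norm (modulated_correlation h (y n) (q n)) \<le> H * translation_defect h (y n) + H * translation_defect h (?v n)"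
    using ev
  proof eventually_elim
    case (elim n)
    show ?case
      using norm_triangle_ineq[of "modulated_correlation h (y n) (q n) - modulated_correlation h 0 (q n)" "modulated_correlation h 0 (q n)"]
        modulated_correlation_shift[of "y n" "q n"] modulated_correlation_bound[OF elim] by simp
  qed
  moreover have "(\<lambda>n. H * translation_defect h (y n) + H * translation_defect h (?v n)) \<longlonglongrightarrow> 0" using l by simp
  ultimately show ?thesis by (rule Lim_null_comparison)
qed

lemma modulated_correlation_tendsto_moment:
  assumes td: "\<And>y. y \<longlonglongrightarrow> 0 \<Longrightarrow> (\<lambda>n. translation_defect h (y n)) \<longlonglongrightarrow> 0" and y: "y \<longlonglongrightarrow> 0"
  shows "(\<lambda>n. modulated_correlation h (y n) 0) \<longlonglongrightarrow> complex_of_real (window_moment 2 h)"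
proof -
  have e: "modulated_correlation h 0 0 = complex_of_real (window_moment 2 h)"
    by (simp add: modulated_correlation_def window_moment_def power2_eq_square flip: of_real_mult)
  have "(\<lambda>n. modulated_correlation h (y n) 0 - modulated_correlation h 0 0) \<longlonglongrightarrow> 0"
  proof (rule Lim_null_comparison)
    have "(\<lambda>n. H * translation_defect h (y n)) \<longlonglongrightarrow> H * 0" by (intro tendsto_intros td y)
    then show "(\<lambda>n. H * translation_defect h (y n)) \<longlonglongrightarrow> 0" by simp
  qed (use modulated_correlation_shift in auto)
  from tendsto_add[OF this tendsto_const[of "modulated_correlation h 0 0"]] show ?thesis unfolding e by simp
qed

end

section \<open>Windows modulated by trigonometric sums\<close>

definition trig_sum :: "('n \<Rightarrow> complex) \<Rightarrow> ('n \<Rightarrow> 'a::euclidean_space) \<Rightarrow> 'a \<Rightarrow> real" where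
  "trig_sum a k x = Re (\<Sum>i\<in>UNIV. a i * cis (k i \<bullet> x))"

lemma trig_sum_bound: "\<bar>trig_sum a k x\<bar> \<le> (\<Sum>i\<in>UNIV. norm (a i))" for a :: "'n::finite \<Rightarrow> complex"
proof -
  have "\<bar>trig_sum a k x\<bar> \<le> norm (\<Sum>i\<in>UNIV. a i * cis (k i \<bullet> x))" unfolding trig_sum_def by (rule abs_Re_le_cmod)
  also have "\<dots> \<le> (\<Sum>i\<in>UNIV. norm (a i * cis (k i \<bullet> x)))" by (rule norm_sum)
  finally show ?thesis by (simp add: norm_mult)
qed

lemma trig_sum_measurable [measurable]: "trig_sum a k \<in> borel_measurable borel" for a :: "'n::finite \<Rightarrow> complex"
  unfolding trig_sum_def[abs_def] by measurable

text \<open>By \<open>Re u * Re w = Re (u * w + u * cnj w) / 2\<close>, sums of frequencies come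
  from \<open>u * w\<close> and differences from \<open>u * cnj w\<close>.\<close>

lemma trig_sum_mult:
  fixes a :: "'n::finite \<Rightarrow> complex"
  shows "trig_sum a k (r *\<^sub>R x) * trig_sum a k (y + r *\<^sub>R x)
    = Re (\<Sum>i\<in>UNIV. \<Sum>j\<in>UNIV. a i * a j * cis (k j \<bullet> y) * cis ((r *\<^sub>R (k i + k j)) \<bullet> x)
        + a i * cnj (a j) * cis (- (k j \<bullet> y)) * cis ((r *\<^sub>R (k i - k j)) \<bullet> x)) / 2"
proof -
  have re: "Re u * Re w = Re (u * w + u * cnj w) / 2" for u w by (simp add: algebra_simps)
  have 1: "(a i * cis (k i \<bullet> (r *\<^sub>R x))) * (a j * cis (k j \<bullet> (y + r *\<^sub>R x)))
     = a i * a j * cis (k j \<bullet> y) * cis ((r *\<^sub>R (k i + k j)) \<bullet> x)" for i j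
    by (simp add: cis_mult[symmetric] inner_add_right inner_add_left distrib_left mult_ac)
  have 2: "(a i * cis (k i \<bullet> (r *\<^sub>R x))) * cnj (a j * cis (k j \<bullet> (y + r *\<^sub>R x)))
     = a i * cnj (a j) * cis (- (k j \<bullet> y)) * cis ((r *\<^sub>R (k i - k j)) \<bullet> x)" for i j
  proof -
    have "cis (k i \<bullet> (r *\<^sub>R x)) * cis (- (k j \<bullet> (y + r *\<^sub>R x))) = cis (- (k j \<bullet> y)) * cis ((r *\<^sub>R (k i - k j)) \<bullet> x)"
      unfolding cis_mult by (simp add: inner_add_right inner_diff_left algebra_simps)
    then show ?thesis by (simp add: cis_cnj[symmetric] mult_ac)
  qed
  show ?thesis
    unfolding trig_sum_def re cnj_sum sum_product 1 2
    by (simp add: sum.distrib)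
qed

text \<open>Substituting \<open>r *\<^sub>R x\<close> for \<open>x\<close> pulls out the volume
  factor, divides the lag by \<open>r\<close> and multiplies all frequencies by \<open>r\<close>.
  This is where the fast oscillation originates.\<close>

lemma autocorrelation_modulated:
  fixes h :: "'a::euclidean_space \<Rightarrow> real" and a :: "'n::finite \<Rightarrow> complex"
  assumes h: "integrable lborel h" "\<And>x. \<bar>h x\<bar> \<le> H" and r: "r > 0"
  shows "autocorrelation (\<lambda>x. scaled h r x * trig_sum a k x) y = r ^ DIM('a) *
    (Re (\<Sum>i\<in>UNIV. \<Sum>j\<in>UNIV. a i * a j * cis (k j \<bullet> y) * modulated_correlation h (y /\<^sub>R r) (r *\<^sub>R (k i + k j))
        + a i * cnj (a j) * cis (- (k j \<bullet> y)) * modulated_correlation h (y /\<^sub>R r) (r *\<^sub>R (k i - k j))) / 2)"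
proof -
  have [measurable]: "h \<in> borel_measurable borel" using h by auto
  note I = integrable_modulated[OF h, of "y /\<^sub>R r"]
  let ?m = "\<lambda>q x. complex_of_real (h x * h (y /\<^sub>R r + x)) * cis (q \<bullet> x)"
  let ?G = "\<lambda>x. \<Sum>i\<in>UNIV. \<Sum>j\<in>UNIV. a i * a j * cis (k j \<bullet> y) * ?m (r *\<^sub>R (k i + k j)) x
        + a i * cnj (a j) * cis (- (k j \<bullet> y)) * ?m (r *\<^sub>R (k i - k j)) x"
  have iG: "integrable lborel ?G"
    by (intro Bochner_Integration.integrable_sum Bochner_Integration.integrable_add integrable_mult_right I)
  have "autocorrelation (\<lambda>x. scaled h r x * trig_sum a k x) y
     = \<bar>r\<bar> ^ DIM('a) *\<^sub>R (\<integral>x. (scaled h r (0 + r *\<^sub>R x) * trig_sum a k (0 + r *\<^sub>R x)) * (scaled h r (y + (0 + r *\<^sub>R x)) * trig_sum a k (y + (0 + r *\<^sub>R x))) \<partial>lborel)"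
    unfolding autocorrelation_def
    by (rule lborel_integral_affine) (use r in \<open>auto simp: scaled_def\<close>)
  also have "\<dots> = r ^ DIM('a) * (\<integral>x. Re (?G x) / 2 \<partial>lborel)"
  proof -
    have "(scaled h r (0 + r *\<^sub>R x) * trig_sum a k (0 + r *\<^sub>R x)) * (scaled h r (y + (0 + r *\<^sub>R x)) * trig_sum a k (y + (0 + r *\<^sub>R x)))
       = Re (?G x) / 2" for x
    proof -
      let ?T = "\<Sum>i\<in>UNIV. \<Sum>j\<in>UNIV. a i * a j * cis (k j \<bullet> y) * cis ((r *\<^sub>R (k i + k j)) \<bullet> x)
        + a i * cnj (a j) * cis (- (k j \<bullet> y)) * cis ((r *\<^sub>R (k i - k j)) \<bullet> x)"
      have s: "scaled h r (r *\<^sub>R x) = h x" "scaled h r (y + r *\<^sub>R x) = h (y /\<^sub>R r + x)"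
        using r by (simp_all add: scaled_def scaleR_add_right)
      have "?G x = complex_of_real (h x * h (y /\<^sub>R r + x)) * ?T"
        unfolding sum_distrib_left by (intro sum.cong refl) (simp add: algebra_simps)
      then have "Re (?G x) / 2 = (h x * h (y /\<^sub>R r + x)) * (Re ?T / 2)" 
      proof -
        have "Re (complex_of_real c * T) / 2 = c * (Re T / 2)" for c T by simp
        with \<open>?G x = complex_of_real (h x * h (y /\<^sub>R r + x)) * ?T\<close> show ?thesis by (simp only:)
      qed
      also have "Re ?T / 2 = trig_sum a k (r *\<^sub>R x) * trig_sum a k (y + r *\<^sub>R x)" by (rule trig_sum_mult[symmetric])
      finally show ?thesis by (simp add: s mult_ac)
    qed
    then show ?thesis using r by (simp only: abs_of_pos real_scaleR_def)
  qed
  also have "(\<integral>x. Re (?G x) / 2 \<partial>lborel) = Re (\<integral>x. ?G x \<partial>lborel) / 2"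
    unfolding integral_Re[OF iG, symmetric] by (rule integral_divide_zero)
  also have "(\<integral>x. ?G x \<partial>lborel) = (\<Sum>i\<in>UNIV. \<Sum>j\<in>UNIV. a i * a j * cis (k j \<bullet> y) * modulated_correlation h (y /\<^sub>R r) (r *\<^sub>R (k i + k j))
        + a i * cnj (a j) * cis (- (k j \<bullet> y)) * modulated_correlation h (y /\<^sub>R r) (r *\<^sub>R (k i - k j)))"
  proof -
    have "(\<integral>x. ?G x \<partial>lborel) = (\<Sum>i\<in>UNIV. \<integral>x. (\<Sum>j\<in>UNIV. a i * a j * cis (k j \<bullet> y) * ?m (r *\<^sub>R (k i + k j)) x
        + a i * cnj (a j) * cis (- (k j \<bullet> y)) * ?m (r *\<^sub>R (k i - k j)) x) \<partial>lborel)"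
      by (rule Bochner_Integration.integral_sum)
         (intro Bochner_Integration.integrable_sum Bochner_Integration.integrable_add integrable_mult_right I)
    also have "\<dots> = (\<Sum>i\<in>UNIV. \<Sum>j\<in>UNIV. \<integral>x. a i * a j * cis (k j \<bullet> y) * ?m (r *\<^sub>R (k i + k j)) x
        + a i * cnj (a j) * cis (- (k j \<bullet> y)) * ?m (r *\<^sub>R (k i - k j)) x \<partial>lborel)"
      by (intro sum.cong refl Bochner_Integration.integral_sum)
         (intro Bochner_Integration.integrable_add integrable_mult_right I)
    also have "\<dots> = (\<Sum>i\<in>UNIV. \<Sum>j\<in>UNIV. a i * a j * cis (k j \<bullet> y) * modulated_correlation h (y /\<^sub>R r) (r *\<^sub>R (k i + k j))
        + a i * cnj (a j) * cis (- (k j \<bullet> y)) * modulated_correlation h (y /\<^sub>R r) (r *\<^sub>R (k i - k j)))"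
      unfolding modulated_correlation_def
      by (intro sum.cong refl, subst Bochner_Integration.integral_add)
         (intro integrable_mult_right I, intro integrable_mult_right I, simp only: integral_mult_right_zero)
    finally show ?thesis .
  qed
  finally show ?thesis .
qed

lemma integral_scaled:
  fixes f :: "'a::euclidean_space \<Rightarrow> 'b::{banach, second_countable_topology}"
  assumes "f \<in> borel_measurable borel" "r > 0"
  shows "(\<integral>x. f x \<partial>lborel) = r ^ DIM('a) *\<^sub>R (\<integral>x. f (r *\<^sub>R x) \<partial>lborel)"
  using lborel_integral_affine[OF assms(1), of r 0] assms(2) by simp

lemma integrable_scaled:
  fixes h :: "'a::euclidean_space \<Rightarrow> real"
  assumes "integrable lborel h" "r > 0"
  shows "integrable lborel (scaled h r)"
  using lborel_integrable_affine_iff[of h "inverse r" 0] assms by (auto simp: scaled_def[abs_def])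

lemma integral_abs_scaled:
  fixes h :: "'a::euclidean_space \<Rightarrow> real"
  assumes [measurable]: "h \<in> borel_measurable borel" and "r > 0"
  shows "(\<integral>x. \<bar>scaled h r x\<bar> \<partial>lborel) = r ^ DIM('a) * (\<integral>x. \<bar>h x\<bar> \<partial>lborel)"
proof -
  have [measurable]: "scaled h r \<in> borel_measurable borel" unfolding scaled_def[abs_def] by measurable
  show ?thesis using integral_scaled[of "\<lambda>x. \<bar>scaled h r x\<bar>" r] assms(2) by (simp add: scaled_def)
qed

lemma modulated_window_mass:
  fixes a :: "'n::finite \<Rightarrow> complex" and h :: "'a::euclidean_space \<Rightarrow> real"
  assumes h: "integrable lborel h" "\<And>x. \<bar>h x\<bar> \<le> H" and r: "r > 0"
  shows "integrable lborel (\<lambda>x. scaled h r x * trig_sum a k x)"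
    and "\<And>x. \<bar>scaled h r x * trig_sum a k x\<bar> \<le> H * (\<Sum>i\<in>UNIV. norm (a i))"
    and "(\<integral>x. \<bar>scaled h r x * trig_sum a k x\<bar> \<partial>lborel) \<le> r ^ DIM('a) * ((\<Sum>i\<in>UNIV. norm (a i)) * (\<integral>x. \<bar>h x\<bar> \<partial>lborel))"
proof -
  have [measurable]: "h \<in> borel_measurable borel" using h by auto
  let ?A = "\<Sum>i\<in>UNIV. norm (a i)"
  have iS: "integrable lborel (scaled h r)" by (rule integrable_scaled[OF h(1) r])
  then have [measurable]: "scaled h r \<in> borel_measurable borel" by auto
  have A0: "0 \<le> ?A" by (rule sum_nonneg) auto
  have le: "\<bar>scaled h r x * trig_sum a k x\<bar> \<le> \<bar>scaled h r x\<bar> * ?A" for x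
    unfolding abs_mult by (intro mult_left_mono trig_sum_bound) auto
  have i2: "integrable lborel (\<lambda>x. \<bar>scaled h r x\<bar> * ?A)" using iS by simp
  show i: "integrable lborel (\<lambda>x. scaled h r x * trig_sum a k x)"
    by (rule Bochner_Integration.integrable_bound[OF i2]) (use le A0 in \<open>auto simp: abs_mult\<close>)
  show "\<bar>scaled h r x * trig_sum a k x\<bar> \<le> H * ?A" for x
    using h(2)[of "x /\<^sub>R r"] by (intro order_trans[OF le] mult_right_mono A0) (simp add: scaled_def)
  have "(\<integral>x. \<bar>scaled h r x * trig_sum a k x\<bar> \<partial>lborel) \<le> (\<integral>x. \<bar>scaled h r x\<bar> * ?A \<partial>lborel)"
    using i i2 by (intro integral_mono le) auto
  also have "\<dots> = r ^ DIM('a) * (?A * (\<integral>x. \<bar>h x\<bar> \<partial>lborel))"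
    using integral_abs_scaled[OF _ r, of h] by simp
  finally show "(\<integral>x. \<bar>scaled h r x * trig_sum a k x\<bar> \<partial>lborel) \<le> r ^ DIM('a) * (?A * (\<integral>x. \<bar>h x\<bar> \<partial>lborel))" .
qed

lemma norm_frequency_at_top:
  fixes q :: "nat \<Rightarrow> 'a::euclidean_space"
  assumes R: "filterlim R at_top sequentially" and q: "q \<longlonglongrightarrow> l" "l \<noteq> 0"
  shows "filterlim (\<lambda>n. norm (R n *\<^sub>R q n)) at_top sequentially"
proof -
  have "filterlim (\<lambda>n. \<bar>R n\<bar>) at_top sequentially"
    using filterlim_at_infinity_imp_norm_at_top[OF filterlim_at_top_imp_at_infinity[OF R]] by simp
  moreover have "(\<lambda>n. norm (q n)) \<longlonglongrightarrow> norm l" by (intro tendsto_intros q)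
  ultimately show ?thesis
    using q(2) filterlim_tendsto_pos_mult_at_top[of "\<lambda>n. norm (q n)" "norm l" sequentially "\<lambda>n. \<bar>R n\<bar>"]
    by (simp add: mult.commute)
qed

text \<open>Frequencies with a nonzero limit diverge after scaling, and their terms vanish. By
  disjointness, differences are nonzero for \<open>i \<noteq> j\<close>, and sums are nonzero except
  for \<open>i = j\<close> at frequency 0. The surviving terms need frequency exactly 0 for every
  \<open>n\<close>, not merely in the limit, which is why \<open>\<kappa> i = 0\<close> is required
  to force \<open>k i n = 0\<close>.\<close>

lemma autocorrelation_limit:
  fixes h :: "'a::euclidean_space \<Rightarrow> real" and a :: "'n::finite \<Rightarrow> complex" and k :: "'n \<Rightarrow> nat \<Rightarrow> 'a"
  assumes h: "h \<in> window_class p" "0 < p"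
    and R: "\<And>n. 0 < R n" "filterlim R at_top sequentially"
    and k: "\<And>i. k i \<longlonglongrightarrow> \<kappa> i" "\<And>i n. \<kappa> i = 0 \<Longrightarrow> k i n = 0"
    and dis: "\<And>i j. i \<noteq> j \<Longrightarrow> {\<kappa> i, - \<kappa> i} \<inter> {\<kappa> j, - \<kappa> j} = {}"
  shows "(\<lambda>n. inverse (R n ^ DIM('a)) * autocorrelation (\<lambda>x. scaled h (R n) x * trig_sum a (\<lambda>i. k i n) x) y)
    \<longlonglongrightarrow> window_moment 2 h * (\<Sum>i\<in>UNIV. (norm (a i))\<^sup>2 / 2 * cos (\<kappa> i \<bullet> y) + (if \<kappa> i = 0 then Re ((a i)\<^sup>2) / 2 else 0))"
proof -
  have hi: "integrable lborel h" using h by (auto simp: window_class_def)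
  have "bounded (range h)" using h by (simp add: window_class_def)
  then obtain H where H: "\<And>x. \<bar>h x\<bar> \<le> H" by (auto simp: bounded_iff)
  note td = translation_defect_tendsto[OF h]
  let ?m = "window_moment 2 h" and ?y = "\<lambda>n. y /\<^sub>R R n"
  have Rinv: "(\<lambda>n. inverse (R n)) \<longlonglongrightarrow> 0" by (rule tendsto_inverse_0_at_top[OF R(2)])
  have y0: "?y \<longlonglongrightarrow> 0" using tendsto_scaleR[OF Rinv tendsto_const[of y]] by simp
  have T1: "(\<lambda>n. a i * a j * cis (k j n \<bullet> y) * modulated_correlation h (?y n) (R n *\<^sub>R (k i n + k j n)))
     \<longlonglongrightarrow> (if j = i then if \<kappa> i = 0 then (a i)\<^sup>2 * of_real ?m else 0 else 0)" for i j
  proof (cases "j = i \<and> \<kappa> i = 0")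
    case True
    have "(\<lambda>n. a i * a j * 1 * modulated_correlation h (?y n) 0) \<longlonglongrightarrow> a i * a j * 1 * of_real ?m"
      by (intro tendsto_intros modulated_correlation_tendsto_moment[OF hi H td y0])
    then show ?thesis using True k(2) by (simp add: power2_eq_square)
  next
    case False
    have nz: "\<kappa> i + \<kappa> j \<noteq> 0"
    proof
      assume s: "\<kappa> i + \<kappa> j = 0"
      then have e: "\<kappa> i = - \<kappa> j" by (simp add: eq_neg_iff_add_eq_0)
      then have "i = j" using dis[of i j] by auto
      then have "\<kappa> i + \<kappa> i = 0" using s by simp
      then have "\<kappa> i = 0" by (simp flip: scaleR_2)
      then show False using False \<open>i = j\<close> by simp
    qed
    have "(\<lambda>n. modulated_correlation h (?y n) (R n *\<^sub>R (k i n + k j n))) \<longlonglongrightarrow> 0"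
      by (rule modulated_correlation_tendsto_0[OF hi H td y0 norm_frequency_at_top[OF R(2) tendsto_add[OF k(1) k(1)] nz]])
    then have "(\<lambda>n. a i * a j * cis (k j n \<bullet> y) * modulated_correlation h (?y n) (R n *\<^sub>R (k i n + k j n)))
      \<longlonglongrightarrow> a i * a j * cis (\<kappa> j \<bullet> y) * 0"
      by (intro tendsto_intros k(1))
    then show ?thesis using False by auto
  qed
  have T2: "(\<lambda>n. a i * cnj (a j) * cis (- (k j n \<bullet> y)) * modulated_correlation h (?y n) (R n *\<^sub>R (k i n - k j n)))
     \<longlonglongrightarrow> (if j = i then of_real ((norm (a i))\<^sup>2) * cis (- (\<kappa> i \<bullet> y)) * of_real ?m else 0)" for i j
  proof (cases "j = i")
    case True
    have "(\<lambda>n. a i * cnj (a i) * cis (- (k i n \<bullet> y)) * modulated_correlation h (?y n) 0)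
      \<longlonglongrightarrow> a i * cnj (a i) * cis (- (\<kappa> i \<bullet> y)) * of_real ?m"
      by (intro tendsto_intros k(1) modulated_correlation_tendsto_moment[OF hi H td y0])
    then show ?thesis unfolding complex_norm_square using True by simp
  next
    case False
    have nz: "\<kappa> i - \<kappa> j \<noteq> 0" using dis[of i j] False by auto
    have "(\<lambda>n. modulated_correlation h (?y n) (R n *\<^sub>R (k i n - k j n))) \<longlonglongrightarrow> 0"
      by (rule modulated_correlation_tendsto_0[OF hi H td y0 norm_frequency_at_top[OF R(2) tendsto_diff[OF k(1) k(1)] nz]])
    then have "(\<lambda>n. a i * cnj (a j) * cis (- (k j n \<bullet> y)) * modulated_correlation h (?y n) (R n *\<^sub>R (k i n - k j n)))
      \<longlonglongrightarrow> a i * cnj (a j) * cis (- (\<kappa> j \<bullet> y)) * 0"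
      by (intro tendsto_intros k(1))
    then show ?thesis using False by simp
  qed
  have "inverse (R n ^ DIM('a)) * autocorrelation (\<lambda>x. scaled h (R n) x * trig_sum a (\<lambda>i. k i n) x) y
     = Re (\<Sum>i\<in>UNIV. \<Sum>j\<in>UNIV. a i * a j * cis (k j n \<bullet> y) * modulated_correlation h (?y n) (R n *\<^sub>R (k i n + k j n))
        + a i * cnj (a j) * cis (- (k j n \<bullet> y)) * modulated_correlation h (?y n) (R n *\<^sub>R (k i n - k j n))) / 2" for n
    unfolding autocorrelation_modulated[OF hi H R(1)] using R(1)[of n] by (simp only: mult.assoc[symmetric]) simp
  moreover have "(\<lambda>n. Re (\<Sum>i\<in>UNIV. \<Sum>j\<in>UNIV. a i * a j * cis (k j n \<bullet> y) * modulated_correlation h (?y n) (R n *\<^sub>R (k i n + k j n))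
        + a i * cnj (a j) * cis (- (k j n \<bullet> y)) * modulated_correlation h (?y n) (R n *\<^sub>R (k i n - k j n))) / 2)
    \<longlonglongrightarrow> Re (\<Sum>i\<in>UNIV. \<Sum>j\<in>UNIV. (if j = i then if \<kappa> i = 0 then (a i)\<^sup>2 * of_real ?m else 0 else 0)
        + (if j = i then of_real ((norm (a i))\<^sup>2) * cis (- (\<kappa> i \<bullet> y)) * of_real ?m else 0)) / 2"
    by (intro tendsto_intros T1 T2) auto
  moreover have "Re (\<Sum>i\<in>UNIV. \<Sum>j\<in>UNIV. (if j = i then if \<kappa> i = 0 then (a i)\<^sup>2 * of_real ?m else 0 else 0)
        + (if j = i then of_real ((norm (a i))\<^sup>2) * cis (- (\<kappa> i \<bullet> y)) * of_real ?m else 0)) / 2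
     = ?m * (\<Sum>i\<in>UNIV. (norm (a i))\<^sup>2 / 2 * cos (\<kappa> i \<bullet> y) + (if \<kappa> i = 0 then Re ((a i)\<^sup>2) / 2 else 0))"
    unfolding sum.distrib sum.delta[OF finite] Re_sum sum_distrib_left sum_divide_distrib
    by (auto simp: sum.distrib[symmetric] Re_sum sum_divide_distrib sum_distrib_left add_divide_distrib algebra_simps intro!: sum.cong)
  ultimately show ?thesis by (simp only:)
qed

section \<open>Convergence of the normalised variance\<close>

context brillinger_process
begin

text \<open>Taking the real part avoids a proof that the second reduced measure is
  symmetric.\<close>

definition asymptotic_variance :: "('a \<Rightarrow> real) \<Rightarrow> 'a \<Rightarrow> real" where
  "asymptotic_variance h q = \<gamma> * window_moment 2 h * Re (structure_factor \<gamma> (\<nu> 2) q)"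

lemma asymptotic_variance_eq:
  "asymptotic_variance h q = window_moment 2 h * (\<gamma> + sintegral (\<nu> 2) (\<lambda>y. cos (q \<bullet> y 1)))"
proof -
  note p = \<nu>_parts[of 2, simplified]
  interpret A: finite_measure "fst (\<nu> 2)" by (rule p)
  interpret B: finite_measure "snd (\<nu> 2)" by (rule p)
  have m: "(\<lambda>x. cis (- (q \<bullet> x))) \<in> borel_measurable (borel :: 'a measure)" by measurable
  have i: "integrable (fst (\<nu> 2)) (\<lambda>y. cis (- (q \<bullet> y 1)))" "integrable (snd (\<nu> 2)) (\<lambda>y. cis (- (q \<bullet> y 1)))"
    using measurable_compose[OF coordinate_measurable(1) m] measurable_compose[OF coordinate_measurable(2) m]
    by (auto intro!: A.integrable_const_bound[where B=1] B.integrable_const_bound[where B=1])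
  have "Re (sintegral (\<nu> 2) (\<lambda>y. cis (- (q \<bullet> y 1)))) = sintegral (\<nu> 2) (\<lambda>y. cos (q \<bullet> y 1))"
    unfolding sintegral_def minus_complex.sel integral_Re[OF i(1), symmetric] integral_Re[OF i(2), symmetric] by simp
  then show ?thesis using \<gamma>_pos
    by (simp add: asymptotic_variance_def structure_factor_def field_simps)
qed

text \<open>By \<open>variance_functional_eq\<close> the normalised variance integrates the
  normalised autocorrelation \<open>F n\<close>, which converges pointwise and is bounded by
  \<open>K\<close> uniformly in lag and \<open>n\<close>. Finiteness of \<open>\<nu> 2\<close> then
  gives dominated convergence, and the cosines in the limit assemble to structure factors.\<close>

theorem variance_limit:
  fixes h :: "'a \<Rightarrow> real" and a :: "'n::finite \<Rightarrow> complex" and k :: "'n \<Rightarrow> nat \<Rightarrow> 'a"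
  assumes h: "h \<in> window_class p" "0 < p"
    and R: "\<And>n. 0 < R n" "filterlim R at_top sequentially"
    and k: "\<And>i. k i \<longlonglongrightarrow> \<kappa> i" "\<And>i n. \<kappa> i = 0 \<Longrightarrow> k i n = 0"
    and dis: "\<And>i j. i \<noteq> j \<Longrightarrow> {\<kappa> i, - \<kappa> i} \<inter> {\<kappa> j, - \<kappa> j} = {}"
  shows "(\<lambda>n. inverse (R n ^ DIM('a)) * variance_functional (\<lambda>x. scaled h (R n) x * trig_sum a (\<lambda>i. k i n) x))
    \<longlonglongrightarrow> (\<Sum>i\<in>UNIV. ((norm (a i))\<^sup>2 / 2 + (if \<kappa> i = 0 then Re ((a i)\<^sup>2) / 2 else 0)) * asymptotic_variance h (\<kappa> i))"
proof -
  have hi: "integrable lborel h" using h by (auto simp: window_class_def)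
  then have [measurable]: "h \<in> borel_measurable borel" by auto
  have "bounded (range h)" using h by (simp add: window_class_def)
  then obtain H where H: "\<And>x. \<bar>h x\<bar> \<le> H" by (auto simp: bounded_iff)
  let ?g = "\<lambda>n x. scaled h (R n) x * trig_sum a (\<lambda>i. k i n) x"
  let ?A = "\<Sum>i\<in>UNIV. norm (a i)" and ?m = "window_moment 2 h"
  note g = modulated_window_mass[OF hi H R(1), where a=a]
  define F where "F n y = inverse (R n ^ DIM('a)) * autocorrelation (?g n) y" for n y
  define L where "L y = ?m * (\<Sum>i\<in>UNIV. (norm (a i))\<^sup>2 / 2 * cos (\<kappa> i \<bullet> y) + (if \<kappa> i = 0 then Re ((a i)\<^sup>2) / 2 else 0))" for y
  define K where "K = H * ?A * (?A * (\<integral>x. \<bar>h x\<bar> \<partial>lborel))"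
  have FL: "(\<lambda>n. F n y) \<longlonglongrightarrow> L y" for y
    unfolding F_def L_def by (rule autocorrelation_limit[OF h R k dis])
  have [measurable]: "?g n \<in> borel_measurable borel" for n using g(1)[of n] by auto
  have Fm [measurable]: "F n \<in> borel_measurable borel" for n unfolding F_def[abs_def] by measurable
  have Lm [measurable]: "L \<in> borel_measurable borel" unfolding L_def[abs_def] by measurable
  have FK: "\<bar>F n y\<bar> \<le> K" for n y
  proof -
    have A0: "0 \<le> ?A" by (rule sum_nonneg) auto
    have H0: "0 \<le> H" using H[of 0] by linarith
    have "\<bar>F n y\<bar> \<le> inverse (R n ^ DIM('a)) * (H * ?A * (\<integral>x. \<bar>?g n x\<bar> \<partial>lborel))"
    proof -
      have "\<bar>inverse (R n ^ DIM('a))\<bar> = inverse (R n ^ DIM('a))" using R(1)[of n] by simp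
      moreover have "\<bar>autocorrelation (?g n) y\<bar> \<le> H * ?A * (\<integral>x. \<bar>?g n x\<bar> \<partial>lborel)"
        by (rule autocorrelation_bound[OF g(1,2)])
      ultimately show ?thesis unfolding F_def abs_mult[of "inverse (R n ^ DIM('a))"] using R(1)[of n]
        by (simp only:) (intro mult_left_mono, assumption, simp)
    qed
    also have "\<dots> \<le> inverse (R n ^ DIM('a)) * (H * ?A * (R n ^ DIM('a) * (?A * (\<integral>x. \<bar>h x\<bar> \<partial>lborel))))"
      using R(1)[of n] A0 H0 by (intro mult_left_mono g(3)) auto
    also have "\<dots> = K" using R(1)[of n] by (simp add: K_def)
    finally show ?thesis .
  qed
  have vf: "inverse (R n ^ DIM('a)) * variance_functional (?g n) = \<gamma> * F n 0 + sintegral (\<nu> 2) (\<lambda>y. F n (y 1))" for n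
    unfolding variance_functional_eq[OF g(1,2)] F_def sintegral_def by (simp add: algebra_simps)
  have dct: "(\<lambda>n. \<integral>y. F n (y 1) \<partial>N) \<longlonglongrightarrow> (\<integral>y. L (y 1) \<partial>N)"
    if N: "finite_measure N" and m: "(\<lambda>y. y 1) \<in> borel_measurable N" for N :: "(nat \<Rightarrow> 'a) measure"
  proof (rule integral_dominated_convergence[where w="\<lambda>_. K"])
    interpret finite_measure N by (rule N)
    show "(\<lambda>y. L (y 1)) \<in> borel_measurable N" "\<And>n. (\<lambda>y. F n (y 1)) \<in> borel_measurable N"
      by (rule measurable_compose[OF m Lm] measurable_compose[OF m Fm])+
    show "integrable N (\<lambda>_. K)" by simp
  qed (use FL FK in auto)
  note p = \<nu>_parts[of 2, simplified] coordinate_measurable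
  have "(\<lambda>n. \<gamma> * F n 0 + sintegral (\<nu> 2) (\<lambda>y. F n (y 1))) \<longlonglongrightarrow> \<gamma> * L 0 + sintegral (\<nu> 2) (\<lambda>y. L (y 1))"
    unfolding sintegral_def by (intro tendsto_intros FL dct p)
  also have "\<gamma> * L 0 + sintegral (\<nu> 2) (\<lambda>y. L (y 1))
     = (\<Sum>i\<in>UNIV. ((norm (a i))\<^sup>2 / 2 + (if \<kappa> i = 0 then Re ((a i)\<^sup>2) / 2 else 0)) * asymptotic_variance h (\<kappa> i))"
  proof -
    let ?w = "\<lambda>i. (norm (a i))\<^sup>2 / 2 + (if \<kappa> i = 0 then Re ((a i)\<^sup>2) / 2 else 0)"
    have L: "L y = (\<Sum>i\<in>UNIV. (?m * ?w i) * cos (\<kappa> i \<bullet> y))" for y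
      unfolding L_def sum_distrib_left by (intro sum.cong refl) (auto simp: algebra_simps)
    have c: "(\<lambda>y. cos (\<kappa> i \<bullet> y)) \<in> borel_measurable borel" for i by measurable
    have ci: "integrable (fst (\<nu> 2)) (\<lambda>y. cos (\<kappa> i \<bullet> y 1))" "integrable (snd (\<nu> 2)) (\<lambda>y. cos (\<kappa> i \<bullet> y 1))" for i
      using sintegral_bound(2,3)[OF c[of i], of 1] by auto
    have "sintegral (\<nu> 2) (\<lambda>y. L (y 1)) = (\<Sum>i\<in>UNIV. (?m * ?w i) * sintegral (\<nu> 2) (\<lambda>y. cos (\<kappa> i \<bullet> y 1)))"
    proof -
      have e: "(\<integral>y. (\<Sum>i\<in>UNIV. (?m * ?w i) * cos (\<kappa> i \<bullet> y 1)) \<partial>N) = (\<Sum>i\<in>UNIV. (?m * ?w i) * (\<integral>y. cos (\<kappa> i \<bullet> y 1) \<partial>N))"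
        if "\<And>i. integrable N (\<lambda>y. cos (\<kappa> i \<bullet> y 1))" for N :: "(nat \<Rightarrow> 'a) measure"
        by (subst Bochner_Integration.integral_sum) (intro integrable_mult_right that, simp only: integral_mult_right_zero)
      show ?thesis unfolding sintegral_def L e[OF ci(1)] e[OF ci(2)]
        by (simp only: right_diff_distrib sum_subtractf)
    qed
    moreover have "\<gamma> * L 0 = (\<Sum>i\<in>UNIV. (?m * ?w i) * \<gamma>)" unfolding L by (simp add: sum_distrib_left mult_ac)
    ultimately show ?thesis
      unfolding asymptotic_variance_eq by (simp only: sum.distrib[symmetric]) (intro sum.cong refl, simp add: algebra_simps)
  qed
  finally show ?thesis unfolding vf .
qed

end

section \<open>The limiting field and the scattering variables\<close>

lemma Re_complex_of_real_mult: "Re (complex_of_real c * z) = c * Re z"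
  by simp

definition normal_pair :: "(real \<times> real) measure" where
  "normal_pair = std_normal_distribution \<Otimes>\<^sub>M std_normal_distribution"

definition scaled_complex :: "real \<Rightarrow> real \<Rightarrow> real \<times> real \<Rightarrow> complex" where
  "scaled_complex \<alpha> \<beta> p = Complex (\<alpha> * fst p) (\<beta> * snd p)"

text \<open>An image of two independent standard normal variables rather than a density, so that a
  standard deviation may be 0, as happens for the imaginary part at wave vector 0. The parameters
  are standard deviations, not variances.\<close>

definition complex_normal :: "real \<Rightarrow> real \<Rightarrow> complex measure" where
  "complex_normal \<alpha> \<beta> = distr normal_pair borel (scaled_complex \<alpha> \<beta>)"

lemma sets_normal_pair [measurable_cong]: "sets normal_pair = sets (borel \<Otimes>\<^sub>M borel)"
  unfolding normal_pair_def by (rule sets_pair_measure_cong) auto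

lemma prob_space_normal_pair: "prob_space normal_pair"
proof -
  interpret prob_space std_normal_distribution by (rule prob_space_std_normal)
  interpret pair_prob_space std_normal_distribution std_normal_distribution ..
  show ?thesis unfolding normal_pair_def by (rule prob_space_axioms)
qed

lemma scaled_complex_measurable [measurable]: "scaled_complex \<alpha> \<beta> \<in> borel_measurable normal_pair"
proof -
  have "scaled_complex \<alpha> \<beta> = (\<lambda>p. complex_of_real (\<alpha> * fst p) + \<i> * complex_of_real (\<beta> * snd p))"
    by (auto simp: scaled_complex_def fun_eq_iff complex_eq_iff)
  then show ?thesis by simp
qed

lemma sets_complex_normal [simp, measurable_cong]: "sets (complex_normal \<alpha> \<beta>) = sets borel"
  by (simp add: complex_normal_def)

lemma prob_space_complex_normal: "prob_space (complex_normal \<alpha> \<beta>)"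
  unfolding complex_normal_def by (rule prob_space.prob_space_distr[OF prob_space_normal_pair]) simp

lemma distr_normal_pair_fst: "distr normal_pair borel fst = std_normal_distribution"
  and distr_normal_pair_snd: "distr normal_pair borel snd = std_normal_distribution"
proof -
  interpret prob_space std_normal_distribution by (rule prob_space_std_normal)
  interpret pair_prob_space std_normal_distribution std_normal_distribution ..
  have b: "distr normal_pair borel f = distr normal_pair std_normal_distribution f" for f :: "real \<times> real \<Rightarrow> real"
    by (rule distr_cong) auto
  show "distr normal_pair borel fst = std_normal_distribution"
    unfolding b unfolding normal_pair_def by (rule prob_space.distr_pair_fst[OF prob_space_std_normal])
  have "distr normal_pair std_normal_distribution snd = distr (distr normal_pair normal_pair (\<lambda>(x, y). (y, x))) std_normal_distribution fst"
    unfolding normal_pair_def by (subst distr_distr) (auto simp: comp_def split_beta')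
  also have "distr normal_pair normal_pair (\<lambda>(x, y). (y, x)) = normal_pair"
    unfolding normal_pair_def by (rule distr_pair_swap[symmetric])
  also have "distr normal_pair std_normal_distribution fst = std_normal_distribution"
    unfolding normal_pair_def by (rule prob_space.distr_pair_fst[OF prob_space_std_normal])
  finally show "distr normal_pair borel snd = std_normal_distribution" unfolding b .
qed

lemma distr_scaled_normal: "\<alpha> > 0 \<Longrightarrow> distr std_normal_distribution borel (\<lambda>x. \<alpha> * x) = density lborel (normal_density 0 \<alpha>)"
proof -
  assume \<alpha>: "\<alpha> > 0"
  interpret prob_space std_normal_distribution by (rule prob_space_std_normal)
  have "distr std_normal_distribution lborel (\<lambda>x. x) = density lborel std_normal_density"
    by (subst distr_cong[of _ std_normal_distribution _ std_normal_distribution _ "\<lambda>x. x"]) (auto simp: distr_id)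
  then have "distributed std_normal_distribution lborel (\<lambda>x. x) std_normal_density"
    by (auto simp: distributed_def)
  from normal_density_affine[OF this, of \<alpha> 0] \<alpha>
  have "distributed std_normal_distribution lborel (\<lambda>x. \<alpha> * x) (normal_density 0 \<alpha>)" by simp
  then have "distr std_normal_distribution lborel (\<lambda>x. \<alpha> * x) = density lborel (normal_density 0 \<alpha>)"
    by (simp add: distributed_def)
  moreover have "distr std_normal_distribution lborel (\<lambda>x. \<alpha> * x) = distr std_normal_distribution borel (\<lambda>x. \<alpha> * x)"
    by (rule distr_cong) auto
  ultimately show ?thesis by simp
qed

lemma centered_normal_of_distr:
  assumes "prob_space N" and X [measurable]: "X \<in> borel_measurable N" and d: "distr N borel X = distr std_normal_distribution borel (\<lambda>x. \<alpha> * x)" and "\<alpha> \<ge> 0"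
  shows "centered_normal N X (\<alpha>\<^sup>2)"
proof (cases "\<alpha> = 0")
  case True
  have "AE x in distr N borel X. x = 0" unfolding d using True by (subst AE_distr_iff) auto
  then have "AE \<omega> in N. X \<omega> = 0" by (subst (asm) AE_distr_iff) auto
  then show ?thesis using True X by (simp add: centered_normal_def)
next
  case False
  then have \<alpha>: "\<alpha> > 0" using assms by simp
  have "distr N lborel X = distr N borel X" by (rule distr_cong) auto
  then have "distributed N lborel X (normal_density 0 \<alpha>)"
    using d distr_scaled_normal[OF \<alpha>] X by (simp add: distributed_def)
  then show ?thesis using \<alpha> by (simp add: centered_normal_def)
qed

text \<open>The law of \<open>Z\<close> determines all requirements: \<open>tr\<close> replaces
  \<open>Z\<close> by the model pair, whose marginals and independence are explicit.\<close>

lemma centered_complex_normal_of_distr: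
  assumes N: "prob_space N" and Z [measurable]: "Z \<in> borel_measurable N" and d: "distr N borel Z = complex_normal \<alpha> \<beta>" and ab: "\<alpha> \<ge> 0" "\<beta> \<ge> 0"
  shows "centered_complex_normal N Z (\<alpha>\<^sup>2) (\<beta>\<^sup>2)"
proof -
  interpret N: prob_space N by (rule N)
  interpret s: prob_space std_normal_distribution by (rule prob_space_std_normal)
  have tr: "distr N K (\<lambda>\<omega>. F (Z \<omega>)) = distr normal_pair K (\<lambda>p. F (scaled_complex \<alpha> \<beta> p))"
    if "F \<in> borel \<rightarrow>\<^sub>M K" for F K
  proof -
    have "distr N K (\<lambda>\<omega>. F (Z \<omega>)) = distr (distr N borel Z) K F"
      using that by (subst distr_distr) (auto simp: comp_def)
    also have "\<dots> = distr normal_pair K (\<lambda>p. F (scaled_complex \<alpha> \<beta> p))"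
      unfolding d complex_normal_def using that by (subst distr_distr) (auto simp: comp_def)
    finally show ?thesis .
  qed
  have re: "distr N borel (\<lambda>\<omega>. Re (Z \<omega>)) = distr std_normal_distribution borel (\<lambda>x. \<alpha> * x)"
  proof -
    have "distr N borel (\<lambda>\<omega>. Re (Z \<omega>)) = distr normal_pair borel (\<lambda>p. \<alpha> * fst p)"
      by (subst tr) (auto simp: scaled_complex_def)
    also have "\<dots> = distr (distr normal_pair borel fst) borel (\<lambda>x. \<alpha> * x)"
      by (subst distr_distr) (auto simp: comp_def)
    finally show ?thesis by (simp add: distr_normal_pair_fst)
  qed
  have im: "distr N borel (\<lambda>\<omega>. Im (Z \<omega>)) = distr std_normal_distribution borel (\<lambda>x. \<beta> * x)"
  proof -
    have "distr N borel (\<lambda>\<omega>. Im (Z \<omega>)) = distr normal_pair borel (\<lambda>p. \<beta> * snd p)"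
      by (subst tr) (auto simp: scaled_complex_def)
    also have "\<dots> = distr (distr normal_pair borel snd) borel (\<lambda>x. \<beta> * x)"
      by (subst distr_distr) (auto simp: comp_def)
    finally show ?thesis by (simp add: distr_normal_pair_snd)
  qed
  have sf: "sigma_finite_measure (distr std_normal_distribution borel (\<lambda>x. \<beta> * x))"
    by (intro prob_space_imp_sigma_finite s.prob_space_distr) simp
  have "distr N borel (\<lambda>\<omega>. Re (Z \<omega>)) \<Otimes>\<^sub>M distr N borel (\<lambda>\<omega>. Im (Z \<omega>)) = distr N (borel \<Otimes>\<^sub>M borel) (\<lambda>\<omega>. (Re (Z \<omega>), Im (Z \<omega>)))"
  proof -
    have "distr N borel (\<lambda>\<omega>. Re (Z \<omega>)) \<Otimes>\<^sub>M distr N borel (\<lambda>\<omega>. Im (Z \<omega>))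
       = distr normal_pair (borel \<Otimes>\<^sub>M borel) (\<lambda>(x, y). (\<alpha> * x, \<beta> * y))"
      unfolding re im normal_pair_def by (rule pair_measure_distr) (auto intro: sf)
    also have "\<dots> = distr N (borel \<Otimes>\<^sub>M borel) (\<lambda>\<omega>. (Re (Z \<omega>), Im (Z \<omega>)))"
      by (subst tr[of "\<lambda>z. (Re z, Im z)"]) (auto simp: scaled_complex_def split_beta')
    finally show ?thesis .
  qed
  then have "N.indep_var borel (\<lambda>\<omega>. Re (Z \<omega>)) borel (\<lambda>\<omega>. Im (Z \<omega>))"
    unfolding N.indep_var_distribution_eq by simp
  then show ?thesis
    unfolding centered_complex_normal_def
    using centered_normal_of_distr[OF N _ re ab(1)] centered_normal_of_distr[OF N _ im ab(2)] by simp
qed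

lemma integral_cis_complex_normal:
  "(\<integral>z. cis (c \<bullet> z) \<partial>complex_normal \<alpha> \<beta>) = complex_of_real (exp (- ((Re c * \<alpha>)\<^sup>2 + (Im c * \<beta>)\<^sup>2) / 2))"
proof -
  interpret s: prob_space std_normal_distribution by (rule prob_space_std_normal)
  interpret p: pair_prob_space std_normal_distribution std_normal_distribution ..
  have e: "cis (c \<bullet> scaled_complex \<alpha> \<beta> q) = cis (fst q * (Re c * \<alpha>)) * cis (snd q * (Im c * \<beta>))" for q
    by (simp add: scaled_complex_def inner_complex_def cis_mult mult_ac)
  have "(\<integral>z. cis (c \<bullet> z) \<partial>complex_normal \<alpha> \<beta>) = (\<integral>q. cis (fst q * (Re c * \<alpha>)) * cis (snd q * (Im c * \<beta>)) \<partial>normal_pair)"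
    unfolding complex_normal_def by (subst integral_distr) (simp_all add: e)
  also have "\<dots> = (\<integral>q. (case q of (x, y) \<Rightarrow> cis (x * (Re c * \<alpha>)) * cis (y * (Im c * \<beta>))) \<partial>(std_normal_distribution \<Otimes>\<^sub>M std_normal_distribution))"
    unfolding normal_pair_def by (simp add: split_beta')
  also have "\<dots> = (\<integral>x. \<integral>y. cis (x * (Re c * \<alpha>)) * cis (y * (Im c * \<beta>)) \<partial>std_normal_distribution \<partial>std_normal_distribution)"
  proof (rule p.integral_fst[symmetric])
    show "integrable (std_normal_distribution \<Otimes>\<^sub>M std_normal_distribution) (\<lambda>(x, y). cis (x * (Re c * \<alpha>)) * cis (y * (Im c * \<beta>)))"
      unfolding split_beta' by (rule p.P.integrable_const_bound[where B=1]) (simp add: norm_mult, measurable)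
  qed
  also have "\<dots> = complex_of_real (exp (- (Re c * \<alpha>)\<^sup>2 / 2)) * complex_of_real (exp (- (Im c * \<beta>)\<^sup>2 / 2))"
    by (simp only: integral_mult_right_zero integral_mult_left_zero std_normal_cis)
  also have "\<dots> = complex_of_real (exp (- ((Re c * \<alpha>)\<^sup>2 + (Im c * \<beta>)\<^sup>2) / 2))"
    by (simp add: exp_add[symmetric] add_divide_distrib flip: of_real_mult)
  finally show ?thesis .
qed

lemma vec_lambda_measurable:
  fixes f :: "'n::finite \<Rightarrow> 'w \<Rightarrow> complex"
  assumes "\<And>i. f i \<in> borel_measurable M"
  shows "(\<lambda>\<omega>. \<chi> i. f i \<omega>) \<in> borel_measurable M"
proof -
  note [measurable] = assms
  have "(\<lambda>\<omega>. (\<chi> i. f i \<omega>) \<bullet> b) \<in> borel_measurable M" if b: "b \<in> (Basis :: (complex ^ 'n) set)" for b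
  proof -
    obtain i u where "b = axis i u" using b by (auto simp: Basis_vec_def)
    then show ?thesis by (simp add: inner_axis)
  qed
  then show ?thesis by (subst borel_measurable_euclidean_space) auto
qed

text \<open>The product runs over the whole space of wave vectors, an uncountable index set, because
  the limit variables are to be independent over all of them at once.\<close>

definition normal_field :: "('a \<Rightarrow> real) \<Rightarrow> ('a \<Rightarrow> real) \<Rightarrow> ('a \<Rightarrow> complex) measure" where
  "normal_field \<alpha> \<beta> = Pi\<^sub>M UNIV (\<lambda>q. complex_normal (\<alpha> q) (\<beta> q))"

context
  fixes \<alpha> \<beta> :: "'a \<Rightarrow> real"
begin

interpretation product_prob_space "\<lambda>q. complex_normal (\<alpha> q) (\<beta> q)" UNIV
  by (intro product_prob_spaceI prob_space_complex_normal)

lemma prob_space_normal_field: "prob_space (normal_field \<alpha> \<beta>)"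
  unfolding normal_field_def by (intro prob_space_PiM prob_space_complex_normal)

lemma normal_field_component [measurable]: "(\<lambda>\<omega>. \<omega> q) \<in> borel_measurable (normal_field \<alpha> \<beta>)"
proof -
  have "(\<lambda>\<omega>. \<omega> q) \<in> normal_field \<alpha> \<beta> \<rightarrow>\<^sub>M complex_normal (\<alpha> q) (\<beta> q)"
    unfolding normal_field_def by (rule measurable_component_singleton) simp
  then show ?thesis by (simp cong: measurable_cong_sets)
qed

lemma distr_normal_field: "distr (normal_field \<alpha> \<beta>) borel (\<lambda>\<omega>. \<omega> q) = complex_normal (\<alpha> q) (\<beta> q)"
proof -
  have "distr (normal_field \<alpha> \<beta>) borel (\<lambda>\<omega>. \<omega> q) = distr (normal_field \<alpha> \<beta>) (complex_normal (\<alpha> q) (\<beta> q)) (\<lambda>\<omega>. \<omega> q)"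
    by (rule distr_cong) auto
  also have "\<dots> = complex_normal (\<alpha> q) (\<beta> q)" unfolding normal_field_def by (rule PiM_component) simp
  finally show ?thesis .
qed

lemma normal_field_indep: "prob_space.indep_vars (normal_field \<alpha> \<beta>) (\<lambda>_. borel) (\<lambda>q \<omega>. \<omega> q) UNIV"
proof -
  interpret N: prob_space "normal_field \<alpha> \<beta>" by (rule prob_space_normal_field)
  have s: "sets (normal_field \<alpha> \<beta>) = sets (Pi\<^sub>M UNIV (\<lambda>_. borel))"
    unfolding normal_field_def by (rule sets_PiM_cong) auto
  have "distr (normal_field \<alpha> \<beta>) (Pi\<^sub>M UNIV (\<lambda>_. borel)) (\<lambda>x. \<lambda>i\<in>UNIV. x i) = distr (normal_field \<alpha> \<beta>) (normal_field \<alpha> \<beta>) (\<lambda>x. x)"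
    by (rule distr_cong) (auto simp: s)
  also have "\<dots> = normal_field \<alpha> \<beta>" by (rule distr_id)
  also have "\<dots> = Pi\<^sub>M UNIV (\<lambda>q. distr (normal_field \<alpha> \<beta>) borel (\<lambda>\<omega>. \<omega> q))"
    unfolding distr_normal_field by (simp add: normal_field_def)
  finally show ?thesis
    by (subst N.indep_vars_iff_distr_eq_PiM') auto
qed

text \<open>Injectivity of \<open>\<kappa>\<close> makes the selected coordinates distinct, hence
  independent; \<open>b\<close> transports the coefficients from the index type to the points
  \<open>\<kappa> i\<close>.\<close>

lemma normal_field_cf:
  fixes a :: "complex ^ 'n::finite" and \<kappa> :: "'n \<Rightarrow> 'a"
  assumes inj: "inj \<kappa>"
  shows "(\<integral>\<omega>. cis (a \<bullet> (\<chi> i. \<omega> (\<kappa> i))) \<partial>normal_field \<alpha> \<beta>)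
    = complex_of_real (exp (- (\<Sum>i\<in>UNIV. (Re (a $ i) * \<alpha> (\<kappa> i))\<^sup>2 + (Im (a $ i) * \<beta> (\<kappa> i))\<^sup>2) / 2))"
proof -
  interpret N: prob_space "normal_field \<alpha> \<beta>" by (rule prob_space_normal_field)
  define b where "b q = a $ (inv \<kappa> q)" for q
  have b: "b (\<kappa> i) = a $ i" for i by (simp add: b_def inj)
  let ?I = "range \<kappa>"
  have "N.indep_vars (\<lambda>_. borel) (\<lambda>q \<omega>. cis (b q \<bullet> \<omega> q)) ?I"
    by (rule N.indep_vars_compose2[OF N.indep_vars_subset[OF normal_field_indep subset_UNIV]]) measurable
  then have "(\<integral>\<omega>. (\<Prod>q\<in>?I. cis (b q \<bullet> \<omega> q)) \<partial>normal_field \<alpha> \<beta>) = (\<Prod>q\<in>?I. \<integral>\<omega>. cis (b q \<bullet> \<omega> q) \<partial>normal_field \<alpha> \<beta>)"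
    by (intro N.indep_vars_lebesgue_integral N.integrable_const_bound[where B=1]) auto
  moreover have "cis (a \<bullet> (\<chi> i. \<omega> (\<kappa> i))) = (\<Prod>q\<in>?I. cis (b q \<bullet> \<omega> q))" for \<omega> :: "'a \<Rightarrow> complex"
    by (simp add: inner_vec_def cis_sum prod.reindex[OF inj] b)
  moreover have "(\<integral>\<omega>. cis (b q \<bullet> \<omega> q) \<partial>normal_field \<alpha> \<beta>)
     = complex_of_real (exp (- ((Re (b q) * \<alpha> q)\<^sup>2 + (Im (b q) * \<beta> q)\<^sup>2) / 2))" for q
  proof -
    have "(\<integral>\<omega>. cis (b q \<bullet> \<omega> q) \<partial>normal_field \<alpha> \<beta>) = (\<integral>z. cis (b q \<bullet> z) \<partial>distr (normal_field \<alpha> \<beta>) borel (\<lambda>\<omega>. \<omega> q))"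
      by (rule integral_distr[symmetric]) auto
    then show ?thesis unfolding distr_normal_field integral_cis_complex_normal .
  qed
  ultimately have "(\<integral>\<omega>. cis (a \<bullet> (\<chi> i. \<omega> (\<kappa> i))) \<partial>normal_field \<alpha> \<beta>)
     = (\<Prod>q\<in>?I. complex_of_real (exp (- ((Re (b q) * \<alpha> q)\<^sup>2 + (Im (b q) * \<beta> q)\<^sup>2) / 2)))" by simp
  also have "\<dots> = (\<Prod>i\<in>UNIV. complex_of_real (exp (- ((Re (a $ i) * \<alpha> (\<kappa> i))\<^sup>2 + (Im (a $ i) * \<beta> (\<kappa> i))\<^sup>2) / 2)))"
    by (simp add: prod.reindex[OF inj] b)
  also have "\<dots> = complex_of_real (exp (- (\<Sum>i\<in>UNIV. (Re (a $ i) * \<alpha> (\<kappa> i))\<^sup>2 + (Im (a $ i) * \<beta> (\<kappa> i))\<^sup>2) / 2))"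
    unfolding of_real_prod[symmetric] exp_sum[OF finite, symmetric] sum_negf[symmetric] sum_divide_distrib ..
  finally show ?thesis .
qed

end

section \<open>Scattering variables and their characteristic functions\<close>

context brillinger_process
begin

text \<open>It is a limit of variances, namely of those with the single frequency \<open>q\<close>.\<close>

lemma asymptotic_variance_nonneg:
  assumes h: "h \<in> window_class p" "0 < p"
  shows "0 \<le> asymptotic_variance h q"
proof -
  define R where "R n = real (Suc n)" for n
  have R: "0 < R n" "filterlim R at_top sequentially" for n
    unfolding R_def[abs_def] by (simp, simp only: filterlim_sequentially_Suc filterlim_real_sequentially)
  have hi: "integrable lborel h" using h by (auto simp: window_class_def)
  have "bounded (range h)" using h by (simp add: window_class_def)
  then obtain H where H: "\<And>x. \<bar>h x\<bar> \<le> H" by (auto simp: bounded_iff)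
  define \<rho> where "\<rho> n = sqrt (inverse (R n ^ DIM('a)))" for n
  have \<rho>2: "(\<rho> n)\<^sup>2 = inverse (R n ^ DIM('a))" for n using R(1)[of n] by (simp add: \<rho>_def)
  let ?a = "\<lambda>_::unit. 1 :: complex" and ?k = "\<lambda>_::unit. q"
  let ?g = "\<lambda>n x. scaled h (R n) x * trig_sum ?a ?k x"
  note g = modulated_window_mass[OF hi H R(1), where a="?a" and k="?k"]
  have lim: "(\<lambda>n. inverse (R n ^ DIM('a)) * variance_functional (?g n))
    \<longlonglongrightarrow> (\<Sum>i\<in>(UNIV :: unit set). ((norm (?a i))\<^sup>2 / 2 + (if ?k i = 0 then Re ((?a i)\<^sup>2) / 2 else 0)) * asymptotic_variance h (?k i))"
    by (rule variance_limit[OF h R, where \<kappa>="?k" and k="\<lambda>_ _. q"]) auto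
  have "0 \<le> (\<Sum>i\<in>(UNIV :: unit set). ((norm (?a i))\<^sup>2 / 2 + (if ?k i = 0 then Re ((?a i)\<^sup>2) / 2 else 0)) * asymptotic_variance h (?k i))"
  proof (rule bounded_function_clt(2))
    show "integrable lborel (?g n)" for n by (rule g(1))
    show "\<bar>?g n x\<bar> \<le> H * (\<Sum>i\<in>UNIV. norm (?a i))" for n x by (rule g(2))
    show "\<rho> \<longlonglongrightarrow> 0"
    proof -
      have "filterlim (\<lambda>n. R n ^ DIM('a)) at_top sequentially"
        by (rule filterlim_pow_at_top[OF _ R(2)]) simp
      then have "(\<lambda>n. sqrt (inverse (R n ^ DIM('a)))) \<longlonglongrightarrow> sqrt 0"
        by (intro tendsto_real_sqrt tendsto_inverse_0_at_top)
      then show ?thesis by (simp add: \<rho>_def[abs_def])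
    qed
    show "(\<rho> n)\<^sup>2 * (\<integral>x. \<bar>?g n x\<bar> \<partial>lborel) \<le> (\<Sum>i\<in>UNIV. norm (?a i)) * (\<integral>x. \<bar>h x\<bar> \<partial>lborel)" for n
    proof -
      have "(\<rho> n)\<^sup>2 * (\<integral>x. \<bar>?g n x\<bar> \<partial>lborel) \<le> (\<rho> n)\<^sup>2 * (R n ^ DIM('a) * ((\<Sum>i\<in>UNIV. norm (?a i)) * (\<integral>x. \<bar>h x\<bar> \<partial>lborel)))"
        by (intro mult_left_mono g(3)) auto
      also have "\<dots> = (\<Sum>i\<in>UNIV. norm (?a i)) * (\<integral>x. \<bar>h x\<bar> \<partial>lborel)" using R(1)[of n] by (simp add: \<rho>2)
      finally show ?thesis .
    qed
    show "(\<lambda>n. (\<rho> n)\<^sup>2 * variance_functional (?g n))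
      \<longlonglongrightarrow> (\<Sum>i\<in>(UNIV :: unit set). ((norm (?a i))\<^sup>2 / 2 + (if ?k i = 0 then Re ((?a i)\<^sup>2) / 2 else 0)) * asymptotic_variance h (?k i))"
      using lim unfolding \<rho>2 .
  qed
  \<comment> \<open>The single frequency has weight \<open>1 / 2\<close>, or 1 when
    \<open>q = 0\<close>; it is positive in both cases and can be divided out.\<close>
  then show ?thesis by (cases "q = 0") (auto simp: UNIV_unit)
qed

lemma scattering_eq:
  "scattering \<eta> \<gamma> h r k \<omega> = complex_of_real (1 / r powr (real DIM('a) / 2)) *
      (\<integral>x. complex_of_real (scaled h r x) * cis (- (k \<bullet> x)) \<partial>count_space (\<eta> \<omega>))
     - indicator {0} k * complex_of_real (window_moment 1 h * \<gamma> * r powr (real DIM('a) / 2))"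
  unfolding scattering_def infsum_complex_eq_integral ..

lemma scattering_measurable:
  assumes h [measurable]: "h \<in> borel_measurable borel"
  shows "scattering \<eta> \<gamma> h r k \<in> borel_measurable M"
proof -
  have [measurable]: "scaled h r \<in> borel_measurable borel" unfolding scaled_def[abs_def] by measurable
  have "(\<lambda>x. complex_of_real (scaled h r x) * cis (- (k \<bullet> x))) \<in> borel_measurable borel" by measurable
  note [measurable] = complex_sum_measurable[OF this]
  show ?thesis unfolding scattering_eq[abs_def] by measurable
qed

text \<open>Rests on \<open>a \<bullet> cis (- t) = Re (a * cis t)\<close>, which explains the
  opposite sign of the frequencies in \<open>trig_sum\<close>. The sums for the separate frequencies
  can be recombined where the window sum converges absolutely, hence almost surely.\<close>

lemma inner_scattering:
  fixes a :: "'n::finite \<Rightarrow> complex" and k :: "'n \<Rightarrow> 'a"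
  assumes h: "integrable lborel h" "\<And>x. \<bar>h x\<bar> \<le> H" and r: "r > 0"
  shows "AE \<omega> in M. (\<Sum>i\<in>UNIV. a i \<bullet> scattering \<eta> \<gamma> h r (k i) \<omega>)
    = r powr (- real DIM('a) / 2) * (\<integral>x. scaled h r x * trig_sum a k x \<partial>count_space (\<eta> \<omega>))
      - (\<Sum>i\<in>UNIV. Re (a i) * (indicator {0} (k i) * (window_moment 1 h * \<gamma> * r powr (real DIM('a) / 2))))"
  using AE_integrable_sum[OF integrable_scaled[OF h(1) r]]
proof eventually_elim
  case (elim \<omega>)
  let ?\<mu> = "count_space (\<eta> \<omega>)"
  let ?f = "\<lambda>i x. complex_of_real (scaled h r x) * cis (- (k i \<bullet> x))"
  have fi: "integrable ?\<mu> (?f i)" for i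
    by (rule Bochner_Integration.integrable_bound[OF elim]) (auto simp: norm_mult)
  have gi: "integrable ?\<mu> (\<lambda>x. scaled h r x * Re (a i * cis (k i \<bullet> x)))" for i
  proof (rule Bochner_Integration.integrable_bound[OF integrable_mult_right[OF elim, of "norm (a i)"]])
    show "AE x in ?\<mu>. norm (scaled h r x * Re (a i * cis (k i \<bullet> x))) \<le> norm (norm (a i) * scaled h r x)"
    proof (rule AE_I2)
      fix x
      have "\<bar>Re (a i * cis (k i \<bullet> x))\<bar> \<le> norm (a i)"
        using abs_Re_le_cmod[of "a i * cis (k i \<bullet> x)"] by (simp only: norm_mult norm_cis mult_1_right)
      then have "\<bar>scaled h r x\<bar> * \<bar>Re (a i * cis (k i \<bullet> x))\<bar> \<le> \<bar>scaled h r x\<bar> * norm (a i)"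
        by (rule mult_left_mono) simp
      then show "norm (scaled h r x * Re (a i * cis (k i \<bullet> x))) \<le> norm (norm (a i) * scaled h r x)"
        by (simp only: real_norm_def abs_mult abs_norm_cancel mult.commute)
    qed
  qed simp
  have inner: "a i \<bullet> (\<integral>x. ?f i x \<partial>?\<mu>) = (\<integral>x. scaled h r x * Re (a i * cis (k i \<bullet> x)) \<partial>?\<mu>)" for i
  proof -
    have "a i \<bullet> (\<integral>x. ?f i x \<partial>?\<mu>) = (\<integral>x. a i \<bullet> ?f i x \<partial>?\<mu>)"
      by (rule integral_inner_right[symmetric]) (use fi in simp)
    also have "\<dots> = (\<integral>x. scaled h r x * Re (a i * cis (k i \<bullet> x)) \<partial>?\<mu>)"
      by (intro Bochner_Integration.integral_cong refl) (simp add: inner_complex_def algebra_simps)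
    finally show ?thesis .
  qed
  have pw: "1 / r powr (real DIM('a) / 2) = r powr (- real DIM('a) / 2)"
    by (simp add: powr_minus_divide)
  have "a i \<bullet> scattering \<eta> \<gamma> h r (k i) \<omega> = r powr (- real DIM('a) / 2) * (\<integral>x. scaled h r x * Re (a i * cis (k i \<bullet> x)) \<partial>?\<mu>)
    - Re (a i) * (indicator {0} (k i) * (window_moment 1 h * \<gamma> * r powr (real DIM('a) / 2)))" for i
  proof -
    have c: "a i \<bullet> (complex_of_real s * z) = s * (a i \<bullet> z)" for s z
      by (simp add: inner_complex_def algebra_simps)
    have d: "a i \<bullet> (indicator {0} (k i) * complex_of_real s) = Re (a i) * (indicator {0} (k i) * s)" for s
      by (simp add: inner_complex_def indicator_def)
    show ?thesis unfolding scattering_eq pw inner_diff_right c d inner ..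
  qed
  then have "(\<Sum>i\<in>UNIV. a i \<bullet> scattering \<eta> \<gamma> h r (k i) \<omega>)
     = r powr (- real DIM('a) / 2) * (\<Sum>i\<in>UNIV. \<integral>x. scaled h r x * Re (a i * cis (k i \<bullet> x)) \<partial>?\<mu>)
      - (\<Sum>i\<in>UNIV. Re (a i) * (indicator {0} (k i) * (window_moment 1 h * \<gamma> * r powr (real DIM('a) / 2))))"
    by (simp only: sum_subtractf sum_distrib_left)
  also have "(\<Sum>i\<in>UNIV. \<integral>x. scaled h r x * Re (a i * cis (k i \<bullet> x)) \<partial>?\<mu>) = (\<integral>x. scaled h r x * trig_sum a k x \<partial>?\<mu>)"
    by (subst Bochner_Integration.integral_sum[OF gi, symmetric]) (simp only: trig_sum_def Re_sum sum_distrib_left)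
  finally show ?case .
qed

text \<open>At the zero wave vector the constant subtracted in \<open>scattering\<close> is exactly
  the mean. Otherwise the mean tends to 0 by membership in \<open>wave_vectors\<close>, and the
  indicator of \<open>k = 0\<close> is eventually 0 because the limit is nonzero, even if the value
  0 occurs for some \<open>r\<close>.\<close>

lemma mean_limit:
  fixes a :: "'n::finite \<Rightarrow> complex" and k :: "'n \<Rightarrow> real \<Rightarrow> 'a"
  assumes h: "integrable lborel h" "\<And>x. \<bar>h x\<bar> \<le> H"
    and R: "\<And>n. 0 < R n" "filterlim R at_top sequentially"
    and k: "\<And>i. k i \<in> wave_vectors h \<union> {\<lambda>_. 0}" "\<And>i. (k i \<longlongrightarrow> \<kappa> i) at_top"
  shows "(\<lambda>n. R n powr (- real DIM('a) / 2) * (\<gamma> * (\<integral>x. scaled h (R n) x * trig_sum a (\<lambda>i. k i (R n)) x \<partial>lborel))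
    - (\<Sum>i\<in>UNIV. Re (a i) * (indicator {0} (k i (R n)) * (window_moment 1 h * \<gamma> * R n powr (real DIM('a) / 2))))) \<longlonglongrightarrow> 0"
proof -
  have [measurable]: "h \<in> borel_measurable borel" using h by auto
  let ?\<rho> = "\<lambda>n. R n powr (- real DIM('a) / 2)"
  let ?J = "\<lambda>i n. \<integral>x. complex_of_real (scaled h (R n) x) * cis (k i (R n) \<bullet> x) \<partial>lborel"
  let ?e = "\<lambda>i n. Re (a i) * (indicator {0} (k i (R n)) * (window_moment 1 h * \<gamma> * R n powr (real DIM('a) / 2)))"
  have si: "integrable lborel (scaled h (R n))" for n by (rule integrable_scaled[OF h(1) R(1)])
  then have sm [measurable]: "scaled h (R n) \<in> borel_measurable borel" for n by auto
  have ci: "integrable lborel (\<lambda>x. complex_of_real (scaled h (R n) x) * cis (k i (R n) \<bullet> x))" for i n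
    by (rule Bochner_Integration.integrable_bound[OF si[of n]]) (simp, measurable, simp add: norm_mult)
  have split: "(\<integral>x. scaled h (R n) x * trig_sum a (\<lambda>i. k i (R n)) x \<partial>lborel) = (\<Sum>i\<in>UNIV. Re (a i * ?J i n))" for n
  proof -
    have "(\<Sum>i\<in>UNIV. Re (a i * ?J i n)) = Re (\<Sum>i\<in>UNIV. a i * ?J i n)" by simp
    also have "(\<Sum>i\<in>UNIV. a i * ?J i n) = (\<integral>x. (\<Sum>i\<in>UNIV. a i * (complex_of_real (scaled h (R n) x) * cis (k i (R n) \<bullet> x))) \<partial>lborel)"
      by (subst Bochner_Integration.integral_sum) (intro integrable_mult_right ci, simp only: integral_mult_right_zero)
    also have "Re \<dots> = (\<integral>x. Re (\<Sum>i\<in>UNIV. a i * (complex_of_real (scaled h (R n) x) * cis (k i (R n) \<bullet> x))) \<partial>lborel)"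
      by (rule integral_Re[symmetric]) (intro Bochner_Integration.integrable_sum integrable_mult_right ci)
    also have "\<dots> = (\<integral>x. scaled h (R n) x * trig_sum a (\<lambda>i. k i (R n)) x \<partial>lborel)"
    proof (rule Bochner_Integration.integral_cong[OF refl])
      fix x
      have "(\<Sum>i\<in>UNIV. a i * (complex_of_real (scaled h (R n) x) * cis (k i (R n) \<bullet> x)))
        = complex_of_real (scaled h (R n) x) * (\<Sum>i\<in>UNIV. a i * cis (k i (R n) \<bullet> x))"
        unfolding sum_distrib_left by (intro sum.cong refl) simp
      then show "Re (\<Sum>i\<in>UNIV. a i * (complex_of_real (scaled h (R n) x) * cis (k i (R n) \<bullet> x)))
        = scaled h (R n) x * trig_sum a (\<lambda>i. k i (R n)) x"
        unfolding trig_sum_def by (simp only: Re_complex_of_real_mult)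
    qed
    finally show ?thesis by simp
  qed
  have "(\<lambda>n. \<gamma> * Re (a i * (complex_of_real (?\<rho> n) * ?J i n)) - ?e i n) \<longlonglongrightarrow> 0" for i
  proof (cases "k i = (\<lambda>_. 0)")
    case True
    have "\<gamma> * Re (a i * (complex_of_real (?\<rho> n) * ?J i n)) - ?e i n = 0" for n
    proof -
      have "?J i n = complex_of_real (\<integral>x. scaled h (R n) x \<partial>lborel)" using True by simp
      also have "(\<integral>x. scaled h (R n) x \<partial>lborel) = R n ^ DIM('a) * window_moment 1 h"
        using integral_scaled[OF sm[of n] R(1)[of n]] R(1)[of n] by (simp add: scaled_def window_moment_def)
      finally have J: "?J i n = complex_of_real (R n ^ DIM('a) * window_moment 1 h)" .
      have "?\<rho> n * R n ^ DIM('a) = R n powr (real DIM('a) / 2)"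
        using R(1)[of n] by (simp add: powr_realpow[symmetric] powr_add[symmetric])
      then have "complex_of_real (?\<rho> n) * ?J i n = complex_of_real (R n powr (real DIM('a) / 2) * window_moment 1 h)"
        unfolding J by (simp only: of_real_mult[symmetric] mult.assoc[symmetric])
      then show ?thesis using True by simp
    qed
    then show ?thesis by (simp only: tendsto_const)
  next
    case False
    then have w: "k i \<in> wave_vectors h" using k(1)[of i] by auto
    then obtain l where l: "l \<noteq> 0" "(k i \<longlongrightarrow> l) at_top"
      and J: "((\<lambda>r. complex_of_real (r powr (- real DIM('a) / 2)) *
        (\<integral>x. complex_of_real (scaled h r x) * cis (k i r \<bullet> x) \<partial>lborel)) \<longlongrightarrow> 0) at_top"
      by (auto simp: wave_vectors_def)
    have "\<forall>\<^sub>F r in at_top. k i r \<noteq> 0" by (rule tendsto_imp_eventually_ne[OF l(2,1)])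
    then have "\<forall>\<^sub>F n in sequentially. k i (R n) \<noteq> 0" by (rule eventually_compose_filterlim[OF _ R(2)])
    then have "\<forall>\<^sub>F n in sequentially. ?e i n = 0" by eventually_elim simp
    then have e: "(\<lambda>n. ?e i n) \<longlonglongrightarrow> 0" by (rule tendsto_eventually)
    have "(\<lambda>n. complex_of_real (?\<rho> n) * ?J i n) \<longlonglongrightarrow> 0" by (rule filterlim_compose[OF J R(2)])
    then have "(\<lambda>n. \<gamma> * Re (a i * (complex_of_real (?\<rho> n) * ?J i n)) - ?e i n) \<longlonglongrightarrow> \<gamma> * Re (a i * 0) - 0"
      by (intro tendsto_intros e)
    then show ?thesis by simp
  qed
  then have "(\<lambda>n. \<Sum>i\<in>UNIV. \<gamma> * Re (a i * (complex_of_real (?\<rho> n) * ?J i n)) - ?e i n) \<longlonglongrightarrow> (\<Sum>i\<in>(UNIV::'n set). 0)"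
    by (intro tendsto_sum)
  moreover have "(\<Sum>i\<in>UNIV. \<gamma> * Re (a i * (complex_of_real (?\<rho> n) * ?J i n)) - ?e i n)
     = ?\<rho> n * (\<gamma> * (\<integral>x. scaled h (R n) x * trig_sum a (\<lambda>i. k i (R n)) x \<partial>lborel)) - (\<Sum>i\<in>UNIV. ?e i n)" for n
  proof -
    have "Re (a i * (complex_of_real (?\<rho> n) * ?J i n)) = ?\<rho> n * Re (a i * ?J i n)" for i
    proof -
      have "a i * (complex_of_real (?\<rho> n) * ?J i n) = complex_of_real (?\<rho> n) * (a i * ?J i n)" by simp
      then show ?thesis by (simp only: Re_complex_of_real_mult)
    qed
    then show ?thesis unfolding split by (simp only: sum_subtractf sum_distrib_left mult.left_commute)
  qed
  ultimately show ?thesis by simp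
qed

text \<open>\<open>?Y\<close> is centred by its mean and \<open>?S\<close> by the constant in
  \<open>scattering\<close>. Almost surely they differ by the deterministic null sequence
  \<open>D n\<close>, so their characteristic functions have the same limit.\<close>

theorem scattering_cf_limit:
  fixes a :: "'n::finite \<Rightarrow> complex" and k :: "'n \<Rightarrow> real \<Rightarrow> 'a"
  assumes h: "h \<in> window_class p" "0 < p"
    and R: "\<And>n. 0 < R n" "filterlim R at_top sequentially"
    and k: "\<And>i. k i \<in> wave_vectors h \<union> {\<lambda>_. 0}" "\<And>i. (k i \<longlongrightarrow> \<kappa> i) at_top"
    and dis: "\<And>i j. i \<noteq> j \<Longrightarrow> {\<kappa> i, - \<kappa> i} \<inter> {\<kappa> j, - \<kappa> j} = {}"
  shows "(\<lambda>n. \<integral>\<omega>. cis (\<Sum>i\<in>UNIV. a i \<bullet> scattering \<eta> \<gamma> h (R n) (k i (R n)) \<omega>) \<partial>M)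
    \<longlonglongrightarrow> complex_of_real (exp (- (\<Sum>i\<in>UNIV. ((norm (a i))\<^sup>2 / 2 + (if \<kappa> i = 0 then Re ((a i)\<^sup>2) / 2 else 0)) * asymptotic_variance h (\<kappa> i)) / 2))"
proof -
  have hi: "integrable lborel h" using h by (auto simp: window_class_def)
  then have hm [measurable]: "h \<in> borel_measurable borel" by auto
  have "bounded (range h)" using h by (simp add: window_class_def)
  then obtain H where H: "\<And>x. \<bar>h x\<bar> \<le> H" by (auto simp: bounded_iff)
  define \<rho> where "\<rho> n = R n powr (- real DIM('a) / 2)" for n
  have \<rho>2: "(\<rho> n)\<^sup>2 = inverse (R n ^ DIM('a))" for n
  proof -
    have "(\<rho> n)\<^sup>2 = R n powr (- real DIM('a))"
      unfolding \<rho>_def power2_eq_square powr_add[symmetric] by simp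
    then show ?thesis using R(1)[of n] by (simp add: powr_minus powr_realpow)
  qed
  have \<rho>0: "\<rho> \<longlonglongrightarrow> 0"
    unfolding \<rho>_def[abs_def] by (rule tendsto_neg_powr[OF _ R(2)]) simp
  let ?k = "\<lambda>i n. k i (R n)"
  let ?g = "\<lambda>n x. scaled h (R n) x * trig_sum a (\<lambda>i. ?k i n) x"
  let ?v = "\<Sum>i\<in>UNIV. ((norm (a i))\<^sup>2 / 2 + (if \<kappa> i = 0 then Re ((a i)\<^sup>2) / 2 else 0)) * asymptotic_variance h (\<kappa> i)"
  have g1: "integrable lborel (?g n)" for n by (rule modulated_window_mass(1)[OF hi H R(1)])
  have g2: "\<bar>?g n x\<bar> \<le> H * (\<Sum>i\<in>UNIV. norm (a i))" for n x by (rule modulated_window_mass(2)[OF hi H R(1)])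
  have g3: "(\<integral>x. \<bar>?g n x\<bar> \<partial>lborel) \<le> R n ^ DIM('a) * ((\<Sum>i\<in>UNIV. norm (a i)) * (\<integral>x. \<bar>h x\<bar> \<partial>lborel))" for n
    by (rule modulated_window_mass(3)[OF hi H R(1)])
  have kl: "?k i \<longlonglongrightarrow> \<kappa> i" for i by (rule filterlim_compose[OF k(2) R(2)])
  \<comment> \<open>The two kinds of wave vector functions are separated by their limits: members of
    \<open>wave_vectors\<close> have a nonzero limit, so a zero limit leaves only the zero
    function.\<close>
  have k0: "?k i n = 0" if "\<kappa> i = 0" for i n
  proof -
    have "k i \<notin> wave_vectors h"
    proof
      assume "k i \<in> wave_vectors h"
      then obtain l where l: "l \<noteq> 0" "(k i \<longlongrightarrow> l) at_top" by (auto simp: wave_vectors_def)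
      have "l = \<kappa> i" by (rule tendsto_unique[OF _ l(2) k(2)]) simp
      then show False using l that by simp
    qed
    then show ?thesis using k(1)[of i] by auto
  qed
  have var: "(\<lambda>n. (\<rho> n)\<^sup>2 * variance_functional (?g n)) \<longlonglongrightarrow> ?v"
    unfolding \<rho>2 by (rule variance_limit[OF h R kl k0 dis])
  have mass: "(\<rho> n)\<^sup>2 * (\<integral>x. \<bar>?g n x\<bar> \<partial>lborel) \<le> (\<Sum>i\<in>UNIV. norm (a i)) * (\<integral>x. \<bar>h x\<bar> \<partial>lborel)" for n
  proof -
    have "(\<rho> n)\<^sup>2 * (\<integral>x. \<bar>?g n x\<bar> \<partial>lborel) \<le> (\<rho> n)\<^sup>2 * (R n ^ DIM('a) * ((\<Sum>i\<in>UNIV. norm (a i)) * (\<integral>x. \<bar>h x\<bar> \<partial>lborel)))"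
      by (intro mult_left_mono g3) auto
    also have "\<dots> = (\<Sum>i\<in>UNIV. norm (a i)) * (\<integral>x. \<bar>h x\<bar> \<partial>lborel)" using R(1)[of n] by (simp add: \<rho>2)
    finally show ?thesis .
  qed
  let ?Y = "\<lambda>n \<omega>. \<rho> n * ((\<integral>x. ?g n x \<partial>count_space (\<eta> \<omega>)) - \<gamma> * (\<integral>x. ?g n x \<partial>lborel))"
  let ?S = "\<lambda>n \<omega>. \<Sum>i\<in>UNIV. a i \<bullet> scattering \<eta> \<gamma> h (R n) (k i (R n)) \<omega>"
  define D where "D n = \<rho> n * (\<gamma> * (\<integral>x. ?g n x \<partial>lborel))
    - (\<Sum>i\<in>UNIV. Re (a i) * (indicator {0} (k i (R n)) * (window_moment 1 h * \<gamma> * R n powr (real DIM('a) / 2))))" for n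
  have D0: "D \<longlonglongrightarrow> 0" unfolding D_def[abs_def] \<rho>_def by (rule mean_limit[OF hi H R k])
  have clt: "(\<lambda>n. \<integral>\<omega>. cis (?Y n \<omega>) \<partial>M) \<longlonglongrightarrow> complex_of_real (exp (- ?v / 2))"
    by (rule bounded_function_clt(1)[OF g1 g2 \<rho>0 mass var])
  have "(\<lambda>n. (\<integral>\<omega>. cis (?S n \<omega>) \<partial>M) - (\<integral>\<omega>. cis (?Y n \<omega>) \<partial>M)) \<longlonglongrightarrow> 0"
  proof (rule Lim_null_comparison)
    show "(\<lambda>n. \<bar>D n\<bar>) \<longlonglongrightarrow> 0" using tendsto_rabs[OF D0] by simp
    show "\<forall>\<^sub>F n in sequentially. norm ((\<integral>\<omega>. cis (?S n \<omega>) \<partial>M) - (\<integral>\<omega>. cis (?Y n \<omega>) \<partial>M)) \<le> \<bar>D n\<bar>"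
    proof (intro always_eventually allI)
      fix n
      note [measurable] = scattering_measurable[OF hm]
      have [measurable]: "?g n \<in> borel_measurable borel" using g1[of n] by auto
      have gs [measurable]: "(\<lambda>\<omega>. \<integral>x. ?g n x \<partial>count_space (\<eta> \<omega>)) \<in> borel_measurable M" by (rule real_sum_measurable) fact
      have iS: "integrable M (\<lambda>\<omega>. cis (?S n \<omega>))" by (rule integrable_const_bound[where B=1]) (simp, measurable)
      have iY: "integrable M (\<lambda>\<omega>. cis (?Y n \<omega>))" by (rule integrable_const_bound[where B=1]) (simp, measurable)
      have "norm ((\<integral>\<omega>. cis (?S n \<omega>) \<partial>M) - (\<integral>\<omega>. cis (?Y n \<omega>) \<partial>M)) = norm (\<integral>\<omega>. cis (?S n \<omega>) - cis (?Y n \<omega>) \<partial>M)"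
        by (subst Bochner_Integration.integral_diff[OF iS iY]) (rule refl)
      also have "\<dots> \<le> (\<integral>\<omega>. norm (cis (?S n \<omega>) - cis (?Y n \<omega>)) \<partial>M)" by (rule integral_norm_bound)
      also have "\<dots> \<le> (\<integral>\<omega>. \<bar>D n\<bar> \<partial>M)"
      proof (rule integral_mono_AE)
        show "integrable M (\<lambda>\<omega>. norm (cis (?S n \<omega>) - cis (?Y n \<omega>)))"
          by (intro integrable_norm Bochner_Integration.integrable_diff iS iY)
        show "integrable M (\<lambda>\<omega>. \<bar>D n\<bar>)" by simp
        show "AE \<omega> in M. norm (cis (?S n \<omega>) - cis (?Y n \<omega>)) \<le> \<bar>D n\<bar>"
          using inner_scattering[OF hi H R(1)[of n], of a "\<lambda>i. ?k i n"]
        proof eventually_elim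
          case (elim \<omega>)
          have "?S n \<omega> - ?Y n \<omega> = D n"
            unfolding elim D_def \<rho>_def[symmetric] by (simp add: algebra_simps)
          then show ?case using norm_cis_diff_le[of "?S n \<omega>" "?Y n \<omega>"] by (simp only:)
        qed
      qed
      finally show "norm ((\<integral>\<omega>. cis (?S n \<omega>) \<partial>M) - (\<integral>\<omega>. cis (?Y n \<omega>) \<partial>M)) \<le> \<bar>D n\<bar>" by (simp add: prob_space)
    qed
  qed
  from tendsto_add[OF this clt] show ?thesis by simp
qed

end

theorem theorem4p1:
  fixes M :: "'w measure"
    and \<eta> :: "'w \<Rightarrow> 'a::euclidean_space set"
    and \<gamma> p :: real
    and \<nu> :: "nat \<Rightarrow> (nat \<Rightarrow> 'a) signed_measure"
    and h :: "'a \<Rightarrow> real"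
    and k :: "'n::finite \<Rightarrow> real \<Rightarrow> 'a"
    and \<kappa> :: "'n \<Rightarrow> 'a"
  assumes "point_process M \<eta>"
    and "stationary M \<eta>"
    and "intensity M \<eta> = ennreal \<gamma>" and "0 < \<gamma>"
    and moments: "\<And>B m. bounded B \<Longrightarrow> B \<in> sets borel \<Longrightarrow> (\<integral>\<^sup>+ \<omega>. npoints (\<eta> \<omega>) B ^ m \<partial>M) < \<infinity>"
    and reduced: "\<And>m. 2 \<le> m \<Longrightarrow> reduced_factorial_cumulant M \<eta> m (\<nu> m)"
    and "0 < p"
    and "(\<integral>\<^sup>+ y. ennreal (1 + norm (y 1) powr p) \<partial>total_variation (\<nu> 2)) < \<infinity>"
    and "\<And>m. 3 \<le> m \<Longrightarrow> emeasure (total_variation (\<nu> m)) (space (total_variation (\<nu> m))) < \<infinity>"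
    and "h \<in> window_class p"
    and "\<And>i. k i \<in> wave_vectors h \<union> {\<lambda>_. 0}"
    and "\<And>i. (k i \<longlongrightarrow> \<kappa> i) at_top"
    and "\<And>i j. i \<noteq> j \<Longrightarrow> {\<kappa> i, - \<kappa> i} \<inter> {\<kappa> j, - \<kappa> j} = {}"
  defines "v \<equiv> \<lambda>q. \<gamma> * window_moment 2 h * Re (structure_factor \<gamma> (\<nu> 2) q)"
  shows "\<exists>(N :: ('a \<Rightarrow> complex) measure) (Z :: 'a \<Rightarrow> ('a \<Rightarrow> complex) \<Rightarrow> complex).
           prob_space N \<and>
           prob_space.indep_vars N (\<lambda>_. borel) Z UNIV \<and>
           (\<forall>q. q \<noteq> 0 \<longrightarrow> centered_complex_normal N (Z q) (v q / 2) (v q / 2)) \<and>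
           centered_complex_normal N (Z 0) (v 0) 0 \<and>
           converges_in_distribution M
             (\<lambda>r \<omega>. (\<chi> i. scattering \<eta> \<gamma> h r (k i r) \<omega>) :: complex ^ 'n)
             N (\<lambda>\<omega>. \<chi> i. Z (\<kappa> i) \<omega>)"
proof -
  interpret brillinger_process M \<eta> \<gamma> \<nu>
  proof unfold_locales
    show "emeasure (total_variation (\<nu> m)) (space (total_variation (\<nu> m))) < \<infinity>" if "2 \<le> m" for m
    proof (cases "m = 2")
      case True
      \<comment> \<open>The weight \<open>1 + norm (y 1) powr p\<close> is at least 1, so the
        integrability assumption bounds the total mass.\<close>
      let ?T = "total_variation (\<nu> 2)"
      have "emeasure ?T (space ?T) = (\<integral>\<^sup>+ y. 1 \<partial>?T)" by simp
      also have "\<dots> \<le> (\<integral>\<^sup>+ y. ennreal (1 + norm (y 1) powr p) \<partial>?T)"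
        by (rule nn_integral_mono) simp
      also have "\<dots> < \<infinity>" by fact
      finally show ?thesis using True by simp
    next
      case False
      then show ?thesis using that assms(9)[of m] by simp
    qed
  qed (use assms(1-4) moments reduced in auto)
  have h: "h \<in> window_class p" "0 < p" by fact+
  then have hm: "h \<in> borel_measurable borel" by (simp add: window_class_def)
  have v: "v q = asymptotic_variance h q" for q by (simp add: v_def asymptotic_variance_def)
  have v0: "0 \<le> v q" for q unfolding v by (rule asymptotic_variance_nonneg[OF h])
  \<comment> \<open>At wave vector 0 the real part carries the whole variance and the imaginary part
    degenerates; elsewhere the variance is shared equally. The witnesses are the coordinates of the
    product measure with these standard deviations.\<close>
  define \<alpha> where "\<alpha> q = (if q = 0 then sqrt (v q) else sqrt (v q / 2))" for q
  define \<beta> where "\<beta> q = (if q = 0 then 0 else sqrt (v q / 2))" for q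
  have ab: "0 \<le> \<alpha> q" "0 \<le> \<beta> q" for q using v0 by (auto simp: \<alpha>_def \<beta>_def)
  let ?N = "normal_field \<alpha> \<beta>" and ?Z = "\<lambda>q \<omega>. \<omega> q :: complex"
  interpret N: prob_space ?N by (rule prob_space_normal_field)
  have Zn: "centered_complex_normal ?N (?Z q) ((\<alpha> q)\<^sup>2) ((\<beta> q)\<^sup>2)" for q
    by (rule centered_complex_normal_of_distr[OF N.prob_space_axioms normal_field_component distr_normal_field ab])
  have inj: "inj \<kappa>"
  proof (rule injI)
    fix i j assume "\<kappa> i = \<kappa> j"
    then show "i = j" using assms(13)[of i j] by auto
  qed
  let ?T = "\<lambda>r \<omega>. (\<chi> i. scattering \<eta> \<gamma> h r (k i r) \<omega>) :: complex ^ 'n" and ?Y = "\<lambda>\<omega>. (\<chi> i. ?Z (\<kappa> i) \<omega>) :: complex ^ 'n"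
  have Tm: "?T r \<in> borel_measurable M" for r by (intro vec_lambda_measurable scattering_measurable hm)
  have Ym: "?Y \<in> borel_measurable ?N" by (intro vec_lambda_measurable normal_field_component)
  have lim: "(\<lambda>n. \<integral>\<omega>. f (?T (R n) \<omega>) \<partial>M) \<longlonglongrightarrow> (\<integral>\<omega>. f (?Y \<omega>) \<partial>?N)"
    if f: "continuous_on UNIV f" "bounded (range f)" and R: "\<And>n. 0 < R n" "filterlim R at_top sequentially"
    for f :: "complex ^ 'n \<Rightarrow> real" and R :: "nat \<Rightarrow> real"
  proof -
    have fm: "f \<in> borel_measurable borel" by (rule borel_measurable_continuous_onI[OF f(1)])
    have cf: "(\<lambda>n. \<integral>x. cis (a \<bullet> x) \<partial>distr M borel (?T (R n))) \<longlonglongrightarrow> (\<integral>x. cis (a \<bullet> x) \<partial>distr ?N borel ?Y)" for a :: "complex ^ 'n"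
    proof -
      \<comment> \<open>At frequency 0 the two weights add up to the square of
        \<open>Re (a $ i)\<close>; at other frequencies the weight is half the sum of the squares of
        both components.\<close>
      have "((norm (a $ i))\<^sup>2 / 2 + (if \<kappa> i = 0 then Re ((a $ i)\<^sup>2) / 2 else 0)) * asymptotic_variance h (\<kappa> i)
        = (Re (a $ i) * \<alpha> (\<kappa> i))\<^sup>2 + (Im (a $ i) * \<beta> (\<kappa> i))\<^sup>2" for i
        using v0[of "\<kappa> i"] unfolding v[symmetric]
        by (cases "\<kappa> i = 0") (simp_all add: \<alpha>_def \<beta>_def cmod_power2 Re_power2 power_mult_distrib field_simps)
      then have e: "(\<Sum>i\<in>UNIV. ((norm (a $ i))\<^sup>2 / 2 + (if \<kappa> i = 0 then Re ((a $ i)\<^sup>2) / 2 else 0)) * asymptotic_variance h (\<kappa> i))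
        = (\<Sum>i\<in>UNIV. (Re (a $ i) * \<alpha> (\<kappa> i))\<^sup>2 + (Im (a $ i) * \<beta> (\<kappa> i))\<^sup>2)" by (intro sum.cong refl)
      have c: "(\<lambda>x. cis (a \<bullet> x)) \<in> borel_measurable borel" by measurable
      have l: "(\<integral>x. cis (a \<bullet> x) \<partial>distr M borel (?T r)) = (\<integral>\<omega>. cis (\<Sum>i\<in>UNIV. a $ i \<bullet> scattering \<eta> \<gamma> h r (k i r) \<omega>) \<partial>M)" for r
        by (subst integral_distr[OF Tm c]) (simp add: inner_vec_def)
      have r: "(\<integral>x. cis (a \<bullet> x) \<partial>distr ?N borel ?Y) = complex_of_real (exp (- (\<Sum>i\<in>UNIV. (Re (a $ i) * \<alpha> (\<kappa> i))\<^sup>2 + (Im (a $ i) * \<beta> (\<kappa> i))\<^sup>2) / 2))"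
        by (subst integral_distr[OF Ym c]) (rule normal_field_cf[OF inj])
      show ?thesis
        unfolding l r e[symmetric] by (rule scattering_cf_limit[OF h R assms(11-13)])
    qed
    have "(\<lambda>n. \<integral>x. f x \<partial>distr M borel (?T (R n))) \<longlonglongrightarrow> (\<integral>x. f x \<partial>distr ?N borel ?Y)"
      by (rule levy_continuity_euclidean[OF _ _ _ _ cf f])
         (auto intro: prob_space_distr N.prob_space_distr Tm Ym)
    then show ?thesis unfolding integral_distr[OF Tm fm] integral_distr[OF Ym fm] .
  qed
  have conv: "((\<lambda>r. \<integral>\<omega>. f (?T r \<omega>) \<partial>M) \<longlongrightarrow> (\<integral>\<omega>. f (?Y \<omega>) \<partial>?N)) at_top"
    if f: "continuous_on UNIV f" "bounded (range f)" for f :: "complex ^ 'n \<Rightarrow> real"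
  proof (rule tendsto_at_topI_sequentially)
    \<comment> \<open>Finitely many terms of \<open>X\<close> may be nonpositive, where
      \<open>lim\<close> does not apply. Replacing \<open>X n\<close> by \<open>max 1 (X n)\<close>
      changes nothing for large \<open>n\<close>.\<close>
    fix X :: "nat \<Rightarrow> real" assume X: "filterlim X at_top sequentially"
    have ev: "\<forall>\<^sub>F n in sequentially. max 1 (X n) = X n"
    proof -
      have "\<forall>\<^sub>F n in sequentially. 1 \<le> X n" using X by (simp add: filterlim_at_top)
      then show ?thesis by eventually_elim simp
    qed
    have "filterlim (\<lambda>n. max 1 (X n)) at_top sequentially"
      by (rule filterlim_at_top_mono[OF X]) simp
    then have "(\<lambda>n. \<integral>\<omega>. f (?T (max 1 (X n)) \<omega>) \<partial>M) \<longlonglongrightarrow> (\<integral>\<omega>. f (?Y \<omega>) \<partial>?N)"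
      by (intro lim f) simp_all
    moreover have "\<forall>\<^sub>F n in sequentially. (\<integral>\<omega>. f (?T (max 1 (X n)) \<omega>) \<partial>M) = (\<integral>\<omega>. f (?T (X n) \<omega>) \<partial>M)"
      using ev by eventually_elim (simp only:)
    ultimately show "(\<lambda>n. \<integral>\<omega>. f (?T (X n) \<omega>) \<partial>M) \<longlonglongrightarrow> (\<integral>\<omega>. f (?Y \<omega>) \<partial>?N)"
      by (rule Lim_transform_eventually)
  qed
  have "converges_in_distribution M ?T ?N ?Y"
    unfolding converges_in_distribution_def using Tm Ym conv by blast
  moreover have "centered_complex_normal ?N (?Z q) (v q / 2) (v q / 2)" if "q \<noteq> 0" for q
    using Zn[of q] v0[of q] that by (simp add: \<alpha>_def \<beta>_def)
  moreover have "centered_complex_normal ?N (?Z 0) (v 0) 0"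
    using Zn[of 0] v0[of 0] by (simp add: \<alpha>_def \<beta>_def)
  ultimately show ?thesis
    using N.prob_space_axioms normal_field_indep[of \<alpha> \<beta>]
    by (intro exI[of _ ?N] exI[of _ ?Z]) simp
qed

end
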